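(* Let $G$ be a finite abelian group with a quotient (surjective homomorphism) $\varrho: G \to \Gamma$. Let $k$ be a field of characteristic $0$ and let $K \supset k$ be an abelian Galois extension with Galois group $\Gamma$. Assume that the Galois action of $\Gamma$ on $K$ lifts to a $k$-linear action of $G$ on a finite dimensional $K$-vector space $V$, i.e. $G$ acts $k$-linearly on $V$ with $\sigma(\lambda \cdot v) = \varrho(\sigma)(\lambda)\cdot \sigma(v)$ for all $\sigma \in G$, $\lambda \in K$, $v \in V$. Let $N = \exp(G)$ be the exponent of $G$, and assume that all $N$-th roots of $1$ lie in $k$. Then $$[V/G] = \mathbb{L}^{\dim_K V} \in K_0(\mathrm{Var}_k).$$
   Context: For a field $k$, the Grothendieck ring of varieties $K_0(\mathrm{Var}_k)$ is the free abelian group generated by (isomorphism classes $[X]$ of) $k$-schemes $X$ of finite type, modulo the subgroup spanned by the scissor relations $[X] = [X\setminus Z] + [Z]$ for $Z \subset X$ a closed subscheme. It is a commutative ring with product $[X]\cdot[Y] = [X\times_k Y]$ and unit $1 = [\mathrm{Spec}\, k]$. The class of the affine line $\mathbb{A}^1_k$ is denoted $\mathbb{L}$. The finite dimensional $K$-vector space $V$ is regarded as a variety over $K$, namely the affine space $\mathrm{Spec}\,\mathrm{Sym}_K(V^\vee)\cong \mathbb{A}^{\dim_K V}_K$, where $V^\vee$ is the $K$-dual. The semilinear action of $G$ on $V$ induces an action of $G$ on this scheme by $k$-automorphisms, compatible with the action of $\Gamma$ on $\mathrm{Spec}\,K$: on coordinate rings it is the action by ring automorphisms that is the Galois action (through $\varrho$)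 on $K$ and $\sigma(\varphi) = \varrho(\sigma)\circ\varphi\circ\sigma^{-1}$ for $\varphi \in V^\vee$, $\sigma\in G$. The quotient $V/G$ is the spectrum of the ring of $G$-invariants; it is a $k$-variety. *)

theory Defs
  imports
    "HOL-Analysis.Abstract_Topology"
    "HOL-Algebra.Algebra"
    "HOL-Algebra.Algebraic_Closure_Type"
    "HOL-Algebra.Free_Abelian_Groups"
begin

section \<open>Algebra\<close>

text \<open>
  The large field is the type \<open>'k\<close> and the base field is a subset \<open>k\<close> of that type.  All other
  rings are records with carriers.  A \<open>k\<close>-algebra is a commutative ring \<open>R\<close> together with its
  structure map \<open>\<iota>\<close>, of which only the values on \<open>k\<close> matter.
\<close>

abbreviation base_ring :: "'k::field set \<Rightarrow> 'k ring"
  where "base_ring k \<equiv> ring_of_type_algebra\<lparr>carrier := k\<rparr>"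

definition fg_algebra :: "'k::field set \<Rightarrow> 'a ring \<Rightarrow> ('k \<Rightarrow> 'a) \<Rightarrow> bool"
  where "fg_algebra k R \<iota> \<longleftrightarrow>
    (\<exists>F. finite F \<and> F \<subseteq> carrier R \<and> generate_ring R (\<iota> ` k \<union> F) = carrier R)"

definition local_ring :: "'a ring \<Rightarrow> bool"
  where "local_ring R \<longleftrightarrow> cring R \<and> (\<exists>!M. maximalideal M R)"

text \<open>The fraction \<open>a / f\<close> in \<open>S\<inverse>R\<close>, as an equivalence class of pairs.\<close>

definition fraction :: "'a ring \<Rightarrow> 'a set \<Rightarrow> 'a \<Rightarrow> 'a \<Rightarrow> ('a \<times> 'a) set"
  where "fraction R S a f =
    {(b, g). b \<in> carrier R \<and> g \<in> S \<and> (\<exists>h\<in>S. h \<otimes>\<^bsub>R\<^esub> (a \<otimes>\<^bsub>R\<^esub> g) = h \<otimes>\<^bsub>R\<^esub> (b \<otimes>\<^bsub>R\<^esub> f))}"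

definition localization :: "'a ring \<Rightarrow> 'a set \<Rightarrow> ('a \<times> 'a) set ring"
  where "localization R S =
    \<lparr>carrier = {fraction R S a f | a f. a \<in> carrier R \<and> f \<in> S},
     monoid.mult = (\<lambda>x y. \<Union>(a, f)\<in>x. \<Union>(b, g)\<in>y. fraction R S (a \<otimes>\<^bsub>R\<^esub> b) (f \<otimes>\<^bsub>R\<^esub> g)),
     monoid.one = fraction R S \<one>\<^bsub>R\<^esub> \<one>\<^bsub>R\<^esub>,
     ring.zero = fraction R S \<zero>\<^bsub>R\<^esub> \<one>\<^bsub>R\<^esub>,
     ring.add = (\<lambda>x y. \<Union>(a, f)\<in>x. \<Union>(b, g)\<in>y.
       fraction R S (a \<otimes>\<^bsub>R\<^esub> g \<oplus>\<^bsub>R\<^esub> b \<otimes>\<^bsub>R\<^esub> f) (f \<otimes>\<^bsub>R\<^esub> g))\<rparr>"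


section \<open>Schemes over a field\<close>

text \<open>
  A space over \<open>k\<close> is a topological space with a sheaf of rings and a ring homomorphism from \<open>k\<close>
  to the global sections; the latter is the same thing as a morphism to \<open>Spec k\<close>.
\<close>

record ('k, 'p, 's) kspace =
  topol :: "'p topology"
  sec :: "'p set \<Rightarrow> 's ring"
  res :: "'p set \<Rightarrow> 'p set \<Rightarrow> 's \<Rightarrow> 's"
  str :: "'k \<Rightarrow> 's"

abbreviation pts :: "('k, 'p, 's) kspace \<Rightarrow> 'p set"
  where "pts S \<equiv> topspace (topol S)"

definition ringed_space :: "'k::field set \<Rightarrow> ('k, 'p, 's) kspace \<Rightarrow> bool"
  where "ringed_space k S \<longleftrightarrow>
    (\<forall>U. openin (topol S) U \<longrightarrow> cring (sec S U)) \<and>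
    (\<forall>U V. openin (topol S) U \<and> openin (topol S) V \<and> V \<subseteq> U \<longrightarrow>
      res S U V \<in> ring_hom (sec S U) (sec S V)) \<and>
    (\<forall>U. openin (topol S) U \<longrightarrow> (\<forall>s\<in>carrier (sec S U). res S U U s = s)) \<and>
    (\<forall>U V W. openin (topol S) U \<and> openin (topol S) V \<and> openin (topol S) W \<and> W \<subseteq> V \<and> V \<subseteq> U \<longrightarrow>
      (\<forall>s\<in>carrier (sec S U). res S V W (res S U V s) = res S U W s)) \<and>
    (\<forall>\<U>. (\<forall>U\<in>\<U>. openin (topol S) U) \<longrightarrow>
      (\<forall>s\<in>carrier (sec S (\<Union>\<U>)). \<forall>t\<in>carrier (sec S (\<Union>\<U>)).
        (\<forall>U\<in>\<U>. res S (\<Union>\<U>) U s = res S (\<Union>\<U>) U t) \<longrightarrow> s = t)) \<and>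
    (\<forall>\<U> s. (\<forall>U\<in>\<U>. openin (topol S) U \<and> s U \<in> carrier (sec S U)) \<and>
      (\<forall>U\<in>\<U>. \<forall>V\<in>\<U>. res S U (U \<inter> V) (s U) = res S V (U \<inter> V) (s V)) \<longrightarrow>
      (\<exists>t\<in>carrier (sec S (\<Union>\<U>)). \<forall>U\<in>\<U>. res S (\<Union>\<U>) U t = s U)) \<and>
    str S \<in> ring_hom (base_ring k) (sec S (pts S))"

definition germ :: "('k, 'p, 's) kspace \<Rightarrow> 'p \<Rightarrow> 'p set \<Rightarrow> 's \<Rightarrow> ('p set \<times> 's) set"
  where "germ S x U s =
    {(V, t). openin (topol S) V \<and> x \<in> V \<and> t \<in> carrier (sec S V) \<and>
      (\<exists>W. openin (topol S) W \<and> x \<in> W \<and> W \<subseteq> U \<inter> V \<and> res S U W s = res S V W t)}"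

definition stalk :: "('k, 'p, 's) kspace \<Rightarrow> 'p \<Rightarrow> ('p set \<times> 's) set ring"
  where "stalk S x =
    \<lparr>carrier = {germ S x U s | U s. openin (topol S) U \<and> x \<in> U \<and> s \<in> carrier (sec S U)},
     monoid.mult = (\<lambda>a b. \<Union>(U, s)\<in>a. \<Union>(V, t)\<in>b.
       germ S x (U \<inter> V) (res S U (U \<inter> V) s \<otimes>\<^bsub>sec S (U \<inter> V)\<^esub> res S V (U \<inter> V) t)),
     monoid.one = germ S x (pts S) \<one>\<^bsub>sec S (pts S)\<^esub>,
     ring.zero = germ S x (pts S) \<zero>\<^bsub>sec S (pts S)\<^esub>,
     ring.add = (\<lambda>a b. \<Union>(U, s)\<in>a. \<Union>(V, t)\<in>b.
       germ S x (U \<inter> V) (res S U (U \<inter> V) s \<oplus>\<^bsub>sec S (U \<inter> V)\<^esub> res S V (U \<inter> V) t))\<rparr>"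

definition locally_ringed_space :: "'k::field set \<Rightarrow> ('k, 'p, 's) kspace \<Rightarrow> bool"
  where "locally_ringed_space k S \<longleftrightarrow>
    ringed_space k S \<and> (\<forall>x\<in>pts S. local_ring (stalk S x))"

text \<open>
  A morphism \<open>S \<rightarrow> T\<close> is a pair of a map on points and a family of maps
  \<open>O\<^sub>T(V) \<rightarrow> O\<^sub>S(f\<inverse>V)\<close> indexed by the open sets \<open>V\<close> of \<open>T\<close>.
\<close>

type_synonym ('p, 's, 'q, 't) kmap = "('p \<Rightarrow> 'q) \<times> ('q set \<Rightarrow> 't \<Rightarrow> 's)"

definition preimg :: "('k, 'p, 's) kspace \<Rightarrow> ('p \<Rightarrow> 'q) \<Rightarrow> 'q set \<Rightarrow> 'p set"
  where "preimg S f V = {x \<in> pts S. f x \<in> V}"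

definition stalk_map ::
    "('k, 'p, 's) kspace \<Rightarrow> ('p, 's, 'q, 't) kmap \<Rightarrow> 'p \<Rightarrow> ('q set \<times> 't) set \<Rightarrow> ('p set \<times> 's) set"
  where "stalk_map S m x a = (\<Union>(V, t)\<in>a. germ S x (preimg S (fst m) V) (snd m V t))"

definition kmorphism ::
    "'k::field set \<Rightarrow> ('k, 'p, 's) kspace \<Rightarrow> ('k, 'q, 't) kspace \<Rightarrow> ('p, 's, 'q, 't) kmap \<Rightarrow> bool"
  where "kmorphism k S T m \<longleftrightarrow>
    continuous_map (topol S) (topol T) (fst m) \<and>
    (\<forall>V. openin (topol T) V \<longrightarrow>
      snd m V \<in> ring_hom (sec T V) (sec S (preimg S (fst m) V))) \<and>
    (\<forall>V W. openin (topol T) V \<and> openin (topol T) W \<and> W \<subseteq> V \<longrightarrow>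
      (\<forall>t\<in>carrier (sec T V).
        snd m W (res T V W t) = res S (preimg S (fst m) V) (preimg S (fst m) W) (snd m V t))) \<and>
    (\<forall>c\<in>k. snd m (pts T) (str T c) = str S c) \<and>
    (\<forall>x\<in>pts S. \<forall>a\<in>carrier (stalk T (fst m x)).
      stalk_map S m x a \<in> Units (stalk S x) \<longrightarrow> a \<in> Units (stalk T (fst m x)))"

text \<open>Two pairs denote the same morphism if they agree on points and on sections over open sets.\<close>

definition kmap_eq ::
    "('k, 'p, 's) kspace \<Rightarrow> ('k, 'q, 't) kspace \<Rightarrow> ('p, 's, 'q, 't) kmap \<Rightarrow> ('p, 's, 'q, 't) kmap \<Rightarrow> bool"
  where "kmap_eq S T m n \<longleftrightarrow>
    (\<forall>x\<in>pts S. fst m x = fst n x) \<and>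
    (\<forall>V. openin (topol T) V \<longrightarrow> (\<forall>t\<in>carrier (sec T V). snd m V t = snd n V t))"

text \<open>Here \<open>T\<close> is the middle space, i.e. the domain of \<open>n\<close> and the codomain of \<open>m\<close>.\<close>

definition kmap_comp ::
    "('k, 'q, 't) kspace \<Rightarrow> ('q, 't, 'r, 'u) kmap \<Rightarrow> ('p, 's, 'q, 't) kmap \<Rightarrow> ('p, 's, 'r, 'u) kmap"
  where "kmap_comp T n m = (fst n \<circ> fst m, \<lambda>W. snd m (preimg T (fst n) W) \<circ> snd n W)"

definition kiso :: "'k::field set \<Rightarrow> ('k, 'p, 's) kspace \<Rightarrow> ('k, 'q, 't) kspace \<Rightarrow> bool"
  where "kiso k S T \<longleftrightarrow>
    (\<exists>m. kmorphism k S T m \<and> homeomorphic_map (topol S) (topol T) (fst m) \<and>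
      (\<forall>V. openin (topol T) V \<longrightarrow>
        snd m V \<in> ring_iso (sec T V) (sec S (preimg S (fst m) V))))"

definition open_subspace :: "('k, 'p, 's) kspace \<Rightarrow> 'p set \<Rightarrow> ('k, 'p, 's) kspace"
  where "open_subspace S U =
    \<lparr>topol = subtopology (topol S) U, sec = sec S, res = res S, str = res S (pts S) U \<circ> str S\<rparr>"

definition closed_immersion ::
    "'k::field set \<Rightarrow> ('k, 'p, 's) kspace \<Rightarrow> ('k, 'q, 't) kspace \<Rightarrow> ('p, 's, 'q, 't) kmap \<Rightarrow> bool"
  where "closed_immersion k Z S i \<longleftrightarrow>
    kmorphism k Z S i \<and>
    embedding_map (topol Z) (topol S) (fst i) \<and> closedin (topol S) (fst i ` pts Z) \<and>
    (\<forall>z\<in>pts Z. stalk_map Z i z ` carrier (stalk S (fst i z)) = carrier (stalk Z z))"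

definition spec_topology :: "'a ring \<Rightarrow> 'a set topology"
  where "spec_topology R =
    topology_generated_by ((\<lambda>f. {P. primeideal P R \<and> f \<notin> P}) ` carrier R)"

text \<open>Functions to the localizations at primes that locally are a fraction.\<close>

definition spec_sections :: "'a ring \<Rightarrow> 'a set set \<Rightarrow> ('a set \<Rightarrow> ('a \<times> 'a) set) set"
  where "spec_sections R U =
    {s \<in> extensional U. \<forall>P\<in>U. \<exists>W. openin (spec_topology R) W \<and> P \<in> W \<and> W \<subseteq> U \<and>
      (\<exists>a\<in>carrier R. \<exists>f\<in>carrier R. \<forall>Q\<in>W. f \<notin> Q \<and> s Q = fraction R (carrier R - Q) a f)}"

definition Spec :: "'a ring \<Rightarrow> ('k \<Rightarrow> 'a) \<Rightarrow> ('k, 'a set, 'a set \<Rightarrow> ('a \<times> 'a) set) kspace"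
  where "Spec R \<iota> =
    \<lparr>topol = spec_topology R,
     sec = (\<lambda>U.
       \<lparr>carrier = spec_sections R U,
        monoid.mult = (\<lambda>s t. \<lambda>P\<in>U. s P \<otimes>\<^bsub>localization R (carrier R - P)\<^esub> t P),
        monoid.one = (\<lambda>P\<in>U. \<one>\<^bsub>localization R (carrier R - P)\<^esub>),
        ring.zero = (\<lambda>P\<in>U. \<zero>\<^bsub>localization R (carrier R - P)\<^esub>),
        ring.add = (\<lambda>s t. \<lambda>P\<in>U. s P \<oplus>\<^bsub>localization R (carrier R - P)\<^esub> t P)\<rparr>),
     res = (\<lambda>U V s. restrict s V),
     str = (\<lambda>c. \<lambda>P\<in>{P. primeideal P R}. fraction R (carrier R - P) (\<iota> c) \<one>\<^bsub>R\<^esub>)\<rparr>"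

definition affine_open :: "'k::field set \<Rightarrow> ('k, 'p, 's) kspace \<Rightarrow> 'p set \<Rightarrow> bool"
  where "affine_open k S U \<longleftrightarrow>
    openin (topol S) U \<and>
    kiso k (open_subspace S U) (Spec (sec S U) (str (open_subspace S U)))"

definition kscheme :: "'k::field set \<Rightarrow> ('k, 'p, 's) kspace \<Rightarrow> bool"
  where "kscheme k S \<longleftrightarrow>
    locally_ringed_space k S \<and> (\<forall>x\<in>pts S. \<exists>U. x \<in> U \<and> affine_open k S U)"

definition finite_type_scheme :: "'k::field set \<Rightarrow> ('k, 'p, 's) kspace \<Rightarrow> bool"
  where "finite_type_scheme k S \<longleftrightarrow>
    kscheme k S \<and>
    (\<exists>\<U>. finite \<U> \<and> \<Union>\<U> = pts S \<and>
      (\<forall>U\<in>\<U>. affine_open k S U \<and> fg_algebra k (sec S U) (str (open_subspace S U))))"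


section \<open>The Grothendieck ring of varieties\<close>

text \<open>
  Isomorphism classes are formed inside one fixed pair of types, namely those of \<open>Spec R\<close> for rings
  \<open>R\<close> with carrier in \<open>'k\<close>.  If \<open>'k\<close> is infinite (in characteristic \<open>0\<close> it is), this is no
  restriction: a scheme of finite type over \<open>k \<subseteq> 'k\<close> has at most \<open>|'k|\<close> points and at most \<open>|'k|\<close>
  sections over each open set, hence an isomorphic copy on these types.  In particular these schemes
  have products among themselves.  A space on other types has a class as well, via its copies.
\<close>

type_synonym 'k small_space = "('k, 'k set, 'k set \<Rightarrow> ('k \<times> 'k) set) kspace"

definition iso_class :: "'k::field set \<Rightarrow> ('k, 'p, 's) kspace \<Rightarrow> 'k small_space set"
  where "iso_class k S = {T. finite_type_scheme k T \<and> kiso k T S}"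

definition free_var_group :: "'k::field set \<Rightarrow> ('k small_space set, int) poly_mapping monoid"
  where "free_var_group k =
    free_Abelian_group (iso_class k ` {S :: 'k small_space. finite_type_scheme k S})"

definition scissor_relations :: "'k::field set \<Rightarrow> ('k small_space set, int) poly_mapping set"
  where "scissor_relations k =
    {frag_of (iso_class k S)
       - (frag_of (iso_class k (open_subspace S (pts S - fst i ` pts Z))) + frag_of (iso_class k Z))
     | (S :: 'k small_space) (Z :: 'k small_space) i.
       finite_type_scheme k S \<and> finite_type_scheme k Z \<and> closed_immersion k Z S i}"

definition scissor_subgroup :: "'k::field set \<Rightarrow> ('k small_space set, int) poly_mapping set"
  where "scissor_subgroup k = generate (free_var_group k) (scissor_relations k)"

definition K0_group :: "'k::field set \<Rightarrow> ('k small_space set, int) poly_mapping set monoid"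
  where "K0_group k = free_var_group k Mod scissor_subgroup k"

definition var_class ::
    "'k::field set \<Rightarrow> ('k, 'p, 's) kspace \<Rightarrow> ('k small_space set, int) poly_mapping set"
  where "var_class k S = scissor_subgroup k #>\<^bsub>free_var_group k\<^esub> frag_of (iso_class k S)"

definition is_product ::
    "'k::field set \<Rightarrow> 'k small_space \<Rightarrow> 'k small_space \<Rightarrow> 'k small_space \<Rightarrow> bool"
  where "is_product k S T P \<longleftrightarrow>
    (\<exists>p q. kmorphism k P S p \<and> kmorphism k P T q \<and>
      (\<forall>(Q :: 'k small_space) a b.
        kscheme k Q \<and> kmorphism k Q S a \<and> kmorphism k Q T b \<longrightarrow>
        (\<exists>m. (kmorphism k Q P m \<and> kmap_eq Q S (kmap_comp P p m) a \<and>
              kmap_eq Q T (kmap_comp P q m) b) \<and>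
          (\<forall>n. kmorphism k Q P n \<and> kmap_eq Q S (kmap_comp P p n) a \<and>
               kmap_eq Q T (kmap_comp P q n) b \<longrightarrow> kmap_eq Q P n m))))"

text \<open>
  \<open>A\<close> is the ring \<open>K\<^sub>0(Var\<^sub>k)\<close>: the additive group is the quotient group above, and the ring
  structure on it is given by \<open>[S] \<cdot> [T] = [S \<times>\<^sub>k T]\<close> and \<open>1 = [Spec k]\<close>.  As the classes \<open>[S]\<close>
  generate the group, these conditions leave only one choice for the operations.
\<close>

definition is_K0_ring ::
    "'k::field set \<Rightarrow> ('k small_space set, int) poly_mapping set ring \<Rightarrow> bool"
  where "is_K0_ring k A \<longleftrightarrow>
    cring A \<and>
    carrier A = carrier (K0_group k) \<and>
    (\<forall>a\<in>carrier A. \<forall>b\<in>carrier A. a \<oplus>\<^bsub>A\<^esub> b = a \<otimes>\<^bsub>K0_group k\<^esub> b) \<and>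
    (\<forall>S T P. finite_type_scheme k S \<and> finite_type_scheme k T \<and> finite_type_scheme k P \<and>
      is_product k S T P \<longrightarrow> var_class k S \<otimes>\<^bsub>A\<^esub> var_class k T = var_class k P) \<and>
    \<one>\<^bsub>A\<^esub> = var_class k (Spec (base_ring k) id)"

definition affine_line :: "'k::field set \<Rightarrow> ('k, 'k list set, 'k list set \<Rightarrow> ('k list \<times> 'k list) set) kspace"
  where "affine_line k =
    Spec (univ_poly ring_of_type_algebra k) (ring.poly_of_const ring_of_type_algebra)"

abbreviation lefschetz :: "'k::field set \<Rightarrow> ('k small_space set, int) poly_mapping set"
  where "lefschetz k \<equiv> var_class k (affine_line k)"


section \<open>Semilinear actions and their quotients\<close>

definition gal_group :: "'k::field set \<Rightarrow> ('k \<Rightarrow> 'k) monoid"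
  where "gal_group k = BijGroup UNIV
    \<lparr>carrier := {\<tau> \<in> ring_iso ring_of_type_algebra ring_of_type_algebra. \<forall>c\<in>k. \<tau> c = c}\<rparr>"

definition galois_extension :: "'k::field set \<Rightarrow> bool"
  where "galois_extension k \<longleftrightarrow>
    subfield k (ring_of_type_algebra :: 'k ring) \<and>
    (\<forall>x. ring.algebraic (ring_of_type_algebra :: 'k ring) k x) \<and>
    {x. \<forall>\<tau>\<in>carrier (gal_group k). \<tau> x = x} = k"

definition group_exponent :: "('g, 'm) monoid_scheme \<Rightarrow> nat"
  where "group_exponent G = (LEAST n. 0 < n \<and> (\<forall>g\<in>carrier G. g [^]\<^bsub>G\<^esub> n = \<one>\<^bsub>G\<^esub>))"

text \<open>
  Polynomials with coefficients in \<open>'k\<close> and with variables in a set \<open>W\<close>; the monomials are finitely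
  supported maps to \<open>nat\<close>.
\<close>

type_synonym ('x, 'k) mpoly = "(('x, nat) poly_mapping, 'k) poly_mapping"

definition mpoly_ring :: "'x set \<Rightarrow> ('x, 'k::field) mpoly ring"
  where "mpoly_ring W = ring_of_type_algebra
    \<lparr>carrier := {p. \<forall>m\<in>Poly_Mapping.keys p. Poly_Mapping.keys m \<subseteq> W}\<rparr>"

definition mpoly_var :: "'x \<Rightarrow> ('x, 'k::field) mpoly"
  where "mpoly_var x = Poly_Mapping.single (Poly_Mapping.single x 1) 1"

definition mpoly_const :: "'k::field \<Rightarrow> ('x, 'k) mpoly"
  where "mpoly_const c = Poly_Mapping.single 0 c"

text \<open>Apply \<open>\<tau>\<close> to the coefficients and replace each variable \<open>x\<close> by the variable \<open>h x\<close>.\<close>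

definition mpoly_map :: "('k \<Rightarrow> 'k) \<Rightarrow> ('x \<Rightarrow> 'x) \<Rightarrow> ('x, 'k::field) mpoly \<Rightarrow> ('x, 'k) mpoly"
  where "mpoly_map \<tau> h p =
    (\<Sum>m\<in>Poly_Mapping.keys p. mpoly_const (\<tau> (Poly_Mapping.lookup p m)) *
      (\<Prod>x\<in>Poly_Mapping.keys m. mpoly_var (h x) ^ Poly_Mapping.lookup m x))"

definition dual_space :: "('k::field \<Rightarrow> 'v::ab_group_add \<Rightarrow> 'v) \<Rightarrow> ('v \<Rightarrow> 'k) set"
  where "dual_space scale = {\<phi>. Vector_Spaces.linear scale (*) \<phi>}"

text \<open>
  The symmetric algebra of the dual space: the polynomial ring with one variable for each linear
  form, modulo the relations that make the passage from linear forms to variables linear.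
\<close>

definition sym_ideal ::
    "('k::field \<Rightarrow> 'v::ab_group_add \<Rightarrow> 'v) \<Rightarrow> ('v \<Rightarrow> 'k, 'k) mpoly set"
  where "sym_ideal scale = genideal (mpoly_ring (dual_space scale))
    ({mpoly_var (\<lambda>v. \<phi> v + \<psi> v) - (mpoly_var \<phi> + mpoly_var \<psi>)
      | \<phi> \<psi>. \<phi> \<in> dual_space scale \<and> \<psi> \<in> dual_space scale} \<union>
     {mpoly_var (\<lambda>v. c * \<phi> v) - mpoly_const c * mpoly_var \<phi> | c \<phi>. \<phi> \<in> dual_space scale})"

definition sym_dual ::
    "('k::field \<Rightarrow> 'v::ab_group_add \<Rightarrow> 'v) \<Rightarrow> ('v \<Rightarrow> 'k, 'k) mpoly set ring"
  where "sym_dual scale = mpoly_ring (dual_space scale) Quot sym_ideal scale"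

definition sym_const ::
    "('k::field \<Rightarrow> 'v::ab_group_add \<Rightarrow> 'v) \<Rightarrow> 'k \<Rightarrow> ('v \<Rightarrow> 'k, 'k) mpoly set"
  where "sym_const scale c = sym_ideal scale +>\<^bsub>mpoly_ring (dual_space scale)\<^esub> mpoly_const c"

text \<open>
  The elements of \<open>sym_dual\<close> are cosets, and \<open>\<sigma>\<close> acts on them by taking images under the ring
  automorphism of the polynomial ring that is \<open>\<rho> \<sigma>\<close> on constants and sends the variable of \<open>\<phi>\<close> to
  the variable of \<open>\<rho> \<sigma> \<circ> \<phi> \<circ> \<sigma>\<inverse>\<close>; it preserves the ideal.
\<close>

definition sym_action ::
    "('g, 'm) monoid_scheme \<Rightarrow> ('g \<Rightarrow> 'k \<Rightarrow> 'k) \<Rightarrow> ('g \<Rightarrow> 'v \<Rightarrow> 'v) \<Rightarrow> 'g \<Rightarrow>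
      ('v \<Rightarrow> 'k, 'k::field) mpoly set \<Rightarrow> ('v \<Rightarrow> 'k, 'k) mpoly set"
  where "sym_action G \<rho> act \<sigma> a = mpoly_map (\<rho> \<sigma>) (\<lambda>\<phi>. \<rho> \<sigma> \<circ> \<phi> \<circ> act (inv\<^bsub>G\<^esub> \<sigma>)) ` a"

definition invariant_ring ::
    "('k::field \<Rightarrow> 'v::ab_group_add \<Rightarrow> 'v) \<Rightarrow> ('g, 'm) monoid_scheme \<Rightarrow> ('g \<Rightarrow> 'k \<Rightarrow> 'k) \<Rightarrow>
      ('g \<Rightarrow> 'v \<Rightarrow> 'v) \<Rightarrow> ('v \<Rightarrow> 'k, 'k) mpoly set ring"
  where "invariant_ring scale G \<rho> act = (sym_dual scale)
    \<lparr>carrier := {a \<in> carrier (sym_dual scale). \<forall>\<sigma>\<in>carrier G. sym_action G \<rho> act \<sigma> a = a}\<rparr>"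

abbreviation quotient_variety ::
    "('k::field \<Rightarrow> 'v::ab_group_add \<Rightarrow> 'v) \<Rightarrow> ('g, 'm) monoid_scheme \<Rightarrow> ('g \<Rightarrow> 'k \<Rightarrow> 'k) \<Rightarrow>
      ('g \<Rightarrow> 'v \<Rightarrow> 'v) \<Rightarrow>
      ('k, ('v \<Rightarrow> 'k, 'k) mpoly set set,
       ('v \<Rightarrow> 'k, 'k) mpoly set set \<Rightarrow> (('v \<Rightarrow> 'k, 'k) mpoly set \<times> ('v \<Rightarrow> 'k, 'k) mpoly set) set) kspace"
  where "quotient_variety scale G \<rho> act \<equiv> Spec (invariant_ring scale G \<rho> act) (sym_const scale)"

end

(*
  The group acts k-linearly with order dividing N, and all N-th roots of unity lie in k, so a
  finite Fourier transform gives a K-basis of V consisting of simultaneous eigenvectors.  In the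
  dual coordinates the ring of invariants is the algebra of those polynomials whose coefficient at
  x^a lies in D a, the k-subspace of K on which the Galois group acts through the character of
  weight a.  Each D a is zero or a line over k, and 1 lies in D a for a in N Z^n.

  For such a multigraded family D, cutting along the hyperplanes x_i = 0 decomposes the spectrum
  into strata.  On the open stratum, where all remaining x_i are invertible, the exponents a with
  D a nonzero form a full sublattice; after choosing a basis of it and nonzero elements of the lines
  D a, the stratum becomes a standard split torus.  Hence the class depends only on the number of
  variables, and it can be compared with the trivial family D a = k, which gives affine space.
*)
theory Submission
  imports Defs
begin

text \<open>The coordinate \<open>x_i\<close> need not lie in a multigraded algebra, but
  \<open>x_i ^ N\<close> does. Hence \<open>x_i ^ N\<close> is the function that is inverted, and
  the stratum \<open>x_i = 0\<close> is its zero set only up to radicals: an element killed by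
  setting \<open>x_i\<close> to 0 has its \<open>N\<close>-th power divisible by
  \<open>x_i ^ N\<close>. The nonzero elements of the lines are chosen on a lattice basis and
  extended multiplicatively, which splits the torus. The given family and the trivial one obey the
  same recursion under cutting, so their classes are compared by one induction and neither is
  computed. What shapes most of the text is that schemes are locally ringed spaces: morphisms into a
  spectrum must be built from ring homomorphisms, shown to be unique (products in \<open>K0\<close>
  are given by a universal property against all schemes) and recognised as open or closed
  immersions. Conditions on stalks are mostly rephrased through sections that are invertible near a
  point. Classes live on one pair of types attached to \<open>'k\<close>, so algebras are copied to
  rings with carrier in \<open>'k\<close> before the relations of \<open>K0\<close> are
  applied.\<close>

section \<open>Commutative rings and local rings\<close>

lemma ring_hom_Units:
  assumes "h \<in> ring_hom R S" "u \<in> Units R"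
  shows "h u \<in> Units S"
proof -
  obtain v where v: "v \<in> carrier R" "v \<otimes>\<^bsub>R\<^esub> u = \<one>\<^bsub>R\<^esub>" "u \<otimes>\<^bsub>R\<^esub> v = \<one>\<^bsub>R\<^esub>" "u \<in> carrier R"
    using assms(2) by (auto simp: Units_def)
  have "h v \<otimes>\<^bsub>S\<^esub> h u = \<one>\<^bsub>S\<^esub>" "h u \<otimes>\<^bsub>S\<^esub> h v = \<one>\<^bsub>S\<^esub>"
    using v ring_hom_mult[OF assms(1)] ring_hom_one[OF assms(1)] by metis+
  then show ?thesis
    using v ring_hom_closed[OF assms(1)] by (auto simp: Units_def)
qed

lemma (in cring) Units_multD:
  assumes "a \<in> carrier R" "b \<in> carrier R" "a \<otimes> b \<in> Units R"
  shows "a \<in> Units R" "b \<in> Units R"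
  using assms unit_factor m_comm by metis+

text \<open>Every axiom of commutative rings mentions at most three elements, so it can be checked
  in a ring \<open>C\<close> whose image contains those three. Stalks satisfy this because three
  germs have representatives on one common open set. That \<open>h\<close> preserves zero is asked
  separately, as it does not follow from \<open>ring_hom\<close> before \<open>R\<close> is known to
  be a ring.\<close>

lemma cring_locally:
  fixes R :: "('a, 'm) ring_scheme"
  assumes "\<And>x y z. \<lbrakk>x \<in> carrier R; y \<in> carrier R; z \<in> carrier R\<rbrakk> \<Longrightarrow>
      \<exists>(C :: ('c, 'n) ring_scheme) h. cring C \<and> h \<in> ring_hom C R \<and> h \<zero>\<^bsub>C\<^esub> = \<zero>\<^bsub>R\<^esub> \<and> {x, y, z} \<subseteq> h ` carrier C"
    and z: "\<zero>\<^bsub>R\<^esub> \<in> carrier R"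
  shows "cring R"
proof -
  have *: "x \<oplus>\<^bsub>R\<^esub> y \<in> carrier R \<and> x \<otimes>\<^bsub>R\<^esub> y \<in> carrier R \<and> \<one>\<^bsub>R\<^esub> \<in> carrier R \<and>
      x \<oplus>\<^bsub>R\<^esub> y = y \<oplus>\<^bsub>R\<^esub> x \<and> x \<otimes>\<^bsub>R\<^esub> y = y \<otimes>\<^bsub>R\<^esub> x \<and>
      (x \<oplus>\<^bsub>R\<^esub> y) \<oplus>\<^bsub>R\<^esub> z = x \<oplus>\<^bsub>R\<^esub> (y \<oplus>\<^bsub>R\<^esub> z) \<and> (x \<otimes>\<^bsub>R\<^esub> y) \<otimes>\<^bsub>R\<^esub> z = x \<otimes>\<^bsub>R\<^esub> (y \<otimes>\<^bsub>R\<^esub> z) \<and>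
      (x \<oplus>\<^bsub>R\<^esub> y) \<otimes>\<^bsub>R\<^esub> z = x \<otimes>\<^bsub>R\<^esub> z \<oplus>\<^bsub>R\<^esub> y \<otimes>\<^bsub>R\<^esub> z \<and> \<zero>\<^bsub>R\<^esub> \<oplus>\<^bsub>R\<^esub> x = x \<and> \<one>\<^bsub>R\<^esub> \<otimes>\<^bsub>R\<^esub> x = x \<and>
      (\<exists>w\<in>carrier R. w \<oplus>\<^bsub>R\<^esub> x = \<zero>\<^bsub>R\<^esub>)"
    if xyz: "x \<in> carrier R" "y \<in> carrier R" "z \<in> carrier R" for x y z
  proof -
    obtain C :: "('c, 'n) ring_scheme" and h where C: "cring C" and h: "h \<in> ring_hom C R"
      and h0: "h \<zero>\<^bsub>C\<^esub> = \<zero>\<^bsub>R\<^esub>" and "{x, y, z} \<subseteq> h ` carrier C"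
      using assms(1)[OF xyz] by metis
    then obtain a b c where abc: "a \<in> carrier C" "b \<in> carrier C" "c \<in> carrier C"
      and eq: "x = h a" "y = h b" "z = h c" by auto
    interpret C: cring C by fact
    note hs = ring_hom_add[OF h, symmetric] ring_hom_mult[OF h, symmetric] ring_hom_one[OF h, symmetric]
      ring_hom_closed[OF h] h0[symmetric]
    have "h (\<ominus>\<^bsub>C\<^esub> a) \<in> carrier R \<and> h (\<ominus>\<^bsub>C\<^esub> a) \<oplus>\<^bsub>R\<^esub> x = \<zero>\<^bsub>R\<^esub>"
      unfolding eq using abc by (simp add: hs C.l_neg)
    then have ex: "\<exists>w\<in>carrier R. w \<oplus>\<^bsub>R\<^esub> x = \<zero>\<^bsub>R\<^esub>" by blast
    show ?thesis
      apply (intro conjI ex)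
      unfolding eq using abc
      by (simp_all add: hs) (simp_all add: C.a_ac C.m_ac C.l_distr C.r_distr)
  qed
  show ?thesis
  proof (rule cringI)
    show "abelian_group R"
      apply (rule abelian_groupI)
      subgoal for x y using *[of x y x] by blast
      subgoal by (rule z)
      subgoal for x y w using *[of x y w] by blast
      subgoal for x y using *[of x y x] by blast
      subgoal for x using *[of x x x] by blast
      subgoal for x using *[of x x x] by blast
      done
    show "comm_monoid R"
      apply (rule comm_monoidI)
      subgoal for x y using *[of x y x] by blast
      subgoal using *[OF z z z] by blast
      subgoal for x y w using *[of x y w] by blast
      subgoal for x using *[of x x x] by blast
      subgoal for x y using *[of x y x] by blast
      done
    show "(x \<oplus>\<^bsub>R\<^esub> y) \<otimes>\<^bsub>R\<^esub> z' = x \<otimes>\<^bsub>R\<^esub> z' \<oplus>\<^bsub>R\<^esub> y \<otimes>\<^bsub>R\<^esub> z'"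
      if "x \<in> carrier R" "y \<in> carrier R" "z' \<in> carrier R" for x y z'
      using *[OF that] by blast
  qed
qed

lemma (in cring) exists_maximalideal:
  assumes "ideal I R" "\<one> \<notin> I"
  shows "\<exists>M. maximalideal M R \<and> I \<subseteq> M"
proof -
  define A where "A = {J. ideal J R \<and> I \<subseteq> J \<and> \<one> \<notin> J}"
  have "\<exists>M\<in>A. \<forall>J\<in>A. M \<subseteq> J \<longrightarrow> J = M"
  proof (rule subset_Zorn_nonempty)
    show "A \<noteq> {}" using assms by (auto simp: A_def)
    fix C assume C: "C \<noteq> {}" "subset.chain A C"
    then have CA: "C \<subseteq> A" and "subset.chain {I. ideal I R} C"
      unfolding pred_on.chain_def A_def by blast+
    from chain_Union_is_ideal[OF this(2)] C(1) have "ideal (\<Union>C) R" by simp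
    moreover have "I \<subseteq> \<Union>C" "\<one> \<notin> \<Union>C" using C(1) CA unfolding A_def by auto
    ultimately show "\<Union>C \<in> A" by (simp add: A_def)
  qed
  then obtain M where "M \<in> A" and mx': "\<forall>J\<in>A. M \<subseteq> J \<longrightarrow> J = M" by blast
  then have M: "ideal M R" "I \<subseteq> M" "\<one> \<notin> M" by (auto simp: A_def)
  have mx: "J = M" if "ideal J R" "I \<subseteq> J" "\<one> \<notin> J" "M \<subseteq> J" for J
    using mx' that by (simp add: A_def)
  have "maximalideal M R"
  proof (rule maximalidealI)
    show "carrier R \<noteq> M" using M(3) by auto
    show "J = M \<or> J = carrier R" if "ideal J R" "M \<subseteq> J" "J \<subseteq> carrier R" for J
    proof (cases "\<one> \<in> J")
      case True
      then show ?thesis using ideal.one_imp_carrier[OF that(1)] by simp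
    next
      case False
      have "I \<subseteq> J" using M(2) that(2) by (rule subset_trans)
      then show ?thesis using mx[OF that(1) _ False that(2)] by simp
    qed
  qed (rule M)
  with M(2) show ?thesis by blast
qed

text \<open>The nonunits are the only candidate for a unique maximal ideal. The right-hand side
  mentions no ideals, only elements with sum 1, and so can be stated for sections near a point
  (\<open>local_at\<close>).\<close>

lemma local_ring_iff:
  fixes R :: "'a ring" (structure)
  assumes "cring R"
  shows "local_ring R \<longleftrightarrow> \<one> \<noteq> \<zero> \<and>
     (\<forall>a\<in>carrier R. \<forall>b\<in>carrier R. a \<oplus> b = \<one> \<longrightarrow> a \<in> Units R \<or> b \<in> Units R)"
proof -
  interpret cring R by fact
  show ?thesis
proof
  assume L: "local_ring R"
  then obtain M where M: "maximalideal M R" and un: "\<And>M'. maximalideal M' R \<Longrightarrow> M' = M"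
    unfolding local_ring_def by blast
  interpret M: maximalideal M R by fact
  have one: "\<one> \<notin> M" using M.one_imp_carrier M.I_notcarr by blast
  have nonunit: "a \<in> M" if a: "a \<in> carrier R" "a \<notin> Units R" for a
  proof -
    have "ideal (PIdl a) R" "\<one> \<notin> PIdl a"
      using a cgenideal_ideal[OF a(1)] by (auto simp: cgenideal_def Units_def m_comm)
    with exists_maximalideal[of "PIdl a"] un have "PIdl a \<subseteq> M" by blast
    then show ?thesis using cgenideal_self[OF a(1)] by blast
  qed
  have "\<one> \<noteq> \<zero>" using one M.zero_closed by auto
  moreover have "a \<in> Units R \<or> b \<in> Units R"
    if "a \<in> carrier R" "b \<in> carrier R" "a \<oplus> b = \<one>" for a b
    using that nonunit[of a] nonunit[of b] M.a_closed[of a b] one by auto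
  ultimately show "\<one> \<noteq> \<zero> \<and> (\<forall>a\<in>carrier R. \<forall>b\<in>carrier R. a \<oplus> b = \<one> \<longrightarrow> a \<in> Units R \<or> b \<in> Units R)"
    by blast
next
  assume A: "\<one> \<noteq> \<zero> \<and> (\<forall>a\<in>carrier R. \<forall>b\<in>carrier R. a \<oplus> b = \<one> \<longrightarrow> a \<in> Units R \<or> b \<in> Units R)"
  define M where "M = carrier R - Units R"
  have mult: "x \<otimes> a \<in> M" if "a \<in> M" "x \<in> carrier R" for a x
    using that Units_multD[of x a] by (auto simp: M_def)
  \<comment> \<open>If a sum of nonunits were a unit, dividing by it would produce two nonunits with
    sum 1.\<close>
  have add: "a \<oplus> b \<in> M" if ab: "a \<in> M" "b \<in> M" for a b
  proof (rule ccontr)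
    assume "a \<oplus> b \<notin> M"
    with ab have u: "a \<oplus> b \<in> Units R" by (auto simp: M_def)
    let ?v = "inv (a \<oplus> b)"
    have "?v \<otimes> a \<oplus> ?v \<otimes> b = \<one>"
      using ab u by (simp add: M_def r_distr[symmetric])
    moreover have "?v \<otimes> a \<in> M" "?v \<otimes> b \<in> M" using mult ab u by auto
    ultimately show False using A unfolding M_def by blast
  qed
  have z: "\<zero> \<in> M"
    using A by (auto simp: M_def Units_def)
  have id: "ideal M R"
  proof (rule idealI)
    show "subgroup M (add_monoid R)"
    proof (rule subgroup.intro)
      show "M \<subseteq> carrier (add_monoid R)" by (auto simp: M_def)
      show "inv\<^bsub>add_monoid R\<^esub> x \<in> M" if "x \<in> M" for x
      proof -
        have "x \<in> carrier R" using that by (simp add: M_def)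
        then have "\<ominus> x = (\<ominus> \<one>) \<otimes> x" by (simp add: l_minus)
        moreover have "(\<ominus> \<one>) \<otimes> x \<in> M" by (rule mult[OF that]) simp
        ultimately show ?thesis unfolding a_inv_def by metis
      qed
    qed (simp_all add: add z)
    show "a \<otimes> x \<in> M" if "a \<in> M" "x \<in> carrier R" for a x
      using mult[OF that] that m_comm[of a x] by (simp add: M_def)
  qed (fact mult ring_axioms)+
  have one: "\<one> \<notin> M" by (simp add: M_def)
  have sub: "J \<subseteq> M" if "ideal J R" "\<one> \<notin> J" for J
  proof
    fix x assume x: "x \<in> J"
    interpret J: ideal J R by fact
    have "x \<notin> Units R"
      using that(2) J.I_l_closed[OF x, of "inv x"] by (metis Units_inv_closed Units_l_inv)
    then show "x \<in> M" using x J.a_Hcarr by (simp add: M_def)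
  qed
  have "maximalideal M R"
  proof (rule maximalidealI[OF id])
    show "carrier R \<noteq> M" using one by auto
    show "J = M \<or> J = carrier R" if "ideal J R" "M \<subseteq> J" "J \<subseteq> carrier R" for J
    proof (cases "\<one> \<in> J")
      case True
      then show ?thesis using ideal.one_imp_carrier[OF that(1)] by simp
    next
      case False
      then show ?thesis using sub[OF that(1)] that(2) by simp
    qed
  qed
  moreover have "M' = M" if M': "maximalideal M' R" for M'
  proof -
    interpret M': maximalideal M' R by fact
    have "\<one> \<notin> M'" using M'.one_imp_carrier M'.I_notcarr by blast
    then have "M' \<subseteq> M" using sub M'.is_ideal by blast
    then have "M = M' \<or> M = carrier R" using M'.I_maximal[OF id] by (auto simp: M_def)
    then show ?thesis using one by auto
  qed
  ultimately show "local_ring R" unfolding local_ring_def using is_cring by blast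
qed
qed

section \<open>Ringed spaces: gluing and local invertibility\<close>

text \<open>Says that the germ of \<open>s\<close> at \<open>x\<close> is a unit of the stalk
  (\<open>germ_Units\<close>), in terms of sections alone. Locality of stalks and of morphisms is
  expressed through it.\<close>

definition unit_near :: "('k, 'p, 's) kspace \<Rightarrow> 'p \<Rightarrow> 'p set \<Rightarrow> 's \<Rightarrow> bool"
  where "unit_near S x U s \<longleftrightarrow>
    (\<exists>W. openin (topol S) W \<and> x \<in> W \<and> W \<subseteq> U \<and> res S U W s \<in> Units (sec S W))"

locale rspace =
  fixes k :: "'k::field set" and S :: "('k, 'p, 's) kspace"
  assumes ringed: "ringed_space k S"
begin

lemmas ringed_unfolded = ringed[unfolded ringed_space_def]

lemma sec_cring [intro]: "openin (topol S) U \<Longrightarrow> cring (sec S U)"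
  by (rule ringed_unfolded[THEN conjunct1, rule_format])

lemma sec_ring [intro]: "openin (topol S) U \<Longrightarrow> ring (sec S U)"
  using sec_cring cring.axioms(1) by blast

lemma res_hom: "\<lbrakk>openin (topol S) U; openin (topol S) V; V \<subseteq> U\<rbrakk> \<Longrightarrow> res S U V \<in> ring_hom (sec S U) (sec S V)"
  by (rule ringed_unfolded[THEN conjunct2, THEN conjunct1, rule_format]) simp

lemmas res_closed = ring_hom_closed[OF res_hom]
lemmas res_mult = ring_hom_mult[OF res_hom]
lemmas res_add = ring_hom_add[OF res_hom]
lemmas res_one = ring_hom_one[OF res_hom]
lemmas res_Units = ring_hom_Units[OF res_hom]

lemma res_zero: "\<lbrakk>openin (topol S) U; openin (topol S) V; V \<subseteq> U\<rbrakk> \<Longrightarrow> res S U V \<zero>\<^bsub>sec S U\<^esub> = \<zero>\<^bsub>sec S V\<^esub>"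
  by (rule ring_hom_zero[OF res_hom]) auto

lemma res_id: "\<lbrakk>openin (topol S) U; s \<in> carrier (sec S U)\<rbrakk> \<Longrightarrow> res S U U s = s"
  by (rule ringed_unfolded[THEN conjunct2, THEN conjunct2, THEN conjunct1, rule_format])

lemma res_res: "\<lbrakk>openin (topol S) U; openin (topol S) V; openin (topol S) W; W \<subseteq> V; V \<subseteq> U;
    s \<in> carrier (sec S U)\<rbrakk> \<Longrightarrow> res S V W (res S U V s) = res S U W s"
  by (rule ringed_unfolded[THEN conjunct2, THEN conjunct2, THEN conjunct2, THEN conjunct1, rule_format]) auto

lemma str_hom: "str S \<in> ring_hom (base_ring k) (sec S (pts S))"
  by (rule ringed_unfolded[THEN conjunct2, THEN conjunct2, THEN conjunct2, THEN conjunct2, THEN conjunct2, THEN conjunct2])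

lemma sec_eqI:
  assumes "openin (topol S) U" "s \<in> carrier (sec S U)" "t \<in> carrier (sec S U)"
    and loc: "\<And>x. x \<in> U \<Longrightarrow> \<exists>W. openin (topol S) W \<and> x \<in> W \<and> W \<subseteq> U \<and> res S U W s = res S U W t"
  shows "s = t"
proof -
  define \<U> where "\<U> = {W. openin (topol S) W \<and> W \<subseteq> U \<and> res S U W s = res S U W t}"
  have "\<Union>\<U> = U" using loc by (fastforce simp: \<U>_def)
  moreover have "\<forall>U\<in>\<U>. openin (topol S) U" by (simp add: \<U>_def)
  moreover have "\<forall>W\<in>\<U>. res S U W s = res S U W t" by (simp add: \<U>_def)
  ultimately show ?thesis
    using ringed_unfolded[THEN conjunct2, THEN conjunct2, THEN conjunct2, THEN conjunct2, THEN conjunct1,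
      THEN spec, of \<U>] assms(2,3) by simp
qed

text \<open>The cover is indexed by points, one neighbourhood for each, which is how local data
  arise in the constructions below; the sheaf axiom indexes sections by open sets instead.\<close>

lemma sec_glue:
  assumes "\<And>x. x \<in> U \<Longrightarrow> openin (topol S) (W x) \<and> x \<in> W x \<and> W x \<subseteq> U"
    and s: "\<And>x. x \<in> U \<Longrightarrow> s x \<in> carrier (sec S (W x))"
    and compat: "\<And>x y. \<lbrakk>x \<in> U; y \<in> U\<rbrakk> \<Longrightarrow> res S (W x) (W x \<inter> W y) (s x) = res S (W y) (W x \<inter> W y) (s y)"
  shows "\<exists>t\<in>carrier (sec S U). \<forall>x\<in>U. res S U (W x) t = s x"
proof -
  \<comment> \<open>Different points may share a neighbourhood. Compatibility then forces their
    sections to agree, so any point with the given neighbourhood may be chosen.\<close>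
  define s' where "s' V = s (SOME x. x \<in> U \<and> W x = V)" for V
  have W: "openin (topol S) (W x)" "x \<in> W x" "W x \<subseteq> U" if "x \<in> U" for x
    using assms(1)[OF that] by auto
  have s': "s' (W x) = s x" if x: "x \<in> U" for x
  proof -
    define y where "y = (SOME y. y \<in> U \<and> W y = W x)"
    have "y \<in> U \<and> W y = W x" unfolding y_def by (rule someI[of _ x]) (simp add: x)
    then have "res S (W x) (W x) (s x) = res S (W x) (W x) (s y)" and y: "y \<in> U" "W y = W x"
      using compat[of x y] x by auto
    then have "s x = s y" using res_id[OF W(1)[OF x]] s[OF x] s[OF y(1)] by (simp add: y)
    then show ?thesis by (simp add: s'_def y_def)
  qed
  have "\<Union>(W ` U) = U" using W by blast
  moreover have "\<exists>t\<in>carrier (sec S (\<Union>(W ` U))). \<forall>V\<in>W ` U. res S (\<Union>(W ` U)) V t = s' V"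
  proof -
    have 1: "\<forall>V\<in>W ` U. openin (topol S) V \<and> s' V \<in> carrier (sec S V)"
      using W s s' by auto
    have 2: "\<forall>V\<in>W ` U. \<forall>V'\<in>W ` U. res S V (V \<inter> V') (s' V) = res S V' (V \<inter> V') (s' V')"
      using s' compat by auto
    show ?thesis
      using ringed_unfolded[THEN conjunct2, THEN conjunct2, THEN conjunct2, THEN conjunct2, THEN conjunct2, THEN conjunct1,
        THEN spec, of "W ` U", THEN spec, of s'] 1 2 by simp
  qed
  ultimately show ?thesis using s' by auto
qed

lemma unit_near_res:
  assumes "openin (topol S) U" "openin (topol S) V" "V \<subseteq> U" "x \<in> V" "s \<in> carrier (sec S U)"
  shows "unit_near S x V (res S U V s) \<longleftrightarrow> unit_near S x U s"
proof
  assume "unit_near S x V (res S U V s)"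
  then obtain W where "openin (topol S) W" "x \<in> W" "W \<subseteq> V" "res S V W (res S U V s) \<in> Units (sec S W)"
    unfolding unit_near_def by blast
  then show "unit_near S x U s"
    unfolding unit_near_def using assms by (intro exI[of _ W]) (auto simp: res_res)
next
  assume "unit_near S x U s"
  then obtain W where W: "openin (topol S) W" "x \<in> W" "W \<subseteq> U" "res S U W s \<in> Units (sec S W)"
    unfolding unit_near_def by blast
  have o: "openin (topol S) (W \<inter> V)" using W assms by blast
  have "res S V (W \<inter> V) (res S U V s) = res S W (W \<inter> V) (res S U W s)"
    using assms W o by (simp add: res_res)
  moreover have "\<dots> \<in> Units (sec S (W \<inter> V))"
    by (rule res_Units[OF W(1) o _ W(4)]) auto
  ultimately show "unit_near S x V (res S U V s)"
    unfolding unit_near_def using o W assms by auto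
qed

lemma unit_near_Units:
  assumes "openin (topol S) U" "x \<in> U" "s \<in> Units (sec S U)"
  shows "unit_near S x U s"
  unfolding unit_near_def using assms by (intro exI[of _ U]) (auto simp: res_id Units_def)

lemma unit_near_mult:
  assumes U: "openin (topol S) U" and x: "x \<in> U" and st: "s \<in> carrier (sec S U)" "t \<in> carrier (sec S U)"
  shows "unit_near S x U (s \<otimes>\<^bsub>sec S U\<^esub> t) \<longleftrightarrow> unit_near S x U s \<and> unit_near S x U t"
proof
  assume "unit_near S x U (s \<otimes>\<^bsub>sec S U\<^esub> t)"
  then obtain W where W: "openin (topol S) W" "x \<in> W" "W \<subseteq> U" "res S U W (s \<otimes>\<^bsub>sec S U\<^esub> t) \<in> Units (sec S W)"
    unfolding unit_near_def by blast
  interpret W: cring "sec S W" using W by blast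
  have "res S U W s \<otimes>\<^bsub>sec S W\<^esub> res S U W t \<in> Units (sec S W)"
    using W U st by (simp add: res_mult)
  then have "res S U W s \<in> Units (sec S W)" "res S U W t \<in> Units (sec S W)"
    using W.Units_multD[OF res_closed[OF U W(1,3) st(1)] res_closed[OF U W(1,3) st(2)]] by simp_all
  then show "unit_near S x U s \<and> unit_near S x U t"
    using W unfolding unit_near_def by blast
next
  assume "unit_near S x U s \<and> unit_near S x U t"
  then obtain W W' where W: "openin (topol S) W" "x \<in> W" "W \<subseteq> U" "res S U W s \<in> Units (sec S W)"
    and W': "openin (topol S) W'" "x \<in> W'" "W' \<subseteq> U" "res S U W' t \<in> Units (sec S W')"
    unfolding unit_near_def by blast
  let ?V = "W \<inter> W'"
  have V: "openin (topol S) ?V" "?V \<subseteq> U" using W W' by auto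
  interpret V: cring "sec S ?V" using V by blast
  have "res S W ?V (res S U W s) \<in> Units (sec S ?V)" "res S W' ?V (res S U W' t) \<in> Units (sec S ?V)"
    using W W' V by (auto intro!: res_Units)
  then have "res S U ?V s \<in> Units (sec S ?V)" "res S U ?V t \<in> Units (sec S ?V)"
    using U V W W' st by (simp_all add: res_res)
  then have "res S U ?V (s \<otimes>\<^bsub>sec S U\<^esub> t) \<in> Units (sec S ?V)"
    using U V st by (simp add: res_mult)
  then show "unit_near S x U (s \<otimes>\<^bsub>sec S U\<^esub> t)"
    unfolding unit_near_def using V W W' by blast
qed

text \<open>Local inverses are unique, hence agree on overlaps and glue to a global inverse.\<close>

lemma Units_glue:
  assumes U: "openin (topol S) U" and s: "s \<in> carrier (sec S U)"
    and near: "\<And>x. x \<in> U \<Longrightarrow> unit_near S x U s"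
  shows "s \<in> Units (sec S U)"
proof -
  define P where "P x W \<longleftrightarrow> openin (topol S) W \<and> x \<in> W \<and> W \<subseteq> U \<and> res S U W s \<in> Units (sec S W)" for x W
  define W where "W x = (SOME W. P x W)" for x
  have PW: "P x (W x)" if "x \<in> U" for x
    using near[OF that] unfolding W_def unit_near_def P_def by (rule someI_ex)
  then have W: "openin (topol S) (W x)" "x \<in> W x" "W x \<subseteq> U" "res S U (W x) s \<in> Units (sec S (W x))"
    if "x \<in> U" for x using that unfolding P_def by auto
  define v where "v x = inv\<^bsub>sec S (W x)\<^esub> (res S U (W x) s)" for x
  have v: "v x \<in> carrier (sec S (W x))" "res S U (W x) s \<otimes>\<^bsub>sec S (W x)\<^esub> v x = \<one>\<^bsub>sec S (W x)\<^esub>" if "x \<in> U" for x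
  proof -
    interpret Wx: cring "sec S (W x)" using W that by blast
    show "v x \<in> carrier (sec S (W x))" "res S U (W x) s \<otimes>\<^bsub>sec S (W x)\<^esub> v x = \<one>\<^bsub>sec S (W x)\<^esub>"
      unfolding v_def using W(4)[OF that] by auto
  qed
  have v': "res S (W x) V (v x) \<in> carrier (sec S V)"
      "res S U V s \<otimes>\<^bsub>sec S V\<^esub> res S (W x) V (v x) = \<one>\<^bsub>sec S V\<^esub>"
    if "x \<in> U" "openin (topol S) V" "V \<subseteq> W x" for x V
  proof -
    have "res S (W x) V (res S U (W x) s) \<otimes>\<^bsub>sec S V\<^esub> res S (W x) V (v x) = \<one>\<^bsub>sec S V\<^esub>"
      using res_mult[of "W x" V "res S U (W x) s" "v x"] res_one[of "W x" V] res_closed[of U "W x" s]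
        v[OF that(1)] that W(1,3)[OF that(1)] U s by simp
    then show "res S U V s \<otimes>\<^bsub>sec S V\<^esub> res S (W x) V (v x) = \<one>\<^bsub>sec S V\<^esub>"
      using that W[OF that(1)] U s by (simp add: res_res)
    show "res S (W x) V (v x) \<in> carrier (sec S V)"
      by (rule res_closed) (use v[OF that(1)] that W[OF that(1)] in auto)
  qed
  have "\<exists>t\<in>carrier (sec S U). \<forall>x\<in>U. res S U (W x) t = v x"
  proof (rule sec_glue)
    fix x y assume xy: "x \<in> U" "y \<in> U"
    let ?V = "W x \<inter> W y"
    have V: "openin (topol S) ?V" "?V \<subseteq> W x" "?V \<subseteq> W y" "?V \<subseteq> U" using W xy by auto
    interpret V: cring "sec S ?V" using V by blast
    have sc: "res S U ?V s \<in> carrier (sec S ?V)" using res_closed[OF U V(1,4) s] .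
    show "res S (W x) ?V (v x) = res S (W y) ?V (v y)"
      using V.inv_unique[of "res S (W x) ?V (v x)" "res S U ?V s" "res S (W y) ?V (v y)"]
        v'[OF xy(1) V(1,2)] v'[OF xy(2) V(1,3)] sc by (simp add: V.m_comm)
  qed (use W v in auto)
  then obtain t where t: "t \<in> carrier (sec S U)" "\<And>x. x \<in> U \<Longrightarrow> res S U (W x) t = v x" by blast
  interpret cring "sec S U" using U by blast
  have "s \<otimes>\<^bsub>sec S U\<^esub> t = \<one>\<^bsub>sec S U\<^esub>"
  proof (rule sec_eqI[OF U])
    fix x assume x: "x \<in> U"
    have "res S U (W x) (s \<otimes>\<^bsub>sec S U\<^esub> t) = res S U (W x) \<one>\<^bsub>sec S U\<^esub>"
      using U W[OF x] s t v[OF x] x by (simp add: res_mult res_one)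
    then show "\<exists>W. openin (topol S) W \<and> x \<in> W \<and> W \<subseteq> U \<and> res S U W (s \<otimes>\<^bsub>sec S U\<^esub> t) = res S U W \<one>\<^bsub>sec S U\<^esub>"
      using W[OF x] by blast
  qed (use s t in auto)
  then show ?thesis using s t m_comm[OF s t(1)] unfolding Units_def by auto
qed

section \<open>Stalks\<close>

text \<open>A germ is the set of all its representatives, so equality of germs rests on transitivity
  of agreeing near \<open>x\<close>: restrict to the intersection of the two witnessing
  neighbourhoods.\<close>

lemma germ_eq_iff:
  assumes "openin (topol S) U" "x \<in> U" "s \<in> carrier (sec S U)"
    and "openin (topol S) V" "x \<in> V" "t \<in> carrier (sec S V)"
  shows "germ S x U s = germ S x V t \<longleftrightarrow>
    (\<exists>W. openin (topol S) W \<and> x \<in> W \<and> W \<subseteq> U \<inter> V \<and> res S U W s = res S V W t)" (is "_ \<longleftrightarrow> ?eq U s V t")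
proof -
  have trans: "?eq U s V' u" if st: "?eq U s V t" and tu: "?eq V t V' u"
    and o: "openin (topol S) U" "openin (topol S) V" "openin (topol S) V'"
    and c: "s \<in> carrier (sec S U)" "t \<in> carrier (sec S V)" "u \<in> carrier (sec S V')" for U V V' s t u
  proof -
    obtain W where W: "openin (topol S) W" "x \<in> W" "W \<subseteq> U \<inter> V" "res S U W s = res S V W t" using st by blast
    obtain W' where W': "openin (topol S) W'" "x \<in> W'" "W' \<subseteq> V \<inter> V'" "res S V W' t = res S V' W' u" using tu by blast
    let ?W = "W \<inter> W'"
    have oW: "openin (topol S) ?W" using W W' by blast
    have "res S U ?W s = res S W ?W (res S U W s)" using o W(1-3) c oW by (simp add: res_res)
    also have "\<dots> = res S V ?W t" unfolding W(4) using o W(1-3) c oW by (simp add: res_res)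
    also have "\<dots> = res S W' ?W (res S V W' t)" using o W'(1-3) c oW by (simp add: res_res)
    also have "\<dots> = res S V' ?W u" unfolding W'(4) using o W'(1-3) c oW by (simp add: res_res)
    finally show ?thesis using oW W W' by blast
  qed
  have refl: "(U, s) \<in> germ S x U s" if "openin (topol S) U" "x \<in> U" "s \<in> carrier (sec S U)" for U s
    using that unfolding germ_def by blast
  have sym: "?eq V t U s" if "?eq U s V t" for U s V t using that by (metis inf_commute)
  show ?thesis
  proof
    assume "germ S x U s = germ S x V t"
    with refl[OF assms(4-6)] have "(V, t) \<in> germ S x U s" by simp
    then show "?eq U s V t" unfolding germ_def by blast
  next
    assume eq: "?eq U s V t"
    show "germ S x U s = germ S x V t"
    proof (rule subset_antisym; rule subsetI)
      fix p assume "p \<in> germ S x U s"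
      then obtain V' u where p: "p = (V', u)" "openin (topol S) V'" "x \<in> V'" "u \<in> carrier (sec S V')" and "?eq U s V' u"
        unfolding germ_def by blast
      then have "?eq V t V' u" using trans[OF sym[OF eq]] assms by blast
      then show "p \<in> germ S x V t" using p unfolding germ_def by blast
    next
      fix p assume "p \<in> germ S x V t"
      then obtain V' u where p: "p = (V', u)" "openin (topol S) V'" "x \<in> V'" "u \<in> carrier (sec S V')" and "?eq V t V' u"
        unfolding germ_def by blast
      then have "?eq U s V' u" using trans[OF eq] assms by blast
      then show "p \<in> germ S x U s" using p unfolding germ_def by blast
    qed
  qed
qed

lemma germ_refl: "\<lbrakk>openin (topol S) U; x \<in> U; s \<in> carrier (sec S U)\<rbrakk> \<Longrightarrow> (U, s) \<in> germ S x U s"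
  unfolding germ_def by blast

lemma germ_memD:
  assumes "(V, t) \<in> germ S x U s" "openin (topol S) U" "x \<in> U" "s \<in> carrier (sec S U)"
  shows "openin (topol S) V" "x \<in> V" "t \<in> carrier (sec S V)" "germ S x V t = germ S x U s"
proof -
  show 1: "openin (topol S) V" "x \<in> V" "t \<in> carrier (sec S V)" using assms(1) unfolding germ_def by auto
  have "\<exists>W. openin (topol S) W \<and> x \<in> W \<and> W \<subseteq> U \<inter> V \<and> res S U W s = res S V W t"
    using assms(1) unfolding germ_def by auto
  then have "germ S x U s = germ S x V t" using germ_eq_iff[OF assms(2-4) 1] by simp
  then show "germ S x V t = germ S x U s" ..
qed

lemma germ_res:
  assumes "openin (topol S) U" "openin (topol S) V" "V \<subseteq> U" "x \<in> V" "s \<in> carrier (sec S U)"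
  shows "germ S x V (res S U V s) = germ S x U s"
proof -
  have c: "res S U V s \<in> carrier (sec S V)" using assms res_closed by blast
  have "res S V V (res S U V s) = res S U V s" using c assms res_id by blast
  then show ?thesis unfolding germ_eq_iff[OF assms(2,4) c assms(1) subsetD[OF assms(3,4)] assms(5)]
    using assms by (intro exI[of _ V]) simp
qed

text \<open>The operations of \<open>stalk\<close> are unions over all representatives. If every
  representative contributes the same set, the union collapses to it, the index set being nonempty
  by \<open>germ_refl\<close>.\<close>

lemma germ_UN:
  assumes "openin (topol S) U" "x \<in> U" "s \<in> carrier (sec S U)"
    and "\<And>V t. \<lbrakk>openin (topol S) V; x \<in> V; t \<in> carrier (sec S V); germ S x V t = germ S x U s\<rbrakk> \<Longrightarrow> F V t = F U s"
  shows "(\<Union>(V, t)\<in>germ S x U s. F V t) = F U s"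
proof -
  have "F V t = F U s" if "(V, t) \<in> germ S x U s" for V t
    by (rule assms(4)) (rule germ_memD[OF that assms(1-3)])+
  then have "(\<Union>(V, t)\<in>germ S x U s. F V t) = (\<Union>(V, t)\<in>germ S x U s. F U s)"
    by (intro SUP_cong) auto
  then show ?thesis using germ_refl[OF assms(1-3)] by auto
qed

text \<open>Well-definedness for any operation that commutes with restriction, applied to addition
  and multiplication alike. The key is \<open>main\<close>: the result may be computed on any
  smaller neighbourhood of \<open>x\<close>, in particular on one where two choices of
  representatives coincide.\<close>

lemma germ_op:
  assumes ob: "\<And>V W s t. \<lbrakk>openin (topol S) V; s \<in> carrier (sec S V); t \<in> carrier (sec S V)\<rbrakk> \<Longrightarrow> ob V s t \<in> carrier (sec S V)"
    and res: "\<And>V W s t. \<lbrakk>openin (topol S) V; openin (topol S) W; W \<subseteq> V; s \<in> carrier (sec S V); t \<in> carrier (sec S V)\<rbrakk>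
      \<Longrightarrow> res S V W (ob V s t) = ob W (res S V W s) (res S V W t)"
    and U: "openin (topol S) U" "x \<in> U" "s \<in> carrier (sec S U)"
    and V: "openin (topol S) V" "x \<in> V" "t \<in> carrier (sec S V)"
  shows "(\<Union>(U', s')\<in>germ S x U s. \<Union>(V', t')\<in>germ S x V t.
       germ S x (U' \<inter> V') (ob (U' \<inter> V') (res S U' (U' \<inter> V') s') (res S V' (U' \<inter> V') t'))) =
     germ S x (U \<inter> V) (ob (U \<inter> V) (res S U (U \<inter> V) s) (res S V (U \<inter> V) t))"
proof -
  let ?g = "\<lambda>U s V t. germ S x (U \<inter> V) (ob (U \<inter> V) (res S U (U \<inter> V) s) (res S V (U \<inter> V) t))"
  have main: "?g U s V t = germ S x W (ob W (res S U W s) (res S V W t))"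
    if U: "openin (topol S) U" "x \<in> U" "s \<in> carrier (sec S U)"
      and V: "openin (topol S) V" "x \<in> V" "t \<in> carrier (sec S V)"
      and W: "openin (topol S) W" "x \<in> W" "W \<subseteq> U" "W \<subseteq> V" for U s V t W
  proof -
    have o: "openin (topol S) (U \<inter> V)" using U V by blast
    have c: "res S U (U \<inter> V) s \<in> carrier (sec S (U \<inter> V))" "res S V (U \<inter> V) t \<in> carrier (sec S (U \<inter> V))"
      using res_closed U V o by auto
    have "ob W (res S U W s) (res S V W t) = res S (U \<inter> V) W (ob (U \<inter> V) (res S U (U \<inter> V) s) (res S V (U \<inter> V) t))"
      using U V W o c by (simp add: res res_res)
    then show ?thesis using germ_res[OF o W(1), of x] ob[OF o c] W by simp
  qed
  have eq: "?g U' s' V' t' = ?g U s V t"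
    if U: "openin (topol S) U" "x \<in> U" "s \<in> carrier (sec S U)"
      and V: "openin (topol S) V" "x \<in> V" "t \<in> carrier (sec S V)"
      and U': "openin (topol S) U'" "x \<in> U'" "s' \<in> carrier (sec S U')" "germ S x U' s' = germ S x U s"
      and V': "openin (topol S) V'" "x \<in> V'" "t' \<in> carrier (sec S V')" "germ S x V' t' = germ S x V t"
    for U s V t U' s' V' t'
  proof -
    obtain W1 where W1: "openin (topol S) W1" "x \<in> W1" "W1 \<subseteq> U' \<inter> U" "res S U' W1 s' = res S U W1 s"
      using germ_eq_iff[OF U'(1-3) U] U'(4) by blast
    obtain W2 where W2: "openin (topol S) W2" "x \<in> W2" "W2 \<subseteq> V' \<inter> V" "res S V' W2 t' = res S V W2 t"
      using germ_eq_iff[OF V'(1-3) V] V'(4) by blast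
    let ?W = "W1 \<inter> W2"
    have W: "openin (topol S) ?W" "x \<in> ?W" using W1 W2 by auto
    have "res S U' ?W s' = res S W1 ?W (res S U' W1 s')" using U' W1(1-3) W by (simp add: res_res)
    also have "\<dots> = res S U ?W s" unfolding W1(4) using U W1(1-3) W by (simp add: res_res)
    finally have 1: "res S U' ?W s' = res S U ?W s" .
    have "res S V' ?W t' = res S W2 ?W (res S V' W2 t')" using V' W2(1-3) W by (simp add: res_res)
    also have "\<dots> = res S V ?W t" unfolding W2(4) using V W2(1-3) W by (simp add: res_res)
    finally have 2: "res S V' ?W t' = res S V ?W t" .
    have sub: "?W \<subseteq> U'" "?W \<subseteq> V'" "?W \<subseteq> U" "?W \<subseteq> V" using W1(3) W2(3) by blast+
    show ?thesis
      unfolding main[OF U'(1-3) V'(1-3) W sub(1,2)] main[OF U V W sub(3,4)] 1 2 ..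
  qed
  have inner: "(\<Union>(V', t')\<in>germ S x V t. ?g U' s' V' t') = ?g U' s' V t"
    if "openin (topol S) U'" "x \<in> U'" "s' \<in> carrier (sec S U')" for U' s'
    by (rule germ_UN[OF V]) (rule eq[OF that V that refl])
  have "(\<Union>(U', s')\<in>germ S x U s. \<Union>(V', t')\<in>germ S x V t. ?g U' s' V' t') =
      (\<Union>(U', s')\<in>germ S x U s. ?g U' s' V t)"
  proof (rule SUP_cong[OF refl])
    fix p assume p: "p \<in> germ S x U s"
    obtain U' s' where [simp]: "p = (U', s')" by (cases p)
    show "(case p of (U', s') \<Rightarrow> \<Union>(V', t')\<in>germ S x V t. ?g U' s' V' t') = (case p of (U', s') \<Rightarrow> ?g U' s' V t)"
      using inner[of U' s'] germ_memD[OF _ U, of U' s'] p by simp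
  qed
  also have "\<dots> = ?g U s V t"
    by (rule germ_UN[OF U]) (rule eq[OF U V _ _ _ _ V refl])
  finally show ?thesis .
qed

lemma stalk_carrier: "carrier (stalk S x) = {germ S x U s | U s. openin (topol S) U \<and> x \<in> U \<and> s \<in> carrier (sec S U)}"
  by (simp add: stalk_def)

lemma germ_mult:
  assumes U: "openin (topol S) U" "x \<in> U" "s \<in> carrier (sec S U)" "t \<in> carrier (sec S U)"
  shows "germ S x U s \<otimes>\<^bsub>stalk S x\<^esub> germ S x U t = germ S x U (s \<otimes>\<^bsub>sec S U\<^esub> t)"
  unfolding stalk_def
  using germ_op[of "\<lambda>V. monoid.mult (sec S V)" U x s U t] assms
  by (simp add: res_mult cring.cring_simprules(5) sec_cring res_id)

lemma germ_add:
  assumes U: "openin (topol S) U" "x \<in> U" "s \<in> carrier (sec S U)" "t \<in> carrier (sec S U)"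
  shows "germ S x U s \<oplus>\<^bsub>stalk S x\<^esub> germ S x U t = germ S x U (s \<oplus>\<^bsub>sec S U\<^esub> t)"
  unfolding stalk_def
  using germ_op[of "\<lambda>V. ring.add (sec S V)" U x s U t] assms
  by (simp add: res_add cring.cring_simprules(1) sec_cring res_id)

lemma pts_open: "openin (topol S) (pts S)" by simp

lemma germ_hom:
  assumes U: "openin (topol S) U" "x \<in> U"
  shows "germ S x U \<in> ring_hom (sec S U) (stalk S x)"
proof (rule ring_hom_memI)
  have sub: "U \<subseteq> pts S" using U openin_subset by blast
  interpret P: cring "sec S (pts S)" by blast
  show "germ S x U \<one>\<^bsub>sec S U\<^esub> = \<one>\<^bsub>stalk S x\<^esub>"
    using germ_res[OF pts_open U(1) sub U(2) P.one_closed] by (simp add: stalk_def res_one[OF pts_open U(1) sub])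
qed (use assms in \<open>auto simp: germ_mult germ_add stalk_carrier\<close>)

lemma germ_zero:
  assumes U: "openin (topol S) U" "x \<in> U"
  shows "germ S x U \<zero>\<^bsub>sec S U\<^esub> = \<zero>\<^bsub>stalk S x\<^esub>"
proof -
  have sub: "U \<subseteq> pts S" using U openin_subset by blast
  interpret P: cring "sec S (pts S)" by blast
  show ?thesis
    using germ_res[OF pts_open U(1) sub U(2) P.zero_closed] by (simp add: stalk_def res_zero[OF pts_open U(1) sub])
qed

lemma stalk_common:
  assumes "a \<in> carrier (stalk S x)" "b \<in> carrier (stalk S x)" "c \<in> carrier (stalk S x)"
  obtains U s t u where "openin (topol S) U" "x \<in> U" "s \<in> carrier (sec S U)" "t \<in> carrier (sec S U)" "u \<in> carrier (sec S U)"
    "a = germ S x U s" "b = germ S x U t" "c = germ S x U u"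
proof -
  obtain U s V t W u where U: "openin (topol S) U" "x \<in> U" "s \<in> carrier (sec S U)" "a = germ S x U s"
    and V: "openin (topol S) V" "x \<in> V" "t \<in> carrier (sec S V)" "b = germ S x V t"
    and W: "openin (topol S) W" "x \<in> W" "u \<in> carrier (sec S W)" "c = germ S x W u"
    using assms unfolding stalk_carrier by blast
  let ?Z = "U \<inter> V \<inter> W"
  have Z: "openin (topol S) ?Z" "x \<in> ?Z" using U V W by auto
  have "germ S x ?Z (res S U ?Z s) = a" "germ S x ?Z (res S V ?Z t) = b" "germ S x ?Z (res S W ?Z u) = c"
    unfolding U(4) V(4) W(4) using U V W Z by (intro germ_res; auto)+
  moreover have "res S U ?Z s \<in> carrier (sec S ?Z)" "res S V ?Z t \<in> carrier (sec S ?Z)" "res S W ?Z u \<in> carrier (sec S ?Z)"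
    using U V W Z by (intro res_closed; auto)+
  ultimately show ?thesis using that[OF Z] by blast
qed

lemma stalk_cring:
  assumes "x \<in> pts S"
  shows "cring (stalk S x)"
proof (rule cring_locally)
  fix a b c assume "a \<in> carrier (stalk S x)" "b \<in> carrier (stalk S x)" "c \<in> carrier (stalk S x)"
  then obtain U s t u where *: "openin (topol S) U" "x \<in> U" "s \<in> carrier (sec S U)" "t \<in> carrier (sec S U)" "u \<in> carrier (sec S U)"
    "a = germ S x U s" "b = germ S x U t" "c = germ S x U u"
    using stalk_common by blast
  show "\<exists>(C :: 's ring) h. cring C \<and> h \<in> ring_hom C (stalk S x) \<and> h \<zero>\<^bsub>C\<^esub> = \<zero>\<^bsub>stalk S x\<^esub> \<and> {a, b, c} \<subseteq> h ` carrier C"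
    by (rule exI[of _ "sec S U"], rule exI[of _ "germ S x U"])
      (use * germ_hom germ_zero in auto)
next
  interpret P: cring "sec S (pts S)" by blast
  show "\<zero>\<^bsub>stalk S x\<^esub> \<in> carrier (stalk S x)"
    using germ_zero[of "pts S" x] ring_hom_closed[OF germ_hom[of "pts S" x] P.zero_closed] assms by simp
qed

text \<open>The inverse germ is represented on some \<open>V\<close>, but its product with
  \<open>s\<close> becomes 1 only after a further restriction to \<open>Z\<close>; this is the
  neighbourhood on which \<open>s\<close> is a unit.\<close>

lemma germ_Units:
  assumes U: "openin (topol S) U" "x \<in> U" "s \<in> carrier (sec S U)"
  shows "germ S x U s \<in> Units (stalk S x) \<longleftrightarrow> unit_near S x U s"
proof
  assume "unit_near S x U s"
  then obtain W where W: "openin (topol S) W" "x \<in> W" "W \<subseteq> U" "res S U W s \<in> Units (sec S W)"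
    unfolding unit_near_def by blast
  from ring_hom_Units[OF germ_hom[OF W(1,2)] W(4)] show "germ S x U s \<in> Units (stalk S x)"
    using germ_res[OF U(1) W(1,3,2) U(3)] by simp
next
  assume "germ S x U s \<in> Units (stalk S x)"
  then obtain b where b: "b \<in> carrier (stalk S x)" "germ S x U s \<otimes>\<^bsub>stalk S x\<^esub> b = \<one>\<^bsub>stalk S x\<^esub>"
    by (auto simp: Units_def)
  then obtain V t where V: "openin (topol S) V" "x \<in> V" "t \<in> carrier (sec S V)" "b = germ S x V t"
    unfolding stalk_carrier by blast
  let ?W = "U \<inter> V"
  have W: "openin (topol S) ?W" "x \<in> ?W" using U V by auto
  interpret W: cring "sec S ?W" using W by blast
  let ?s = "res S U ?W s" and ?t = "res S V ?W t"
  have c: "?s \<in> carrier (sec S ?W)" "?t \<in> carrier (sec S ?W)" using U V W res_closed by auto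
  have "germ S x ?W ?s = germ S x U s" "germ S x ?W ?t = b" using U V W by (auto simp: germ_res)
  then have "germ S x ?W (?s \<otimes>\<^bsub>sec S ?W\<^esub> ?t) = germ S x ?W \<one>\<^bsub>sec S ?W\<^esub>"
    using b(2) germ_mult[OF W c] ring_hom_one[OF germ_hom[OF W]] by simp
  then obtain Z where Z: "openin (topol S) Z" "x \<in> Z" "Z \<subseteq> ?W"
    "res S ?W Z (?s \<otimes>\<^bsub>sec S ?W\<^esub> ?t) = res S ?W Z \<one>\<^bsub>sec S ?W\<^esub>"
    using germ_eq_iff[OF W _ W] c by auto
  interpret Z: cring "sec S Z" using Z by blast
  have cz: "res S ?W Z ?s \<in> carrier (sec S Z)" "res S ?W Z ?t \<in> carrier (sec S Z)"
    using res_closed[OF W(1) Z(1,3)] c by auto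
  have "res S ?W Z ?s \<otimes>\<^bsub>sec S Z\<^esub> res S ?W Z ?t = \<one>\<^bsub>sec S Z\<^esub>"
    using Z(4) res_mult[OF W(1) Z(1,3) c] res_one[OF W(1) Z(1,3)] by simp
  then have "res S ?W Z ?s \<in> Units (sec S Z)" using cz Z.m_comm[OF cz] unfolding Units_def by auto
  then have "res S U Z s \<in> Units (sec S Z)" using U V W Z by (simp add: res_res)
  then show "unit_near S x U s" unfolding unit_near_def using Z by blast
qed

text \<open>The criterion of \<open>local_ring_iff\<close> for the stalk at \<open>x\<close>, read
  on representatives, with units of the stalk replaced by \<open>unit_near\<close>.\<close>

definition local_at :: "'p \<Rightarrow> bool" where
  "local_at x \<longleftrightarrow>
    (\<forall>U. openin (topol S) U \<and> x \<in> U \<longrightarrow> \<one>\<^bsub>sec S U\<^esub> \<noteq> \<zero>\<^bsub>sec S U\<^esub> \<and>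
      (\<forall>s\<in>carrier (sec S U). \<forall>t\<in>carrier (sec S U).
        s \<oplus>\<^bsub>sec S U\<^esub> t = \<one>\<^bsub>sec S U\<^esub> \<longrightarrow> unit_near S x U s \<or> unit_near S x U t))"

lemma local_ring_stalk_iff:
  assumes x: "x \<in> pts S"
  shows "local_ring (stalk S x) \<longleftrightarrow> local_at x"
proof -
  interpret st: cring "stalk S x" by (rule stalk_cring[OF x])
  have cc: "\<one>\<^bsub>sec S U\<^esub> \<in> carrier (sec S U)" "\<zero>\<^bsub>sec S U\<^esub> \<in> carrier (sec S U)" if "openin (topol S) U" for U
    using sec_cring[OF that] by (simp_all add: cring.cring_simprules)
  show ?thesis unfolding local_ring_iff[OF st.is_cring]
  proof (intro iffI conjI ballI impI)
    assume L: "\<one>\<^bsub>stalk S x\<^esub> \<noteq> \<zero>\<^bsub>stalk S x\<^esub> \<and> (\<forall>a\<in>carrier (stalk S x). \<forall>b\<in>carrier (stalk S x).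
      a \<oplus>\<^bsub>stalk S x\<^esub> b = \<one>\<^bsub>stalk S x\<^esub> \<longrightarrow> a \<in> Units (stalk S x) \<or> b \<in> Units (stalk S x))"
    show "local_at x" unfolding local_at_def
    proof (intro allI impI conjI ballI)
      fix U assume U: "openin (topol S) U \<and> x \<in> U"
      then show "\<one>\<^bsub>sec S U\<^esub> \<noteq> \<zero>\<^bsub>sec S U\<^esub>"
        using L germ_zero[of U x] ring_hom_one[OF germ_hom[of U x]] by metis
      fix s t assume st: "s \<in> carrier (sec S U)" "t \<in> carrier (sec S U)" "s \<oplus>\<^bsub>sec S U\<^esub> t = \<one>\<^bsub>sec S U\<^esub>"
      then have "germ S x U s \<oplus>\<^bsub>stalk S x\<^esub> germ S x U t = \<one>\<^bsub>stalk S x\<^esub>"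
        using U germ_add ring_hom_one[OF germ_hom[of U x]] by simp
      moreover have "germ S x U s \<in> carrier (stalk S x)" "germ S x U t \<in> carrier (stalk S x)"
        using U st by (auto simp: stalk_carrier)
      ultimately show "unit_near S x U s \<or> unit_near S x U t"
        using L germ_Units U st by blast
    qed
  next
    assume L: "local_at x"
    show "\<one>\<^bsub>stalk S x\<^esub> \<noteq> \<zero>\<^bsub>stalk S x\<^esub>"
    proof
      assume eq: "\<one>\<^bsub>stalk S x\<^esub> = \<zero>\<^bsub>stalk S x\<^esub>"
      then have "germ S x (pts S) \<one>\<^bsub>sec S (pts S)\<^esub> = germ S x (pts S) \<zero>\<^bsub>sec S (pts S)\<^esub>"
        by (simp add: stalk_def)
      then obtain W where W: "openin (topol S) W" "x \<in> W" "W \<subseteq> pts S"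
        "res S (pts S) W \<one>\<^bsub>sec S (pts S)\<^esub> = res S (pts S) W \<zero>\<^bsub>sec S (pts S)\<^esub>"
        using germ_eq_iff[OF pts_open x _ pts_open x] cc[OF pts_open] by auto
      then show False using L res_one[OF pts_open W(1,3)] res_zero[OF pts_open W(1,3)]
        unfolding local_at_def by auto
    qed
    fix a b assume ab: "a \<in> carrier (stalk S x)" "b \<in> carrier (stalk S x)" "a \<oplus>\<^bsub>stalk S x\<^esub> b = \<one>\<^bsub>stalk S x\<^esub>"
    then obtain U s t where U: "openin (topol S) U" "x \<in> U" and st: "s \<in> carrier (sec S U)" "t \<in> carrier (sec S U)"
      and a: "a = germ S x U s" and b: "b = germ S x U t" using stalk_common[OF ab(1,2,2)] by metis
    interpret U: cring "sec S U" using U by blast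
    have "germ S x U (s \<oplus>\<^bsub>sec S U\<^esub> t) = germ S x U \<one>\<^bsub>sec S U\<^esub>"
      using ab(3) germ_add[OF U st] ring_hom_one[OF germ_hom[OF U]] by (simp add: a b)
    then obtain W where W: "openin (topol S) W" "x \<in> W" "W \<subseteq> U"
      "res S U W (s \<oplus>\<^bsub>sec S U\<^esub> t) = res S U W \<one>\<^bsub>sec S U\<^esub>"
      using germ_eq_iff[OF U _ U] st by auto
    have "res S U W s \<oplus>\<^bsub>sec S W\<^esub> res S U W t = \<one>\<^bsub>sec S W\<^esub>"
      using W st res_add[OF U(1) W(1,3)] res_one[OF U(1) W(1,3)] by simp
    then have "unit_near S x W (res S U W s) \<or> unit_near S x W (res S U W t)"
      using L W res_closed[OF U(1) W(1,3)] st unfolding local_at_def by blast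
    then have "unit_near S x U s \<or> unit_near S x U t"
      using unit_near_res[OF U(1) W(1,3,2)] st by blast
    then show "a \<in> Units (stalk S x) \<or> b \<in> Units (stalk S x)"
      using germ_Units[OF U] st a b by blast
  qed
qed

end

lemma locally_ringed_iff:
  "locally_ringed_space k S \<longleftrightarrow> ringed_space k S \<and> (\<forall>x\<in>pts S. rspace.local_at S x)"
  unfolding locally_ringed_space_def using rspace.local_ring_stalk_iff[of k S] by (auto simp: rspace_def)

section \<open>Morphisms and isomorphisms of spaces over \<open>k\<close>\<close>

lemma preimg_iff: "x \<in> preimg S f V \<longleftrightarrow> x \<in> pts S \<and> f x \<in> V"
  by (simp add: preimg_def)

lemma preimg_open: "\<lbrakk>continuous_map (topol S) (topol T) f; openin (topol T) V\<rbrakk> \<Longrightarrow> openin (topol S) (preimg S f V)"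
  unfolding preimg_def by (rule openin_continuous_map_preimage)

lemma preimg_mono: "V \<subseteq> W \<Longrightarrow> preimg S f V \<subseteq> preimg S f W"
  by (auto simp: preimg_def)

lemma preimg_pts: "continuous_map (topol S) (topol T) f \<Longrightarrow> preimg S f (pts T) = pts S"
  by (auto simp: preimg_def continuous_map_def)

lemma preimg_comp:
  "continuous_map (topol S) (topol T) f \<Longrightarrow> preimg S (g \<circ> f) V = preimg S f (preimg T g V)"
  by (auto simp: preimg_def continuous_map_def)

text \<open>The part of \<open>kmorphism\<close> that mentions neither the structure map nor stalks.
  It already makes \<open>stalk_map\<close> well defined on germs (\<open>stalk_map_germ\<close>),
  which is what allows the last condition of \<open>kmorphism\<close> to be translated.\<close>

definition premorphism :: "('k, 'p, 's) kspace \<Rightarrow> ('k, 'q, 't) kspace \<Rightarrow> ('p, 's, 'q, 't) kmap \<Rightarrow> bool"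
  where "premorphism S T m \<longleftrightarrow>
    continuous_map (topol S) (topol T) (fst m) \<and>
    (\<forall>V. openin (topol T) V \<longrightarrow>
      snd m V \<in> ring_hom (sec T V) (sec S (preimg S (fst m) V))) \<and>
    (\<forall>V W. openin (topol T) V \<and> openin (topol T) W \<and> W \<subseteq> V \<longrightarrow>
      (\<forall>t\<in>carrier (sec T V).
        snd m W (res T V W t) = res S (preimg S (fst m) V) (preimg S (fst m) W) (snd m V t)))"

lemma premorphismD:
  assumes "premorphism S T m"
  shows "continuous_map (topol S) (topol T) (fst m)"
    and "\<And>V. openin (topol T) V \<Longrightarrow> snd m V \<in> ring_hom (sec T V) (sec S (preimg S (fst m) V))"
    and "\<And>V W t. \<lbrakk>openin (topol T) V; openin (topol T) W; W \<subseteq> V; t \<in> carrier (sec T V)\<rbrakk> \<Longrightarrow>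
      snd m W (res T V W t) = res S (preimg S (fst m) V) (preimg S (fst m) W) (snd m V t)"
    and "\<And>V t. \<lbrakk>openin (topol T) V; t \<in> carrier (sec T V)\<rbrakk> \<Longrightarrow> snd m V t \<in> carrier (sec S (preimg S (fst m) V))"
    and "\<And>V. openin (topol T) V \<Longrightarrow> openin (topol S) (preimg S (fst m) V)"
proof -
  show 1: "continuous_map (topol S) (topol T) (fst m)"
    and 2: "\<And>V. openin (topol T) V \<Longrightarrow> snd m V \<in> ring_hom (sec T V) (sec S (preimg S (fst m) V))"
    and "\<And>V W t. \<lbrakk>openin (topol T) V; openin (topol T) W; W \<subseteq> V; t \<in> carrier (sec T V)\<rbrakk> \<Longrightarrow>
      snd m W (res T V W t) = res S (preimg S (fst m) V) (preimg S (fst m) W) (snd m V t)"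
    using assms unfolding premorphism_def by simp_all
  show "\<And>V t. \<lbrakk>openin (topol T) V; t \<in> carrier (sec T V)\<rbrakk> \<Longrightarrow> snd m V t \<in> carrier (sec S (preimg S (fst m) V))"
    using ring_hom_closed[OF 2] .
  show "\<And>V. openin (topol T) V \<Longrightarrow> openin (topol S) (preimg S (fst m) V)"
    using preimg_open[OF 1] .
qed

lemma premorphism_unit_near:
  assumes S: "rspace k S" and T: "rspace k T" and m: "premorphism S T m"
    and x: "x \<in> pts S" "fst m x \<in> V" "openin (topol T) V" "t \<in> carrier (sec T V)"
    and u: "unit_near T (fst m x) V t"
  shows "unit_near S x (preimg S (fst m) V) (snd m V t)"
proof -
  interpret S: rspace k S by fact
  interpret T: rspace k T by fact
  obtain W where W: "openin (topol T) W" "fst m x \<in> W" "W \<subseteq> V" "res T V W t \<in> Units (sec T W)"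
    using u unfolding unit_near_def by blast
  have "res S (preimg S (fst m) V) (preimg S (fst m) W) (snd m V t) \<in> Units (sec S (preimg S (fst m) W))"
    using ring_hom_Units[OF premorphismD(2)[OF m W(1)] W(4)] premorphismD(3)[OF m x(3) W(1,3) x(4)] by simp
  moreover have "openin (topol S) (preimg S (fst m) W)" "x \<in> preimg S (fst m) W"
    "preimg S (fst m) W \<subseteq> preimg S (fst m) V"
    using premorphismD(5)[OF m W(1)] x(1) W(2,3) by (auto simp: preimg_def)
  ultimately show ?thesis unfolding unit_near_def by blast
qed

lemma stalk_map_germ:
  assumes S: "rspace k S" and T: "rspace k T" and m: "premorphism S T m"
    and x: "x \<in> pts S" "fst m x \<in> V" "openin (topol T) V" "t \<in> carrier (sec T V)"
  shows "stalk_map S m x (germ T (fst m x) V t) = germ S x (preimg S (fst m) V) (snd m V t)"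
proof -
  interpret S: rspace k S by fact
  interpret T: rspace k T by fact
  note mD = premorphismD[OF m]
  let ?p = "preimg S (fst m)"
  show ?thesis unfolding stalk_map_def
  proof (rule T.germ_UN[OF x(3,2,4)])
    fix V' t' assume V': "openin (topol T) V'" "fst m x \<in> V'" "t' \<in> carrier (sec T V')"
      and "germ T (fst m x) V' t' = germ T (fst m x) V t"
    then obtain W where W: "openin (topol T) W" "fst m x \<in> W" "W \<subseteq> V' \<inter> V" "res T V' W t' = res T V W t"
      using T.germ_eq_iff[OF V' x(3,2,4)] by blast
    have W': "W \<subseteq> V" "W \<subseteq> V'" using W(3) by auto
    have xp: "x \<in> ?p V" "x \<in> ?p V'" "x \<in> ?p W" using x V' W by (auto simp: preimg_def)
    have "germ S x (?p V') (snd m V' t') = germ S x (?p W) (res S (?p V') (?p W) (snd m V' t'))"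
      by (rule S.germ_res[symmetric]) (use mD(4,5) V' W(1) preimg_mono[OF W'(2), of S "fst m"] xp in auto)
    also have "\<dots> = germ S x (?p W) (snd m W (res T V W t))"
      using mD(3)[OF V'(1) W(1) W'(2) V'(3)] W(4) by simp
    also have "\<dots> = germ S x (?p W) (res S (?p V) (?p W) (snd m V t))"
      using mD(3)[OF x(3) W(1) W'(1) x(4)] by simp
    also have "\<dots> = germ S x (?p V) (snd m V t)"
      by (rule S.germ_res) (use mD(4,5) x W(1) preimg_mono[OF W'(1), of S "fst m"] xp in auto)
    finally show "germ S x (?p V') (snd m V' t') = germ S x (?p V) (snd m V t)" .
  qed
qed

text \<open>A local homomorphism of stalks is one that reflects units, and a germ is a unit iff its
  section is invertible near the point. Later verifications of \<open>kmorphism\<close> go through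
  this form.\<close>

lemma kmorphism_iff:
  assumes S: "rspace k S" and T: "rspace k T"
  shows "kmorphism k S T m \<longleftrightarrow> premorphism S T m \<and> (\<forall>c\<in>k. snd m (pts T) (str T c) = str S c) \<and>
    (\<forall>x\<in>pts S. \<forall>V t. openin (topol T) V \<longrightarrow> fst m x \<in> V \<longrightarrow> t \<in> carrier (sec T V) \<longrightarrow>
      unit_near S x (preimg S (fst m) V) (snd m V t) \<longrightarrow> unit_near T (fst m x) V t)"
proof -
  interpret S: rspace k S by fact
  interpret T: rspace k T by fact
  have "(\<forall>a\<in>carrier (stalk T (fst m x)). stalk_map S m x a \<in> Units (stalk S x) \<longrightarrow> a \<in> Units (stalk T (fst m x))) \<longleftrightarrow>
    (\<forall>V t. openin (topol T) V \<longrightarrow> fst m x \<in> V \<longrightarrow> t \<in> carrier (sec T V) \<longrightarrow>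
      unit_near S x (preimg S (fst m) V) (snd m V t) \<longrightarrow> unit_near T (fst m x) V t)"
    if m: "premorphism S T m" and x: "x \<in> pts S" for x
  proof -
    have "(stalk_map S m x (germ T (fst m x) V t) \<in> Units (stalk S x) \<longrightarrow> germ T (fst m x) V t \<in> Units (stalk T (fst m x)))
      \<longleftrightarrow> (unit_near S x (preimg S (fst m) V) (snd m V t) \<longrightarrow> unit_near T (fst m x) V t)"
      if "openin (topol T) V" "fst m x \<in> V" "t \<in> carrier (sec T V)" for V t
    proof -
      have "x \<in> preimg S (fst m) V" using x that by (simp add: preimg_def)
      then show ?thesis
        unfolding stalk_map_germ[OF S T m x that(2,1,3)] T.germ_Units[OF that]
        using S.germ_Units[OF premorphismD(5)[OF m that(1)] _ premorphismD(4)[OF m that(1,3)]] by blast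
    qed
    then show ?thesis unfolding T.stalk_carrier by blast
  qed
  then show ?thesis unfolding kmorphism_def premorphism_def by auto
qed

lemma kmorphismD:
  assumes "rspace k S" "rspace k T" "kmorphism k S T m"
  shows "premorphism S T m" "c \<in> k \<Longrightarrow> snd m (pts T) (str T c) = str S c"
    "\<lbrakk>x \<in> pts S; openin (topol T) V; fst m x \<in> V; t \<in> carrier (sec T V);
      unit_near S x (preimg S (fst m) V) (snd m V t)\<rbrakk> \<Longrightarrow> unit_near T (fst m x) V t"
  using assms(3) unfolding kmorphism_iff[OF assms(1,2)] by blast+

lemma kmorphism_comp:
  assumes S: "rspace k S" and T: "rspace k T" and R: "rspace k R"
    and m: "kmorphism k S T m" and n: "kmorphism k T R n"
  shows "kmorphism k S R (kmap_comp T n m)"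
proof -
  interpret S: rspace k S by fact
  interpret T: rspace k T by fact
  interpret R: rspace k R by fact
  note m' = kmorphismD[OF S T m] and n' = kmorphismD[OF T R n]
  note mD = premorphismD[OF m'(1)] and nD = premorphismD[OF n'(1)]
  have fst: "fst (kmap_comp T n m) = fst n \<circ> fst m"
    and snd: "snd (kmap_comp T n m) W = snd m (preimg T (fst n) W) \<circ> snd n W" for W
    by (simp_all add: kmap_comp_def)
  note pre = preimg_comp[OF mD(1), of "fst n"]
  have p: "premorphism S R (kmap_comp T n m)"
    unfolding premorphism_def fst snd pre
  proof (intro conjI allI impI ballI)
    show "continuous_map (topol S) (topol R) (fst n \<circ> fst m)"
      by (rule continuous_map_compose) (rule mD nD)+
    show "snd m (preimg T (fst n) V) \<circ> snd n V \<in> ring_hom (sec R V) (sec S (preimg S (fst m) (preimg T (fst n) V)))"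
      if "openin (topol R) V" for V
      by (rule ring_hom_trans[OF nD(2)[OF that] mD(2)[OF nD(5)[OF that]]])
    fix V W t assume "openin (topol R) V \<and> openin (topol R) W \<and> W \<subseteq> V" and t: "t \<in> carrier (sec R V)"
    then have VW: "openin (topol R) V" "openin (topol R) W" "W \<subseteq> V" by auto
    show "(snd m (preimg T (fst n) W) \<circ> snd n W) (res R V W t) =
      res S (preimg S (fst m) (preimg T (fst n) V)) (preimg S (fst m) (preimg T (fst n) W))
        ((snd m (preimg T (fst n) V) \<circ> snd n V) t)"
      using nD(3)[OF VW t] mD(3)[OF nD(5)[OF VW(1)] nD(5)[OF VW(2)] preimg_mono[OF VW(3)] nD(4)[OF VW(1) t]]
      by simp
  qed
  show ?thesis unfolding kmorphism_iff[OF S R]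
  proof (intro conjI p ballI allI impI)
    show "snd (kmap_comp T n m) (pts R) (str R c) = str S c" if "c \<in> k" for c
      using n'(2)[OF that] m'(2)[OF that] preimg_pts[OF nD(1)] by (simp add: snd)
    fix x V t assume x: "x \<in> pts S" "openin (topol R) V" "fst (kmap_comp T n m) x \<in> V" "t \<in> carrier (sec R V)"
      and u: "unit_near S x (preimg S (fst (kmap_comp T n m)) V) (snd (kmap_comp T n m) V t)"
    have fx: "fst m x \<in> pts T" using mD(1) x(1) by (auto simp: continuous_map_def)
    have "unit_near T (fst m x) (preimg T (fst n) V) (snd n V t)"
      by (rule m'(3)[OF x(1) nD(5)[OF x(2)]]) (use x u fx nD(4) in \<open>auto simp: fst snd pre preimg_iff\<close>)
    then show "unit_near R (fst (kmap_comp T n m) x) V t"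
      using n'(3)[OF fx x(2)] x by (simp add: fst)
  qed
qed

lemma kiso_trans:
  assumes S: "rspace k S" and T: "rspace k T" and R: "rspace k R"
    and "kiso k S T" "kiso k T R"
  shows "kiso k S R"
proof -
  obtain m where m: "kmorphism k S T m" "homeomorphic_map (topol S) (topol T) (fst m)"
    and mi: "\<And>V. openin (topol T) V \<Longrightarrow> snd m V \<in> ring_iso (sec T V) (sec S (preimg S (fst m) V))"
    using assms(4) unfolding kiso_def by blast
  obtain n where n: "kmorphism k T R n" "homeomorphic_map (topol T) (topol R) (fst n)"
    and ni: "\<And>V. openin (topol R) V \<Longrightarrow> snd n V \<in> ring_iso (sec R V) (sec T (preimg T (fst n) V))"
    using assms(5) unfolding kiso_def by blast
  note mc = premorphismD(1)[OF kmorphismD(1)[OF S T m(1)]] and nc = premorphismD(1)[OF kmorphismD(1)[OF T R n(1)]]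
  have "homeomorphic_map (topol S) (topol R) (fst (kmap_comp T n m))"
    using homeomorphic_map_compose[OF m(2) n(2)] by (simp add: kmap_comp_def)
  moreover have "snd (kmap_comp T n m) V \<in> ring_iso (sec R V) (sec S (preimg S (fst (kmap_comp T n m)) V))"
    if "openin (topol R) V" for V
    using ring_iso_set_trans[OF ni[OF that] mi[OF preimg_open[OF nc that]]] preimg_comp[OF mc, of "fst n"]
    by (simp add: kmap_comp_def)
  ultimately show ?thesis
    unfolding kiso_def using kmorphism_comp[OF S T R m(1) n(1)] by blast
qed

text \<open>Over \<open>V\<close> the inverse is the inverse of \<open>snd m\<close> over the
  preimage of \<open>V\<close> under \<open>g\<close>; the types fit because pulling that set back
  along \<open>fst m\<close> returns \<open>V\<close> (\<open>fgV\<close>).\<close>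

lemma kiso_sym:
  assumes S: "rspace k S" and T: "rspace k T" and "kiso k S T"
  shows "kiso k T S"
proof -
  interpret S: rspace k S by fact
  interpret T: rspace k T by fact
  obtain m where m: "kmorphism k S T m" "homeomorphic_map (topol S) (topol T) (fst m)"
    and mi: "\<And>V. openin (topol T) V \<Longrightarrow> snd m V \<in> ring_iso (sec T V) (sec S (preimg S (fst m) V))"
    using assms(3) unfolding kiso_def by blast
  note m' = kmorphismD[OF S T m(1)]
  note mD = premorphismD[OF m'(1)]
  obtain g where g: "homeomorphic_maps (topol S) (topol T) (fst m) g"
    using m(2) unfolding homeomorphic_map_maps by blast
  then have gc: "continuous_map (topol T) (topol S) g"
    and gf: "\<And>x. x \<in> pts S \<Longrightarrow> g (fst m x) = x" and fg: "\<And>y. y \<in> pts T \<Longrightarrow> fst m (g y) = y"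
    unfolding homeomorphic_maps_def by auto
  have gp: "g y \<in> pts S" if "y \<in> pts T" for y using gc that by (auto simp: continuous_map_def)
  have fp: "fst m x \<in> pts T" if "x \<in> pts S" for x using mD(1) that by (auto simp: continuous_map_def)
  let ?f = "preimg S (fst m)" and ?g = "preimg T g"
  have fgV: "?f (?g V) = V" if "openin (topol S) V" for V
    using openin_subset[OF that] gf fp by (auto simp: preimg_def subset_iff)
  have go: "openin (topol T) (?g V)" if "openin (topol S) V" for V using preimg_open[OF gc that] .
  define G where "G V = inv_into (carrier (sec T (?g V))) (snd m (?g V))" for V
  have mi': "snd m (?g V) \<in> ring_iso (sec T (?g V)) (sec S V)" if "openin (topol S) V" for V
    using mi[OF go[OF that]] fgV[OF that] by simp
  have Gi: "G V \<in> ring_iso (sec S V) (sec T (?g V))" if "openin (topol S) V" for V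
    unfolding G_def by (rule ring_iso_set_sym[OF _ mi'[OF that]]) (use go that in blast)
  have inj: "inj_on (snd m (?g V)) (carrier (sec T (?g V)))" and surj: "snd m (?g V) ` carrier (sec T (?g V)) = carrier (sec S V)"
    if "openin (topol S) V" for V
    using mi'[OF that] by (auto simp: ring_iso_def bij_betw_def)
  have FG: "snd m (?g V) (G V s) = s" if "openin (topol S) V" "s \<in> carrier (sec S V)" for V s
    unfolding G_def by (rule f_inv_into_f) (use surj[OF that(1)] that in blast)
  have GF: "G V (snd m (?g V) t) = t" if "openin (topol S) V" "t \<in> carrier (sec T (?g V))" for V t
    unfolding G_def by (rule inv_into_f_f[OF inj[OF that(1)] that(2)])
  have Gc: "G V s \<in> carrier (sec T (?g V))" if "openin (topol S) V" "s \<in> carrier (sec S V)" for V s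
    using Gi[OF that(1)] that(2) by (auto simp: ring_iso_def dest: ring_hom_closed)
  have Fres: "snd m (?g W) (res T (?g V) (?g W) (G V s)) = res S V W s"
    if VW: "openin (topol S) V" "openin (topol S) W" "W \<subseteq> V" and s: "s \<in> carrier (sec S V)" for V W s
    using mD(3)[OF go[OF VW(1)] go[OF VW(2)] preimg_mono[OF VW(3)] Gc[OF VW(1) s]] FG[OF VW(1) s] fgV VW by simp
  have "kmorphism k T S (g, G)" unfolding kmorphism_iff[OF T S]
  proof (intro conjI ballI allI impI)
    show "premorphism T S (g, G)" unfolding premorphism_def fst_conv snd_conv
    proof (intro conjI allI impI ballI gc)
      show "G V \<in> ring_hom (sec S V) (sec T (?g V))" if "openin (topol S) V" for V
        using Gi[OF that] by (simp add: ring_iso_def)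
      fix V W s assume "openin (topol S) V \<and> openin (topol S) W \<and> W \<subseteq> V" and s: "s \<in> carrier (sec S V)"
      then have VW: "openin (topol S) V" "openin (topol S) W" "W \<subseteq> V" by auto
      have "res T (?g V) (?g W) (G V s) \<in> carrier (sec T (?g W))"
        by (rule T.res_closed[OF go[OF VW(1)] go[OF VW(2)] preimg_mono[OF VW(3)] Gc[OF VW(1) s]])
      then show "G W (res S V W s) = res T (?g V) (?g W) (G V s)"
        using GF[OF VW(2)] Fres[OF VW s] by metis
    qed
    show "snd (g, G) (pts S) (str S c) = str T c" if "c \<in> k" for c
    proof -
      have "str T c \<in> carrier (sec T (pts T))"
        using ring_hom_closed[OF T.str_hom] that by (simp add: ring_of_type_algebra_def)
      then show ?thesis using GF[of "pts S" "str T c"] m'(2)[OF that] preimg_pts[OF gc] by simp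
    qed
    fix y V s assume y: "y \<in> pts T" "openin (topol S) V" "fst (g, G) y \<in> V" "s \<in> carrier (sec S V)"
      and "unit_near T y (preimg T (fst (g, G)) V) (snd (g, G) V s)"
    then obtain W where W: "openin (topol T) W" "y \<in> W" "W \<subseteq> ?g V" "res T (?g V) W (G V s) \<in> Units (sec T W)"
      unfolding unit_near_def by auto
    \<comment> \<open>For locality, a neighbourhood \<open>W\<close> on which the section becomes a
      unit in \<open>T\<close> is carried back to the neighbourhood
      \<open>preimg S (fst m) W\<close> of \<open>g y\<close>, and \<open>snd m W\<close> maps the
      unit there.\<close>
    have gfW: "?g (?f W) = W" using openin_subset[OF W(1)] gp fg by (auto simp: preimg_def subset_iff)
    have W': "openin (topol S) (?f W)" "g y \<in> ?f W" "?f W \<subseteq> V"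
      using mD(5)[OF W(1)] y W(2) gp fg preimg_mono[OF W(3), of S "fst m"] fgV[OF y(2)] by (auto simp: preimg_iff)
    have "snd m W (res T (?g V) W (G V s)) = res S V (?f W) s"
      using Fres[OF y(2) W'(1,3) y(4)] by (simp add: gfW)
    then have "res S V (?f W) s \<in> Units (sec S (?f W))" using ring_hom_Units[OF mD(2)[OF W(1)] W(4)] by simp
    then show "unit_near S (fst (g, G) y) V s" using W' unfolding unit_near_def by auto
  qed
  moreover have "homeomorphic_map (topol T) (topol S) g"
    using g homeomorphic_maps_sym homeomorphic_map_maps by metis
  ultimately show ?thesis unfolding kiso_def using Gi by (intro exI[of _ "(g, G)"]) auto
qed

lemma finite_type_rspace: "finite_type_scheme k S \<Longrightarrow> rspace k S"
  by (simp add: finite_type_scheme_def kscheme_def locally_ringed_space_def rspace_def)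

text \<open>Symmetry and transitivity of \<open>kiso\<close> are available between ringed spaces;
  the members of a class are such by \<open>finite_type_rspace\<close>.\<close>

lemma iso_class_cong:
  assumes "rspace k S" "rspace k S'" "kiso k S S'"
  shows "iso_class k S = iso_class k S'"
  unfolding iso_class_def
  using kiso_trans[OF finite_type_rspace assms(1,2) _ assms(3)]
    kiso_trans[OF finite_type_rspace assms(2,1) _ kiso_sym[OF assms]] by blast

lemma openin_open_subspace:
  assumes "openin (topol S) U"
  shows "openin (topol (open_subspace S U)) V \<longleftrightarrow> openin (topol S) V \<and> V \<subseteq> U"
  using assms by (auto simp: open_subspace_def openin_open_subtopology)

lemma pts_open_subspace: "openin (topol S) U \<Longrightarrow> pts (open_subspace S U) = U"
  using openin_subset[of "topol S" U] by (auto simp: open_subspace_def)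

lemma rspace_open_subspace:
  assumes S: "rspace k S" and U: "openin (topol S) U"
  shows "rspace k (open_subspace S U)"
proof -
  interpret S: rspace k S by fact
  let ?U = "open_subspace S U"
  have s: "sec ?U = sec S" "res ?U = res S" "str ?U = res S (pts S) U \<circ> str S" by (simp_all add: open_subspace_def)
  note o = openin_open_subspace[OF U] pts_open_subspace[OF U]
  note r = S.ringed_unfolded
  show ?thesis unfolding rspace_def ringed_space_def o s
  proof (intro conjI)
    show "\<forall>V. openin (topol S) V \<and> V \<subseteq> U \<longrightarrow> cring (sec S V)" by blast
    show "\<forall>V W. (openin (topol S) V \<and> V \<subseteq> U) \<and> (openin (topol S) W \<and> W \<subseteq> U) \<and> W \<subseteq> V \<longrightarrow>
      res S V W \<in> ring_hom (sec S V) (sec S W)" using S.res_hom by blast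
    show "\<forall>V. openin (topol S) V \<and> V \<subseteq> U \<longrightarrow> (\<forall>s\<in>carrier (sec S V). res S V V s = s)" using S.res_id by blast
    show "\<forall>U' V W. (openin (topol S) U' \<and> U' \<subseteq> U) \<and> (openin (topol S) V \<and> V \<subseteq> U) \<and>
       (openin (topol S) W \<and> W \<subseteq> U) \<and> W \<subseteq> V \<and> V \<subseteq> U' \<longrightarrow>
       (\<forall>s\<in>carrier (sec S U'). res S V W (res S U' V s) = res S U' W s)" using S.res_res by blast
    show "\<forall>\<U>. (\<forall>V\<in>\<U>. openin (topol S) V \<and> V \<subseteq> U) \<longrightarrow>
       (\<forall>s\<in>carrier (sec S (\<Union>\<U>)). \<forall>t\<in>carrier (sec S (\<Union>\<U>)).
           (\<forall>V\<in>\<U>. res S (\<Union>\<U>) V s = res S (\<Union>\<U>) V t) \<longrightarrow> s = t)"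
    proof (intro allI impI)
      fix \<U> assume "\<forall>V\<in>\<U>. openin (topol S) V \<and> V \<subseteq> U"
      then have "\<forall>V\<in>\<U>. openin (topol S) V" by blast
      then show "\<forall>s\<in>carrier (sec S (\<Union>\<U>)). \<forall>t\<in>carrier (sec S (\<Union>\<U>)).
           (\<forall>V\<in>\<U>. res S (\<Union>\<U>) V s = res S (\<Union>\<U>) V t) \<longrightarrow> s = t"
        using r[THEN conjunct2, THEN conjunct2, THEN conjunct2, THEN conjunct2, THEN conjunct1, THEN spec, of \<U>] by simp
    qed
    show "\<forall>\<U> s. (\<forall>V\<in>\<U>. (openin (topol S) V \<and> V \<subseteq> U) \<and> s V \<in> carrier (sec S V)) \<and>
       (\<forall>V\<in>\<U>. \<forall>V'\<in>\<U>. res S V (V \<inter> V') (s V) = res S V' (V \<inter> V') (s V')) \<longrightarrow>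
       (\<exists>t\<in>carrier (sec S (\<Union>\<U>)). \<forall>V\<in>\<U>. res S (\<Union>\<U>) V t = s V)"
    proof (intro allI impI, elim conjE)
      fix \<U> s assume "\<forall>V\<in>\<U>. (openin (topol S) V \<and> V \<subseteq> U) \<and> s V \<in> carrier (sec S V)"
        and c: "\<forall>V\<in>\<U>. \<forall>V'\<in>\<U>. res S V (V \<inter> V') (s V) = res S V' (V \<inter> V') (s V')"
      then have "\<forall>V\<in>\<U>. openin (topol S) V \<and> s V \<in> carrier (sec S V)" by blast
      with c show "\<exists>t\<in>carrier (sec S (\<Union>\<U>)). \<forall>V\<in>\<U>. res S (\<Union>\<U>) V t = s V"
        using r[THEN conjunct2, THEN conjunct2, THEN conjunct2, THEN conjunct2, THEN conjunct2, THEN conjunct1,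
          THEN spec, of \<U>, THEN spec, of s] by simp
    qed
    show "res S (pts S) U \<circ> str S \<in> ring_hom (base_ring k) (sec S U)"
      by (rule ring_hom_trans[OF S.str_hom S.res_hom]) (use U openin_subset in auto)
  qed
qed

text \<open>\<open>open_subspace\<close> keeps the sections and restrictions of \<open>S\<close>, so
  the same pair \<open>m\<close> serves. Only the structure map changes, by restriction to
  \<open>U\<close>, and \<open>U\<close> and \<open>pts S\<close> have the same preimage in
  \<open>Q\<close>.\<close>

lemma kmorphism_into_open:
  assumes Q: "rspace k Q" and S: "rspace k S" and U: "openin (topol S) U"
    and m: "kmorphism k Q S m" and sub: "\<And>x. x \<in> pts Q \<Longrightarrow> fst m x \<in> U"
  shows "kmorphism k Q (open_subspace S U) m"
proof -
  interpret Q: rspace k Q by fact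
  interpret S: rspace k S by fact
  let ?U = "open_subspace S U"
  have s: "sec ?U = sec S" "res ?U = res S" "str ?U = res S (pts S) U \<circ> str S" by (simp_all add: open_subspace_def)
  note o = openin_open_subspace[OF U] pts_open_subspace[OF U]
  note m' = kmorphismD[OF Q S m]
  note mD = premorphismD[OF m'(1)]
  have preU: "preimg Q (fst m) U = pts Q" using sub by (auto simp: preimg_def)
  have preS: "preimg Q (fst m) (pts S) = pts Q" by (rule preimg_pts[OF mD(1)])
  show ?thesis unfolding kmorphism_iff[OF Q rspace_open_subspace[OF S U]]
  proof (intro conjI ballI allI impI)
    show "premorphism Q ?U m" unfolding premorphism_def s o
    proof (intro conjI allI impI ballI)
      show "continuous_map (topol Q) (topol ?U) (fst m)"
        using mD(1) sub by (auto simp: open_subspace_def continuous_map_in_subtopology)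
    qed (use mD in auto)
    show "snd m (pts ?U) (str ?U c) = str Q c" if c: "c \<in> k" for c
    proof -
      have sc: "str S c \<in> carrier (sec S (pts S))" "str Q c \<in> carrier (sec Q (pts Q))"
        using ring_hom_closed[OF S.str_hom] ring_hom_closed[OF Q.str_hom] c by (simp_all add: ring_of_type_algebra_def)
      then show ?thesis
        unfolding o s using mD(3)[OF S.pts_open U openin_subset[OF U] sc(1)] m'(2)[OF c]
        by (simp add: preU preS Q.res_id)
    qed
    fix x V t assume x: "x \<in> pts Q" "openin (topol ?U) V" "fst m x \<in> V" "t \<in> carrier (sec ?U V)"
      "unit_near Q x (preimg Q (fst m) V) (snd m V t)"
    then have "unit_near S (fst m x) V t" using m'(3) by (simp add: o s)
    then show "unit_near ?U (fst m x) V t" unfolding unit_near_def o s using x(2) unfolding o by blast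
  qed
qed

section \<open>Localizations at primes and sections over spectra\<close>

abbreviation fr :: "'a ring \<Rightarrow> 'a set \<Rightarrow> 'a \<Rightarrow> 'a \<Rightarrow> ('a \<times> 'a) set"
  where "fr R P \<equiv> fraction R (carrier R - P)"

abbreviation loc :: "'a ring \<Rightarrow> 'a set \<Rightarrow> ('a \<times> 'a) set ring"
  where "loc R P \<equiv> localization R (carrier R - P)"

abbreviation primes :: "'a ring \<Rightarrow> 'a set set"
  where "primes R \<equiv> {P. primeideal P R}"

abbreviation basic_open :: "'a ring \<Rightarrow> 'a \<Rightarrow> 'a set set"
  where "basic_open R f \<equiv> {P. primeideal P R \<and> f \<notin> P}"

locale prime_loc = cring R + primeideal P R for R :: "'a ring" (structure) and P
begin

lemma den_mult: "\<lbrakk>f \<in> carrier R - P; g \<in> carrier R - P\<rbrakk> \<Longrightarrow> f \<otimes> g \<in> carrier R - P"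
  using I_prime by auto

lemma den_one: "\<one> \<in> carrier R - P"
  using one_imp_carrier I_notcarr by auto

lemma fr_mem_iff:
  "(b, g) \<in> fr R P a f \<longleftrightarrow> b \<in> carrier R \<and> g \<in> carrier R - P \<and>
    (\<exists>h\<in>carrier R - P. h \<otimes> (a \<otimes> g) = h \<otimes> (b \<otimes> f))"
  by (auto simp: fraction_def)

text \<open>Fractions are classes of pairs, so this amounts to transitivity of the relation defining
  them. Two witnesses \<open>h\<close> and \<open>h'\<close> combine to
  \<open>h \<otimes> h' \<otimes> g\<close> with the middle denominator \<open>g\<close>, and
  primality keeps this product outside \<open>P\<close>.\<close>

lemma fr_eq_iff:
  assumes a: "a \<in> carrier R" "f \<in> carrier R - P" and b: "b \<in> carrier R" "g \<in> carrier R - P"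
  shows "fr R P a f = fr R P b g \<longleftrightarrow> (\<exists>h\<in>carrier R - P. h \<otimes> (a \<otimes> g) = h \<otimes> (b \<otimes> f))"
proof -
  let ?eq = "\<lambda>a f b g. \<exists>h\<in>carrier R - P. h \<otimes> (a \<otimes> g) = h \<otimes> (b \<otimes> f)"
  have trans: "?eq a f c e" if e1: "?eq a f b g" and e2: "?eq b g c e"
    and c: "a \<in> carrier R" "f \<in> carrier R - P" "b \<in> carrier R" "g \<in> carrier R - P" "c \<in> carrier R" "e \<in> carrier R - P"
    for a f b g c e
  proof -
    obtain h h' where h: "h \<in> carrier R - P" "h \<otimes> (a \<otimes> g) = h \<otimes> (b \<otimes> f)"
      and h': "h' \<in> carrier R - P" "h' \<otimes> (b \<otimes> e) = h' \<otimes> (c \<otimes> g)" using e1 e2 by blast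
    have "(h \<otimes> h' \<otimes> g) \<otimes> (a \<otimes> e) = h' \<otimes> e \<otimes> (h \<otimes> (a \<otimes> g))" using c h(1) h'(1) by (simp add: m_ac)
    also have "\<dots> = h \<otimes> f \<otimes> (h' \<otimes> (b \<otimes> e))" unfolding h(2) using c h(1) h'(1) by (simp add: m_ac)
    also have "\<dots> = (h \<otimes> h' \<otimes> g) \<otimes> (c \<otimes> f)" unfolding h'(2) using c h(1) h'(1) by (simp add: m_ac)
    finally show ?thesis using den_mult[OF den_mult[OF h(1) h'(1)] c(4)] by blast
  qed
  have sym: "?eq b g a f" if "?eq a f b g" for a f b g using that by metis
  show ?thesis
  proof
    assume "fr R P a f = fr R P b g"
    moreover have "(b, g) \<in> fr R P b g" unfolding fr_mem_iff using b den_one by auto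
    ultimately have "(b, g) \<in> fr R P a f" by simp
    then show "?eq a f b g" unfolding fr_mem_iff by blast
  next
    assume e: "?eq a f b g"
    have "(c, d) \<in> fr R P a f \<longleftrightarrow> (c, d) \<in> fr R P b g" for c d
      unfolding fr_mem_iff using trans[OF e _ a b] trans[OF sym[OF e] _ b a] by blast
    then show "fr R P a f = fr R P b g" by auto
  qed
qed

lemma fr_eqI:
  assumes "a \<in> carrier R" "f \<in> carrier R - P" "b \<in> carrier R" "g \<in> carrier R - P" "a \<otimes> g = b \<otimes> f"
  shows "fr R P a f = fr R P b g"
  unfolding fr_eq_iff[OF assms(1-4)] using den_one assms(5) by metis

text \<open>The operations of \<open>localization\<close> are unions over representatives, as for
  stalks; such a union collapses once the value is independent of the representative.\<close>

lemma fr_UN: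
  assumes a: "a \<in> carrier R" "f \<in> carrier R - P"
    and "\<And>b g. \<lbrakk>b \<in> carrier R; g \<in> carrier R - P; fr R P b g = fr R P a f\<rbrakk> \<Longrightarrow> F b g = F a f"
  shows "(\<Union>(b, g)\<in>fr R P a f. F b g) = F a f"
proof -
  have "(\<Union>(b, g)\<in>fr R P a f. F b g) = (\<Union>(b, g)\<in>fr R P a f. F a f)"
  proof (rule SUP_cong[OF refl])
    fix p assume p: "p \<in> fr R P a f"
    obtain b g where [simp]: "p = (b, g)" by (cases p)
    have m: "(b, g) \<in> fr R P a f" using p by simp
    then have bg: "b \<in> carrier R" "g \<in> carrier R - P" unfolding fr_mem_iff by auto
    have "fr R P b g = fr R P a f"
      unfolding fr_eq_iff[OF bg a] using m unfolding fr_mem_iff by metis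
    with assms(3)[OF bg] show "(case p of (b, g) \<Rightarrow> F b g) = (case p of (b, g) \<Rightarrow> F a f)" by simp
  qed
  moreover have "(a, f) \<in> fr R P a f" unfolding fr_mem_iff using a den_one by auto
  ultimately show ?thesis by auto
qed

lemma fr_mult:
  assumes a: "a \<in> carrier R" "f \<in> carrier R - P" and b: "b \<in> carrier R" "g \<in> carrier R - P"
  shows "fr R P a f \<otimes>\<^bsub>loc R P\<^esub> fr R P b g = fr R P (a \<otimes> b) (f \<otimes> g)"
proof -
  have eq: "fr R P (a' \<otimes> b') (f' \<otimes> g') = fr R P (a \<otimes> b) (f \<otimes> g)"
    if a: "a \<in> carrier R" "f \<in> carrier R - P" and b: "b \<in> carrier R" "g \<in> carrier R - P"
      and a': "a' \<in> carrier R" "f' \<in> carrier R - P" "fr R P a' f' = fr R P a f"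
      and b': "b' \<in> carrier R" "g' \<in> carrier R - P" "fr R P b' g' = fr R P b g" for a f b g a' f' b' g'
  proof -
    obtain h where h: "h \<in> carrier R - P" "h \<otimes> (a' \<otimes> f) = h \<otimes> (a \<otimes> f')"
      using a'(3) unfolding fr_eq_iff[OF a'(1,2) a] by blast
    obtain j where j: "j \<in> carrier R - P" "j \<otimes> (b' \<otimes> g) = j \<otimes> (b \<otimes> g')"
      using b'(3) unfolding fr_eq_iff[OF b'(1,2) b] by blast
    have "(h \<otimes> j) \<otimes> ((a' \<otimes> b') \<otimes> (f \<otimes> g)) = (h \<otimes> (a' \<otimes> f)) \<otimes> (j \<otimes> (b' \<otimes> g))"
      using a b a' b' h(1) j(1) by (simp add: m_ac)
    also have "\<dots> = (h \<otimes> j) \<otimes> ((a \<otimes> b) \<otimes> (f' \<otimes> g'))"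
      unfolding h(2) j(2) using a b a' b' h(1) j(1) by (simp add: m_ac)
    finally have e: "(h \<otimes> j) \<otimes> ((a' \<otimes> b') \<otimes> (f \<otimes> g)) = (h \<otimes> j) \<otimes> ((a \<otimes> b) \<otimes> (f' \<otimes> g'))" .
    show ?thesis
      by (rule fr_eq_iff[THEN iffD2, OF _ den_mult[OF a'(2) b'(2)] _ den_mult[OF a(2) b(2)]])
        (use e den_mult[OF h(1) j(1)] a b a' b' in auto)
  qed
  have inner: "(\<Union>(b', g')\<in>fr R P b g. fr R P (a' \<otimes> b') (f' \<otimes> g')) = fr R P (a' \<otimes> b) (f' \<otimes> g)"
    if "a' \<in> carrier R" "f' \<in> carrier R - P" for a' f'
    by (rule fr_UN[OF b]) (rule eq[OF that b that refl])
  have "(\<Union>(a', f')\<in>fr R P a f. \<Union>(b', g')\<in>fr R P b g. fr R P (a' \<otimes> b') (f' \<otimes> g')) =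
      (\<Union>(b', g')\<in>fr R P b g. fr R P (a \<otimes> b') (f \<otimes> g'))"
    by (rule fr_UN[OF a]) (simp only: inner inner[OF a] eq[OF a b _ _ _ b refl])
  then show ?thesis using inner[OF a] by (simp add: localization_def)
qed

lemma fr_add:
  assumes a: "a \<in> carrier R" "f \<in> carrier R - P" and b: "b \<in> carrier R" "g \<in> carrier R - P"
  shows "fr R P a f \<oplus>\<^bsub>loc R P\<^esub> fr R P b g = fr R P (a \<otimes> g \<oplus> b \<otimes> f) (f \<otimes> g)"
proof -
  have eq: "fr R P (a' \<otimes> g' \<oplus> b' \<otimes> f') (f' \<otimes> g') = fr R P (a \<otimes> g \<oplus> b \<otimes> f) (f \<otimes> g)"
    if a: "a \<in> carrier R" "f \<in> carrier R - P" and b: "b \<in> carrier R" "g \<in> carrier R - P"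
      and a': "a' \<in> carrier R" "f' \<in> carrier R - P" "fr R P a' f' = fr R P a f"
      and b': "b' \<in> carrier R" "g' \<in> carrier R - P" "fr R P b' g' = fr R P b g" for a f b g a' f' b' g'
  proof -
    obtain h where h: "h \<in> carrier R - P" "h \<otimes> (a' \<otimes> f) = h \<otimes> (a \<otimes> f')"
      using a'(3) unfolding fr_eq_iff[OF a'(1,2) a] by blast
    obtain j where j: "j \<in> carrier R - P" "j \<otimes> (b' \<otimes> g) = j \<otimes> (b \<otimes> g')"
      using b'(3) unfolding fr_eq_iff[OF b'(1,2) b] by blast
    have "(h \<otimes> j) \<otimes> ((a' \<otimes> g' \<oplus> b' \<otimes> f') \<otimes> (f \<otimes> g)) =
        (h \<otimes> (a' \<otimes> f)) \<otimes> (j \<otimes> g' \<otimes> g) \<oplus> (j \<otimes> (b' \<otimes> g)) \<otimes> (h \<otimes> f' \<otimes> f)"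
      using a b a' b' h(1) j(1) by (simp add: m_ac l_distr r_distr)
    also have "\<dots> = (h \<otimes> j) \<otimes> ((a \<otimes> g \<oplus> b \<otimes> f) \<otimes> (f' \<otimes> g'))"
      unfolding h(2) j(2) using a b a' b' h(1) j(1) by (simp add: m_ac l_distr r_distr)
    finally have e: "(h \<otimes> j) \<otimes> ((a' \<otimes> g' \<oplus> b' \<otimes> f') \<otimes> (f \<otimes> g)) = (h \<otimes> j) \<otimes> ((a \<otimes> g \<oplus> b \<otimes> f) \<otimes> (f' \<otimes> g'))" .
    show ?thesis
      by (rule fr_eq_iff[THEN iffD2, OF _ den_mult[OF a'(2) b'(2)] _ den_mult[OF a(2) b(2)]])
        (use e den_mult[OF h(1) j(1)] a b a' b' in auto)
  qed
  have inner: "(\<Union>(b', g')\<in>fr R P b g. fr R P (a' \<otimes> g' \<oplus> b' \<otimes> f') (f' \<otimes> g')) = fr R P (a' \<otimes> g \<oplus> b \<otimes> f') (f' \<otimes> g)"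
    if "a' \<in> carrier R" "f' \<in> carrier R - P" for a' f'
    by (rule fr_UN[OF b]) (rule eq[OF that b that refl])
  have "(\<Union>(a', f')\<in>fr R P a f. \<Union>(b', g')\<in>fr R P b g. fr R P (a' \<otimes> g' \<oplus> b' \<otimes> f') (f' \<otimes> g')) =
      (\<Union>(b', g')\<in>fr R P b g. fr R P (a \<otimes> g' \<oplus> b' \<otimes> f) (f \<otimes> g'))"
    by (rule fr_UN[OF a]) (simp only: inner inner[OF a] eq[OF a b _ _ _ b refl])
  then show ?thesis using inner[OF a] by (simp add: localization_def)
qed

lemma loc_carrier: "carrier (loc R P) = {fr R P a f | a f. a \<in> carrier R \<and> f \<in> carrier R - P}"
  by (simp add: localization_def)

lemma fr_closed: "\<lbrakk>a \<in> carrier R; f \<in> carrier R - P\<rbrakk> \<Longrightarrow> fr R P a f \<in> carrier (loc R P)"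
  unfolding loc_carrier by blast

lemma loc_one: "\<one>\<^bsub>loc R P\<^esub> = fr R P \<one> \<one>" and loc_zero: "\<zero>\<^bsub>loc R P\<^esub> = fr R P \<zero> \<one>"
  by (simp_all add: localization_def)

lemma loc_E:
  assumes "x \<in> carrier (loc R P)"
  obtains a f where "a \<in> carrier R" "f \<in> carrier R - P" "x = fr R P a f"
  using assms unfolding loc_carrier by blast

lemma loc_cring: "cring (loc R P)"
proof -
  have zero_closed: "\<zero> \<in> carrier R" by (rule ring.ring_simprules(2)[OF ring_axioms])
  note c = den_mult den_one
  have "abelian_group (loc R P)"
  proof (rule abelian_groupI)
    fix x y assume "x \<in> carrier (loc R P)" "y \<in> carrier (loc R P)"
    then obtain a f b g where e: "x = fr R P a f" "y = fr R P b g"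
      and ab: "a \<in> carrier R" "f \<in> carrier R - P" "b \<in> carrier R" "g \<in> carrier R - P"
      by (metis loc_E)
    show "x \<oplus>\<^bsub>loc R P\<^esub> y \<in> carrier (loc R P)"
      unfolding e fr_add[OF ab] by (rule fr_closed) (use ab c in auto)
    show "x \<oplus>\<^bsub>loc R P\<^esub> y = y \<oplus>\<^bsub>loc R P\<^esub> x"
      unfolding e fr_add[OF ab] fr_add[OF ab(3,4,1,2)]
      by (rule fr_eqI) (use ab c(1)[of f g] c(1)[of g f] in \<open>auto simp: a_ac m_ac\<close>)
    show "\<zero>\<^bsub>loc R P\<^esub> \<oplus>\<^bsub>loc R P\<^esub> x = x"
      unfolding e loc_zero fr_add[OF zero_closed den_one ab(1,2)]
      by (rule fr_eqI) (use ab den_one c(1)[of \<one> f] in \<open>auto simp: a_ac m_ac\<close>)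
    show "\<exists>y\<in>carrier (loc R P). y \<oplus>\<^bsub>loc R P\<^esub> x = \<zero>\<^bsub>loc R P\<^esub>"
    proof (rule bexI[of _ "fr R P (\<ominus> a) f"])
      have "fr R P (\<ominus> a) f \<oplus>\<^bsub>loc R P\<^esub> fr R P a f = fr R P (\<ominus> a \<otimes> f \<oplus> a \<otimes> f) (f \<otimes> f)"
        by (rule fr_add) (use ab in auto)
      also have "\<dots> = fr R P \<zero> \<one>"
        by (rule fr_eqI) (use ab den_one c(1)[of f f] in \<open>auto simp: l_minus l_neg\<close>)
      finally show "fr R P (\<ominus> a) f \<oplus>\<^bsub>loc R P\<^esub> x = \<zero>\<^bsub>loc R P\<^esub>" by (simp add: e loc_zero)
    qed (use ab fr_closed in auto)
    fix z assume "z \<in> carrier (loc R P)"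
    then obtain d h where e': "z = fr R P d h" and d: "d \<in> carrier R" "h \<in> carrier R - P" by (metis loc_E)
    have 1: "a \<otimes> g \<oplus> b \<otimes> f \<in> carrier R" "b \<otimes> h \<oplus> d \<otimes> g \<in> carrier R" using ab d by auto
    show "x \<oplus>\<^bsub>loc R P\<^esub> y \<oplus>\<^bsub>loc R P\<^esub> z = x \<oplus>\<^bsub>loc R P\<^esub> (y \<oplus>\<^bsub>loc R P\<^esub> z)"
      unfolding e e' fr_add[OF ab] fr_add[OF ab(3,4) d] fr_add[OF 1(1) c(1)[OF ab(2,4)] d]
        fr_add[OF ab(1,2) 1(2) c(1)[OF ab(4) d(2)]]
      by (rule fr_eqI) (use ab d c(1)[OF c(1)[OF ab(2,4)] d(2)] c(1)[OF ab(2) c(1)[OF ab(4) d(2)]]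
          in \<open>auto simp: a_ac m_ac l_distr r_distr\<close>)
  next
    show "\<zero>\<^bsub>loc R P\<^esub> \<in> carrier (loc R P)" unfolding loc_zero using fr_closed den_one by auto
  qed
  moreover have "comm_monoid (loc R P)"
  proof (rule comm_monoidI)
    fix x y assume "x \<in> carrier (loc R P)" "y \<in> carrier (loc R P)"
    then obtain a f b g where e: "x = fr R P a f" "y = fr R P b g"
      and ab: "a \<in> carrier R" "f \<in> carrier R - P" "b \<in> carrier R" "g \<in> carrier R - P"
      by (metis loc_E)
    show "x \<otimes>\<^bsub>loc R P\<^esub> y \<in> carrier (loc R P)"
      unfolding e fr_mult[OF ab] by (rule fr_closed) (use ab c in auto)
    show "x \<otimes>\<^bsub>loc R P\<^esub> y = y \<otimes>\<^bsub>loc R P\<^esub> x"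
      unfolding e fr_mult[OF ab] fr_mult[OF ab(3,4,1,2)] using ab by (simp add: m_ac)
    show "\<one>\<^bsub>loc R P\<^esub> \<otimes>\<^bsub>loc R P\<^esub> x = x"
      unfolding e loc_one fr_mult[OF one_closed den_one ab(1,2)] using ab by simp
    fix z assume "z \<in> carrier (loc R P)"
    then obtain d h where e': "z = fr R P d h" and d: "d \<in> carrier R" "h \<in> carrier R - P" by (metis loc_E)
    have 1: "a \<otimes> b \<in> carrier R" "b \<otimes> d \<in> carrier R" using ab d by auto
    show "x \<otimes>\<^bsub>loc R P\<^esub> y \<otimes>\<^bsub>loc R P\<^esub> z = x \<otimes>\<^bsub>loc R P\<^esub> (y \<otimes>\<^bsub>loc R P\<^esub> z)"
      unfolding e e' fr_mult[OF ab] fr_mult[OF ab(3,4) d] fr_mult[OF 1(1) c(1)[OF ab(2,4)] d]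
        fr_mult[OF ab(1,2) 1(2) c(1)[OF ab(4) d(2)]] using ab d by (simp add: m_ac)
  next
    show "\<one>\<^bsub>loc R P\<^esub> \<in> carrier (loc R P)" unfolding loc_one using fr_closed den_one by auto
  qed
  moreover have "(x \<oplus>\<^bsub>loc R P\<^esub> y) \<otimes>\<^bsub>loc R P\<^esub> z = x \<otimes>\<^bsub>loc R P\<^esub> z \<oplus>\<^bsub>loc R P\<^esub> y \<otimes>\<^bsub>loc R P\<^esub> z"
    if "x \<in> carrier (loc R P)" "y \<in> carrier (loc R P)" "z \<in> carrier (loc R P)" for x y z
  proof -
    obtain a f b g d h where e: "x = fr R P a f" "y = fr R P b g" "z = fr R P d h"
      and ab: "a \<in> carrier R" "f \<in> carrier R - P" "b \<in> carrier R" "g \<in> carrier R - P"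
        and d: "d \<in> carrier R" "h \<in> carrier R - P"
      using \<open>x \<in> _\<close> \<open>y \<in> _\<close> \<open>z \<in> _\<close> by (metis loc_E)
    have 1: "a \<otimes> g \<oplus> b \<otimes> f \<in> carrier R" "a \<otimes> d \<in> carrier R" "b \<otimes> d \<in> carrier R" using ab d by auto
    note c2 = c(1)[OF ab(2,4)] c(1)[OF ab(2) d(2)] c(1)[OF ab(4) d(2)]
    show ?thesis
      unfolding e fr_add[OF ab] fr_mult[OF ab(1,2) d] fr_mult[OF ab(3,4) d]
        fr_mult[OF 1(1) c2(1) d] fr_add[OF 1(2) c2(2) 1(3) c2(3)]
      by (rule fr_eqI) (use ab d c(1)[OF c2(1) d(2)] c(1)[OF c2(2,3)]
          in \<open>auto simp: a_ac m_ac l_distr r_distr\<close>)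
  qed
  ultimately show ?thesis by (rule cringI)
qed

end

lemma prime_locI: "\<lbrakk>cring R; primeideal P R\<rbrakk> \<Longrightarrow> prime_loc R P"
  by (simp add: prime_loc_def)

text \<open>The topology is only generated by the basic open sets. They form a base because the
  intersection of two of them is the basic open set of the product.\<close>

lemma openin_spec_iff:
  fixes R :: "'a ring" (structure)
  assumes "cring R"
  shows "openin (spec_topology R) U \<longleftrightarrow> (\<forall>P\<in>U. \<exists>f\<in>carrier R. P \<in> basic_open R f \<and> basic_open R f \<subseteq> U)"
proof -
  interpret cring R by fact
  let ?B = "basic_open R ` carrier R"
  have "\<forall>P\<in>U. \<exists>f\<in>carrier R. P \<in> basic_open R f \<and> basic_open R f \<subseteq> U"
    if "generate_topology_on ?B U" for U
    using that
  proof induction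
    case (Int U V)
    show ?case
    proof
      fix P assume P: "P \<in> U \<inter> V"
      obtain f where f: "f \<in> carrier R" "P \<in> basic_open R f" "basic_open R f \<subseteq> U"
        using bspec[OF Int.IH(1)] P by auto
      obtain g where g: "g \<in> carrier R" "P \<in> basic_open R g" "basic_open R g \<subseteq> V"
        using bspec[OF Int.IH(2)] P by auto
      interpret P: primeideal P R using f by simp
      have sub: "basic_open R (f \<otimes> g) \<subseteq> basic_open R f \<inter> basic_open R g"
      proof
        fix Q assume Q: "Q \<in> basic_open R (f \<otimes> g)"
        then interpret Q: primeideal Q R by simp
        show "Q \<in> basic_open R f \<inter> basic_open R g"
          using Q f(1) g(1) Q.I_l_closed[of g f] Q.I_r_closed[of f g] by auto
      qed
      have "f \<otimes> g \<notin> P" using P.I_prime[OF f(1) g(1)] f(2) g(2) by auto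
      then show "\<exists>f\<in>carrier R. P \<in> basic_open R f \<and> basic_open R f \<subseteq> U \<inter> V"
      proof (intro bexI[of _ "f \<otimes> g"] conjI)
        show "basic_open R (f \<otimes> g) \<subseteq> U \<inter> V" using sub f(3) g(3) by (meson Int_mono subset_trans)
      qed (use f g in \<open>simp_all\<close>)
    qed
  next
    case (UN K)
    show ?case
    proof
      fix P assume "P \<in> \<Union>K"
      then obtain V where V: "V \<in> K" "P \<in> V" by blast
      obtain f where f: "f \<in> carrier R" "P \<in> basic_open R f" "basic_open R f \<subseteq> V"
        using bspec[OF UN.IH[OF V(1)] V(2)] by auto
      have "basic_open R f \<subseteq> \<Union>K" using f(3) V(1) by (rule subset_trans[OF _ Union_upper])
      with f(1,2) show "\<exists>f\<in>carrier R. P \<in> basic_open R f \<and> basic_open R f \<subseteq> \<Union>K" by (intro bexI[of _ f] conjI)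
    qed
  next
    case (Basis s)
    then obtain f where f: "f \<in> carrier R" "s = basic_open R f" by blast
    show ?case
    proof
      fix P assume "P \<in> s"
      then show "\<exists>f\<in>carrier R. P \<in> basic_open R f \<and> basic_open R f \<subseteq> s"
        by (intro bexI[of _ f]) (simp_all add: f)
    qed
  qed simp
  moreover have "generate_topology_on ?B U"
    if *: "\<forall>P\<in>U. \<exists>f\<in>carrier R. P \<in> basic_open R f \<and> basic_open R f \<subseteq> U"
  proof -
    have "U = \<Union>{V \<in> ?B. V \<subseteq> U}"
    proof
      show "U \<subseteq> \<Union>{V \<in> ?B. V \<subseteq> U}"
      proof
        fix P assume "P \<in> U"
        then obtain f where f: "f \<in> carrier R" "P \<in> basic_open R f" "basic_open R f \<subseteq> U"
          using bspec[OF *] by auto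
        show "P \<in> \<Union>{V \<in> ?B. V \<subseteq> U}"
          by (rule UnionI[OF _ f(2)]) (use f(1,3) in simp)
      qed
    qed blast
    moreover have "generate_topology_on ?B (\<Union>{V \<in> ?B. V \<subseteq> U})"
      by (rule generate_topology_on.UN) (rule generate_topology_on.Basis, blast)
    ultimately show ?thesis by simp
  qed
  ultimately show ?thesis unfolding spec_topology_def openin_topology_generated_by_iff by (rule iffI)
qed

lemma topspace_spec:
  fixes R :: "'a ring" (structure)
  assumes "cring R"
  shows "topspace (spec_topology R) = primes R"
proof -
  interpret cring R by fact
  have "\<one> \<notin> P" if "primeideal P R" for P
  proof -
    interpret primeideal P R by fact
    show ?thesis using one_imp_carrier I_notcarr by auto
  qed
  then show ?thesis unfolding spec_topology_def topology_generated_by_topspace by auto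
qed

lemma openin_basic: "\<lbrakk>cring R; f \<in> carrier R\<rbrakk> \<Longrightarrow> openin (spec_topology R) (basic_open R f)"
  unfolding openin_spec_iff by (intro ballI bexI[of _ f]) simp_all

lemma Spec_simps [simp]:
  "topol (Spec R \<iota>) = spec_topology R"
  "carrier (sec (Spec R \<iota>) U) = spec_sections R U"
  "s \<otimes>\<^bsub>sec (Spec R \<iota>) U\<^esub> t = (\<lambda>P\<in>U. s P \<otimes>\<^bsub>loc R P\<^esub> t P)"
  "s \<oplus>\<^bsub>sec (Spec R \<iota>) U\<^esub> t = (\<lambda>P\<in>U. s P \<oplus>\<^bsub>loc R P\<^esub> t P)"
  "\<one>\<^bsub>sec (Spec R \<iota>) U\<^esub> = (\<lambda>P\<in>U. \<one>\<^bsub>loc R P\<^esub>)"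
  "\<zero>\<^bsub>sec (Spec R \<iota>) U\<^esub> = (\<lambda>P\<in>U. \<zero>\<^bsub>loc R P\<^esub>)"
  "res (Spec R \<iota>) U V s = restrict s V"
  "str (Spec R \<iota>) = (\<lambda>c. \<lambda>P\<in>primes R. fr R P (\<iota> c) \<one>\<^bsub>R\<^esub>)"
  by (simp_all add: Spec_def)

text \<open>Ties one neighbourhood to one fraction, so that operations on sections reduce to
  formulas for fractions over a common \<open>W\<close>.\<close>

definition loc_rep :: "'a ring \<Rightarrow> ('a set \<Rightarrow> ('a \<times> 'a) set) \<Rightarrow> 'a set set \<Rightarrow> 'a \<Rightarrow> 'a \<Rightarrow> bool"
  where "loc_rep R s W a f \<longleftrightarrow> openin (spec_topology R) W \<and> a \<in> carrier R \<and> f \<in> carrier R \<and>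
    (\<forall>Q\<in>W. f \<notin> Q \<and> s Q = fr R Q a f)"

lemma spec_sections_iff:
  "s \<in> spec_sections R U \<longleftrightarrow> s \<in> extensional U \<and> (\<forall>P\<in>U. \<exists>W a f. P \<in> W \<and> W \<subseteq> U \<and> loc_rep R s W a f)"
proof -
  have "(\<exists>W. openin T W \<and> P \<in> W \<and> W \<subseteq> U \<and> (\<exists>a\<in>C. \<exists>f\<in>C. \<forall>Q\<in>W. A Q a f)) \<longleftrightarrow>
      (\<exists>W a f. P \<in> W \<and> W \<subseteq> U \<and> openin T W \<and> a \<in> C \<and> f \<in> C \<and> (\<forall>Q\<in>W. A Q a f))"
    for P T C and A :: "'a set \<Rightarrow> 'a \<Rightarrow> 'a \<Rightarrow> bool" by metis
  then show ?thesis by (simp add: spec_sections_def loc_rep_def)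
qed

lemma loc_repE:
  assumes "s \<in> spec_sections R U" "P \<in> U"
  obtains W a f where "P \<in> W" "W \<subseteq> U" "loc_rep R s W a f"
  using assms unfolding spec_sections_iff by blast

lemma loc_repD:
  assumes "loc_rep R s W a f"
  shows "openin (spec_topology R) W" "a \<in> carrier R" "f \<in> carrier R"
    "Q \<in> W \<Longrightarrow> f \<in> carrier R - Q" "Q \<in> W \<Longrightarrow> s Q = fr R Q a f"
  using assms unfolding loc_rep_def by auto

lemma loc_rep_subset: "\<lbrakk>loc_rep R s W a f; openin (spec_topology R) V; V \<subseteq> W\<rbrakk> \<Longrightarrow> loc_rep R s V a f"
  unfolding loc_rep_def by auto

lemma loc_rep_cong: "\<lbrakk>loc_rep R s W a f; \<And>Q. Q \<in> W \<Longrightarrow> s' Q = s Q\<rbrakk> \<Longrightarrow> loc_rep R s' W a f"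
  unfolding loc_rep_def by auto

section \<open>Spectra of algebras as locally ringed spaces\<close>

locale kalg = cring R for R :: "'a ring" (structure) +
  fixes k :: "'k::field set" and \<iota> :: "'k \<Rightarrow> 'a"
  assumes str_ring_hom: "\<iota> \<in> ring_hom (base_ring k) R"
begin

abbreviation "openR \<equiv> openin (spec_topology R)"
abbreviation "SpR \<equiv> Spec R \<iota>"

lemma pts_Spec: "pts SpR = primes R"
  by (simp add: topspace_spec[OF is_cring])

lemma open_primes: "openR U \<Longrightarrow> U \<subseteq> primes R"
  using openin_subset[of "spec_topology R" U] topspace_spec[OF is_cring] by simp

lemma open_ploc: "\<lbrakk>openR U; P \<in> U\<rbrakk> \<Longrightarrow> prime_loc R P"
  by (rule prime_locI[OF is_cring]) (drule open_primes, auto)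

lemma rep_ploc: "\<lbrakk>loc_rep R s W a f; P \<in> W\<rbrakk> \<Longrightarrow> prime_loc R P"
  by (rule open_ploc[OF loc_repD(1)])

lemma \<iota>_closed: "c \<in> k \<Longrightarrow> \<iota> c \<in> carrier R"
  using ring_hom_closed[OF str_ring_hom] by (simp add: ring_of_type_algebra_def)

lemma sections_loc: "\<lbrakk>openR U; s \<in> spec_sections R U; P \<in> U\<rbrakk> \<Longrightarrow> s P \<in> carrier (loc R P)"
proof -
  assume "openR U" and s: "s \<in> spec_sections R U" "P \<in> U"
  obtain W a f where W: "P \<in> W" "W \<subseteq> U" "loc_rep R s W a f" by (rule loc_repE[OF s])
  interpret P: prime_loc R P by (rule rep_ploc[OF W(3,1)])
  show ?thesis using P.fr_closed[OF loc_repD(2,4)[OF W(3)]] loc_repD(5)[OF W(3,1)] W(1) by simp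
qed

lemma sectionsI:
  assumes "s \<in> extensional U" "\<And>P. P \<in> U \<Longrightarrow> \<exists>W a f. P \<in> W \<and> W \<subseteq> U \<and> loc_rep R s W a f"
  shows "s \<in> spec_sections R U"
  using assms unfolding spec_sections_iff by simp

lemma loc_repI:
  assumes "openR W" "a \<in> carrier R" "f \<in> carrier R"
    "\<And>Q. Q \<in> W \<Longrightarrow> f \<in> carrier R - Q" "\<And>Q. Q \<in> W \<Longrightarrow> s Q = fr R Q a f"
  shows "loc_rep R s W a f"
  using assms unfolding loc_rep_def by auto

lemma rep2E:
  assumes U: "openR U" and s: "s \<in> spec_sections R U" and t: "t \<in> spec_sections R U" and P: "P \<in> U"
  obtains W a f b g where "P \<in> W" "W \<subseteq> U" "loc_rep R s W a f" "loc_rep R t W b g"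
proof -
  obtain W a f where W: "P \<in> W" "W \<subseteq> U" "loc_rep R s W a f" by (rule loc_repE[OF s P])
  obtain V b g where V: "P \<in> V" "V \<subseteq> U" "loc_rep R t V b g" by (rule loc_repE[OF t P])
  have o: "openR (W \<inter> V)" using loc_repD(1)[OF W(3)] loc_repD(1)[OF V(3)] by (rule openin_Int)
  show ?thesis
    by (rule that[of "W \<inter> V" a f b g])
      (use W V loc_rep_subset[OF W(3) o] loc_rep_subset[OF V(3) o] in auto)
qed

lemma rep_add:
  assumes "loc_rep R s W a f" "loc_rep R t W b g" "W \<subseteq> U"
  shows "loc_rep R (\<lambda>P\<in>U. s P \<oplus>\<^bsub>loc R P\<^esub> t P) W (a \<otimes> g \<oplus> b \<otimes> f) (f \<otimes> g)"
proof (rule loc_repI)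
  note s = loc_repD[OF assms(1)] and t = loc_repD[OF assms(2)]
  fix Q assume Q: "Q \<in> W"
  interpret Q: prime_loc R Q by (rule rep_ploc[OF assms(1) Q])
  show "f \<otimes> g \<in> carrier R - Q" using Q.den_mult[OF s(4)[OF Q] t(4)[OF Q]] .
  show "(\<lambda>P\<in>U. s P \<oplus>\<^bsub>loc R P\<^esub> t P) Q = fr R Q (a \<otimes> g \<oplus> b \<otimes> f) (f \<otimes> g)"
    using Q.fr_add[OF s(2) s(4)[OF Q] t(2) t(4)[OF Q]] s(5)[OF Q] t(5)[OF Q] Q assms(3) by auto
qed (use loc_repD[OF assms(1)] loc_repD[OF assms(2)] in simp_all)

lemma rep_mult:
  assumes "loc_rep R s W a f" "loc_rep R t W b g" "W \<subseteq> U"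
  shows "loc_rep R (\<lambda>P\<in>U. s P \<otimes>\<^bsub>loc R P\<^esub> t P) W (a \<otimes> b) (f \<otimes> g)"
proof (rule loc_repI)
  note s = loc_repD[OF assms(1)] and t = loc_repD[OF assms(2)]
  fix Q assume Q: "Q \<in> W"
  interpret Q: prime_loc R Q by (rule rep_ploc[OF assms(1) Q])
  show "f \<otimes> g \<in> carrier R - Q" using Q.den_mult[OF s(4)[OF Q] t(4)[OF Q]] .
  show "(\<lambda>P\<in>U. s P \<otimes>\<^bsub>loc R P\<^esub> t P) Q = fr R Q (a \<otimes> b) (f \<otimes> g)"
    using Q.fr_mult[OF s(2) s(4)[OF Q] t(2) t(4)[OF Q]] s(5)[OF Q] t(5)[OF Q] Q assms(3) by auto
qed (use loc_repD[OF assms(1)] loc_repD[OF assms(2)] in simp_all)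

lemma rep_const:
  assumes "openR U" "W \<subseteq> U" "openR W" "b \<in> carrier R"
  shows "loc_rep R (\<lambda>P\<in>U. fr R P b \<one>) W b \<one>"
proof (rule loc_repI)
  fix Q assume Q: "Q \<in> W"
  interpret Q: prime_loc R Q by (rule open_ploc[OF assms(3) Q])
  show "\<one> \<in> carrier R - Q" by (rule Q.den_one)
  show "(\<lambda>P\<in>U. fr R P b \<one>) Q = fr R Q b \<one>" using Q assms(2) by auto
qed (use assms in auto)

lemma sections_op:
  assumes "openR U" "s \<in> spec_sections R U" "t \<in> spec_sections R U"
  shows "(\<lambda>P\<in>U. s P \<oplus>\<^bsub>loc R P\<^esub> t P) \<in> spec_sections R U"
    and "(\<lambda>P\<in>U. s P \<otimes>\<^bsub>loc R P\<^esub> t P) \<in> spec_sections R U"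
proof -
  have "\<exists>W a f. P \<in> W \<and> W \<subseteq> U \<and> loc_rep R (\<lambda>P\<in>U. s P \<oplus>\<^bsub>loc R P\<^esub> t P) W a f"
    "\<exists>W a f. P \<in> W \<and> W \<subseteq> U \<and> loc_rep R (\<lambda>P\<in>U. s P \<otimes>\<^bsub>loc R P\<^esub> t P) W a f" if P: "P \<in> U" for P
  proof -
    obtain W a f b g where *: "P \<in> W" "W \<subseteq> U" "loc_rep R s W a f" "loc_rep R t W b g" by (rule rep2E[OF assms P])
    show "\<exists>W a f. P \<in> W \<and> W \<subseteq> U \<and> loc_rep R (\<lambda>P\<in>U. s P \<oplus>\<^bsub>loc R P\<^esub> t P) W a f"
      by (intro exI conjI) (rule *(1,2) rep_add[OF *(3,4,2)])+
    show "\<exists>W a f. P \<in> W \<and> W \<subseteq> U \<and> loc_rep R (\<lambda>P\<in>U. s P \<otimes>\<^bsub>loc R P\<^esub> t P) W a f"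
      by (intro exI conjI) (rule *(1,2) rep_mult[OF *(3,4,2)])+
  qed
  show "(\<lambda>P\<in>U. s P \<oplus>\<^bsub>loc R P\<^esub> t P) \<in> spec_sections R U"
    by (rule sectionsI[OF restrict_extensional]) fact
  show "(\<lambda>P\<in>U. s P \<otimes>\<^bsub>loc R P\<^esub> t P) \<in> spec_sections R U"
    by (rule sectionsI[OF restrict_extensional]) fact
qed

lemma sections_const:
  assumes "openR U" "b \<in> carrier R"
  shows "(\<lambda>P\<in>U. fr R P b \<one>) \<in> spec_sections R U"
proof (rule sectionsI)
  fix P assume "P \<in> U"
  then show "\<exists>W a f. P \<in> W \<and> W \<subseteq> U \<and> loc_rep R (\<lambda>P\<in>U. fr R P b \<one>) W a f"
    by (intro exI conjI) (rule subset_refl rep_const[OF assms(1) subset_refl assms] | assumption)+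
qed simp

lemma sections_neg:
  assumes U: "openR U" and s: "s \<in> spec_sections R U"
  shows "(\<lambda>P\<in>U. \<ominus>\<^bsub>loc R P\<^esub> s P) \<in> spec_sections R U"
proof (rule sectionsI)
  fix P assume P: "P \<in> U"
  obtain W a f where W: "P \<in> W" "W \<subseteq> U" "loc_rep R s W a f" by (rule loc_repE[OF s P])
  note r = loc_repD[OF W(3)]
  have "loc_rep R (\<lambda>P\<in>U. \<ominus>\<^bsub>loc R P\<^esub> s P) W (\<ominus> a) f"
  proof (rule loc_repI)
    fix Q assume Q: "Q \<in> W"
    interpret Q: prime_loc R Q by (rule rep_ploc[OF W(3) Q])
    interpret L: cring "loc R Q" by (rule Q.loc_cring)
    have c: "\<ominus> a \<in> carrier R" using r(2) by simp
    have "fr R Q (\<ominus> a) f \<oplus>\<^bsub>loc R Q\<^esub> fr R Q a f = fr R Q (\<ominus> a \<otimes> f \<oplus> a \<otimes> f) (f \<otimes> f)"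
      by (rule Q.fr_add[OF c r(4)[OF Q] r(2) r(4)[OF Q]])
    also have "\<dots> = \<zero>\<^bsub>loc R Q\<^esub>" unfolding Q.loc_zero
      by (rule Q.fr_eqI) (use r(2) r(4)[OF Q] Q.den_one Q.den_mult[OF r(4)[OF Q] r(4)[OF Q]] in \<open>auto simp: l_minus l_neg\<close>)
    finally have "\<ominus>\<^bsub>loc R Q\<^esub> (fr R Q a f) = fr R Q (\<ominus> a) f"
      using L.minus_equality Q.fr_closed[OF c r(4)[OF Q]] Q.fr_closed[OF r(2) r(4)[OF Q]] by blast
    then show "(\<lambda>P\<in>U. \<ominus>\<^bsub>loc R P\<^esub> s P) Q = fr R Q (\<ominus> a) f" using r(5)[OF Q] Q W(2) by auto
  qed (use r in auto)
  then show "\<exists>W a f. P \<in> W \<and> W \<subseteq> U \<and> loc_rep R (\<lambda>P\<in>U. \<ominus>\<^bsub>loc R P\<^esub> s P) W a f"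
    using W(1,2) by (intro exI conjI)
qed simp

lemma sec_cring:
  assumes U: "openR U"
  shows "cring (sec SpR U)"
proof -
  have L: "cring (loc R P)" if "P \<in> U" for P
    using prime_loc.loc_cring[OF open_ploc[OF U that]] .
  note Ls = cring.cring_simprules[OF L]
  note c = sections_loc[OF U]
  have one: "(\<lambda>P\<in>U. \<one>\<^bsub>loc R P\<^esub>) \<in> spec_sections R U"
  proof -
    have "(\<lambda>P\<in>U. \<one>\<^bsub>loc R P\<^esub>) = (\<lambda>P\<in>U. fr R P \<one> \<one>)"
      by (rule restrict_ext) (rule prime_loc.loc_one[OF open_ploc[OF U]])
    then show ?thesis using sections_const[OF U one_closed] by simp
  qed
  have zero: "(\<lambda>P\<in>U. \<zero>\<^bsub>loc R P\<^esub>) \<in> spec_sections R U"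
  proof -
    have "(\<lambda>P\<in>U. \<zero>\<^bsub>loc R P\<^esub>) = (\<lambda>P\<in>U. fr R P \<zero> \<one>)"
      by (rule restrict_ext) (rule prime_loc.loc_zero[OF open_ploc[OF U]])
    then show ?thesis using sections_const[OF U zero_closed] by simp
  qed
  have ext: "restrict s U = s" if "s \<in> spec_sections R U" for s
    using that unfolding spec_sections_iff by (simp add: extensional_restrict)
  show ?thesis
  proof (rule cringI)
    show "abelian_group (sec SpR U)"
    proof (rule abelian_groupI, simp_all add: sections_op[OF U] zero)
      fix s assume s: "s \<in> spec_sections R U"
      show "(\<lambda>P\<in>U. (if P \<in> U then \<zero>\<^bsub>loc R P\<^esub> else undefined) \<oplus>\<^bsub>loc R P\<^esub> s P) = s"
        by (subst (2) ext[OF s, symmetric]) (rule restrict_ext, simp add: c[OF s] Ls(8))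
      show "\<exists>t\<in>spec_sections R U. (\<lambda>P\<in>U. t P \<oplus>\<^bsub>loc R P\<^esub> s P) = (\<lambda>P\<in>U. \<zero>\<^bsub>loc R P\<^esub>)"
        by (rule bexI[OF _ sections_neg[OF U s]]) (rule restrict_ext, simp add: c[OF s] Ls(9))
      fix t assume t: "t \<in> spec_sections R U"
      show "(\<lambda>P\<in>U. s P \<oplus>\<^bsub>loc R P\<^esub> t P) = (\<lambda>P\<in>U. t P \<oplus>\<^bsub>loc R P\<^esub> s P)"
        by (rule restrict_ext) (rule Ls(10), auto simp: c s t)
      fix u assume u: "u \<in> spec_sections R U"
      show "(\<lambda>P\<in>U. (if P \<in> U then s P \<oplus>\<^bsub>loc R P\<^esub> t P else undefined) \<oplus>\<^bsub>loc R P\<^esub> u P) =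
        (\<lambda>P\<in>U. s P \<oplus>\<^bsub>loc R P\<^esub> (if P \<in> U then t P \<oplus>\<^bsub>loc R P\<^esub> u P else undefined))"
        by (rule restrict_ext) (simp add: Ls(7) c s t u)
    qed
    show "comm_monoid (sec SpR U)"
    proof (rule comm_monoidI, simp_all add: sections_op[OF U] one)
      fix s assume s: "s \<in> spec_sections R U"
      show "(\<lambda>P\<in>U. (if P \<in> U then \<one>\<^bsub>loc R P\<^esub> else undefined) \<otimes>\<^bsub>loc R P\<^esub> s P) = s"
        by (subst (2) ext[OF s, symmetric]) (rule restrict_ext, simp add: c[OF s] Ls(12))
      fix t assume t: "t \<in> spec_sections R U"
      show "(\<lambda>P\<in>U. s P \<otimes>\<^bsub>loc R P\<^esub> t P) = (\<lambda>P\<in>U. t P \<otimes>\<^bsub>loc R P\<^esub> s P)"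
        by (rule restrict_ext) (rule Ls(14), auto simp: c s t)
      fix u assume u: "u \<in> spec_sections R U"
      show "(\<lambda>P\<in>U. (if P \<in> U then s P \<otimes>\<^bsub>loc R P\<^esub> t P else undefined) \<otimes>\<^bsub>loc R P\<^esub> u P) =
        (\<lambda>P\<in>U. s P \<otimes>\<^bsub>loc R P\<^esub> (if P \<in> U then t P \<otimes>\<^bsub>loc R P\<^esub> u P else undefined))"
        by (rule restrict_ext) (simp add: Ls(11) c s t u)
    qed
    fix s t u assume "s \<in> carrier (sec SpR U)" "t \<in> carrier (sec SpR U)" "u \<in> carrier (sec SpR U)"
    then have stu: "s \<in> spec_sections R U" "t \<in> spec_sections R U" "u \<in> spec_sections R U" by simp_all
    show "(s \<oplus>\<^bsub>sec SpR U\<^esub> t) \<otimes>\<^bsub>sec SpR U\<^esub> u = s \<otimes>\<^bsub>sec SpR U\<^esub> u \<oplus>\<^bsub>sec SpR U\<^esub> t \<otimes>\<^bsub>sec SpR U\<^esub> u"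
      by simp (rule restrict_ext, simp add: Ls(13) c stu)
  qed
qed

lemma sections_restrict:
  assumes "openR V" "V \<subseteq> U" "s \<in> spec_sections R U"
  shows "restrict s V \<in> spec_sections R V"
proof (rule sectionsI)
  fix P assume P: "P \<in> V"
  obtain W a f where W: "P \<in> W" "W \<subseteq> U" "loc_rep R s W a f" using loc_repE[OF assms(3)] P assms(2) by blast
  have o: "openR (W \<inter> V)" using loc_repD(1)[OF W(3)] assms(1) by (rule openin_Int)
  have "loc_rep R (restrict s V) (W \<inter> V) a f"
    by (rule loc_rep_cong[OF loc_rep_subset[OF W(3) o]]) auto
  then show "\<exists>W a f. P \<in> W \<and> W \<subseteq> V \<and> loc_rep R (restrict s V) W a f"
    using W(1) P by (intro exI[of _ "W \<inter> V"] exI conjI) auto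
qed simp

lemma sections_ext: "\<lbrakk>s \<in> spec_sections R U; t \<in> spec_sections R U; \<And>P. P \<in> U \<Longrightarrow> s P = t P\<rbrakk> \<Longrightarrow> s = t"
  unfolding spec_sections_iff by (rule extensionalityI) auto

lemma rspace_Spec: "rspace k SpR"
proof -
  note simps = Spec_simps(1,2,7)
  show ?thesis unfolding rspace_def ringed_space_def simps
  proof (intro conjI allI impI ballI)
    show "cring (sec SpR U)" if "openR U" for U using sec_cring[OF that] .
    fix U V assume "openR U \<and> openR V \<and> V \<subseteq> U"
    then have UV: "openR U" "openR V" "V \<subseteq> U" by auto
    show "(\<lambda>s. restrict s V) \<in> ring_hom (sec SpR U) (sec SpR V)"
      by (rule ring_hom_memI) (use UV sections_restrict[OF UV(2,3)] in \<open>auto simp: fun_eq_iff\<close>)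
  next
    show "restrict s U = s" if "s \<in> spec_sections R U" for s U
      using that unfolding spec_sections_iff by (simp add: extensional_restrict)
  next
    show "restrict (restrict s V) W = restrict s W" if "openR U \<and> openR V \<and> openR W \<and> W \<subseteq> V \<and> V \<subseteq> U"
      for s :: "'a set \<Rightarrow> ('a \<times> 'a) set" and U V W using that by (auto simp: fun_eq_iff)
  next
    fix \<U> and s t :: "'a set \<Rightarrow> ('a \<times> 'a) set"
    assume st: "s \<in> spec_sections R (\<Union>\<U>)" "t \<in> spec_sections R (\<Union>\<U>)"
      and eq: "\<forall>U\<in>\<U>. restrict s U = restrict t U"
    show "s = t"
    proof (rule sections_ext[OF st])
      fix P assume "P \<in> \<Union>\<U>"
      then obtain U where "U \<in> \<U>" "P \<in> U" by blast
      then show "s P = t P" using eq by (metis restrict_apply')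
    qed
  next
    fix \<U> and s :: "'a set set \<Rightarrow> 'a set \<Rightarrow> ('a \<times> 'a) set"
    assume A: "(\<forall>U\<in>\<U>. openR U \<and> s U \<in> spec_sections R U) \<and>
       (\<forall>U\<in>\<U>. \<forall>V\<in>\<U>. restrict (s U) (U \<inter> V) = restrict (s V) (U \<inter> V))"
    \<comment> \<open>At each prime the value is read off from some member of the cover;
      compatibility makes the choice irrelevant.\<close>
    define t where "t = (\<lambda>P\<in>\<Union>\<U>. s (SOME U. U \<in> \<U> \<and> P \<in> U) P)"
    have t: "t P = s U P" if U: "U \<in> \<U>" "P \<in> U" for U P
    proof -
      let ?V = "SOME U. U \<in> \<U> \<and> P \<in> U"
      have V: "?V \<in> \<U> \<and> P \<in> ?V" by (rule someI[of _ U]) (use U in simp)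
      have "restrict (s U) (U \<inter> ?V) = restrict (s ?V) (U \<inter> ?V)"
        using bspec[OF bspec[OF A[THEN conjunct2] U(1)] conjunct1[OF V]] .
      from fun_cong[OF this, of P] have "s U P = s ?V P" using U(2) conjunct2[OF V] by (simp only: restrict_apply Int_iff simp_thms if_True)
      moreover have "P \<in> \<Union>\<U>" using U by (rule UnionI)
      then have "t P = s ?V P" unfolding t_def by (rule restrict_apply')
      ultimately show ?thesis by (simp only:)
    qed
    have "t \<in> spec_sections R (\<Union>\<U>)"
    proof (rule sectionsI)
      fix P assume "P \<in> \<Union>\<U>"
      then obtain U where U: "U \<in> \<U>" "P \<in> U" by blast
      have "s U \<in> spec_sections R U" using bspec[OF conjunct1[OF A] U(1)] by (rule conjunct2)
      then obtain W a f where W: "P \<in> W" "W \<subseteq> U" "loc_rep R (s U) W a f" using U(2) by (rule loc_repE)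
      have "loc_rep R t W a f" by (rule loc_rep_cong[OF W(3)]) (use t U W in auto)
      then show "\<exists>W a f. P \<in> W \<and> W \<subseteq> \<Union>\<U> \<and> loc_rep R t W a f"
        using W U by (intro exI[of _ W] exI[of _ a] exI[of _ f]) auto
    qed (simp add: t_def)
    moreover have "\<forall>U\<in>\<U>. restrict t U = s U"
    proof
      fix U assume U: "U \<in> \<U>"
      have "s U \<in> spec_sections R U" using bspec[OF conjunct1[OF A] U] by (rule conjunct2)
      then have "s U \<in> extensional U" unfolding spec_sections_iff by simp
      then show "restrict t U = s U" using t[OF U] by (intro extensionalityI) auto
    qed
    ultimately show "\<exists>t\<in>spec_sections R (\<Union>\<U>). \<forall>U\<in>\<U>. restrict t U = s U" by (intro bexI[of _ t])
  next
    have o: "openR (primes R)" by (metis openin_topspace topspace_spec[OF is_cring])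
    have pl: "prime_loc R P" if "P \<in> primes R" for P using open_ploc[OF o that] .
    show "str SpR \<in> ring_hom (base_ring k) (sec SpR (topspace (spec_topology R)))"
      unfolding topspace_spec[OF is_cring]
    proof (rule ring_hom_memI)
      show "str SpR c \<in> carrier (sec SpR (primes R))" if "c \<in> carrier (base_ring k)" for c
        using sections_const[OF o] ring_hom_closed[OF str_ring_hom that] by simp
      fix c d assume cd: "c \<in> carrier (base_ring k)" "d \<in> carrier (base_ring k)"
      note h = ring_hom_closed[OF str_ring_hom cd(1)] ring_hom_closed[OF str_ring_hom cd(2)]
      have "fr R P (\<iota> c) \<one> \<otimes>\<^bsub>loc R P\<^esub> fr R P (\<iota> d) \<one> = fr R P (\<iota> c \<otimes> \<iota> d) \<one>"
        "fr R P (\<iota> c) \<one> \<oplus>\<^bsub>loc R P\<^esub> fr R P (\<iota> d) \<one> = fr R P (\<iota> c \<oplus> \<iota> d) \<one>" if "P \<in> primes R" for P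
      proof -
        interpret P: prime_loc R P by (rule pl[OF that])
        show "fr R P (\<iota> c) \<one> \<otimes>\<^bsub>loc R P\<^esub> fr R P (\<iota> d) \<one> = fr R P (\<iota> c \<otimes> \<iota> d) \<one>"
          "fr R P (\<iota> c) \<one> \<oplus>\<^bsub>loc R P\<^esub> fr R P (\<iota> d) \<one> = fr R P (\<iota> c \<oplus> \<iota> d) \<one>"
          using P.fr_mult[OF h(1) P.den_one h(2) P.den_one] P.fr_add[OF h(1) P.den_one h(2) P.den_one] h by simp_all
      qed
      then show "str SpR (c \<otimes>\<^bsub>base_ring k\<^esub> d) = str SpR c \<otimes>\<^bsub>sec SpR (primes R)\<^esub> str SpR d"
        "str SpR (c \<oplus>\<^bsub>base_ring k\<^esub> d) = str SpR c \<oplus>\<^bsub>sec SpR (primes R)\<^esub> str SpR d"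
        using ring_hom_mult[OF str_ring_hom cd] ring_hom_add[OF str_ring_hom cd] by (auto intro!: restrict_ext)
    next
      show "str SpR \<one>\<^bsub>base_ring k\<^esub> = \<one>\<^bsub>sec SpR (primes R)\<^esub>"
        using ring_hom_one[OF str_ring_hom] prime_loc.loc_one[OF pl] by (auto intro!: restrict_ext)
    qed
  qed
qed

sublocale S: rspace k SpR by (rule rspace_Spec)

text \<open>The bridge between prime ideals and \<open>unit_near\<close>. The fraction
  \<open>a / f\<close> describes \<open>s\<close> only at \<open>P\<close> itself, so for the
  converse direction it is traded for a fraction \<open>b / g\<close> valid on a neighbourhood,
  whose numerator is also outside \<open>P\<close>.\<close>

lemma unit_near_Spec_iff:
  assumes U: "openR U" and s: "s \<in> spec_sections R U" and P: "P \<in> U"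
    and a: "a \<in> carrier R" "f \<in> carrier R - P" "s P = fr R P a f"
  shows "unit_near SpR P U s \<longleftrightarrow> a \<notin> P"
proof
  interpret P: prime_loc R P by (rule open_ploc[OF U P])
  assume "unit_near SpR P U s"
  then obtain W where W: "openR W" "P \<in> W" "W \<subseteq> U" "restrict s W \<in> Units (sec SpR W)"
    unfolding unit_near_def by auto
  then obtain t where t: "t \<in> spec_sections R W" "restrict s W \<otimes>\<^bsub>sec SpR W\<^esub> t = \<one>\<^bsub>sec SpR W\<^esub>"
    by (auto simp: Units_def)
  have "s P \<otimes>\<^bsub>loc R P\<^esub> t P = \<one>\<^bsub>loc R P\<^esub>" using fun_cong[OF t(2), of P] W(2) by simp
  moreover obtain b g where b: "b \<in> carrier R" "g \<in> carrier R - P" "t P = fr R P b g"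
    by (rule P.loc_E[OF sections_loc[OF W(1) t(1) W(2)]])
  ultimately have "fr R P (a \<otimes> b) (f \<otimes> g) = fr R P \<one> \<one>"
    using P.fr_mult[OF a(1,2) b(1,2)] a(3) by (simp add: P.loc_one)
  then obtain h where h: "h \<in> carrier R - P" "h \<otimes> (a \<otimes> b \<otimes> \<one>) = h \<otimes> (\<one> \<otimes> (f \<otimes> g))"
    using P.fr_eq_iff[OF _ P.den_mult[OF a(2) b(2)] one_closed P.den_one, of "a \<otimes> b"] a b by auto
  have "h \<otimes> (f \<otimes> g) \<notin> P" using P.den_mult[OF h(1) P.den_mult[OF a(2) b(2)]] by simp
  then have "h \<otimes> (a \<otimes> b) \<notin> P" using h a b by simp
  then show "a \<notin> P" using P.I_l_closed P.I_r_closed h a b by (metis DiffD1 m_closed)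
next
  interpret P: prime_loc R P by (rule open_ploc[OF U P])
  assume aP: "a \<notin> P"
  obtain W b g where W: "P \<in> W" "W \<subseteq> U" "loc_rep R s W b g" by (rule loc_repE[OF s P])
  note r = loc_repD[OF W(3)]
  have "fr R P b g = fr R P a f" using r(5)[OF W(1)] a by simp
  then obtain h where h: "h \<in> carrier R - P" "h \<otimes> (b \<otimes> f) = h \<otimes> (a \<otimes> g)"
    using P.fr_eq_iff[OF r(2) r(4)[OF W(1)] a(1,2)] by auto
  have "h \<otimes> (a \<otimes> g) \<notin> P" using P.den_mult[OF h(1) P.den_mult[OF _ r(4)[OF W(1)]], of a] aP a by simp
  then have bP: "b \<notin> P" using h P.I_l_closed P.I_r_closed a r(2) by (metis DiffD1 m_closed)
  \<comment> \<open>\<open>b\<close> may vanish elsewhere in \<open>W\<close>; on the part where it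
    does not, \<open>g / b\<close> is the inverse.\<close>
  define V where "V = W \<inter> basic_open R b"
  have V: "openR V" unfolding V_def using r(1) openin_basic[OF is_cring r(2)] by (rule openin_Int)
  have PV: "P \<in> V" unfolding V_def using W(1) bP P.primeideal_axioms by simp
  have VU: "V \<subseteq> U" unfolding V_def using W(2) by auto
  have d: "b \<in> carrier R - Q" "g \<in> carrier R - Q" "s Q = fr R Q b g" if "Q \<in> V" for Q
    using that r(2) r(4)[of Q] r(5)[of Q] by (auto simp: V_def)
  define t where "t = (\<lambda>Q\<in>V. fr R Q g b)"
  have "loc_rep R t V g b"
    by (rule loc_repI) (use V r(2,3) d(1) in \<open>simp_all add: t_def\<close>)
  then have t: "t \<in> spec_sections R V"
    unfolding t_def by (intro sectionsI[OF restrict_extensional] exI conjI) (assumption | rule subset_refl)+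
  have "(\<lambda>Q\<in>V. restrict s V Q \<otimes>\<^bsub>loc R Q\<^esub> t Q) = (\<lambda>Q\<in>V. \<one>\<^bsub>loc R Q\<^esub>)"
  proof (rule restrict_ext)
    fix Q assume Q: "Q \<in> V"
    interpret Q: prime_loc R Q by (rule open_ploc[OF V Q])
    note d = d[OF Q]
    have c: "b \<otimes> g \<in> carrier R" "g \<otimes> b \<in> carrier R - Q" using r(2,3) Q.den_mult[OF d(2,1)] by simp_all
    have "s Q \<otimes>\<^bsub>loc R Q\<^esub> fr R Q g b = fr R Q (b \<otimes> g) (g \<otimes> b)"
      using Q.fr_mult[OF r(2) d(2) r(3) d(1)] d(3) by simp
    also have "\<dots> = \<one>\<^bsub>loc R Q\<^esub>" unfolding Q.loc_one
      by (rule Q.fr_eqI[OF c one_closed Q.den_one]) (use m_comm[OF r(2,3)] c in simp)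
    finally show "restrict s V Q \<otimes>\<^bsub>loc R Q\<^esub> t Q = \<one>\<^bsub>loc R Q\<^esub>" using Q by (simp add: t_def)
  qed
  then have e: "restrict s V \<otimes>\<^bsub>sec SpR V\<^esub> t = \<one>\<^bsub>sec SpR V\<^esub>" by (simp only: Spec_simps)
  have c: "restrict s V \<in> carrier (sec SpR V)" "t \<in> carrier (sec SpR V)"
    using sections_restrict[OF V VU s] t by (simp_all only: Spec_simps)
  have "restrict s V \<in> Units (sec SpR V)"
    unfolding Units_def using c e cring.cring_simprules(14)[OF sec_cring[OF V] c] by force
  then have "res SpR U V s \<in> Units (sec SpR V)" by (simp only: Spec_simps)
  then show "unit_near SpR P U s" unfolding unit_near_def using V PV VU by (intro exI[of _ V]) simp
qed

lemma local_at_Spec: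
  assumes P: "P \<in> primes R"
  shows "S.local_at P"
proof -
  interpret P: prime_loc R P using prime_locI[OF is_cring] P by simp
  have z: "\<zero> \<in> carrier R" by (rule ring.ring_simprules(2)[OF ring_axioms])
  show ?thesis unfolding S.local_at_def
  proof (intro allI impI conjI ballI)
    fix U assume "openin (topol SpR) U \<and> P \<in> U"
    then have U: "openR U" "P \<in> U" by auto
    show "\<one>\<^bsub>sec SpR U\<^esub> \<noteq> \<zero>\<^bsub>sec SpR U\<^esub>"
    proof
      assume "\<one>\<^bsub>sec SpR U\<^esub> = \<zero>\<^bsub>sec SpR U\<^esub>"
      from fun_cong[OF this, of P] have "fr R P \<one> \<one> = fr R P \<zero> \<one>" using U by (simp add: P.loc_one P.loc_zero)
      then obtain h where "h \<in> carrier R - P" "h \<otimes> (\<one> \<otimes> \<one>) = h \<otimes> (\<zero> \<otimes> \<one>)"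
        using P.fr_eq_iff[OF one_closed P.den_one z P.den_one] by auto
      then show False using P.zero_closed by simp
    qed
    fix s t assume st: "s \<in> carrier (sec SpR U)" "t \<in> carrier (sec SpR U)" "s \<oplus>\<^bsub>sec SpR U\<^esub> t = \<one>\<^bsub>sec SpR U\<^esub>"
    have st': "s \<in> spec_sections R U" "t \<in> spec_sections R U" using st by simp_all
    have e: "s P \<oplus>\<^bsub>loc R P\<^esub> t P = \<one>\<^bsub>loc R P\<^esub>" using fun_cong[OF st(3), of P] U by simp
    obtain a f where a: "a \<in> carrier R" "f \<in> carrier R - P" "s P = fr R P a f"
      by (rule P.loc_E[OF sections_loc[OF U(1) st'(1) U(2)]])
    obtain b g where b: "b \<in> carrier R" "g \<in> carrier R - P" "t P = fr R P b g"
      by (rule P.loc_E[OF sections_loc[OF U(1) st'(2) U(2)]])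
    have c: "a \<otimes> g \<oplus> b \<otimes> f \<in> carrier R" using a b by auto
    have "fr R P (a \<otimes> g \<oplus> b \<otimes> f) (f \<otimes> g) = fr R P \<one> \<one>"
      using e P.fr_add[OF a(1,2) b(1,2)] by (simp add: a(3) b(3) P.loc_one)
    then obtain h where h: "h \<in> carrier R - P" "h \<otimes> ((a \<otimes> g \<oplus> b \<otimes> f) \<otimes> \<one>) = h \<otimes> (\<one> \<otimes> (f \<otimes> g))"
      using P.fr_eq_iff[OF c P.den_mult[OF a(2) b(2)] one_closed P.den_one] by auto
    have "h \<otimes> (f \<otimes> g) \<notin> P" using P.den_mult[OF h(1) P.den_mult[OF a(2) b(2)]] by simp
    then have "h \<otimes> (a \<otimes> g \<oplus> b \<otimes> f) \<notin> P" using h a b c by simp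
    then have "\<not> (a \<in> P \<and> b \<in> P)"
      using P.I_l_closed P.I_r_closed P.a_closed h a b by (metis DiffD1)
    then show "unit_near SpR P U s \<or> unit_near SpR P U t"
      using unit_near_Spec_iff[OF U(1) st'(1) U(2) a] unit_near_Spec_iff[OF U(1) st'(2) U(2) b] by simp
  qed
qed

lemma locally_ringed_Spec: "locally_ringed_space k SpR"
  unfolding locally_ringed_iff using rspace_Spec local_at_Spec pts_Spec by (auto simp: rspace_def)

text \<open>The canonical homomorphism from \<open>R\<close> to the global sections. It is bijective
  for domains (\<open>glob_bij\<close>), and a morphism into the spectrum is determined by its
  effect on the image of this map (\<open>kmorphism_unique\<close>).\<close>

definition glob :: "'a \<Rightarrow> 'a set \<Rightarrow> ('a \<times> 'a) set"
  where "glob b = (\<lambda>P\<in>primes R. fr R P b \<one>)"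

lemma open_primes_all: "openR (primes R)"
  using S.pts_open pts_Spec by (metis Spec_simps(1))

lemma glob_hom: "glob \<in> ring_hom R (sec SpR (primes R))"
proof (rule ring_hom_memI)
  have pl: "prime_loc R P" if "P \<in> primes R" for P using open_ploc[OF open_primes_all that] .
  show "glob b \<in> carrier (sec SpR (primes R))" if "b \<in> carrier R" for b
    using sections_const[OF open_primes_all that] by (simp add: glob_def)
  show "glob \<one> = \<one>\<^bsub>sec SpR (primes R)\<^esub>"
    using prime_loc.loc_one[OF pl] by (auto simp: glob_def intro!: restrict_ext)
  fix c d assume h: "c \<in> carrier R" "d \<in> carrier R"
  have "fr R P c \<one> \<otimes>\<^bsub>loc R P\<^esub> fr R P d \<one> = fr R P (c \<otimes> d) \<one>"
    "fr R P c \<one> \<oplus>\<^bsub>loc R P\<^esub> fr R P d \<one> = fr R P (c \<oplus> d) \<one>" if "P \<in> primes R" for P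
  proof -
    interpret P: prime_loc R P by (rule pl[OF that])
    show "fr R P c \<one> \<otimes>\<^bsub>loc R P\<^esub> fr R P d \<one> = fr R P (c \<otimes> d) \<one>"
      "fr R P c \<one> \<oplus>\<^bsub>loc R P\<^esub> fr R P d \<one> = fr R P (c \<oplus> d) \<one>"
      using P.fr_mult[OF h(1) P.den_one h(2) P.den_one] P.fr_add[OF h(1) P.den_one h(2) P.den_one] h by simp_all
  qed
  then show "glob (c \<otimes> d) = glob c \<otimes>\<^bsub>sec SpR (primes R)\<^esub> glob d" "glob (c \<oplus> d) = glob c \<oplus>\<^bsub>sec SpR (primes R)\<^esub> glob d"
    by (auto simp: glob_def intro!: restrict_ext)
qed

lemma str_glob: "str SpR c = glob (\<iota> c)"
  by (simp add: glob_def)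

text \<open>On a domain the numerators and denominators of a section can be compared at the generic point.\<close>

lemma glob_bij:
  assumes "domain R"
  shows "bij_betw glob (carrier R) (carrier (sec SpR (primes R)))"
proof -
  interpret D: domain R by fact
  let ?O = "{\<zero>}"
  have "primeideal ?O R" by (rule D.zeroprimeideal)
  then interpret O: prime_loc R ?O by (rule prime_locI[OF is_cring])
  have Oeq: "fr R ?O a f = fr R ?O b g \<longleftrightarrow> a \<otimes> g = b \<otimes> f"
    if "a \<in> carrier R" "b \<in> carrier R" "f \<in> carrier R - ?O" "g \<in> carrier R - ?O" for a b f g
    using O.fr_eq_iff[of a f b g] that D.m_lcancel by (metis DiffD1 DiffD2 O.fr_eqI insertI1 m_closed singletonD)
  have Op: "?O \<in> primes R" using O.primeideal_axioms by simp
  have z: "\<zero> \<in> carrier R" by (rule ring.ring_simprules(2)[OF ring_axioms])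
  have Oin: "?O \<in> W" if W: "openR W" "P \<in> W" for P W
  proof -
    obtain f where f: "f \<in> carrier R" "P \<in> basic_open R f" "basic_open R f \<subseteq> W"
      using W unfolding openin_spec_iff[OF is_cring] by meson
    then interpret P: primeideal P R by simp
    have "f \<noteq> \<zero>" using f(2) P.zero_closed by auto
    then have "?O \<in> basic_open R f" using Op by simp
    then show ?thesis using f(3) by blast
  qed
  have "inj_on glob (carrier R)"
  proof (rule inj_onI)
    fix b c assume bc: "b \<in> carrier R" "c \<in> carrier R" "glob b = glob c"
    from fun_cong[OF bc(3), of ?O] have "fr R ?O b \<one> = fr R ?O c \<one>" using Op by (simp add: glob_def)
    then show "b = c" using Oeq[OF bc(1,2) O.den_one O.den_one] bc by simp
  qed
  moreover have "s \<in> glob ` carrier R" if "s \<in> carrier (sec SpR (primes R))" for s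
  proof -
    have s: "s \<in> spec_sections R (primes R)" using that by simp
    \<comment> \<open>The stalk at the zero ideal is the fraction field, so \<open>a0 / f0\<close>
      is the section seen as an element of that field; by \<open>gen\<close> it has, at every prime,
      a fraction representing the section there.\<close>
    obtain a0 f0 where a0: "a0 \<in> carrier R" "f0 \<in> carrier R - ?O" "s ?O = fr R ?O a0 f0"
      by (rule O.loc_E[OF sections_loc[OF open_primes_all s Op]])
    have gen: "\<exists>a f. a \<in> carrier R \<and> f \<in> carrier R - P \<and> s P = fr R P a f \<and> a \<otimes> f0 = a0 \<otimes> f"
      if P: "P \<in> primes R" for P
    proof -
      obtain W a f where W: "P \<in> W" "W \<subseteq> primes R" "loc_rep R s W a f" by (rule loc_repE[OF s P])
      note r = loc_repD[OF W(3)]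
      have OW: "?O \<in> W" by (rule Oin[OF r(1) W(1)])
      have "fr R ?O a f = fr R ?O a0 f0" using r(5)[OF OW] a0(3) by simp
      then have "a \<otimes> f0 = a0 \<otimes> f" using Oeq[OF r(2) a0(1) r(4)[OF OW] a0(2)] by simp
      then show ?thesis using r(2) r(4)[OF W(1)] r(5)[OF W(1)] by metis
    qed
    \<comment> \<open>The ideal of those \<open>r\<close> for which \<open>r\<close> times
      \<open>a0 / f0\<close> lies in \<open>R\<close>. For every maximal ideal it contains a
      denominator outside it, hence it contains 1, and then \<open>a0 / f0\<close> itself comes from
      \<open>R\<close>.\<close>
    define I where "I = {r \<in> carrier R. \<exists>b\<in>carrier R. r \<otimes> a0 = b \<otimes> f0}"
    have f0: "f0 \<in> carrier R" "f0 \<noteq> \<zero>" using a0 by auto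
    have I_I: "r \<in> I" if "r \<in> carrier R" "b \<in> carrier R" "r \<otimes> a0 = b \<otimes> f0" for r b
      using that unfolding I_def by (intro CollectI conjI bexI[of _ b])
    have I_E: "\<exists>b. b \<in> carrier R \<and> r \<otimes> a0 = b \<otimes> f0 \<and> r \<in> carrier R" if "r \<in> I" for r
      using that unfolding I_def by (elim CollectE conjE bexE) (intro exI conjI)
    have mult: "x \<otimes> y \<in> I" if y: "y \<in> I" and x: "x \<in> carrier R" for x y
    proof -
      obtain c where c: "c \<in> carrier R" "y \<otimes> a0 = c \<otimes> f0" "y \<in> carrier R" using I_E[OF y] by (elim exE conjE)
      have "(x \<otimes> y) \<otimes> a0 = (x \<otimes> c) \<otimes> f0" using c x a0(1) f0(1) by (simp add: m_assoc)
      then show ?thesis using c x by (intro I_I[of _ "x \<otimes> c"]) simp_all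
    qed
    have "ideal I R"
    proof (rule idealI)
      show "x \<otimes> y \<in> I" if "y \<in> I" "x \<in> carrier R" for x y using mult[OF that] .
      show "y \<otimes> x \<in> I" if "y \<in> I" "x \<in> carrier R" for x y
        using mult[OF that] m_comm[of x y] that(2) I_E[OF that(1)] by auto
      show "subgroup I (add_monoid R)"
      proof (rule subgroup.intro)
        show "I \<subseteq> carrier (add_monoid R)" unfolding I_def by auto
        show "\<one>\<^bsub>add_monoid R\<^esub> \<in> I" using a0(1) f0(1) z by (simp, intro I_I[of _ \<zero>]) simp_all
        show "x \<otimes>\<^bsub>add_monoid R\<^esub> y \<in> I" if x: "x \<in> I" and y: "y \<in> I" for x y
        proof -
          obtain b where b: "b \<in> carrier R" "x \<otimes> a0 = b \<otimes> f0" "x \<in> carrier R" using I_E[OF x] by (elim exE conjE)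
          obtain c where c: "c \<in> carrier R" "y \<otimes> a0 = c \<otimes> f0" "y \<in> carrier R" using I_E[OF y] by (elim exE conjE)
          have "(x \<oplus> y) \<otimes> a0 = (b \<oplus> c) \<otimes> f0" using b c a0(1) f0(1) by (simp add: l_distr)
          then have "x \<oplus> y \<in> I" using b(1,3) c(1,3) by (intro I_I[of _ "b \<oplus> c"]) simp_all
          then show ?thesis by simp
        qed
        show "inv\<^bsub>add_monoid R\<^esub> x \<in> I" if "x \<in> I" for x
        proof -
          have "x \<in> carrier R" using I_E[OF that] by auto
          then have "\<ominus> x = (\<ominus> \<one>) \<otimes> x" by (simp add: l_minus)
          moreover have "(\<ominus> \<one>) \<otimes> x \<in> I" by (rule mult[OF that]) simp
          ultimately show ?thesis unfolding a_inv_def by metis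
        qed
      qed
    qed (rule ring_axioms)
    have "\<one> \<in> I"
    proof (rule ccontr)
      assume "\<one> \<notin> I"
      from exists_maximalideal[OF \<open>ideal I R\<close> this] obtain M where M: "maximalideal M R" "I \<subseteq> M" by blast
      have "primeideal M R" by (rule maximalideal_prime[OF M(1)])
      then obtain a f where a: "a \<in> carrier R" "f \<in> carrier R - M" "a \<otimes> f0 = a0 \<otimes> f" using gen[of M] by auto
      have "f \<in> I" using a a0(1) m_comm[of f a0] by (intro I_I[of _ a]) simp_all
      then show False using M(2) a(2) by auto
    qed
    from I_E[OF this] obtain b where b: "b \<in> carrier R" "a0 = b \<otimes> f0" using a0(1) by auto
    have "s = glob b"
    proof (rule sections_ext[OF s])
      show "glob b \<in> spec_sections R (primes R)" using sections_const[OF open_primes_all b(1)] by (simp add: glob_def)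
      fix P assume P: "P \<in> primes R"
      then obtain a f where a: "a \<in> carrier R" "f \<in> carrier R - P" "s P = fr R P a f" "a \<otimes> f0 = a0 \<otimes> f" using gen by blast
      interpret P: prime_loc R P by (rule open_ploc[OF open_primes_all P])
      have "f0 \<otimes> a = f0 \<otimes> (b \<otimes> f)" using a b f0 by (simp add: m_ac)
      moreover have "b \<otimes> f \<in> carrier R" using b(1) a(2) by simp
      ultimately have "a = b \<otimes> f" using D.m_lcancel[OF f0(2,1) a(1)] by blast
      then have "fr R P a f = fr R P b \<one>" by (intro P.fr_eqI) (use a b P.den_one in auto)
      then show "s P = glob b P" using a(3) P by (simp add: glob_def)
    qed
    then show ?thesis using b(1) by blast
  qed
  ultimately show ?thesis unfolding bij_betw_def using ring_hom_closed[OF glob_hom] by blast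
qed

end

section \<open>Morphisms from a locally ringed space to a spectrum\<close>

text \<open>The universal property of the spectrum: a homomorphism \<open>\<theta>\<close> of
  algebras into the global sections of a locally ringed space \<open>Q\<close> comes from a morphism
  (\<open>kmorphism_F\<close>), unique up to \<open>kmap_eq\<close>
  (\<open>kmorphism_unique\<close>).\<close>

locale spec_map = kalg R k \<iota> + Q: rspace k Q
  for R :: "'a ring" (structure) and k :: "'k::field set" and \<iota> and Q :: "('k, 'p, 's) kspace" +
  fixes \<theta> :: "'a \<Rightarrow> 's"
  assumes Q_local: "\<And>x. x \<in> pts Q \<Longrightarrow> Q.local_at x"
    and \<theta>_hom: "\<theta> \<in> ring_hom R (sec Q (pts Q))"
    and \<theta>_str: "\<And>c. c \<in> k \<Longrightarrow> \<theta> (\<iota> c) = str Q c"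
begin

abbreviation "openQ \<equiv> openin (topol Q)"

text \<open>The preimage of the maximal ideal of the stalk at \<open>x\<close>: the elements of
  \<open>R\<close> whose germs are not units.\<close>

definition pt :: "'p \<Rightarrow> 'a set"
  where "pt x = {b \<in> carrier R. \<not> unit_near Q x (pts Q) (\<theta> b)}"

text \<open>The locus where \<open>b\<close> does not vanish, open in \<open>Q\<close>. It is the
  preimage under \<open>pt\<close> of the basic open set of \<open>b\<close>, which gives
  continuity.\<close>

definition E :: "'a \<Rightarrow> 'p set"
  where "E b = {x \<in> pts Q. unit_near Q x (pts Q) (\<theta> b)}"

definition tr :: "'p set \<Rightarrow> 'a \<Rightarrow> 's"
  where "tr W b = res Q (pts Q) W (\<theta> b)"

abbreviation pre :: "'a set set \<Rightarrow> 'p set"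
  where "pre U \<equiv> preimg Q pt U"

lemma openQ_sub: "openQ W \<Longrightarrow> W \<subseteq> pts Q"
  by (rule openin_subset)

lemma tr_hom: "openQ W \<Longrightarrow> tr W \<in> ring_hom R (sec Q W)"
  using ring_hom_trans[OF \<theta>_hom Q.res_hom[OF Q.pts_open _ openQ_sub]] by (simp add: comp_def tr_def[abs_def])

lemmas tr_closed = ring_hom_closed[OF tr_hom]
lemmas tr_mult = ring_hom_mult[OF tr_hom]
lemmas tr_add = ring_hom_add[OF tr_hom]
lemmas tr_one = ring_hom_one[OF tr_hom]
lemmas \<theta>_closed = ring_hom_closed[OF \<theta>_hom]

lemma res_tr:
  assumes "openQ W" "openQ V" "V \<subseteq> W" "b \<in> carrier R"
  shows "res Q W V (tr W b) = tr V b"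
  unfolding tr_def using Q.res_res[OF Q.pts_open assms(1,2,3) openQ_sub[OF assms(1)] \<theta>_closed[OF assms(4)]] .

lemma openQ_E:
  assumes "b \<in> carrier R"
  shows "openQ (E b)"
proof (subst openin_subopen, rule ballI)
  fix x assume "x \<in> E b"
  then obtain W where W: "openQ W" "x \<in> W" "W \<subseteq> pts Q" "res Q (pts Q) W (\<theta> b) \<in> Units (sec Q W)"
    unfolding E_def unit_near_def by blast
  then have "W \<subseteq> E b" unfolding E_def unit_near_def by blast
  then show "\<exists>T. openQ T \<and> x \<in> T \<and> T \<subseteq> E b" using W by blast
qed

lemma pt_iff: "\<lbrakk>x \<in> pts Q; b \<in> carrier R\<rbrakk> \<Longrightarrow> b \<in> carrier R - pt x \<longleftrightarrow> x \<in> E b"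
  by (simp add: pt_def E_def)

lemma pt_prime:
  assumes x: "x \<in> pts Q"
  shows "primeideal (pt x) R"
proof -
  interpret P: cring "sec Q (pts Q)" by (rule Q.sec_cring[OF Q.pts_open])
  note lx = Q_local[OF x, unfolded Q.local_at_def, rule_format, OF conjI[OF Q.pts_open x]]
  have mult: "unit_near Q x (pts Q) (\<theta> (a \<otimes> b)) \<longleftrightarrow> unit_near Q x (pts Q) (\<theta> a) \<and> unit_near Q x (pts Q) (\<theta> b)"
    if "a \<in> carrier R" "b \<in> carrier R" for a b
    using Q.unit_near_mult[OF Q.pts_open x] ring_hom_mult[OF \<theta>_hom that] \<theta>_closed that by simp
  have one: "unit_near Q x (pts Q) (\<theta> \<one>)"
    using Q.unit_near_Units[OF Q.pts_open x P.Units_one_closed] ring_hom_one[OF \<theta>_hom] by simp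
  \<comment> \<open>Dividing by \<open>\<theta> (a \<oplus> b)\<close> on a neighbourhood where it
    is a unit gives two sections with sum 1; locality at \<open>x\<close> makes one of them a unit
    near \<open>x\<close>.\<close>
  have add: "unit_near Q x (pts Q) (\<theta> a) \<or> unit_near Q x (pts Q) (\<theta> b)"
    if ab: "a \<in> carrier R" "b \<in> carrier R" and u: "unit_near Q x (pts Q) (\<theta> (a \<oplus> b))" for a b
  proof -
    obtain W where W: "openQ W" "x \<in> W" "W \<subseteq> pts Q" "res Q (pts Q) W (\<theta> (a \<oplus> b)) \<in> Units (sec Q W)"
      using u unfolding unit_near_def by blast
    interpret W: cring "sec Q W" by (rule Q.sec_cring[OF W(1)])
    let ?v = "inv\<^bsub>sec Q W\<^esub> (tr W (a \<oplus> b))"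
    have uv: "tr W (a \<oplus> b) \<in> Units (sec Q W)" using W(4) by (simp add: tr_def)
    note cl = tr_closed[OF W(1) ab(1)] tr_closed[OF W(1) ab(2)] W.Units_inv_closed[OF uv]
    have "?v \<otimes>\<^bsub>sec Q W\<^esub> tr W a \<oplus>\<^bsub>sec Q W\<^esub> ?v \<otimes>\<^bsub>sec Q W\<^esub> tr W b = ?v \<otimes>\<^bsub>sec Q W\<^esub> tr W (a \<oplus> b)"
      using cl tr_add[OF W(1) ab] by (simp add: W.r_distr)
    also have "\<dots> = \<one>\<^bsub>sec Q W\<^esub>" by (rule W.Units_l_inv[OF uv])
    finally have "unit_near Q x W (?v \<otimes>\<^bsub>sec Q W\<^esub> tr W a) \<or> unit_near Q x W (?v \<otimes>\<^bsub>sec Q W\<^esub> tr W b)"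
      using Q_local[OF x, unfolded Q.local_at_def, rule_format, OF conjI[OF W(1,2)]] cl by simp
    then have "unit_near Q x W (tr W a) \<or> unit_near Q x W (tr W b)"
      using Q.unit_near_mult[OF W(1,2)] cl by blast
    then show ?thesis
      unfolding tr_def using Q.unit_near_res[OF Q.pts_open W(1,3,2)] \<theta>_closed ab by blast
  qed
  have zero: "\<not> unit_near Q x (pts Q) (\<theta> \<zero>)"
  proof
    assume "unit_near Q x (pts Q) (\<theta> \<zero>)"
    then obtain W where W: "openQ W" "x \<in> W" "W \<subseteq> pts Q" "res Q (pts Q) W (\<theta> \<zero>) \<in> Units (sec Q W)"
      unfolding unit_near_def by blast
    interpret W: cring "sec Q W" by (rule Q.sec_cring[OF W(1)])
    have "tr W \<zero> = \<zero>\<^bsub>sec Q W\<^esub>" by (rule ring_hom_zero[OF tr_hom[OF W(1)] ring_axioms W.ring_axioms])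
    then have "\<zero>\<^bsub>sec Q W\<^esub> \<in> Units (sec Q W)" using W(4) by (simp add: tr_def)
    then have "\<one>\<^bsub>sec Q W\<^esub> = \<zero>\<^bsub>sec Q W\<^esub>" using W.Units_l_inv W.r_null W.Units_inv_closed by metis
    then show False using Q_local[OF x, unfolded Q.local_at_def, rule_format, OF conjI[OF W(1,2)]] by simp
  qed
  show ?thesis
  proof (rule primeidealI)
    have l: "r \<otimes> a \<in> pt x" if "a \<in> pt x" "r \<in> carrier R" for a r
      using that mult[of r a] by (simp add: pt_def)
    show "ideal (pt x) R"
    proof (rule idealI)
      show "subgroup (pt x) (add_monoid R)"
      proof (rule subgroup.intro)
        show "pt x \<subseteq> carrier (add_monoid R)" by (auto simp: pt_def)
        show "a \<otimes>\<^bsub>add_monoid R\<^esub> b \<in> pt x" if "a \<in> pt x" "b \<in> pt x" for a b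
          using that add[of a b] by (auto simp: pt_def)
        show "\<one>\<^bsub>add_monoid R\<^esub> \<in> pt x" using zero by (simp add: pt_def)
        show "inv\<^bsub>add_monoid R\<^esub> a \<in> pt x" if "a \<in> pt x" for a
        proof -
          have "a \<in> carrier R" using that by (simp add: pt_def)
          then have "\<ominus> a = (\<ominus> \<one>) \<otimes> a" by (simp add: l_minus)
          moreover have "(\<ominus> \<one>) \<otimes> a \<in> pt x" by (rule l[OF that]) simp
          ultimately show ?thesis unfolding a_inv_def by metis
        qed
      qed
      show "r \<otimes> a \<in> pt x" if "a \<in> pt x" "r \<in> carrier R" for a r using l[OF that] .
      show "a \<otimes> r \<in> pt x" if "a \<in> pt x" "r \<in> carrier R" for a r
        using l[OF that] that m_comm[of r a] by (simp add: pt_def)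
    qed (rule ring_axioms)
    show "carrier R \<noteq> pt x" using one one_closed unfolding pt_def by blast
    show "a \<in> pt x \<or> b \<in> pt x" if "a \<in> carrier R" "b \<in> carrier R" "a \<otimes> b \<in> pt x" for a b
      using that mult[of a b] by (simp add: pt_def)
  qed (rule is_cring)
qed

lemma pt_ploc: "x \<in> pts Q \<Longrightarrow> prime_loc R (pt x)"
  by (rule prime_locI[OF is_cring pt_prime])

lemma pt_cont: "continuous_map (topol Q) (spec_topology R) pt"
proof -
  have "openQ {x \<in> pts Q. pt x \<in> U}" if U: "openR U" for U
  proof (subst openin_subopen, rule ballI)
    fix x assume "x \<in> {x \<in> pts Q. pt x \<in> U}"
    then have x: "x \<in> pts Q" "pt x \<in> U" by auto
    obtain f where f: "f \<in> carrier R" "pt x \<in> basic_open R f" "basic_open R f \<subseteq> U"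
      using bspec[OF U[unfolded openin_spec_iff[OF is_cring]] x(2)] by (elim bexE conjE)
    have "x \<in> E f" using f(1,2) x pt_iff[OF x(1) f(1)] by auto
    moreover have "E f \<subseteq> {x \<in> pts Q. pt x \<in> U}"
    proof
      fix y assume y: "y \<in> E f"
      then have yp: "y \<in> pts Q" by (simp add: E_def)
      have "pt y \<in> basic_open R f" using pt_iff[OF yp f(1)] y pt_prime[OF yp] by auto
      then show "y \<in> {x \<in> pts Q. pt x \<in> U}" using f(3) yp by blast
    qed
    ultimately show "\<exists>T. openQ T \<and> x \<in> T \<and> T \<subseteq> {x \<in> pts Q. pt x \<in> U}" using openQ_E[OF f(1)] by blast
  qed
  then show ?thesis unfolding continuous_map_def topspace_spec[OF is_cring] using pt_prime by auto
qed

lemma pre_open: "openR U \<Longrightarrow> openQ (pre U)"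
  using preimg_open[OF _ , of Q SpR pt U] pt_cont by simp

lemma pre_primes: "pre (primes R) = pts Q"
  using preimg_pts[of Q SpR pt] pt_cont pts_Spec by simp

lemma tr_Units:
  assumes W: "openQ W" and b: "b \<in> carrier R" and g: "\<And>z. z \<in> W \<Longrightarrow> b \<in> carrier R - pt z"
  shows "tr W b \<in> Units (sec Q W)"
proof (rule Q.Units_glue[OF W tr_closed[OF W b]])
  fix x assume x: "x \<in> W"
  then have "x \<in> E b" using pt_iff[OF _ b, of x] g[OF x] openQ_sub[OF W] by blast
  then show "unit_near Q x W (tr W b)"
    unfolding tr_def using Q.unit_near_res[OF Q.pts_open W openQ_sub[OF W] x \<theta>_closed[OF b]] by (simp add: E_def)
qed

text \<open>The fraction \<open>a / g\<close> describes \<open>s\<close> along \<open>pt\<close> on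
  \<open>W\<close>. The set \<open>W\<close> is an arbitrary open subset of \<open>Q\<close>, not a
  preimage of a set of primes, which leaves room to shrink it inside \<open>Q\<close> as in
  \<open>good_compat\<close>.\<close>

definition good :: "'p set \<Rightarrow> ('a set \<Rightarrow> ('a \<times> 'a) set) \<Rightarrow> 'a \<Rightarrow> 'a \<Rightarrow> bool"
  where "good W s a g \<longleftrightarrow> openQ W \<and> a \<in> carrier R \<and> g \<in> carrier R \<and>
    (\<forall>z\<in>W. g \<in> carrier R - pt z \<and> s (pt z) = fr R (pt z) a g)"

lemma goodD:
  assumes "good W s a g"
  shows "openQ W" "a \<in> carrier R" "g \<in> carrier R" "\<And>z. z \<in> W \<Longrightarrow> g \<in> carrier R - pt z"
    "\<And>z. z \<in> W \<Longrightarrow> s (pt z) = fr R (pt z) a g" "tr W g \<in> Units (sec Q W)"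
  using assms tr_Units[of W g] unfolding good_def by auto

lemma good_subset: "\<lbrakk>good W s a g; openQ V; V \<subseteq> W\<rbrakk> \<Longrightarrow> good V s a g"
  unfolding good_def by blast

text \<open>Two fractions for \<open>s\<close> agree at \<open>pt x\<close> up to a factor
  \<open>u\<close> outside this prime. On a neighbourhood of \<open>x\<close> the images of
  \<open>u\<close> and \<open>g\<close> are units and can be cancelled, so the equation holds
  locally and hence on \<open>W\<close>.\<close>

lemma good_compat:
  assumes ag: "good W s a g" and bh: "good W s b h" and t: "t \<in> carrier (sec Q W)"
    and eq: "t \<otimes>\<^bsub>sec Q W\<^esub> tr W g = tr W a"
  shows "t \<otimes>\<^bsub>sec Q W\<^esub> tr W h = tr W b"
proof -
  note a = goodD[OF ag] and b = goodD[OF bh]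
  note W = a(1)
  interpret W: cring "sec Q W" by (rule Q.sec_cring[OF W])
  show ?thesis
  proof (rule Q.sec_eqI[OF W])
    fix x assume x: "x \<in> W"
    have xp: "x \<in> pts Q" using openQ_sub[OF W] x by blast
    interpret P: prime_loc R "pt x" by (rule pt_ploc[OF xp])
    have "fr R (pt x) a g = fr R (pt x) b h" using a(5)[OF x] b(5)[OF x] by simp
    then obtain u where u: "u \<in> carrier R - pt x" "u \<otimes> (a \<otimes> h) = u \<otimes> (b \<otimes> g)"
      using P.fr_eq_iff[OF a(2) a(4)[OF x] b(2) b(4)[OF x]] by blast
    have uR: "u \<in> carrier R" using u(1) by simp
    define V where "V = W \<inter> E u"
    have V: "openQ V" "V \<subseteq> W" "x \<in> V"
      unfolding V_def using W openQ_E[OF uR] x pt_iff[OF xp uR] u(1) by auto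
    interpret V: cring "sec Q V" by (rule Q.sec_cring[OF V(1)])
    have "u \<in> carrier R - pt z" if z: "z \<in> V" for z
    proof -
      have "z \<in> pts Q" using openQ_sub[OF V(1)] z by blast
      then show ?thesis using pt_iff[OF _ uR] z by (simp add: V_def)
    qed
    then have uu: "tr V u \<in> Units (sec Q V)" by (rule tr_Units[OF V(1) uR])
    have gu: "tr V g \<in> Units (sec Q V)" by (rule goodD(6)[OF good_subset[OF ag V(1,2)]])
    let ?t = "res Q W V t"
    note cl = Q.res_closed[OF W V(1,2) t] tr_closed[OF V(1) uR] tr_closed[OF V(1) a(2)] tr_closed[OF V(1) a(3)]
      tr_closed[OF V(1) b(2)] tr_closed[OF V(1) b(3)]
    have e1: "?t \<otimes>\<^bsub>sec Q V\<^esub> tr V g = tr V a"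
      using Q.res_mult[OF W V(1,2) t tr_closed[OF W a(3)]] res_tr[OF W V(1,2)] a(2,3) eq by simp
    have e2: "tr V u \<otimes>\<^bsub>sec Q V\<^esub> (tr V a \<otimes>\<^bsub>sec Q V\<^esub> tr V h) = tr V u \<otimes>\<^bsub>sec Q V\<^esub> (tr V b \<otimes>\<^bsub>sec Q V\<^esub> tr V g)"
      using arg_cong[OF u(2), of "tr V"] uR a(2,3) b(2,3) by (simp add: tr_mult[OF V(1)])
    have "(tr V u \<otimes>\<^bsub>sec Q V\<^esub> tr V g) \<otimes>\<^bsub>sec Q V\<^esub> (?t \<otimes>\<^bsub>sec Q V\<^esub> tr V h) =
        tr V u \<otimes>\<^bsub>sec Q V\<^esub> ((?t \<otimes>\<^bsub>sec Q V\<^esub> tr V g) \<otimes>\<^bsub>sec Q V\<^esub> tr V h)"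
      using cl by (simp add: V.m_ac)
    also have "\<dots> = (tr V u \<otimes>\<^bsub>sec Q V\<^esub> tr V g) \<otimes>\<^bsub>sec Q V\<^esub> tr V b"
      unfolding e1 e2 using cl by (simp add: V.m_ac)
    finally have "?t \<otimes>\<^bsub>sec Q V\<^esub> tr V h = tr V b"
      using V.Units_l_cancel[OF V.Units_m_closed[OF uu gu] V.m_closed[OF cl(1,6)] cl(5)] by blast
    then have "res Q W V (t \<otimes>\<^bsub>sec Q W\<^esub> tr W h) = res Q W V (tr W b)"
      using Q.res_mult[OF W V(1,2) t tr_closed[OF W b(3)]] res_tr[OF W V(1,2)] b(2,3) by simp
    then show "\<exists>V. openQ V \<and> x \<in> V \<and> V \<subseteq> W \<and> res Q W V (t \<otimes>\<^bsub>sec Q W\<^esub> tr W h) = res Q W V (tr W b)"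
      using V by blast
  qed (use t tr_closed[OF W] b(2,3) in auto)
qed

text \<open>\<open>t\<close> is the pullback of \<open>s\<close>: locally, \<open>t\<close> times
  the denominator is the numerator. As the relation determines \<open>t\<close>
  (\<open>rel_unique\<close>), properties of the pullback \<open>F\<close> reduce to exhibiting a
  suitable \<open>t\<close>; \<open>rel_op\<close>, \<open>rel_const\<close> and
  \<open>rel_restrict\<close> yield the homomorphism and restriction laws.\<close>

definition rel :: "'a set set \<Rightarrow> ('a set \<Rightarrow> ('a \<times> 'a) set) \<Rightarrow> 's \<Rightarrow> bool"
  where "rel U s t \<longleftrightarrow> t \<in> carrier (sec Q (pre U)) \<and>
    (\<forall>x\<in>pre U. \<exists>W a g. x \<in> W \<and> W \<subseteq> pre U \<and> good W s a g \<and>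
      res Q (pre U) W t \<otimes>\<^bsub>sec Q W\<^esub> tr W g = tr W a)"

lemma relE:
  assumes "rel U s t" "x \<in> pre U"
  obtains W a g where "x \<in> W" "W \<subseteq> pre U" "good W s a g"
    "res Q (pre U) W t \<otimes>\<^bsub>sec Q W\<^esub> tr W g = tr W a"
  using assms unfolding rel_def by blast

lemma rel_closed: "rel U s t \<Longrightarrow> t \<in> carrier (sec Q (pre U))"
  unfolding rel_def by blast

lemma relI:
  assumes "t \<in> carrier (sec Q (pre U))"
    and "\<And>x. x \<in> pre U \<Longrightarrow> \<exists>W a g. x \<in> W \<and> W \<subseteq> pre U \<and> good W s a g \<and>
      res Q (pre U) W t \<otimes>\<^bsub>sec Q W\<^esub> tr W g = tr W a"
  shows "rel U s t"
  using assms unfolding rel_def by blast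

lemma rel_subset_eq:
  assumes U: "openR U" and t: "t \<in> carrier (sec Q (pre U))" and W: "W \<subseteq> pre U" "openQ W" and V: "openQ V" "V \<subseteq> W"
    and ab: "a \<in> carrier R" "g \<in> carrier R"
    and e: "res Q (pre U) W t \<otimes>\<^bsub>sec Q W\<^esub> tr W g = tr W a"
  shows "res Q (pre U) V t \<otimes>\<^bsub>sec Q V\<^esub> tr V g = tr V a"
proof -
  have "res Q W V (res Q (pre U) W t \<otimes>\<^bsub>sec Q W\<^esub> tr W g) = res Q W V (tr W a)" using e by simp
  then show ?thesis
    using Q.res_mult[OF W(2) V Q.res_closed[OF pre_open[OF U] W(2,1) t] tr_closed[OF W(2) ab(2)]]
      res_tr[OF W(2) V] ab Q.res_res[OF pre_open[OF U] W(2) V(1,2) W(1) t] by simp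
qed

text \<open>\<open>rel\<close> provides some fraction near each point; by \<open>good_compat\<close>
  the equation then holds for every fraction describing \<open>s\<close>, which is what uniqueness
  requires.\<close>

lemma rel_strong:
  assumes U: "openR U" and r: "rel U s t" and bh: "good W s b h" and W: "W \<subseteq> pre U"
  shows "res Q (pre U) W t \<otimes>\<^bsub>sec Q W\<^esub> tr W h = tr W b"
proof -
  note b = goodD[OF bh] and t = rel_closed[OF r]
  interpret W: cring "sec Q W" by (rule Q.sec_cring[OF b(1)])
  note cW = Q.res_closed[OF pre_open[OF U] b(1) W t]
  show ?thesis
  proof (rule Q.sec_eqI[OF b(1)])
    fix x assume x: "x \<in> W"
    then have "x \<in> pre U" using W by blast
    then obtain W' a g where W': "x \<in> W'" "W' \<subseteq> pre U" "good W' s a g"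
      "res Q (pre U) W' t \<otimes>\<^bsub>sec Q W'\<^esub> tr W' g = tr W' a" by (rule relE[OF r])
    note a = goodD[OF W'(3)]
    let ?V = "W \<inter> W'"
    have V: "openQ ?V" "?V \<subseteq> W" "?V \<subseteq> W'" "x \<in> ?V" "?V \<subseteq> pre U" using b(1) a(1) x W'(1) W by auto
    have "res Q (pre U) ?V t \<otimes>\<^bsub>sec Q ?V\<^esub> tr ?V h = tr ?V b"
    proof (rule good_compat[OF good_subset[OF W'(3) V(1,3)] good_subset[OF bh V(1,2)]])
      show "res Q (pre U) ?V t \<in> carrier (sec Q ?V)" by (rule Q.res_closed[OF pre_open[OF U] V(1,5) t])
      show "res Q (pre U) ?V t \<otimes>\<^bsub>sec Q ?V\<^esub> tr ?V g = tr ?V a"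
        by (rule rel_subset_eq[OF U t W'(2) a(1) V(1,3) a(2,3) W'(4)])
    qed
    then have "res Q W ?V (res Q (pre U) W t \<otimes>\<^bsub>sec Q W\<^esub> tr W h) = res Q W ?V (tr W b)"
      using Q.res_mult[OF b(1) V(1,2) cW tr_closed[OF b(1,3)]] res_tr[OF b(1) V(1,2)] b(2,3)
        Q.res_res[OF pre_open[OF U] b(1) V(1,2) W t] by simp
    then show "\<exists>V. openQ V \<and> x \<in> V \<and> V \<subseteq> W \<and>
      res Q W V (res Q (pre U) W t \<otimes>\<^bsub>sec Q W\<^esub> tr W h) = res Q W V (tr W b)" using V by blast
  qed (use cW tr_closed[OF b(1)] b(2,3) in auto)
qed

lemma rel_unique:
  assumes U: "openR U" and r: "rel U s t" "rel U s t'"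
  shows "t = t'"
proof (rule Q.sec_eqI[OF pre_open[OF U] rel_closed[OF r(1)] rel_closed[OF r(2)]])
  fix x assume "x \<in> pre U"
  then obtain W a g where W: "x \<in> W" "W \<subseteq> pre U" "good W s a g"
    "res Q (pre U) W t \<otimes>\<^bsub>sec Q W\<^esub> tr W g = tr W a" by (rule relE[OF r(1)])
  note a = goodD[OF W(3)]
  interpret W: cring "sec Q W" by (rule Q.sec_cring[OF a(1)])
  note c = Q.res_closed[OF pre_open[OF U] a(1) W(2) rel_closed[OF r(1)]]
    Q.res_closed[OF pre_open[OF U] a(1) W(2) rel_closed[OF r(2)]] W.Units_closed[OF a(6)]
  have "tr W g \<otimes>\<^bsub>sec Q W\<^esub> res Q (pre U) W t = tr W g \<otimes>\<^bsub>sec Q W\<^esub> res Q (pre U) W t'"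
    using rel_strong[OF U r(2) W(3,2)] W(4) W.m_comm[OF c(3,1)] W.m_comm[OF c(3,2)] by simp
  then have "res Q (pre U) W t = res Q (pre U) W t'" using W.Units_l_cancel[OF a(6) c(1,2)] by simp
  then show "\<exists>W. openQ W \<and> x \<in> W \<and> W \<subseteq> pre U \<and> res Q (pre U) W t = res Q (pre U) W t'"
    using W a(1) by blast
qed

lemma good_exists:
  assumes s: "s \<in> spec_sections R U" and x: "x \<in> pre U"
  obtains W0 a g where "pt x \<in> W0" "W0 \<subseteq> U" "loc_rep R s W0 a g" "x \<in> pre W0" "pre W0 \<subseteq> pre U" "good (pre W0) s a g"
proof -
  have "pt x \<in> U" using x by (simp add: preimg_iff)
  from loc_repE[OF s this] obtain W0 a g where W0: "pt x \<in> W0" "W0 \<subseteq> U" "loc_rep R s W0 a g" .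
  have "good (pre W0) s a g"
    unfolding good_def using pre_open[OF loc_repD(1)[OF W0(3)]] loc_repD(2-5)[OF W0(3)] by (auto simp: preimg_iff)
  moreover have "x \<in> pre W0" using W0(1) x by (simp add: preimg_iff)
  ultimately show ?thesis by (intro that[OF W0 _ preimg_mono[OF W0(2)]])
qed

lemma rel_exists:
  assumes U: "openR U" and s: "s \<in> spec_sections R U"
  shows "\<exists>t. rel U s t"
proof -
  define Pd where "Pd x W a g \<longleftrightarrow> x \<in> W \<and> W \<subseteq> pre U \<and> good W s a g" for x W a g
  have "\<exists>W a g. Pd x W a g" if x: "x \<in> pre U" for x
    unfolding Pd_def by (rule good_exists[OF s x]) (intro exI conjI)
  then have "\<forall>x. \<exists>W a g. x \<in> pre U \<longrightarrow> Pd x W a g" by blast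
  then obtain W where "\<forall>x. \<exists>a g. x \<in> pre U \<longrightarrow> Pd x (W x) a g" by metis
  then obtain a where "\<forall>x. \<exists>g. x \<in> pre U \<longrightarrow> Pd x (W x) (a x) g" by metis
  then obtain g where "\<forall>x. x \<in> pre U \<longrightarrow> Pd x (W x) (a x) (g x)" by metis
  then have W: "x \<in> W x" "W x \<subseteq> pre U" "good (W x) s (a x) (g x)" if "x \<in> pre U" for x
    using that unfolding Pd_def by auto
  \<comment> \<open>The local pullback is the numerator times the inverse of the denominator, a unit
    on \<open>W x\<close>. On an overlap two of them satisfy the same equation with a unit as
    factor, so they agree and glue.\<close>
  define v where "v x = tr (W x) (a x) \<otimes>\<^bsub>sec Q (W x)\<^esub> inv\<^bsub>sec Q (W x)\<^esub> (tr (W x) (g x))" for x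
  have v: "v x \<in> carrier (sec Q (W x))" "v x \<otimes>\<^bsub>sec Q (W x)\<^esub> tr (W x) (g x) = tr (W x) (a x)" if x: "x \<in> pre U" for x
  proof -
    note d = goodD[OF W(3)[OF x]]
    interpret Wx: cring "sec Q (W x)" by (rule Q.sec_cring[OF d(1)])
    note c = tr_closed[OF d(1,2)] Wx.Units_closed[OF d(6)] Wx.Units_inv_closed[OF d(6)]
    show "v x \<in> carrier (sec Q (W x))" unfolding v_def using c by simp
    show "v x \<otimes>\<^bsub>sec Q (W x)\<^esub> tr (W x) (g x) = tr (W x) (a x)"
      unfolding v_def using c Wx.Units_l_inv[OF d(6)] by (simp add: Wx.m_assoc)
  qed
  have "\<exists>t\<in>carrier (sec Q (pre U)). \<forall>x\<in>pre U. res Q (pre U) (W x) t = v x"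
  proof (rule Q.sec_glue)
    show "openQ (W x) \<and> x \<in> W x \<and> W x \<subseteq> pre U" if "x \<in> pre U" for x
      using W[OF that] goodD(1) by blast
    show "v x \<in> carrier (sec Q (W x))" if "x \<in> pre U" for x by (rule v(1)[OF that])
    fix x y assume x: "x \<in> pre U" and y: "y \<in> pre U"
    note dx = goodD[OF W(3)[OF x]] and dy = goodD[OF W(3)[OF y]]
    let ?V = "W x \<inter> W y"
    have V: "openQ ?V" "?V \<subseteq> W x" "?V \<subseteq> W y" using dx(1) dy(1) by auto
    interpret V: cring "sec Q ?V" by (rule Q.sec_cring[OF V(1)])
    note gx = good_subset[OF W(3)[OF x] V(1,2)] and gy = good_subset[OF W(3)[OF y] V(1,3)]
    note cx = Q.res_closed[OF dx(1) V(1,2) v(1)[OF x]] and cy = Q.res_closed[OF dy(1) V(1,3) v(1)[OF y]]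
    have ex: "res Q (W x) ?V (v x) \<otimes>\<^bsub>sec Q ?V\<^esub> tr ?V (g x) = tr ?V (a x)"
      using arg_cong[OF v(2)[OF x], of "res Q (W x) ?V"] Q.res_mult[OF dx(1) V(1,2) v(1)[OF x] tr_closed[OF dx(1,3)]]
        res_tr[OF dx(1) V(1,2)] dx(2,3) by simp
    have ey: "res Q (W y) ?V (v y) \<otimes>\<^bsub>sec Q ?V\<^esub> tr ?V (g y) = tr ?V (a y)"
      using arg_cong[OF v(2)[OF y], of "res Q (W y) ?V"] Q.res_mult[OF dy(1) V(1,3) v(1)[OF y] tr_closed[OF dy(1,3)]]
        res_tr[OF dy(1) V(1,3)] dy(2,3) by simp
    have ex': "res Q (W x) ?V (v x) \<otimes>\<^bsub>sec Q ?V\<^esub> tr ?V (g y) = tr ?V (a y)"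
      by (rule good_compat[OF gx gy cx ex])
    note gu = goodD(6)[OF gy] and gc = V.Units_closed[OF goodD(6)[OF gy]]
    have "tr ?V (g y) \<otimes>\<^bsub>sec Q ?V\<^esub> res Q (W x) ?V (v x) = tr ?V (g y) \<otimes>\<^bsub>sec Q ?V\<^esub> res Q (W y) ?V (v y)"
      using ex' ey V.m_comm[OF gc cx] V.m_comm[OF gc cy] by simp
    then show "res Q (W x) ?V (v x) = res Q (W y) ?V (v y)" using V.Units_l_cancel[OF gu cx cy] by simp
  qed
  then obtain t where t: "t \<in> carrier (sec Q (pre U))" "\<forall>x\<in>pre U. res Q (pre U) (W x) t = v x" by blast
  have "rel U s t"
  proof (rule relI[OF t(1)])
    fix x assume x: "x \<in> pre U"
    then show "\<exists>W a g. x \<in> W \<and> W \<subseteq> pre U \<and> good W s a g \<and>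
      res Q (pre U) W t \<otimes>\<^bsub>sec Q W\<^esub> tr W g = tr W a"
      using W[OF x] v(2)[OF x] bspec[OF t(2) x] by (intro exI[of _ "W x"] exI[of _ "a x"] exI[of _ "g x"]) simp
  qed
  then show ?thesis ..
qed

definition F :: "'a set set \<Rightarrow> ('a set \<Rightarrow> ('a \<times> 'a) set) \<Rightarrow> 's"
  where "F U s = (THE t. rel U s t)"

lemma F_eqI:
  assumes "openR U" "rel U s t"
  shows "F U s = t"
  unfolding F_def
proof (rule the_equality)
  show "rel U s t" by fact
  show "t' = t" if "rel U s t'" for t' using rel_unique[OF assms(1) that assms(2)] .
qed

lemma F_rel:
  assumes "openR U" "s \<in> spec_sections R U"
  shows "rel U s (F U s)"
proof -
  obtain t where "rel U s t" using rel_exists[OF assms] ..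
  then show ?thesis using F_eqI[OF assms(1)] by simp
qed

lemma tr_\<theta>: "b \<in> carrier R \<Longrightarrow> tr (pts Q) b = \<theta> b"
  unfolding tr_def by (rule Q.res_id[OF Q.pts_open \<theta>_closed])

lemma rel_op:
  assumes U: "openR U" and r: "rel U s t" and r': "rel U s' t'"
  shows "rel U (\<lambda>P\<in>U. s P \<oplus>\<^bsub>loc R P\<^esub> s' P) (t \<oplus>\<^bsub>sec Q (pre U)\<^esub> t')"
    and "rel U (\<lambda>P\<in>U. s P \<otimes>\<^bsub>loc R P\<^esub> s' P) (t \<otimes>\<^bsub>sec Q (pre U)\<^esub> t')"
proof -
  interpret Qu: cring "sec Q (pre U)" by (rule Q.sec_cring[OF pre_open[OF U]])
  note t = rel_closed[OF r] and t' = rel_closed[OF r']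
  have "(\<exists>W a g. x \<in> W \<and> W \<subseteq> pre U \<and> good W (\<lambda>P\<in>U. s P \<oplus>\<^bsub>loc R P\<^esub> s' P) a g \<and>
      res Q (pre U) W (t \<oplus>\<^bsub>sec Q (pre U)\<^esub> t') \<otimes>\<^bsub>sec Q W\<^esub> tr W g = tr W a) \<and>
    (\<exists>W a g. x \<in> W \<and> W \<subseteq> pre U \<and> good W (\<lambda>P\<in>U. s P \<otimes>\<^bsub>loc R P\<^esub> s' P) a g \<and>
      res Q (pre U) W (t \<otimes>\<^bsub>sec Q (pre U)\<^esub> t') \<otimes>\<^bsub>sec Q W\<^esub> tr W g = tr W a)" if x: "x \<in> pre U" for x
  proof -
    obtain W1 a g where W1: "x \<in> W1" "W1 \<subseteq> pre U" "good W1 s a g"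
      "res Q (pre U) W1 t \<otimes>\<^bsub>sec Q W1\<^esub> tr W1 g = tr W1 a" by (rule relE[OF r x])
    obtain W2 b h where W2: "x \<in> W2" "W2 \<subseteq> pre U" "good W2 s' b h"
      "res Q (pre U) W2 t' \<otimes>\<^bsub>sec Q W2\<^esub> tr W2 h = tr W2 b" by (rule relE[OF r' x])
    let ?W = "W1 \<inter> W2"
    have W: "openQ ?W" "?W \<subseteq> W1" "?W \<subseteq> W2" "?W \<subseteq> pre U" "x \<in> ?W"
      using goodD(1)[OF W1(3)] goodD(1)[OF W2(3)] W1(1,2) W2(1) by auto
    interpret W: cring "sec Q ?W" by (rule Q.sec_cring[OF W(1)])
    note a = goodD[OF good_subset[OF W1(3) W(1,2)]] and b = goodD[OF good_subset[OF W2(3) W(1,3)]]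
    have e1: "res Q (pre U) ?W t \<otimes>\<^bsub>sec Q ?W\<^esub> tr ?W g = tr ?W a"
      by (rule rel_subset_eq[OF U t W1(2) goodD(1)[OF W1(3)] W(1,2) a(2,3) W1(4)])
    have e2: "res Q (pre U) ?W t' \<otimes>\<^bsub>sec Q ?W\<^esub> tr ?W h = tr ?W b"
      by (rule rel_subset_eq[OF U t' W2(2) goodD(1)[OF W2(3)] W(1,3) b(2,3) W2(4)])
    note c = Q.res_closed[OF pre_open[OF U] W(1,4) t] Q.res_closed[OF pre_open[OF U] W(1,4) t']
      tr_closed[OF W(1) a(2)] tr_closed[OF W(1) a(3)] tr_closed[OF W(1) b(2)] tr_closed[OF W(1) b(3)]
    let ?t = "res Q (pre U) ?W t" and ?t' = "res Q (pre U) ?W t'"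
    have "?t \<otimes>\<^bsub>sec Q ?W\<^esub> ?t' \<otimes>\<^bsub>sec Q ?W\<^esub> (tr ?W g \<otimes>\<^bsub>sec Q ?W\<^esub> tr ?W h) =
        (?t \<otimes>\<^bsub>sec Q ?W\<^esub> tr ?W g) \<otimes>\<^bsub>sec Q ?W\<^esub> (?t' \<otimes>\<^bsub>sec Q ?W\<^esub> tr ?W h)"
      using c by (simp add: W.m_ac)
    then have m: "res Q (pre U) ?W (t \<otimes>\<^bsub>sec Q (pre U)\<^esub> t') \<otimes>\<^bsub>sec Q ?W\<^esub> tr ?W (g \<otimes> h) = tr ?W (a \<otimes> b)"
      unfolding e1 e2 using Q.res_mult[OF pre_open[OF U] W(1,4) t t'] tr_mult[OF W(1)] a(2,3) b(2,3) by simp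
    have "(?t \<oplus>\<^bsub>sec Q ?W\<^esub> ?t') \<otimes>\<^bsub>sec Q ?W\<^esub> (tr ?W g \<otimes>\<^bsub>sec Q ?W\<^esub> tr ?W h) =
        (?t \<otimes>\<^bsub>sec Q ?W\<^esub> tr ?W g) \<otimes>\<^bsub>sec Q ?W\<^esub> tr ?W h \<oplus>\<^bsub>sec Q ?W\<^esub>
        (?t' \<otimes>\<^bsub>sec Q ?W\<^esub> tr ?W h) \<otimes>\<^bsub>sec Q ?W\<^esub> tr ?W g"
      using c by (simp add: W.m_ac W.l_distr W.r_distr)
    then have p: "res Q (pre U) ?W (t \<oplus>\<^bsub>sec Q (pre U)\<^esub> t') \<otimes>\<^bsub>sec Q ?W\<^esub> tr ?W (g \<otimes> h) = tr ?W (a \<otimes> h \<oplus> b \<otimes> g)"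
      unfolding e1 e2 using Q.res_add[OF pre_open[OF U] W(1,4) t t'] tr_mult[OF W(1)] tr_add[OF W(1)] a(2,3) b(2,3) by simp
    have "g \<otimes> h \<in> carrier R - pt z \<and>
      (\<lambda>P\<in>U. s P \<oplus>\<^bsub>loc R P\<^esub> s' P) (pt z) = fr R (pt z) (a \<otimes> h \<oplus> b \<otimes> g) (g \<otimes> h) \<and>
      (\<lambda>P\<in>U. s P \<otimes>\<^bsub>loc R P\<^esub> s' P) (pt z) = fr R (pt z) (a \<otimes> b) (g \<otimes> h)" if z: "z \<in> ?W" for z
    proof -
      have zp: "z \<in> pts Q" "pt z \<in> U" using W(4) z by (auto simp: preimg_iff)
      interpret P: prime_loc R "pt z" by (rule pt_ploc[OF zp(1)])
      show ?thesis
        using P.fr_mult[OF a(2) a(4)[OF z] b(2) b(4)[OF z]] P.fr_add[OF a(2) a(4)[OF z] b(2) b(4)[OF z]]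
          P.den_mult[OF a(4)[OF z] b(4)[OF z]] a(5)[OF z] b(5)[OF z] zp(2) by simp
    qed
    then have gd: "good ?W (\<lambda>P\<in>U. s P \<oplus>\<^bsub>loc R P\<^esub> s' P) (a \<otimes> h \<oplus> b \<otimes> g) (g \<otimes> h)"
      "good ?W (\<lambda>P\<in>U. s P \<otimes>\<^bsub>loc R P\<^esub> s' P) (a \<otimes> b) (g \<otimes> h)"
      unfolding good_def using W(1) a(2,3) b(2,3) by simp_all
    show ?thesis
      apply (rule conjI)
      subgoal by (intro exI conjI) (rule W(5) W(4) gd(1) p)+
      subgoal by (intro exI conjI) (rule W(5) W(4) gd(2) m)+
      done
  qed
  note main = this
  show "rel U (\<lambda>P\<in>U. s P \<oplus>\<^bsub>loc R P\<^esub> s' P) (t \<oplus>\<^bsub>sec Q (pre U)\<^esub> t')"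
    by (rule relI[OF Qu.a_closed[OF t t']]) (rule main[THEN conjunct1])
  show "rel U (\<lambda>P\<in>U. s P \<otimes>\<^bsub>loc R P\<^esub> s' P) (t \<otimes>\<^bsub>sec Q (pre U)\<^esub> t')"
    by (rule relI[OF Qu.m_closed[OF t t']]) (rule main[THEN conjunct2])
qed

lemma rel_const:
  assumes U: "openR U" and b: "b \<in> carrier R"
  shows "rel U (\<lambda>P\<in>U. fr R P b \<one>) (tr (pre U) b)"
proof (rule relI[OF tr_closed[OF pre_open[OF U] b]])
  fix x assume x: "x \<in> pre U"
  interpret Qu: cring "sec Q (pre U)" by (rule Q.sec_cring[OF pre_open[OF U]])
  have "good (pre U) (\<lambda>P\<in>U. fr R P b \<one>) b \<one>"
    unfolding good_def using pre_open[OF U] b prime_loc.den_one[OF pt_ploc] by (auto simp: preimg_iff)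
  moreover have "res Q (pre U) (pre U) (tr (pre U) b) \<otimes>\<^bsub>sec Q (pre U)\<^esub> tr (pre U) \<one> = tr (pre U) b"
    using Q.res_id[OF pre_open[OF U]] tr_closed[OF pre_open[OF U] b] tr_one[OF pre_open[OF U]] by simp
  ultimately show "\<exists>W a g. x \<in> W \<and> W \<subseteq> pre U \<and> good W (\<lambda>P\<in>U. fr R P b \<one>) a g \<and>
      res Q (pre U) W (tr (pre U) b) \<otimes>\<^bsub>sec Q W\<^esub> tr W g = tr W a"
    using x by (intro exI conjI) (assumption | rule subset_refl)+
qed

lemma rel_restrict:
  assumes U: "openR U" and V: "openR V" "V \<subseteq> U" and r: "rel U s t"
  shows "rel V (restrict s V) (res Q (pre U) (pre V) t)"
proof (rule relI)
  note t = rel_closed[OF r] and VU = preimg_mono[OF V(2), of Q pt]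
  show "res Q (pre U) (pre V) t \<in> carrier (sec Q (pre V))"
    by (rule Q.res_closed[OF pre_open[OF U] pre_open[OF V(1)] VU t])
  fix x assume x: "x \<in> pre V"
  then have "x \<in> pre U" using VU by blast
  then obtain W1 a g where W1: "x \<in> W1" "W1 \<subseteq> pre U" "good W1 s a g"
      "res Q (pre U) W1 t \<otimes>\<^bsub>sec Q W1\<^esub> tr W1 g = tr W1 a" by (rule relE[OF r])
  let ?W = "W1 \<inter> pre V"
  have W: "openQ ?W" "?W \<subseteq> W1" "?W \<subseteq> pre V" "x \<in> ?W"
    using goodD(1)[OF W1(3)] pre_open[OF V(1)] W1(1) x by auto
  have "good ?W (restrict s V) a g"
    using good_subset[OF W1(3) W(1,2)] unfolding good_def by (auto simp: preimg_iff)
  moreover have "res Q (pre U) ?W t \<otimes>\<^bsub>sec Q ?W\<^esub> tr ?W g = tr ?W a"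
    by (rule rel_subset_eq[OF U t W1(2) goodD(1)[OF W1(3)] W(1,2) goodD(2,3)[OF W1(3)] W1(4)])
  then have "res Q (pre V) ?W (res Q (pre U) (pre V) t) \<otimes>\<^bsub>sec Q ?W\<^esub> tr ?W g = tr ?W a"
    using Q.res_res[OF pre_open[OF U] pre_open[OF V(1)] W(1,3) VU t] by simp
  ultimately show "\<exists>W a g. x \<in> W \<and> W \<subseteq> pre V \<and> good W (restrict s V) a g \<and>
      res Q (pre V) W (res Q (pre U) (pre V) t) \<otimes>\<^bsub>sec Q W\<^esub> tr W g = tr W a"
    using W(3,4) by (intro exI[of _ ?W] exI conjI)
qed

lemma F_closed: "\<lbrakk>openR U; s \<in> spec_sections R U\<rbrakk> \<Longrightarrow> F U s \<in> carrier (sec Q (pre U))"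
  by (rule rel_closed[OF F_rel])

lemma F_const: "\<lbrakk>openR U; b \<in> carrier R\<rbrakk> \<Longrightarrow> F U (\<lambda>P\<in>U. fr R P b \<one>) = tr (pre U) b"
  by (rule F_eqI[OF _ rel_const])

lemma F_glob: "b \<in> carrier R \<Longrightarrow> F (primes R) (glob b) = \<theta> b"
  using F_const[OF open_primes_all] by (simp add: glob_def pre_primes tr_\<theta>)

lemma F_hom:
  assumes U: "openR U"
  shows "F U \<in> ring_hom (sec SpR U) (sec Q (pre U))"
proof (rule ring_hom_memI)
  show "F U s \<in> carrier (sec Q (pre U))" if "s \<in> carrier (sec SpR U)" for s
    using F_closed[OF U] that by simp
  fix s s' assume "s \<in> carrier (sec SpR U)" "s' \<in> carrier (sec SpR U)"
  then have s: "s \<in> spec_sections R U" "s' \<in> spec_sections R U" by simp_all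
  note r = F_rel[OF U s(1)] F_rel[OF U s(2)]
  show "F U (s \<otimes>\<^bsub>sec SpR U\<^esub> s') = F U s \<otimes>\<^bsub>sec Q (pre U)\<^esub> F U s'"
    unfolding Spec_simps by (rule F_eqI[OF U rel_op(2)[OF U r]])
  show "F U (s \<oplus>\<^bsub>sec SpR U\<^esub> s') = F U s \<oplus>\<^bsub>sec Q (pre U)\<^esub> F U s'"
    unfolding Spec_simps by (rule F_eqI[OF U rel_op(1)[OF U r]])
next
  have "(\<lambda>P\<in>U. \<one>\<^bsub>loc R P\<^esub>) = (\<lambda>P\<in>U. fr R P \<one> \<one>)"
    by (rule restrict_ext) (rule prime_loc.loc_one[OF open_ploc[OF U]])
  then show "F U \<one>\<^bsub>sec SpR U\<^esub> = \<one>\<^bsub>sec Q (pre U)\<^esub>"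
    using F_const[OF U one_closed] tr_one[OF pre_open[OF U]] by simp
qed

text \<open>For locality: if the pullback of \<open>a / g\<close> is a unit near \<open>x\<close>,
  so is its product with the unit coming from \<open>g\<close>, which is the image of
  \<open>a\<close>. Hence \<open>a\<close> is outside \<open>pt x\<close>, and
  \<open>unit_near_Spec_iff\<close> applies.\<close>

lemma kmorphism_F: "kmorphism k Q SpR (pt, F)"
  unfolding kmorphism_iff[OF Q.rspace_axioms rspace_Spec]
proof (intro conjI ballI allI impI)
  show "premorphism Q SpR (pt, F)"
    unfolding premorphism_def fst_conv snd_conv Spec_simps(1,2)
  proof (intro conjI allI impI ballI)
    show "continuous_map (topol Q) (spec_topology R) pt" by (rule pt_cont)
    show "F U \<in> ring_hom (sec SpR U) (sec Q (pre U))" if "openR U" for U by (rule F_hom[OF that])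
    fix U V s assume "openR U \<and> openR V \<and> V \<subseteq> U" and s: "s \<in> spec_sections R U"
    then have UV: "openR U" "openR V" "V \<subseteq> U" by auto
    show "F V (res SpR U V s) = res Q (pre U) (pre V) (F U s)"
      unfolding Spec_simps by (rule F_eqI[OF UV(2) rel_restrict[OF UV F_rel[OF UV(1) s]]])
  qed
  show "snd (pt, F) (pts SpR) (str SpR c) = str Q c" if c: "c \<in> k" for c
    using F_glob[OF \<iota>_closed[OF c]] \<theta>_str[OF c] by (simp only: snd_conv pts_Spec str_glob)
  fix x U s assume x: "x \<in> pts Q" "openin (topol SpR) U" "fst (pt, F) x \<in> U" "s \<in> carrier (sec SpR U)"
    and u: "unit_near Q x (preimg Q (fst (pt, F)) U) (snd (pt, F) U s)"
  have U: "openR U" and s: "s \<in> spec_sections R U" and xU: "x \<in> pre U" "pt x \<in> U" using x by (simp_all add: preimg_iff)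
  have u': "unit_near Q x (pre U) (F U s)" using u by simp
  obtain W a g where W: "x \<in> W" "W \<subseteq> pre U" "good W s a g"
      "res Q (pre U) W (F U s) \<otimes>\<^bsub>sec Q W\<^esub> tr W g = tr W a" by (rule relE[OF F_rel[OF U s] xU(1)])
  note a = goodD[OF W(3)]
  have "unit_near Q x W (res Q (pre U) W (F U s))"
    using Q.unit_near_res[OF pre_open[OF U] a(1) W(2,1) F_closed[OF U s]] u' by simp
  moreover have "unit_near Q x W (tr W g)" by (rule Q.unit_near_Units[OF a(1) W(1) a(6)])
  ultimately have "unit_near Q x W (tr W a)"
    using Q.unit_near_mult[OF a(1) W(1) Q.res_closed[OF pre_open[OF U] a(1) W(2) F_closed[OF U s]] tr_closed[OF a(1,3)]]
    by (simp add: W(4))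
  then have "x \<in> E a"
    unfolding tr_def E_def using Q.unit_near_res[OF Q.pts_open a(1) openQ_sub[OF a(1)] W(1) \<theta>_closed[OF a(2)]] x(1) by simp
  then have "a \<notin> pt x" using pt_iff[OF x(1) a(2)] by simp
  then show "unit_near SpR (fst (pt, F) x) U s"
    using unit_near_Spec_iff[OF U s xU(2) a(2) a(4)[OF W(1)] a(5)[OF W(1)]] by simp
qed

text \<open>Locality of \<open>n\<close> forces the map on points: \<open>b\<close> is outside
  \<open>fst n x\<close> iff \<open>glob b\<close> is invertible near that prime iff
  \<open>\<theta> b\<close> is invertible near \<open>x\<close>. The maps on sections are forced
  because \<open>snd n U s\<close> satisfies \<open>rel\<close>.\<close>

lemma kmorphism_unique:
  assumes n: "kmorphism k Q SpR n" and g: "\<And>b. b \<in> carrier R \<Longrightarrow> snd n (primes R) (glob b) = \<theta> b"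
  shows "kmap_eq Q SpR n (pt, F)"
proof -
  note nD = kmorphismD[OF Q.rspace_axioms rspace_Spec n]
  note pD = premorphismD[OF nD(1), unfolded Spec_simps(1,2)]
  have fn: "fst n x \<in> primes R" if "x \<in> pts Q" for x
    using pD(1) that by (auto simp: continuous_map_def topspace_spec[OF is_cring])
  have pren: "preimg Q (fst n) (primes R) = pts Q" using fn by (auto simp: preimg_def)
  have gs: "glob b \<in> spec_sections R (primes R)" if "b \<in> carrier R" for b
    using ring_hom_closed[OF glob_hom that] by simp
  have pt: "fst n x = pt x" if x: "x \<in> pts Q" for x
  proof -
    interpret P: prime_loc R "fst n x" using fn[OF x] by (intro prime_locI[OF is_cring]) simp
    have "b \<notin> fst n x \<longleftrightarrow> unit_near Q x (pts Q) (\<theta> b)" if b: "b \<in> carrier R" for b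
    proof -
      have "unit_near SpR (fst n x) (primes R) (glob b) \<longleftrightarrow> b \<notin> fst n x"
        by (rule unit_near_Spec_iff[OF open_primes_all gs[OF b] fn[OF x] b P.den_one]) (use fn[OF x] in \<open>simp add: glob_def\<close>)
      moreover have "unit_near SpR (fst n x) (primes R) (glob b) \<longleftrightarrow> unit_near Q x (pts Q) (\<theta> b)"
      proof
        assume "unit_near SpR (fst n x) (primes R) (glob b)"
        from premorphism_unit_near[OF Q.rspace_axioms rspace_Spec nD(1) x fn[OF x] _ _ this]
        show "unit_near Q x (pts Q) (\<theta> b)" using open_primes_all gs[OF b] g[OF b] by (simp add: pren)
      next
        assume "unit_near Q x (pts Q) (\<theta> b)"
        then show "unit_near SpR (fst n x) (primes R) (glob b)"
          using nD(3)[OF x _ fn[OF x]] open_primes_all gs[OF b] g[OF b] by (simp add: pren)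
      qed
      ultimately show ?thesis by simp
    qed
    moreover have "fst n x \<subseteq> carrier R" using P.a_subset .
    ultimately show ?thesis unfolding pt_def by blast
  qed
  have pre: "preimg Q (fst n) U = pre U" for U using pt by (auto simp: preimg_def)
  have "rel U s (snd n U s)" if U: "openR U" and s: "s \<in> spec_sections R U" for U s
  proof (rule relI)
    show nc: "snd n U s \<in> carrier (sec Q (pre U))" using pD(4)[OF U s] by (simp add: pre)
    fix x assume x: "x \<in> pre U"
    from good_exists[OF s x] obtain W a h where W: "pt x \<in> W" "W \<subseteq> U" "loc_rep R s W a h"
      "x \<in> pre W" "pre W \<subseteq> pre U" "good (pre W) s a h" .
    note r = loc_repD[OF W(3)]
    have Wp: "W \<subseteq> primes R" by (rule open_primes[OF r(1)])
    have rs: "restrict s W \<in> spec_sections R W" by (rule sections_restrict[OF r(1) W(2) s])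
    have rg: "restrict (glob b) W \<in> spec_sections R W" if "b \<in> carrier R" for b
      by (rule sections_restrict[OF r(1) Wp gs[OF that]])
    have tr: "tr (pre W) b = snd n W (restrict (glob b) W)" if b: "b \<in> carrier R" for b
      using pD(3)[OF open_primes_all r(1) Wp gs[OF b]] g[OF b] by (simp add: tr_def pre pre_primes)
    \<comment> \<open>Over \<open>W\<close> the section is \<open>a / h\<close>, so multiplying it
      by \<open>h\<close> gives \<open>a\<close>; the image of this identity under
      \<open>snd n W\<close> is the equation required by \<open>rel\<close>.\<close>
    have "(\<lambda>P\<in>W. restrict s W P \<otimes>\<^bsub>loc R P\<^esub> restrict (glob h) W P) = restrict (glob a) W"
    proof (rule restrict_ext)
      fix P assume P: "P \<in> W"
      interpret P: prime_loc R P by (rule open_ploc[OF r(1) P])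
      have "fr R P a h \<otimes>\<^bsub>loc R P\<^esub> fr R P h \<one> = fr R P (a \<otimes> h) (h \<otimes> \<one>)"
        by (rule P.fr_mult[OF r(2) r(4)[OF P] r(3) P.den_one])
      also have "\<dots> = fr R P a \<one>"
        by (rule P.fr_eqI) (use r(2,3) r(4)[OF P] P.den_one in simp_all)
      finally show "restrict s W P \<otimes>\<^bsub>loc R P\<^esub> restrict (glob h) W P = glob a P"
        using r(5)[OF P] P Wp by (simp add: glob_def subset_iff)
    qed
    then have "restrict s W \<otimes>\<^bsub>sec SpR W\<^esub> restrict (glob h) W = restrict (glob a) W" by (simp only: Spec_simps)
    moreover have "snd n W (restrict s W \<otimes>\<^bsub>sec SpR W\<^esub> restrict (glob h) W) =
        snd n W (restrict s W) \<otimes>\<^bsub>sec Q (pre W)\<^esub> snd n W (restrict (glob h) W)"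
      using ring_hom_mult[OF pD(2)[OF r(1)]] rs rg[OF r(3)] by (simp only: Spec_simps pre)
    ultimately have "snd n W (restrict s W) \<otimes>\<^bsub>sec Q (pre W)\<^esub> tr (pre W) h = tr (pre W) a"
      using tr[OF r(2)] tr[OF r(3)] by simp
    moreover have "snd n W (restrict s W) = res Q (pre U) (pre W) (snd n U s)"
      using pD(3)[OF U r(1) W(2) s] by (simp add: pre)
    ultimately show "\<exists>W a g. x \<in> W \<and> W \<subseteq> pre U \<and> good W s a g \<and>
      res Q (pre U) W (snd n U s) \<otimes>\<^bsub>sec Q W\<^esub> tr W g = tr W a"
      using W(4-6) by (intro exI[of _ "pre W"] exI[of _ a] exI[of _ h]) simp
  qed
  then have "snd n U s = F U s" if "openR U" "s \<in> spec_sections R U" for U s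
    using F_eqI[OF that(1)] that by metis
  then show ?thesis unfolding kmap_eq_def using pt by simp
qed

end

section \<open>Spectra of localizations and of quotients\<close>

text \<open>Openness onto the image is reduced to a condition at single points. For maps of spectra
  the set \<open>V\<close> required by \<open>nb\<close> is the basic open set of one element
  carried over from the other ring.\<close>

lemma homeomorphic_map_onto_image:
  assumes cont: "continuous_map T Y f" and inj: "inj_on f (topspace T)"
    and nb: "\<And>x U. \<lbrakk>openin T U; x \<in> U\<rbrakk> \<Longrightarrow> \<exists>V. openin Y V \<and> f x \<in> V \<and> (\<forall>z\<in>topspace T. f z \<in> V \<longrightarrow> z \<in> U)"
  shows "homeomorphic_map T (subtopology Y (f ` topspace T)) f"
proof (rule bijective_open_imp_homeomorphic_map)
  show "continuous_map T (subtopology Y (f ` topspace T)) f"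
    using cont by (simp add: continuous_map_in_subtopology)
  show "f ` topspace T = topspace (subtopology Y (f ` topspace T))"
    using cont by (auto simp: continuous_map_def)
  show "open_map T (subtopology Y (f ` topspace T)) f"
    unfolding open_map_def
  proof (intro allI impI)
    fix U assume U: "openin T U"
    have sub: "U \<subseteq> topspace T" by (rule openin_subset[OF U])
    define V where "V = \<Union>{V. openin Y V \<and> (\<forall>z\<in>topspace T. f z \<in> V \<longrightarrow> z \<in> U)}"
    have "openin Y V" unfolding V_def by (rule openin_Union) simp
    moreover have "f ` U = V \<inter> f ` topspace T"
    proof (rule subset_antisym; rule subsetI)
      fix y assume "y \<in> f ` U"
      then obtain x where x: "x \<in> U" "y = f x" by auto
      with nb[OF U x(1)] have "y \<in> V" unfolding V_def by auto
      then show "y \<in> V \<inter> f ` topspace T" using x sub by auto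
    next
      fix y assume y: "y \<in> V \<inter> f ` topspace T"
      then obtain z where z: "z \<in> topspace T" "y = f z" by auto
      have "z \<in> U" using y z unfolding V_def by auto
      then show "y \<in> f ` U" using z by auto
    qed
    ultimately show "openin (subtopology Y (f ` topspace T)) (f ` U)" unfolding openin_subtopology by auto
  qed
qed (rule inj)

locale kalg_hom = A: kalg R k \<iota> + B: kalg R' k \<iota>'
  for R :: "'a ring" and k :: "'k::field set" and \<iota> and R' :: "'b ring" and \<iota>' +
  fixes \<phi> :: "'a \<Rightarrow> 'b"
  assumes \<phi>_hom: "\<phi> \<in> ring_hom R R'" and \<phi>_str: "\<And>c. c \<in> k \<Longrightarrow> \<phi> (\<iota> c) = \<iota>' c"
begin

lemmas \<phi>_closed = ring_hom_closed[OF \<phi>_hom]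
lemmas \<phi>_mult = ring_hom_mult[OF \<phi>_hom]
lemmas \<phi>_add = ring_hom_add[OF \<phi>_hom]
lemmas \<phi>_one = ring_hom_one[OF \<phi>_hom]

lemma \<phi>_zero: "\<phi> \<zero>\<^bsub>R\<^esub> = \<zero>\<^bsub>R'\<^esub>"
  by (rule ring_hom_zero[OF \<phi>_hom A.ring_axioms B.ring_axioms])

lemma \<phi>_pow: "a \<in> carrier R \<Longrightarrow> \<phi> (a [^]\<^bsub>R\<^esub> (n::nat)) = \<phi> a [^]\<^bsub>R'\<^esub> n"
  by (induction n) (simp_all add: \<phi>_one \<phi>_mult)

text \<open>The morphism of spectra induced by \<open>\<phi>\<close>, obtained from the universal
  property by composing \<open>\<phi>\<close> with the map to the global sections.\<close>

sublocale M: spec_map R k \<iota> "Spec R' \<iota>'" "B.glob \<circ> \<phi>"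
proof
  show "rspace.local_at (Spec R' \<iota>') P" if "P \<in> pts (Spec R' \<iota>')" for P
    using B.local_at_Spec that by (simp only: B.pts_Spec)
  show "B.glob \<circ> \<phi> \<in> ring_hom R (sec (Spec R' \<iota>') (pts (Spec R' \<iota>')))"
    unfolding B.pts_Spec by (rule ring_hom_trans[OF \<phi>_hom B.glob_hom])
  show "(B.glob \<circ> \<phi>) (\<iota> c) = str (Spec R' \<iota>') c" if "c \<in> k" for c
    unfolding B.str_glob using \<phi>_str[OF that] by simp
qed

lemma glob_sections: "b \<in> carrier R' \<Longrightarrow> B.glob b \<in> spec_sections R' (primes R')"
  using ring_hom_closed[OF B.glob_hom] by simp

lemma pt_eq:
  assumes P: "P \<in> primes R'"
  shows "M.pt P = {b \<in> carrier R. \<phi> b \<in> P}"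
proof -
  interpret P: prime_loc R' P using P by (intro prime_locI[OF B.is_cring]) simp
  have "unit_near (Spec R' \<iota>') P (primes R') (B.glob (\<phi> b)) \<longleftrightarrow> \<phi> b \<notin> P" if b: "b \<in> carrier R" for b
    by (rule B.unit_near_Spec_iff[OF B.open_primes_all glob_sections[OF \<phi>_closed[OF b]] P \<phi>_closed[OF b] P.den_one])
      (use P in \<open>simp add: B.glob_def\<close>)
  then show ?thesis unfolding M.pt_def B.pts_Spec by auto
qed

lemma pre_iff: "P \<in> M.pre U \<longleftrightarrow> P \<in> primes R' \<and> M.pt P \<in> U"
  by (simp only: preimg_iff B.pts_Spec)

lemma pt_ploc': "P \<in> primes R' \<Longrightarrow> prime_loc R (M.pt P)"
  using M.pt_ploc by (simp only: B.pts_Spec)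

lemma F_sections: "\<lbrakk>A.openR U; s \<in> spec_sections R U\<rbrakk> \<Longrightarrow> M.F U s \<in> spec_sections R' (M.pre U)"
  using M.F_closed by simp

text \<open>\<open>F\<close> is characterised only by equations near a point. These involve some
  fraction \<open>b / h\<close> and give the value with numerator \<open>\<phi> b\<close> and
  denominator \<open>\<phi> h\<close>; as \<open>b / h\<close> and \<open>a / g\<close> agree at
  \<open>M.pt P\<close>, so do their images.\<close>

lemma F_at:
  assumes U: "A.openR U" and s: "s \<in> spec_sections R U" and P: "P \<in> primes R'" and PU: "M.pt P \<in> U"
    and a: "a \<in> carrier R" "g \<in> carrier R - M.pt P" "s (M.pt P) = fr R (M.pt P) a g"
  shows "M.F U s P = fr R' P (\<phi> a) (\<phi> g)"
proof -
  interpret P: prime_loc R' P using P by (intro prime_locI[OF B.is_cring]) simp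
  interpret p: prime_loc R "M.pt P" by (rule pt_ploc'[OF P])
  have den: "\<phi> h \<in> carrier R' - P" if "h \<in> carrier R - M.pt P" for h
    using that \<phi>_closed[of h] unfolding pt_eq[OF P] by simp
  have xU: "P \<in> M.pre U" unfolding pre_iff using P PU by simp
  obtain W b h where W: "P \<in> W" "W \<subseteq> M.pre U" "M.good W s b h"
    "res (Spec R' \<iota>') (M.pre U) W (M.F U s) \<otimes>\<^bsub>sec (Spec R' \<iota>') W\<^esub> M.tr W h = M.tr W b"
    by (rule M.relE[OF M.F_rel[OF U s] xU])
  note gd = M.goodD[OF W(3)]
  have oW: "openin (spec_topology R') W" using gd(1) by simp
  have Wp: "W \<subseteq> primes R'" by (rule B.open_primes[OF oW])
  have tr: "M.tr W c P = fr R' P (\<phi> c) \<one>\<^bsub>R'\<^esub>" for c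
    unfolding M.tr_def using W(1) Wp by (auto simp: B.glob_def)
  have "M.F U s P \<otimes>\<^bsub>loc R' P\<^esub> fr R' P (\<phi> h) \<one>\<^bsub>R'\<^esub> = fr R' P (\<phi> b) \<one>\<^bsub>R'\<^esub>"
    using fun_cong[OF W(4), of P] W(1) by (simp add: tr)
  moreover obtain x y where xy: "x \<in> carrier R'" "y \<in> carrier R' - P" "M.F U s P = fr R' P x y"
    by (rule P.loc_E[OF B.sections_loc[OF _ F_sections[OF U s] xU]]) (use M.pre_open[OF U] in simp_all)
  ultimately have "fr R' P (x \<otimes>\<^bsub>R'\<^esub> \<phi> h) (y \<otimes>\<^bsub>R'\<^esub> \<one>\<^bsub>R'\<^esub>) = fr R' P (\<phi> b) \<one>\<^bsub>R'\<^esub>"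
    using P.fr_mult[OF xy(1,2) \<phi>_closed[OF gd(3)] P.den_one] by simp
  then obtain u where u: "u \<in> carrier R' - P"
    "u \<otimes>\<^bsub>R'\<^esub> (x \<otimes>\<^bsub>R'\<^esub> \<phi> h \<otimes>\<^bsub>R'\<^esub> \<one>\<^bsub>R'\<^esub>) = u \<otimes>\<^bsub>R'\<^esub> (\<phi> b \<otimes>\<^bsub>R'\<^esub> (y \<otimes>\<^bsub>R'\<^esub> \<one>\<^bsub>R'\<^esub>))"
    using P.fr_eq_iff[OF B.m_closed[OF xy(1) \<phi>_closed[OF gd(3)]] P.den_mult[OF xy(2) P.den_one] \<phi>_closed[OF gd(2)] P.den_one]
    by blast
  have "u \<otimes>\<^bsub>R'\<^esub> (x \<otimes>\<^bsub>R'\<^esub> \<phi> h) = u \<otimes>\<^bsub>R'\<^esub> (\<phi> b \<otimes>\<^bsub>R'\<^esub> y)"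
    using u xy(1,2) \<phi>_closed[OF gd(3)] \<phi>_closed[OF gd(2)] by simp
  then have 1: "M.F U s P = fr R' P (\<phi> b) (\<phi> h)"
    unfolding xy(3) P.fr_eq_iff[OF xy(1,2) \<phi>_closed[OF gd(2)] den[OF gd(4)[OF W(1)]]] using u(1) by blast
  have "fr R (M.pt P) b h = fr R (M.pt P) a g" using gd(5)[OF W(1)] a(3) by simp
  then obtain v where v: "v \<in> carrier R - M.pt P" "v \<otimes>\<^bsub>R\<^esub> (b \<otimes>\<^bsub>R\<^esub> g) = v \<otimes>\<^bsub>R\<^esub> (a \<otimes>\<^bsub>R\<^esub> h)"
    using p.fr_eq_iff[OF gd(2) gd(4)[OF W(1)] a(1,2)] by blast
  have "\<phi> v \<otimes>\<^bsub>R'\<^esub> (\<phi> b \<otimes>\<^bsub>R'\<^esub> \<phi> g) = \<phi> v \<otimes>\<^bsub>R'\<^esub> (\<phi> a \<otimes>\<^bsub>R'\<^esub> \<phi> h)"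
    using arg_cong[OF v(2), of \<phi>] v(1) gd(2,3) a(1,2) by (simp add: \<phi>_mult)
  then have "fr R' P (\<phi> b) (\<phi> h) = fr R' P (\<phi> a) (\<phi> g)"
    unfolding P.fr_eq_iff[OF \<phi>_closed[OF gd(2)] den[OF gd(4)[OF W(1)]] \<phi>_closed[OF a(1)] den[OF a(2)]]
    using den[OF v(1)] by blast
  with 1 show ?thesis by simp
qed

end

text \<open>\<open>R'\<close> is the ring of fractions of \<open>R\<close> with powers of
  \<open>f\<close> as denominators, described by its properties instead of as a ring of pairs. This
  fits subrings of one ring of Laurent polynomials, where \<open>\<phi>\<close> is the
  identity.\<close>

locale kalg_localization = kalg_hom R k \<iota> R' \<iota>' \<phi>
  for R :: "'a ring" and k :: "'k::field set" and \<iota> and R' :: "'b ring" and \<iota>' and \<phi> +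
  fixes f :: 'a
  assumes f: "f \<in> carrier R" and f_unit: "\<phi> f \<in> Units R'"
    and frac: "\<And>y. y \<in> carrier R' \<Longrightarrow> \<exists>a n. a \<in> carrier R \<and> y \<otimes>\<^bsub>R'\<^esub> \<phi> f [^]\<^bsub>R'\<^esub> (n::nat) = \<phi> a"
    and inj: "inj_on \<phi> (carrier R)"
begin

lemma f_not_mem: "P \<in> primes R' \<Longrightarrow> \<phi> f [^]\<^bsub>R'\<^esub> (n::nat) \<in> carrier R' - P"
proof -
  assume "P \<in> primes R'"
  then interpret P: prime_loc R' P by (intro prime_locI[OF B.is_cring]) simp
  have "\<phi> f \<notin> P"
  proof
    assume "\<phi> f \<in> P"
    from P.I_l_closed[OF this B.Units_inv_closed[OF f_unit]] show False using f_unit P.den_one by simp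
  qed
  then show ?thesis
    by (induction n) (use P.den_one P.den_mult[of _ "\<phi> f"] \<phi>_closed[OF f] in simp_all)
qed

text \<open>\<open>y\<close> and \<open>\<phi> a\<close> differ by a power of the unit
  \<open>\<phi> f\<close>, so a prime contains both or neither. Primes of \<open>R'\<close> are
  thereby determined by their preimages in \<open>R\<close>.\<close>

lemma mem_iff:
  assumes P: "P \<in> primes R'" and y: "y \<in> carrier R'" and a: "a \<in> carrier R" "y \<otimes>\<^bsub>R'\<^esub> \<phi> f [^]\<^bsub>R'\<^esub> (n::nat) = \<phi> a"
  shows "y \<in> P \<longleftrightarrow> a \<in> M.pt P"
proof -
  interpret P: prime_loc R' P using P by (intro prime_locI[OF B.is_cring]) simp
  have n: "\<phi> f [^]\<^bsub>R'\<^esub> n \<in> carrier R' - P" by (rule f_not_mem[OF P])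
  have "y \<in> P \<longleftrightarrow> \<phi> a \<in> P"
    using P.I_r_closed[of y "\<phi> f [^]\<^bsub>R'\<^esub> n"] P.den_mult[of y, OF _ n] n y unfolding a(2)[symmetric] by blast
  then show ?thesis using a(1) by (simp add: pt_eq[OF P])
qed

lemma pt_inj: "inj_on M.pt (primes R')"
proof (rule inj_onI)
  fix P P' assume P: "P \<in> primes R'" "P' \<in> primes R'" "M.pt P = M.pt P'"
  interpret P: primeideal P R' using P by simp
  interpret P': primeideal P' R' using P by simp
  have "y \<in> P \<longleftrightarrow> y \<in> P'" if y: "y \<in> carrier R'" for y
  proof -
    obtain a and n :: nat where "a \<in> carrier R" "y \<otimes>\<^bsub>R'\<^esub> \<phi> f [^]\<^bsub>R'\<^esub> n = \<phi> a" using frac[OF y] by blast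
    then show ?thesis using mem_iff[OF P(1) y] mem_iff[OF P(2) y] P(3) by simp
  qed
  then show "P = P'" using P.a_subset P'.a_subset by blast
qed

lemma pt_image: "M.pt ` primes R' = basic_open R f"
proof (rule subset_antisym; rule subsetI)
  fix P assume "P \<in> M.pt ` primes R'"
  then obtain P' where P': "P' \<in> primes R'" "P = M.pt P'" by blast
  have "\<phi> f \<notin> P'" using f_not_mem[OF P'(1), of 1] \<phi>_closed[OF f] by simp
  then show "P \<in> basic_open R f" using M.pt_prime[of P'] P' B.pts_Spec by (simp add: pt_eq[OF P'(1)])
next
  fix P assume P: "P \<in> basic_open R f"
  then interpret P: prime_loc R P by (intro prime_locI[OF A.is_cring]) simp
  have fP: "f [^]\<^bsub>R\<^esub> n \<in> carrier R - P" for n :: nat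
    by (induction n) (use P.den_one P.den_mult[of _ f] f P in simp_all)
  let ?F = "\<lambda>n::nat. \<phi> f [^]\<^bsub>R'\<^esub> n"
  have Fc: "?F n \<in> carrier R'" for n using \<phi>_closed[OF f] by simp
  have Fu: "?F n \<in> Units R'" for n using f_unit by (induction n) simp_all
  \<comment> \<open>The extension of \<open>P\<close>: the elements with some numerator in
    \<open>P\<close>. By \<open>P'_iff\<close> the choice of numerator does not matter, since
    \<open>f\<close> is outside \<open>P\<close> and \<open>\<phi>\<close> is injective.\<close>
  define P' where "P' = {y \<in> carrier R'. \<exists>a n. a \<in> P \<and> y \<otimes>\<^bsub>R'\<^esub> ?F n = \<phi> a}"
  have P'_iff: "y \<in> P' \<longleftrightarrow> a \<in> P" if y: "y \<in> carrier R'" and a: "a \<in> carrier R" "y \<otimes>\<^bsub>R'\<^esub> ?F n = \<phi> a" for y a n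
  proof
    assume "y \<in> P'"
    then obtain b m where b: "b \<in> P" "y \<otimes>\<^bsub>R'\<^esub> ?F m = \<phi> b" unfolding P'_def by blast
    have bc: "b \<in> carrier R" by (rule P.a_Hcarr[OF b(1)])
    have "\<phi> (a \<otimes>\<^bsub>R\<^esub> f [^]\<^bsub>R\<^esub> m) = (y \<otimes>\<^bsub>R'\<^esub> ?F n) \<otimes>\<^bsub>R'\<^esub> ?F m" using a f by (simp add: \<phi>_mult \<phi>_pow)
    also have "\<dots> = (y \<otimes>\<^bsub>R'\<^esub> ?F m) \<otimes>\<^bsub>R'\<^esub> ?F n" using y Fc by (simp add: B.m_ac)
    also have "\<dots> = \<phi> (b \<otimes>\<^bsub>R\<^esub> f [^]\<^bsub>R\<^esub> n)" unfolding b(2) using bc f by (simp add: \<phi>_mult \<phi>_pow)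
    finally have "a \<otimes>\<^bsub>R\<^esub> f [^]\<^bsub>R\<^esub> m = b \<otimes>\<^bsub>R\<^esub> f [^]\<^bsub>R\<^esub> n" using inj a(1) bc f unfolding inj_on_def by simp
    moreover have "b \<otimes>\<^bsub>R\<^esub> f [^]\<^bsub>R\<^esub> n \<in> P" by (rule P.I_r_closed[OF b(1)]) (use f in simp)
    ultimately show "a \<in> P" using P.I_prime[OF a(1), of "f [^]\<^bsub>R\<^esub> m"] fP[of m] by auto
  qed (use a y in \<open>auto simp: P'_def\<close>)
  have "primeideal P' R'"
  proof (rule primeidealI)
    have rep: "\<exists>a n. a \<in> carrier R \<and> y \<otimes>\<^bsub>R'\<^esub> ?F n = \<phi> a" if "y \<in> carrier R'" for y
      using frac[OF that] by blast
    have mult: "x \<otimes>\<^bsub>R'\<^esub> y \<in> P' \<longleftrightarrow> x \<in> P' \<or> y \<in> P'" if x: "x \<in> carrier R'" and y: "y \<in> carrier R'" for x y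
    proof -
      obtain a n where a: "a \<in> carrier R" "x \<otimes>\<^bsub>R'\<^esub> ?F n = \<phi> a" using rep[OF x] by blast
      obtain b m where b: "b \<in> carrier R" "y \<otimes>\<^bsub>R'\<^esub> ?F m = \<phi> b" using rep[OF y] by blast
      have "x \<otimes>\<^bsub>R'\<^esub> y \<otimes>\<^bsub>R'\<^esub> ?F (n + m) = (x \<otimes>\<^bsub>R'\<^esub> ?F n) \<otimes>\<^bsub>R'\<^esub> (y \<otimes>\<^bsub>R'\<^esub> ?F m)"
        using x y Fc \<phi>_closed[OF f] by (simp add: B.nat_pow_mult[symmetric] B.m_ac)
      then have e: "x \<otimes>\<^bsub>R'\<^esub> y \<otimes>\<^bsub>R'\<^esub> ?F (n + m) = \<phi> (a \<otimes>\<^bsub>R\<^esub> b)" using a b by (simp add: \<phi>_mult)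
      have "a \<otimes>\<^bsub>R\<^esub> b \<in> P \<longleftrightarrow> a \<in> P \<or> b \<in> P"
        using P.I_prime[OF a(1) b(1)] P.I_l_closed[of b a] P.I_r_closed[of a b] a(1) b(1) by blast
      then show ?thesis
        using P'_iff[OF B.m_closed[OF x y] A.m_closed[OF a(1) b(1)] e] P'_iff[OF x a] P'_iff[OF y b] by simp
    qed
    show id: "ideal P' R'"
    proof (rule idealI)
      show "x \<otimes>\<^bsub>R'\<^esub> y \<in> P'" if "y \<in> P'" "x \<in> carrier R'" for x y
        using mult[of x y] that by (auto simp: P'_def)
      show "y \<otimes>\<^bsub>R'\<^esub> x \<in> P'" if "y \<in> P'" "x \<in> carrier R'" for x y
        using mult[of y x] that by (auto simp: P'_def)
      show "subgroup P' (add_monoid R')"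
      proof (rule subgroup.intro)
        show "P' \<subseteq> carrier (add_monoid R')" by (auto simp: P'_def)
        have z: "\<zero>\<^bsub>R\<^esub> \<in> carrier R" "\<zero>\<^bsub>R'\<^esub> \<in> carrier R'" by simp_all
        have "\<zero>\<^bsub>R'\<^esub> \<otimes>\<^bsub>R'\<^esub> ?F 0 = \<phi> \<zero>\<^bsub>R\<^esub>" by (simp add: \<phi>_zero)
        from P'_iff[OF z(2,1) this] show "\<one>\<^bsub>add_monoid R'\<^esub> \<in> P'" using P.zero_closed by simp
        show "x \<otimes>\<^bsub>add_monoid R'\<^esub> y \<in> P'" if xy: "x \<in> P'" "y \<in> P'" for x y
        proof -
          have x: "x \<in> carrier R'" and y: "y \<in> carrier R'" using xy by (auto simp: P'_def)
          obtain a n where a: "a \<in> carrier R" "x \<otimes>\<^bsub>R'\<^esub> ?F n = \<phi> a" using rep[OF x] by blast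
          obtain b m where b: "b \<in> carrier R" "y \<otimes>\<^bsub>R'\<^esub> ?F m = \<phi> b" using rep[OF y] by blast
          have aP: "a \<in> P" "b \<in> P" using P'_iff[OF x a] P'_iff[OF y b] xy by simp_all
          let ?c = "a \<otimes>\<^bsub>R\<^esub> f [^]\<^bsub>R\<^esub> m \<oplus>\<^bsub>R\<^esub> b \<otimes>\<^bsub>R\<^esub> f [^]\<^bsub>R\<^esub> n"
          have fc: "f [^]\<^bsub>R\<^esub> i \<in> carrier R" for i :: nat using f by simp
          have "(x \<oplus>\<^bsub>R'\<^esub> y) \<otimes>\<^bsub>R'\<^esub> ?F (n + m) = (x \<otimes>\<^bsub>R'\<^esub> ?F n) \<otimes>\<^bsub>R'\<^esub> ?F m \<oplus>\<^bsub>R'\<^esub> (y \<otimes>\<^bsub>R'\<^esub> ?F m) \<otimes>\<^bsub>R'\<^esub> ?F n"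
            using x y Fc \<phi>_closed[OF f] by (simp add: B.nat_pow_mult[symmetric] B.m_ac B.l_distr)
          then have e: "(x \<oplus>\<^bsub>R'\<^esub> y) \<otimes>\<^bsub>R'\<^esub> ?F (n + m) = \<phi> ?c"
            unfolding a(2) b(2) using a(1) b(1) f by (simp add: \<phi>_mult \<phi>_add \<phi>_pow)
          have "?c \<in> P" by (rule P.a_closed[OF P.I_r_closed[OF aP(1) fc] P.I_r_closed[OF aP(2) fc]])
          then show ?thesis using P'_iff[OF _ _ e] x y P.a_Hcarr by simp
        qed
        show "inv\<^bsub>add_monoid R'\<^esub> x \<in> P'" if "x \<in> P'" for x
        proof -
          have x: "x \<in> carrier R'" using that by (simp add: P'_def)
          then have "\<ominus>\<^bsub>R'\<^esub> x = (\<ominus>\<^bsub>R'\<^esub> \<one>\<^bsub>R'\<^esub>) \<otimes>\<^bsub>R'\<^esub> x" by (simp add: B.l_minus)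
          moreover have "(\<ominus>\<^bsub>R'\<^esub> \<one>\<^bsub>R'\<^esub>) \<otimes>\<^bsub>R'\<^esub> x \<in> P'" using mult[of "\<ominus>\<^bsub>R'\<^esub> \<one>\<^bsub>R'\<^esub>" x] x that by simp
          ultimately show ?thesis unfolding a_inv_def by metis
        qed
      qed
    qed (rule B.ring_axioms)
    show "carrier R' \<noteq> P'"
    proof
      assume eq: "carrier R' = P'"
      have "\<one>\<^bsub>R'\<^esub> \<otimes>\<^bsub>R'\<^esub> ?F 0 = \<phi> \<one>\<^bsub>R\<^esub>" by (simp add: \<phi>_one)
      from P'_iff[OF B.one_closed A.one_closed this] show False using eq P.den_one by auto
    qed
    show "x \<in> P' \<or> y \<in> P'" if "x \<in> carrier R'" "y \<in> carrier R'" "x \<otimes>\<^bsub>R'\<^esub> y \<in> P'" for x y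
      using mult[OF that(1,2)] that(3) by simp
  qed (rule B.is_cring)
  then have P'p: "P' \<in> primes R'" by simp
  have "\<phi> a \<in> P' \<longleftrightarrow> a \<in> P" if "a \<in> carrier R" for a
    using P'_iff[of "\<phi> a" a 0] \<phi>_closed that by simp
  then have "M.pt P' = P" using P.a_subset unfolding pt_eq[OF P'p] by blast
  then show "P \<in> M.pt ` primes R'" using P'p by blast
qed

lemma homeo: "homeomorphic_map (spec_topology R') (subtopology (spec_topology R) (basic_open R f)) M.pt"
proof -
  have "homeomorphic_map (spec_topology R') (subtopology (spec_topology R) (M.pt ` topspace (spec_topology R'))) M.pt"
  proof (rule homeomorphic_map_onto_image)
    show "continuous_map (spec_topology R') (spec_topology R) M.pt" using M.pt_cont by simp
    show "inj_on M.pt (topspace (spec_topology R'))" using pt_inj by (simp only: topspace_spec[OF B.is_cring])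
    fix P U assume U: "openin (spec_topology R') U" "P \<in> U"
    obtain y where y: "y \<in> carrier R'" "P \<in> basic_open R' y" "basic_open R' y \<subseteq> U"
      using bspec[OF U(1)[unfolded openin_spec_iff[OF B.is_cring]] U(2)] by (elim bexE conjE)
    obtain a and n :: nat where a: "a \<in> carrier R" "y \<otimes>\<^bsub>R'\<^esub> \<phi> f [^]\<^bsub>R'\<^esub> n = \<phi> a" using frac[OF y(1)] by blast
    have m: "M.pt P' \<in> basic_open R a \<longleftrightarrow> P' \<in> basic_open R' y" if "P' \<in> primes R'" for P'
      using mem_iff[OF that y(1) a] that prime_loc.axioms(2)[OF pt_ploc'[OF that]] by simp
    show "\<exists>V. openin (spec_topology R) V \<and> M.pt P \<in> V \<and> (\<forall>z\<in>topspace (spec_topology R'). M.pt z \<in> V \<longrightarrow> z \<in> U)"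
    proof (intro exI[of _ "basic_open R a"] conjI ballI impI)
      show "openin (spec_topology R) (basic_open R a)" by (rule openin_basic[OF A.is_cring a(1)])
      show "M.pt P \<in> basic_open R a" using m[of P] y(2) by simp
      show "z \<in> U" if "z \<in> topspace (spec_topology R')" "M.pt z \<in> basic_open R a" for z
        using m[of z] that y(3) unfolding topspace_spec[OF B.is_cring] by blast
    qed
  qed
  then show ?thesis by (simp only: topspace_spec[OF B.is_cring] pt_image)
qed

text \<open>A witness \<open>u\<close> for equality over \<open>R'\<close> becomes the image of a
  witness \<open>c\<close> in \<open>R\<close> after multiplication by a power of
  \<open>\<phi> f\<close>; injectivity of \<open>\<phi>\<close> then pulls the equation
  back.\<close>

lemma stalk_inj:
  assumes P: "P \<in> primes R'" and a: "a \<in> carrier R" "g \<in> carrier R - M.pt P" and b: "b \<in> carrier R" "h \<in> carrier R - M.pt P"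
    and eq: "fr R' P (\<phi> a) (\<phi> g) = fr R' P (\<phi> b) (\<phi> h)"
  shows "fr R (M.pt P) a g = fr R (M.pt P) b h"
proof -
  interpret P: prime_loc R' P using P by (intro prime_locI[OF B.is_cring]) simp
  interpret p: prime_loc R "M.pt P" by (rule pt_ploc'[OF P])
  have den: "\<phi> h \<in> carrier R' - P" if "h \<in> carrier R - M.pt P" for h
    using that \<phi>_closed[of h] unfolding pt_eq[OF P] by simp
  obtain u where u: "u \<in> carrier R' - P" "u \<otimes>\<^bsub>R'\<^esub> (\<phi> a \<otimes>\<^bsub>R'\<^esub> \<phi> h) = u \<otimes>\<^bsub>R'\<^esub> (\<phi> b \<otimes>\<^bsub>R'\<^esub> \<phi> g)"
    using eq unfolding P.fr_eq_iff[OF \<phi>_closed[OF a(1)] den[OF a(2)] \<phi>_closed[OF b(1)] den[OF b(2)]] by blast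
  have uc: "u \<in> carrier R'" using u(1) by simp
  obtain c and n :: nat where c: "c \<in> carrier R" "u \<otimes>\<^bsub>R'\<^esub> \<phi> f [^]\<^bsub>R'\<^esub> n = \<phi> c" using frac[OF uc] by blast
  have cP: "c \<in> carrier R - M.pt P" using mem_iff[OF P uc c] u(1) c(1) by simp
  note cl = \<phi>_closed[OF a(1)] \<phi>_closed[OF b(1)] den[OF a(2)] den[OF b(2)] uc
  have Fc: "\<phi> f [^]\<^bsub>R'\<^esub> n \<in> carrier R'" using \<phi>_closed[OF f] by simp
  have "\<phi> (c \<otimes>\<^bsub>R\<^esub> (a \<otimes>\<^bsub>R\<^esub> h)) = (u \<otimes>\<^bsub>R'\<^esub> (\<phi> a \<otimes>\<^bsub>R'\<^esub> \<phi> h)) \<otimes>\<^bsub>R'\<^esub> \<phi> f [^]\<^bsub>R'\<^esub> n"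
    using a b c(1) cl Fc by (simp add: \<phi>_mult c(2)[symmetric] B.m_ac)
  also have "\<dots> = \<phi> (c \<otimes>\<^bsub>R\<^esub> (b \<otimes>\<^bsub>R\<^esub> g))"
    unfolding u(2) using a b c(1) cl Fc by (simp add: \<phi>_mult c(2)[symmetric] B.m_ac)
  finally have "c \<otimes>\<^bsub>R\<^esub> (a \<otimes>\<^bsub>R\<^esub> h) = c \<otimes>\<^bsub>R\<^esub> (b \<otimes>\<^bsub>R\<^esub> g)" using inj a b c(1) unfolding inj_on_def by simp
  then show ?thesis unfolding p.fr_eq_iff[OF a b] using cP by blast
qed

lemma F_inj:
  assumes U: "A.openR U" "U \<subseteq> basic_open R f"
  shows "inj_on (M.F U) (spec_sections R U)"
proof (rule inj_onI)
  fix s t assume s: "s \<in> spec_sections R U" and t: "t \<in> spec_sections R U" and eq: "M.F U s = M.F U t"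
  show "s = t"
  proof (rule A.sections_ext[OF s t])
    fix P assume P: "P \<in> U"
    then obtain P' where P': "P' \<in> primes R'" "P = M.pt P'" using U(2) unfolding pt_image[symmetric] by blast
    interpret p: prime_loc R P unfolding P'(2) by (rule pt_ploc'[OF P'(1)])
    obtain a g where a: "a \<in> carrier R" "g \<in> carrier R - P" "s P = fr R P a g"
      by (rule p.loc_E[OF A.sections_loc[OF U(1) s P]])
    obtain b h where b: "b \<in> carrier R" "h \<in> carrier R - P" "t P = fr R P b h"
      by (rule p.loc_E[OF A.sections_loc[OF U(1) t P]])
    show "s P = t P"
      using F_at[OF U(1) s P'(1), of a g] F_at[OF U(1) t P'(1), of b h] stalk_inj[OF P'(1), of a g b h] a b P P'(2) eq by simp
  qed
qed

lemma F_surj: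
  assumes U: "A.openR U" "U \<subseteq> basic_open R f" and s': "s' \<in> spec_sections R' (M.pre U)"
  shows "\<exists>s\<in>spec_sections R U. M.F U s = s'"
proof -
  \<comment> \<open>At each prime the section over the preimage is a fraction whose numerator and
    denominator come from \<open>R\<close>. Carrying it to \<open>U\<close> prime by prime is
    unambiguous by \<open>stalk_inj\<close>, and \<open>rep\<close> supplies one fraction for a
    whole neighbourhood.\<close>
  define Rp where "Rp P a g \<longleftrightarrow> a \<in> carrier R \<and> g \<in> carrier R - M.pt P \<and> s' P = fr R' P (\<phi> a) (\<phi> g)" for P a g
  define q where "q = inv_into (primes R') M.pt"
  have q: "q P \<in> primes R'" "M.pt (q P) = P" if "P \<in> U" for P
    using U(2) that inv_into_into[of P M.pt "primes R'"] f_inv_into_f[of P M.pt "primes R'"]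
    unfolding q_def pt_image[symmetric] by blast+
  define s where "s = (\<lambda>P\<in>U. let (a, g) = SOME (a, g). Rp (q P) a g in fr R P a g)"
  have qpt: "q (M.pt P') = P'" if "P' \<in> primes R'" for P'
    unfolding q_def using inv_into_f_f[OF pt_inj that] .
  have s_eq: "s P = fr R P a g" if P: "P \<in> U" and r: "Rp (q P) a g" for P a g
  proof -
    obtain b h where bh: "(SOME (a, g). Rp (q P) a g) = (b, h)" by fastforce
    have "case (SOME (a, g). Rp (q P) a g) of (a, g) \<Rightarrow> Rp (q P) a g" by (rule someI[of _ "(a, g)"]) (simp add: r)
    then have r': "Rp (q P) b h" using bh by simp
    have "fr R (M.pt (q P)) b h = fr R (M.pt (q P)) a g"
      by (rule stalk_inj[OF q(1)[OF P]]) (use r r' in \<open>simp_all add: Rp_def\<close>)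
    then show ?thesis using P bh q(2)[OF P] by (simp add: s_def)
  qed
  have rep: "\<exists>W a g. P \<in> W \<and> W \<subseteq> U \<and> A.openR W \<and> a \<in> carrier R \<and> g \<in> carrier R \<and> (\<forall>Q\<in>W. Rp (q Q) a g)" if P: "P \<in> U" for P
  proof -
    have "q P \<in> M.pre U" unfolding pre_iff using q[OF P] P by simp
    from loc_repE[OF s' this] obtain W' y z where W': "q P \<in> W'" "W' \<subseteq> M.pre U" "loc_rep R' s' W' y z" .
    note r = loc_repD[OF W'(3)]
    obtain a and n :: nat where a: "a \<in> carrier R" "y \<otimes>\<^bsub>R'\<^esub> \<phi> f [^]\<^bsub>R'\<^esub> n = \<phi> a" using frac[OF r(2)] by blast
    obtain g and m :: nat where g: "g \<in> carrier R" "z \<otimes>\<^bsub>R'\<^esub> \<phi> f [^]\<^bsub>R'\<^esub> m = \<phi> g" using frac[OF r(3)] by blast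
    define W where "W = M.pt ` W'"
    have W'p: "W' \<subseteq> primes R'" by (rule B.open_primes[OF r(1)])
    have "openin (subtopology (spec_topology R) (basic_open R f)) W"
      unfolding W_def using homeo r(1) homeomorphic_imp_open_map open_map_def by blast
    then have oW: "A.openR W"
      using openin_open_subtopology[OF openin_basic[OF A.is_cring f]] by blast
    \<comment> \<open>\<open>a\<close> and \<open>g\<close> clear the denominators of
      \<open>y\<close> and \<open>z\<close> with different exponents \<open>n\<close> and
      \<open>m\<close>; the crossed powers of \<open>f\<close> balance them, so the fraction is
      still \<open>y / z\<close>.\<close>
    have Rp: "Rp (q Q) (a \<otimes>\<^bsub>R\<^esub> f [^]\<^bsub>R\<^esub> m) (g \<otimes>\<^bsub>R\<^esub> f [^]\<^bsub>R\<^esub> n)" if Q: "Q \<in> W" for Q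
    proof -
      obtain Q' where Q': "Q' \<in> W'" "Q = M.pt Q'" using Q unfolding W_def by blast
      have Qp: "Q' \<in> primes R'" using Q'(1) W'p by blast
      interpret Q: prime_loc R' Q' using Qp by (intro prime_locI[OF B.is_cring]) simp
      note fn = f_not_mem[OF Qp]
      have z: "z \<in> carrier R' - Q'" by (rule r(4)[OF Q'(1)])
      have pg: "\<phi> (g \<otimes>\<^bsub>R\<^esub> f [^]\<^bsub>R\<^esub> n) = (z \<otimes>\<^bsub>R'\<^esub> \<phi> f [^]\<^bsub>R'\<^esub> m) \<otimes>\<^bsub>R'\<^esub> \<phi> f [^]\<^bsub>R'\<^esub> n"
        and pa: "\<phi> (a \<otimes>\<^bsub>R\<^esub> f [^]\<^bsub>R\<^esub> m) = (y \<otimes>\<^bsub>R'\<^esub> \<phi> f [^]\<^bsub>R'\<^esub> n) \<otimes>\<^bsub>R'\<^esub> \<phi> f [^]\<^bsub>R'\<^esub> m"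
        unfolding a(2) g(2) using a(1) g(1) f by (simp_all add: \<phi>_mult \<phi>_pow)
      have d: "\<phi> (g \<otimes>\<^bsub>R\<^esub> f [^]\<^bsub>R\<^esub> n) \<in> carrier R' - Q'"
        unfolding pg by (rule Q.den_mult[OF Q.den_mult[OF z fn] fn])
      have "s' Q' = fr R' Q' (\<phi> (a \<otimes>\<^bsub>R\<^esub> f [^]\<^bsub>R\<^esub> m)) (\<phi> (g \<otimes>\<^bsub>R\<^esub> f [^]\<^bsub>R\<^esub> n))"
        unfolding r(5)[OF Q'(1)]
      proof (rule Q.fr_eqI[OF r(2) z _ d])
        show "\<phi> (a \<otimes>\<^bsub>R\<^esub> f [^]\<^bsub>R\<^esub> m) \<in> carrier R'" using a(1) f by (intro \<phi>_closed) simp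
        show "y \<otimes>\<^bsub>R'\<^esub> \<phi> (g \<otimes>\<^bsub>R\<^esub> f [^]\<^bsub>R\<^esub> n) = \<phi> (a \<otimes>\<^bsub>R\<^esub> f [^]\<^bsub>R\<^esub> m) \<otimes>\<^bsub>R'\<^esub> z"
          unfolding pg pa using r(2,3) fn by (simp add: B.m_ac)
      qed
      moreover have "g \<otimes>\<^bsub>R\<^esub> f [^]\<^bsub>R\<^esub> n \<in> carrier R - M.pt Q'"
        unfolding pt_eq[OF Qp] using d g(1) f by simp
      ultimately show ?thesis unfolding Rp_def Q'(2) qpt[OF Qp] using a(1) f by simp
    qed
    have "P \<in> W" unfolding W_def using W'(1) q(2)[OF P] by force
    moreover have "W \<subseteq> U" unfolding W_def using W'(2) pre_iff by blast
    moreover have "a \<otimes>\<^bsub>R\<^esub> f [^]\<^bsub>R\<^esub> m \<in> carrier R" "g \<otimes>\<^bsub>R\<^esub> f [^]\<^bsub>R\<^esub> n \<in> carrier R" using a(1) g(1) f by simp_all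
    ultimately show ?thesis using oW Rp by metis
  qed
  have s: "s \<in> spec_sections R U"
  proof (rule A.sectionsI)
    fix P assume "P \<in> U"
    from rep[OF this] obtain W a g where W: "P \<in> W" "W \<subseteq> U" "A.openR W" "a \<in> carrier R" "g \<in> carrier R"
      and r: "\<forall>Q\<in>W. Rp (q Q) a g" by blast
    have "loc_rep R s W a g"
    proof (rule A.loc_repI[OF W(3-5)])
      fix Q assume Q: "Q \<in> W"
      have QU: "Q \<in> U" using Q W(2) by blast
      show "g \<in> carrier R - Q" using bspec[OF r Q] q(2)[OF QU] by (simp add: Rp_def)
      show "s Q = fr R Q a g" using s_eq[OF QU] bspec[OF r Q] by blast
    qed
    then show "\<exists>W a f. P \<in> W \<and> W \<subseteq> U \<and> loc_rep R s W a f" using W(1,2) by (intro exI conjI)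
  qed (simp add: s_def)
  have "M.F U s = s'"
  proof (rule B.sections_ext[OF F_sections[OF U(1) s] s'])
    fix P' assume "P' \<in> M.pre U"
    then have P': "P' \<in> primes R'" "M.pt P' \<in> U" by (simp_all only: pre_iff)
    from rep[OF P'(2)] obtain a g where r: "Rp (q (M.pt P')) a g" by blast
    then have r': "Rp P' a g" by (simp only: qpt[OF P'(1)])
    show "M.F U s P' = s' P'"
      using F_at[OF U(1) s P', of a g] s_eq[OF P'(2) r] r' by (simp add: Rp_def)
  qed
  with s show ?thesis by blast
qed

lemma kiso_localization: "kiso k (Spec R' \<iota>') (open_subspace (Spec R \<iota>) (basic_open R f))"
proof -
  let ?D = "basic_open R f"
  have oD: "openin (topol (Spec R \<iota>)) ?D" using openin_basic[OF A.is_cring f] by simp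
  have "kmorphism k (Spec R' \<iota>') (open_subspace (Spec R \<iota>) ?D) (M.pt, M.F)"
    by (rule kmorphism_into_open[OF B.rspace_Spec A.rspace_Spec oD M.kmorphism_F])
      (use pt_image B.pts_Spec in auto)
  moreover have "homeomorphic_map (topol (Spec R' \<iota>')) (topol (open_subspace (Spec R \<iota>) ?D)) M.pt"
    using homeo by (simp add: open_subspace_def)
  moreover have "M.F U \<in> ring_iso (sec (open_subspace (Spec R \<iota>) ?D) U) (sec (Spec R' \<iota>') (M.pre U))"
    if "openin (topol (open_subspace (Spec R \<iota>) ?D)) U" for U
  proof -
    have U: "A.openR U" "U \<subseteq> ?D" using that unfolding openin_open_subspace[OF oD] by simp_all
    have "bij_betw (M.F U) (spec_sections R U) (spec_sections R' (M.pre U))"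
      unfolding bij_betw_def
    proof (intro conjI F_inj[OF U] subset_antisym subsetI)
      show "s' \<in> M.F U ` spec_sections R U" if "s' \<in> spec_sections R' (M.pre U)" for s'
        using F_surj[OF U that] by blast
      show "s' \<in> spec_sections R' (M.pre U)" if "s' \<in> M.F U ` spec_sections R U" for s'
        using that F_sections[OF U(1)] by blast
    qed
    then show ?thesis unfolding ring_iso_def using M.F_hom[OF U(1)] by (simp add: open_subspace_def)
  qed
  ultimately show ?thesis unfolding kiso_def by (intro exI[of _ "(M.pt, M.F)"]) simp
qed

end

text \<open>The kernel contains \<open>f\<close>, and each of its elements has a power divisible by
  \<open>f\<close>. The image of the spectrum is then the zero set of \<open>f\<close>, while the
  scheme structure may differ from that of the quotient by \<open>f\<close>. This is enough for a
  scissor relation, which involves the open complement and some closed subscheme.\<close>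

locale kalg_closed = kalg_hom R k \<iota> R' \<iota>' \<phi>
  for R :: "'a ring" and k :: "'k::field set" and \<iota> and R' :: "'b ring" and \<iota>' and \<phi> +
  fixes f :: 'a
  assumes f: "f \<in> carrier R" and f_zero: "\<phi> f = \<zero>\<^bsub>R'\<^esub>"
    and surj: "\<phi> ` carrier R = carrier R'"
    and nilp: "\<And>a. \<lbrakk>a \<in> carrier R; \<phi> a = \<zero>\<^bsub>R'\<^esub>\<rbrakk> \<Longrightarrow> \<exists>c n. c \<in> carrier R \<and> a [^]\<^bsub>R\<^esub> (n::nat) = c \<otimes>\<^bsub>R\<^esub> f"
begin

lemma lift: "y \<in> carrier R' \<Longrightarrow> \<exists>a. a \<in> carrier R \<and> y = \<phi> a"
  using surj by blast

lemma \<phi>_mem_iff: "\<lbrakk>P \<in> primes R'; a \<in> carrier R\<rbrakk> \<Longrightarrow> \<phi> a \<in> P \<longleftrightarrow> a \<in> M.pt P"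
  by (simp add: pt_eq)

lemma pt_inj: "inj_on M.pt (primes R')"
proof (rule inj_onI)
  fix P P' assume P: "P \<in> primes R'" "P' \<in> primes R'" "M.pt P = M.pt P'"
  interpret P: primeideal P R' using P by simp
  interpret P': primeideal P' R' using P by simp
  have "y \<in> P \<longleftrightarrow> y \<in> P'" if y: "y \<in> carrier R'" for y
  proof -
    obtain a where "a \<in> carrier R" "y = \<phi> a" using lift[OF y] by blast
    then show ?thesis using \<phi>_mem_iff[OF P(1)] \<phi>_mem_iff[OF P(2)] P(3) by simp
  qed
  then show "P = P'" using P.a_subset P'.a_subset by blast
qed

lemma pt_image: "M.pt ` primes R' = primes R - basic_open R f"
proof (rule subset_antisym; rule subsetI)
  fix P assume "P \<in> M.pt ` primes R'"
  then obtain P' where P': "P' \<in> primes R'" "P = M.pt P'" by blast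
  interpret P': primeideal P' R' using P'(1) by simp
  have "f \<in> P" unfolding P'(2) pt_eq[OF P'(1)] using f f_zero P'.zero_closed by simp
  then show "P \<in> primes R - basic_open R f" using M.pt_prime[of P'] P' B.pts_Spec by simp
next
  fix P assume "P \<in> primes R - basic_open R f"
  then have P: "primeideal P R" "f \<in> P" by auto
  interpret P: prime_loc R P using P by (intro prime_locI[OF A.is_cring]) simp
  have pow: "a \<in> P" if "a \<in> carrier R" "a [^]\<^bsub>R\<^esub> n \<in> P" for a and n :: nat
    using that(2)
  proof (induction n)
    case 0
    then show ?case using P.den_one by simp
  next
    case (Suc n)
    then show ?case using P.I_prime[of "a [^]\<^bsub>R\<^esub> n" a] that(1) by auto
  qed
  \<comment> \<open>A prime containing \<open>f\<close> contains the whole kernel, through the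
    powers of its elements; hence it is the preimage of its image.\<close>
  have ker: "a \<in> P" if a: "a \<in> carrier R" "\<phi> a = \<zero>\<^bsub>R'\<^esub>" for a
  proof -
    obtain c and n :: nat where c: "c \<in> carrier R" "a [^]\<^bsub>R\<^esub> n = c \<otimes>\<^bsub>R\<^esub> f" using nilp[OF a] by blast
    have "a [^]\<^bsub>R\<^esub> n \<in> P" unfolding c(2) by (rule P.I_l_closed[OF P(2) c(1)])
    then show ?thesis by (rule pow[OF a(1)])
  qed
  define P' where "P' = \<phi> ` P"
  have Pc: "a \<in> carrier R" if "a \<in> P" for a using P.a_Hcarr[OF that] .
  have P'_iff: "\<phi> a \<in> P' \<longleftrightarrow> a \<in> P" if a: "a \<in> carrier R" for a
  proof
    assume "\<phi> a \<in> P'"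
    then obtain b where b: "b \<in> P" "\<phi> a = \<phi> b" unfolding P'_def by blast
    have bc: "b \<in> carrier R" by (rule Pc[OF b(1)])
    have "\<phi> (a \<oplus>\<^bsub>R\<^esub> (\<ominus>\<^bsub>R\<^esub> \<one>\<^bsub>R\<^esub>) \<otimes>\<^bsub>R\<^esub> b) = \<phi> (b \<oplus>\<^bsub>R\<^esub> (\<ominus>\<^bsub>R\<^esub> \<one>\<^bsub>R\<^esub>) \<otimes>\<^bsub>R\<^esub> b)"
      using a bc b(2) by (simp add: \<phi>_add \<phi>_mult)
    also have "b \<oplus>\<^bsub>R\<^esub> (\<ominus>\<^bsub>R\<^esub> \<one>\<^bsub>R\<^esub>) \<otimes>\<^bsub>R\<^esub> b = \<zero>\<^bsub>R\<^esub>" using bc by (simp add: A.l_minus A.r_neg)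
    finally have d: "a \<oplus>\<^bsub>R\<^esub> (\<ominus>\<^bsub>R\<^esub> \<one>\<^bsub>R\<^esub>) \<otimes>\<^bsub>R\<^esub> b \<in> P" using ker a bc \<phi>_zero by simp
    have "a = (a \<oplus>\<^bsub>R\<^esub> (\<ominus>\<^bsub>R\<^esub> \<one>\<^bsub>R\<^esub>) \<otimes>\<^bsub>R\<^esub> b) \<oplus>\<^bsub>R\<^esub> b" using a bc by (simp add: A.l_minus A.a_assoc A.l_neg)
    also have "\<dots> \<in> P" by (rule P.a_closed[OF d b(1)])
    finally show "a \<in> P" .
  qed (auto simp: P'_def)
  have "primeideal P' R'"
  proof (rule primeidealI)
    show "ideal P' R'"
    proof (rule idealI)
      show "x \<otimes>\<^bsub>R'\<^esub> y \<in> P'" if yx: "y \<in> P'" "x \<in> carrier R'" for x y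
      proof -
        obtain a b where ab: "a \<in> carrier R" "x = \<phi> a" "b \<in> P" "y = \<phi> b" using lift[OF yx(2)] yx(1) by (auto simp: P'_def)
        then have "x \<otimes>\<^bsub>R'\<^esub> y = \<phi> (a \<otimes>\<^bsub>R\<^esub> b)" using Pc by (simp add: \<phi>_mult)
        then show ?thesis using P.I_l_closed[OF ab(3,1)] by (simp add: P'_def)
      qed
      show "y \<otimes>\<^bsub>R'\<^esub> x \<in> P'" if yx: "y \<in> P'" "x \<in> carrier R'" for x y
      proof -
        obtain a b where ab: "a \<in> carrier R" "x = \<phi> a" "b \<in> P" "y = \<phi> b" using lift[OF yx(2)] yx(1) by (auto simp: P'_def)
        then have "y \<otimes>\<^bsub>R'\<^esub> x = \<phi> (b \<otimes>\<^bsub>R\<^esub> a)" using Pc by (simp add: \<phi>_mult)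
        then show ?thesis using P.I_r_closed[OF ab(3,1)] by (simp add: P'_def)
      qed
      show "subgroup P' (add_monoid R')"
      proof (rule subgroup.intro)
        show "P' \<subseteq> carrier (add_monoid R')" using Pc \<phi>_closed by (auto simp: P'_def)
        have "\<zero>\<^bsub>R'\<^esub> \<in> P'" unfolding P'_def \<phi>_zero[symmetric] by (rule imageI) (rule P.zero_closed)
        then show "\<one>\<^bsub>add_monoid R'\<^esub> \<in> P'" by simp
        show "x \<otimes>\<^bsub>add_monoid R'\<^esub> y \<in> P'" if xy: "x \<in> P'" "y \<in> P'" for x y
        proof -
          obtain a b where ab: "a \<in> P" "x = \<phi> a" "b \<in> P" "y = \<phi> b" using xy by (auto simp: P'_def)
          then have "x \<oplus>\<^bsub>R'\<^esub> y = \<phi> (a \<oplus>\<^bsub>R\<^esub> b)" using Pc by (simp add: \<phi>_add)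
          then show ?thesis using P.a_closed[OF ab(1,3)] by (simp add: P'_def)
        qed
        show "inv\<^bsub>add_monoid R'\<^esub> x \<in> P'" if "x \<in> P'" for x
        proof -
          obtain a where a: "a \<in> P" "x = \<phi> a" using \<open>x \<in> P'\<close> by (auto simp: P'_def)
          have "\<ominus>\<^bsub>R\<^esub> a \<in> P" using P.a_inv_closed[OF a(1)] .
          moreover have "\<phi> (\<ominus>\<^bsub>R\<^esub> a) \<oplus>\<^bsub>R'\<^esub> x = \<zero>\<^bsub>R'\<^esub>"
            using Pc[OF a(1)] \<phi>_add[of "\<ominus>\<^bsub>R\<^esub> a" a] by (simp add: a(2) A.l_neg \<phi>_zero)
          then have "\<phi> (\<ominus>\<^bsub>R\<^esub> a) = \<ominus>\<^bsub>R'\<^esub> x"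
            using B.minus_equality[of "\<phi> (\<ominus>\<^bsub>R\<^esub> a)" x] Pc[OF a(1)] \<phi>_closed by (simp add: a(2))
          ultimately show ?thesis unfolding a_inv_def[symmetric] P'_def by (metis imageI)
        qed
      qed
    qed (rule B.ring_axioms)
    show "carrier R' \<noteq> P'" using P'_iff[OF A.one_closed] P.den_one \<phi>_one B.one_closed by (metis DiffD2)
    show "x \<in> P' \<or> y \<in> P'" if xy: "x \<in> carrier R'" "y \<in> carrier R'" "x \<otimes>\<^bsub>R'\<^esub> y \<in> P'" for x y
    proof -
      obtain a where a: "a \<in> carrier R" "x = \<phi> a" using lift[OF xy(1)] by blast
      obtain b where b: "b \<in> carrier R" "y = \<phi> b" using lift[OF xy(2)] by blast
      have "a \<otimes>\<^bsub>R\<^esub> b \<in> P" using P'_iff[of "a \<otimes>\<^bsub>R\<^esub> b"] xy(3) a b by (simp add: \<phi>_mult)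
      then show ?thesis using P.I_prime[OF a(1) b(1)] P'_iff a b by blast
    qed
  qed (rule B.is_cring)
  then have P'p: "P' \<in> primes R'" by simp
  have "M.pt P' = P" unfolding pt_eq[OF P'p] using P'_iff P.a_subset by blast
  then show "P \<in> M.pt ` primes R'" using P'p by blast
qed

lemma embedding: "embedding_map (spec_topology R') (spec_topology R) M.pt"
  unfolding embedding_map_def
proof (rule homeomorphic_map_onto_image)
  show "continuous_map (spec_topology R') (spec_topology R) M.pt" using M.pt_cont by simp
  show "inj_on M.pt (topspace (spec_topology R'))" using pt_inj by (simp only: topspace_spec[OF B.is_cring])
  fix P U assume U: "openin (spec_topology R') U" "P \<in> U"
  obtain y where y: "y \<in> carrier R'" "P \<in> basic_open R' y" "basic_open R' y \<subseteq> U"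
    using bspec[OF U(1)[unfolded openin_spec_iff[OF B.is_cring]] U(2)] by (elim bexE conjE)
  obtain a where a: "a \<in> carrier R" "y = \<phi> a" using lift[OF y(1)] by blast
  have m: "M.pt P' \<in> basic_open R a \<longleftrightarrow> P' \<in> basic_open R' y" if "P' \<in> primes R'" for P'
    using \<phi>_mem_iff[OF that a(1)] a(2) that prime_loc.axioms(2)[OF pt_ploc'[OF that]] by simp
  show "\<exists>V. openin (spec_topology R) V \<and> M.pt P \<in> V \<and> (\<forall>z\<in>topspace (spec_topology R'). M.pt z \<in> V \<longrightarrow> z \<in> U)"
  proof (intro exI[of _ "basic_open R a"] conjI ballI impI)
    show "openin (spec_topology R) (basic_open R a)" by (rule openin_basic[OF A.is_cring a(1)])
    show "M.pt P \<in> basic_open R a" using m[of P] y(2) by simp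
    show "z \<in> U" if "z \<in> topspace (spec_topology R')" "M.pt z \<in> basic_open R a" for z
      using m[of z] that y(3) unfolding topspace_spec[OF B.is_cring] by blast
  qed
qed

lemma stalk_surj:
  assumes P: "P \<in> primes R'"
  shows "stalk_map (Spec R' \<iota>') (M.pt, M.F) P ` carrier (stalk (Spec R \<iota>) (M.pt P)) = carrier (stalk (Spec R' \<iota>') P)"
proof -
  let ?Z = "Spec R' \<iota>'" and ?S = "Spec R \<iota>"
  have pm: "premorphism ?Z ?S (M.pt, M.F)" by (rule kmorphismD(1)[OF B.rspace_Spec A.rspace_Spec M.kmorphism_F])
  have Pp: "P \<in> pts ?Z" using P by (simp only: B.pts_Spec)
  have sm: "stalk_map ?Z (M.pt, M.F) P (germ ?S (M.pt P) V t) = germ ?Z P (M.pre V) (M.F V t)"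
    if "A.openR V" "M.pt P \<in> V" "t \<in> spec_sections R V" for V t
    using stalk_map_germ[OF B.rspace_Spec A.rspace_Spec pm Pp, of V t] that by simp
  show ?thesis
  proof (rule subset_antisym; rule subsetI)
    fix c assume "c \<in> stalk_map ?Z (M.pt, M.F) P ` carrier (stalk ?S (M.pt P))"
    then obtain V t where V: "A.openR V" "M.pt P \<in> V" "t \<in> spec_sections R V"
      and c: "c = stalk_map ?Z (M.pt, M.F) P (germ ?S (M.pt P) V t)"
      unfolding A.S.stalk_carrier by auto
    have "P \<in> M.pre V" unfolding pre_iff using P V(2) by simp
    then show "c \<in> carrier (stalk ?Z P)"
      unfolding c sm[OF V] B.S.stalk_carrier using M.pre_open[OF V(1)] M.F_closed[OF V(1,3)] by blast
  next
    fix c assume "c \<in> carrier (stalk ?Z P)"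
    then obtain U' s' where U': "B.openR U'" "P \<in> U'" "s' \<in> spec_sections R' U'" and c: "c = germ ?Z P U' s'"
      unfolding B.S.stalk_carrier by auto
    obtain W' y z where W': "P \<in> W'" "W' \<subseteq> U'" "loc_rep R' s' W' y z" by (rule loc_repE[OF U'(3,2)])
    note r = loc_repD[OF W'(3)]
    obtain a where a: "a \<in> carrier R" "y = \<phi> a" using lift[OF r(2)] by blast
    obtain g where g: "g \<in> carrier R" "z = \<phi> g" using lift[OF r(3)] by blast
    let ?D = "basic_open R g"
    have oD: "A.openR ?D" by (rule openin_basic[OF A.is_cring g(1)])
    \<comment> \<open>The given germ is a fraction \<open>y / z\<close> near \<open>P\<close>.
      Lifting numerator and denominator along the surjection gives a section over the basic open set
      of \<open>g\<close> that pulls back to it.\<close>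
    define t where "t = (\<lambda>Q\<in>?D. fr R Q a g)"
    have "loc_rep R t ?D a g"
      by (rule A.loc_repI[OF oD a(1) g(1)]) (use g(1) in \<open>simp_all add: t_def\<close>)
    then have t: "t \<in> spec_sections R ?D"
      unfolding t_def by (intro A.sectionsI[OF restrict_extensional] exI conjI) (assumption | rule subset_refl)+
    have W'p: "W' \<subseteq> primes R'" by (rule B.open_primes[OF r(1)])
    have mem: "M.pt Q \<in> ?D" if "Q \<in> W'" for Q
      using r(4)[OF that] \<phi>_mem_iff[of Q g] g that W'p prime_loc.axioms(2)[OF pt_ploc'[of Q]] by auto
    have W'pre: "W' \<subseteq> M.pre ?D" using mem W'p pre_iff by blast
    have eq: "M.F ?D t Q = s' Q" if Q: "Q \<in> W'" for Q
    proof -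
      have Qp: "Q \<in> primes R'" using Q W'p by blast
      show ?thesis
        using F_at[OF oD t Qp mem[OF Q] a(1), of g] mem[OF Q] g r(5)[OF Q] a(2) by (simp add: t_def)
    qed
    have "germ ?Z P (M.pre ?D) (M.F ?D t) = germ ?Z P U' s'"
    proof (subst B.S.germ_eq_iff)
      show "\<exists>W. openin (topol ?Z) W \<and> P \<in> W \<and> W \<subseteq> M.pre ?D \<inter> U' \<and>
        res ?Z (M.pre ?D) W (M.F ?D t) = res ?Z U' W s'"
        using r(1) W'(1,2) W'pre eq by (intro exI[of _ W']) (simp add: restrict_def fun_eq_iff)
    qed (use M.pre_open[OF oD] W'(1) W'pre M.F_closed[OF oD t] U' in auto)
    then have "c = stalk_map ?Z (M.pt, M.F) P (germ ?S (M.pt P) ?D t)" unfolding c sm[OF oD mem[OF W'(1)] t] by simp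
    moreover have "germ ?S (M.pt P) ?D t \<in> carrier (stalk ?S (M.pt P))"
      unfolding A.S.stalk_carrier using oD mem[OF W'(1)] t
      by (intro CollectI exI[of _ ?D] exI[of _ t] conjI) simp_all
    ultimately show "c \<in> stalk_map ?Z (M.pt, M.F) P ` carrier (stalk ?S (M.pt P))" by blast
  qed
qed

lemma closed_immersion_Spec: "closed_immersion k (Spec R' \<iota>') (Spec R \<iota>) (M.pt, M.F)"
  unfolding closed_immersion_def fst_conv
proof (intro conjI ballI)
  show "kmorphism k (Spec R' \<iota>') (Spec R \<iota>) (M.pt, M.F)" by (rule M.kmorphism_F)
  show "embedding_map (topol (Spec R' \<iota>')) (topol (Spec R \<iota>)) M.pt" using embedding by simp
  show "closedin (topol (Spec R \<iota>)) (M.pt ` pts (Spec R' \<iota>'))"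
    unfolding B.pts_Spec pt_image using A.S.pts_open openin_basic[OF A.is_cring f]
    by (simp add: closedin_def topspace_spec[OF A.is_cring] Diff_Diff_Int Int_absorb1 subset_iff)
  show "stalk_map (Spec R' \<iota>') (M.pt, M.F) z ` carrier (stalk (Spec R \<iota>) (M.pt z)) = carrier (stalk (Spec R' \<iota>') z)"
    if "z \<in> pts (Spec R' \<iota>')" for z using stalk_surj that by (simp only: B.pts_Spec)
qed

lemma complement: "pts (Spec R \<iota>) - M.pt ` pts (Spec R' \<iota>') = basic_open R f"
  unfolding B.pts_Spec A.pts_Spec pt_image by auto

end

section \<open>Affine schemes of finite type and their copies on the small types\<close>

lemma generate_ring_image:
  assumes "ring R" "ring R'" "h \<in> ring_hom R R'" "H \<subseteq> carrier R"
  shows "h ` generate_ring R H \<subseteq> generate_ring R' (h ` H)"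
proof
  interpret ring R by fact
  interpret R': ring R' by fact
  note h = assms(3)
  fix y assume "y \<in> h ` generate_ring R H"
  then obtain x where x: "x \<in> generate_ring R H" "y = h x" by blast
  note gc = generate_ring_in_carrier[OF assms(4)]
  have "h x \<in> generate_ring R' (h ` H)" using x(1)
  proof induction
    case one
    then show ?case using generate_ring.one[of R'] ring_hom_one[OF h] by simp
  next
    case (incl x)
    then show ?case by (simp add: generate_ring.incl)
  next
    case (a_inv x)
    have xc: "x \<in> carrier R" using gc a_inv by blast
    have "h (\<ominus>\<^bsub>R\<^esub> x) \<oplus>\<^bsub>R'\<^esub> h x = \<zero>\<^bsub>R'\<^esub>"
      using ring_hom_add[OF h, of "\<ominus>\<^bsub>R\<^esub> x" x] xc ring_hom_zero[OF h assms(1,2)] by (simp add: l_neg)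
    then have "\<ominus>\<^bsub>R'\<^esub> h x = h (\<ominus>\<^bsub>R\<^esub> x)"
      using R'.minus_equality[of "h (\<ominus>\<^bsub>R\<^esub> x)" "h x"] xc ring_hom_closed[OF h] by simp
    then show ?case using generate_ring.a_inv[OF a_inv.IH] by simp
  next
    case (eng_add x y)
    then show ?case using generate_ring.eng_add[OF eng_add.IH] ring_hom_add[OF h] gc by simp
  next
    case (eng_mult x y)
    then show ?case using generate_ring.eng_mult[OF eng_mult.IH] ring_hom_mult[OF h] gc by simp
  qed
  then show "y \<in> generate_ring R' (h ` H)" using x(2) by simp
qed

lemma fg_algebra_image:
  assumes R: "kalg R k \<iota>" and R': "kalg R' k \<iota>'" and h: "h \<in> ring_hom R R'" "h ` carrier R = carrier R'"
    and str: "\<And>c. c \<in> k \<Longrightarrow> h (\<iota> c) = \<iota>' c" and fg: "fg_algebra k R \<iota>"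
  shows "fg_algebra k R' \<iota>'"
proof -
  interpret R: kalg R k \<iota> by fact
  interpret R': kalg R' k \<iota>' by fact
  obtain F where F: "finite F" "F \<subseteq> carrier R" "generate_ring R (\<iota> ` k \<union> F) = carrier R"
    using fg unfolding fg_algebra_def by blast
  have sub: "\<iota> ` k \<union> F \<subseteq> carrier R" using F(2) R.\<iota>_closed by auto
  have e: "h ` (\<iota> ` k \<union> F) = \<iota>' ` k \<union> h ` F" using str by (auto simp: image_Un image_image)
  have "carrier R' \<subseteq> generate_ring R' (\<iota>' ` k \<union> h ` F)"
    using generate_ring_image[OF R.ring_axioms R'.ring_axioms h(1) sub] unfolding F(3) h(2) e .
  moreover have "generate_ring R' (\<iota>' ` k \<union> h ` F) \<subseteq> carrier R'"
    using R'.generate_ring_in_carrier[of "\<iota>' ` k \<union> h ` F"] R'.\<iota>_closed F(2) ring_hom_closed[OF h(1)] by blast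
  ultimately show ?thesis unfolding fg_algebra_def using F(1,2) ring_hom_closed[OF h(1)]
    by (intro exI[of _ "h ` F"]) auto
qed

text \<open>An isomorphism is a localization at 1; thus \<open>kiso_localization\<close> also shows
  that isomorphic algebras have isomorphic spectra.\<close>

lemma kalg_iso_localization:
  assumes R: "kalg R k \<iota>" and R': "kalg R' k \<iota>'" and h: "h \<in> ring_iso R R'"
    and str: "\<And>c. c \<in> k \<Longrightarrow> h (\<iota> c) = \<iota>' c"
  shows "kalg_localization R k \<iota> R' \<iota>' h \<one>\<^bsub>R\<^esub>"
proof -
  interpret R: kalg R k \<iota> by fact
  interpret R': kalg R' k \<iota>' by fact
  have hh: "h \<in> ring_hom R R'" and bij: "bij_betw h (carrier R) (carrier R')" using h by (auto simp: ring_iso_def)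
  show ?thesis
  proof
    show "h \<one>\<^bsub>R\<^esub> \<in> Units R'" using ring_hom_one[OF hh] by simp
    show "inj_on h (carrier R)" using bij by (rule bij_betw_imp_inj_on)
    show "\<exists>a n. a \<in> carrier R \<and> y \<otimes>\<^bsub>R'\<^esub> h \<one>\<^bsub>R\<^esub> [^]\<^bsub>R'\<^esub> (n::nat) = h a" if y: "y \<in> carrier R'" for y
    proof -
      obtain a where "a \<in> carrier R" "y = h a" using bij y unfolding bij_betw_def by blast
      then show ?thesis using y ring_hom_one[OF hh] by (intro exI[of _ a] exI[of _ 0]) simp
    qed
  qed (use hh str in auto)
qed

lemma (in kalg) basic_open_one: "basic_open R \<one> = primes R"
  using prime_loc.den_one[OF prime_locI[OF is_cring]] by auto

text \<open>Both spectra are compared with the open subspace of \<open>Spec R \<iota>\<close> on the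
  basic open set of 1, which consists of all points.\<close>

lemma iso_class_Spec:
  assumes R: "kalg R k \<iota>" and R': "kalg R' k \<iota>'" and h: "h \<in> ring_iso R R'"
    and str: "\<And>c. c \<in> k \<Longrightarrow> h (\<iota> c) = \<iota>' c"
  shows "iso_class k (Spec R \<iota>) = iso_class k (Spec R' \<iota>')"
proof -
  interpret R: kalg R k \<iota> by fact
  interpret R': kalg R' k \<iota>' by fact
  have o: "openin (topol (Spec R \<iota>)) (basic_open R \<one>\<^bsub>R\<^esub>)" using openin_basic[OF R.is_cring R.one_closed] by simp
  have "kiso k (Spec R' \<iota>') (open_subspace (Spec R \<iota>) (basic_open R \<one>\<^bsub>R\<^esub>))"
    by (rule kalg_localization.kiso_localization[OF kalg_iso_localization[OF assms]])
  moreover have "kiso k (Spec R \<iota>) (open_subspace (Spec R \<iota>) (basic_open R \<one>\<^bsub>R\<^esub>))"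
    by (rule kalg_localization.kiso_localization[OF kalg_iso_localization[OF R R ring_iso_set_refl]]) simp
  ultimately show ?thesis
    using iso_class_cong[OF R'.rspace_Spec rspace_open_subspace[OF R.rspace_Spec o]]
      iso_class_cong[OF R.rspace_Spec rspace_open_subspace[OF R.rspace_Spec o]] by simp
qed

text \<open>\<open>affine_open\<close> refers to the ring of sections, not to \<open>R\<close>. For
  a domain the two are identified by \<open>glob\<close>, so the whole space is a single affine open
  set with finitely generated sections.\<close>

lemma (in kalg) finite_type_Spec:
  assumes "domain R" and fg: "fg_algebra k R \<iota>"
  shows "finite_type_scheme k SpR"
proof -
  let ?S = "sec SpR (primes R)" and ?\<iota> = "str (open_subspace SpR (primes R))"
  have str: "?\<iota> c = glob (\<iota> c)" for c
    by (simp add: open_subspace_def glob_def topspace_spec[OF is_cring])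
  have iso: "glob \<in> ring_iso R ?S" unfolding ring_iso_def using glob_hom glob_bij[OF assms(1)] by simp
  interpret S': kalg ?S k ?\<iota>
  proof (rule kalg.intro)
    show "cring ?S" by (rule sec_cring[OF open_primes_all])
    have "glob \<circ> \<iota> \<in> ring_hom (base_ring k) ?S" by (rule ring_hom_trans[OF str_ring_hom glob_hom])
    moreover have "glob \<circ> \<iota> = ?\<iota>" by (rule ext) (simp add: str)
    ultimately show "kalg_axioms ?S k ?\<iota>" unfolding kalg_axioms_def by simp
  qed
  have o: "openin (topol SpR) (primes R)" using open_primes_all by simp
  have loc: "kalg_localization R k \<iota> ?S ?\<iota> glob \<one>"
    by (rule kalg_iso_localization[OF kalg_axioms S'.kalg_axioms iso]) (simp add: str)
  have "kiso k (Spec ?S ?\<iota>) (open_subspace SpR (primes R))"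
    using kalg_localization.kiso_localization[OF loc] unfolding basic_open_one .
  from kiso_sym[OF S'.rspace_Spec rspace_open_subspace[OF rspace_Spec o] this]
  have aff: "affine_open k SpR (primes R)" unfolding affine_open_def using o by simp
  have "fg_algebra k ?S ?\<iota>"
    by (rule fg_algebra_image[OF kalg_axioms S'.kalg_axioms glob_hom _ _ fg])
      (use glob_bij[OF assms(1)] in \<open>simp_all add: str bij_betw_def\<close>)
  moreover have "kscheme k SpR" unfolding kscheme_def using locally_ringed_Spec aff pts_Spec by blast
  ultimately show ?thesis
    unfolding finite_type_scheme_def pts_Spec using aff by (intro conjI exI[of _ "{primes R}"]) simp_all
qed

text \<open>Conditions under which the spectrum has an isomorphic copy among the generators of the
  free group. The injection into \<open>'k\<close> provides a ring on that type, and being a domain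
  gives access to the global sections by \<open>glob_bij\<close>.\<close>

definition small_alg :: "'k::field set \<Rightarrow> 'a ring \<Rightarrow> ('k \<Rightarrow> 'a) \<Rightarrow> bool"
  where "small_alg k R \<iota> \<longleftrightarrow> kalg R k \<iota> \<and> domain R \<and> fg_algebra k R \<iota> \<and> (\<exists>e :: 'a \<Rightarrow> 'k. inj_on e (carrier R))"

lemma small_copy:
  fixes R :: "'a ring" and k :: "'k::field set"
  assumes "small_alg k R \<iota>"
  obtains R0 :: "'k ring" and \<iota>0 e where "kalg R0 k \<iota>0" "domain R0" "fg_algebra k R0 \<iota>0"
    "e \<in> ring_iso R R0" "\<And>c. c \<in> k \<Longrightarrow> e (\<iota> c) = \<iota>0 c"
proof -
  obtain e :: "'a \<Rightarrow> 'k" where e: "inj_on e (carrier R)" and R: "kalg R k \<iota>" "domain R" "fg_algebra k R \<iota>"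
    using assms unfolding small_alg_def by blast
  interpret R: kalg R k \<iota> by fact
  interpret D: domain R by fact
  let ?R = "image_ring e R"
  have iso: "e \<in> ring_iso R ?R" by (rule inj_imp_image_ring_iso[OF e])
  have dom: "domain ?R" by (rule D.inj_imp_image_ring_is_domain[OF e])
  have hom: "e \<in> ring_hom R ?R" and bij: "bij_betw e (carrier R) (carrier ?R)" using iso by (auto simp: ring_iso_def)
  interpret D': domain ?R by fact
  have k': "kalg ?R k (e \<circ> \<iota>)"
    by unfold_locales (rule ring_hom_trans[OF R.str_ring_hom hom])
  have "fg_algebra k ?R (e \<circ> \<iota>)"
    by (rule fg_algebra_image[OF R(1) k' hom _ _ R(3)]) (use bij in \<open>simp_all add: bij_betw_def\<close>)
  then show ?thesis using that[OF k' dom _ iso] by simp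
qed

lemma iso_class_small:
  assumes "small_alg k R \<iota>"
  shows "iso_class k (Spec R \<iota>) \<in> iso_class k ` {S :: ('k::field) small_space. finite_type_scheme k S}"
proof -
  from small_copy[OF assms] obtain R0 :: "'k ring" and \<iota>0 e where R0: "kalg R0 k \<iota>0" "domain R0" "fg_algebra k R0 \<iota>0"
    and e: "e \<in> ring_iso R R0" "\<And>c. c \<in> k \<Longrightarrow> e (\<iota> c) = \<iota>0 c" by metis
  have "kalg R k \<iota>" using assms by (simp add: small_alg_def)
  from iso_class_Spec[OF this R0(1) e] kalg.finite_type_Spec[OF R0] show ?thesis by auto
qed

section \<open>Scissor relations between affine schemes\<close>

text \<open>The generator relation \<open>r\<close> lies in the scissor subgroup, so the coset of
  \<open>s\<close> is the sum of the other two. The assumption \<open>U\<close> places the class of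
  the open complement among the free generators, so that its coset is an element of
  \<open>A\<close>.\<close>

lemma K0_add:
  assumes A: "is_K0_ring k A"
    and S: "finite_type_scheme k (S :: ('k::field) small_space)" and Z: "finite_type_scheme k (Z :: 'k small_space)"
    and i: "closed_immersion k Z S i"
    and U: "iso_class k (open_subspace S (pts S - fst i ` pts Z)) \<in> iso_class k ` {S :: 'k small_space. finite_type_scheme k S}"
  shows "var_class k S = var_class k (open_subspace S (pts S - fst i ` pts Z)) \<oplus>\<^bsub>A\<^esub> var_class k Z"
proof -
  let ?G = "free_var_group k" and ?H = "scissor_subgroup k" and ?U = "open_subspace S (pts S - fst i ` pts Z)"
  let ?I = "iso_class k ` {S :: 'k small_space. finite_type_scheme k S}"
  define s u z where "s = frag_of (iso_class k S)" and "u = frag_of (iso_class k ?U)" and "z = frag_of (iso_class k Z)"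
  have G: "?G = free_Abelian_group ?I" by (simp add: free_var_group_def)
  have carr: "frag_of x \<in> carrier ?G \<longleftrightarrow> x \<in> ?I" for x unfolding G by simp
  have suz: "s \<in> carrier ?G" "u \<in> carrier ?G" "z \<in> carrier ?G"
    unfolding s_def u_def z_def carr using S Z U by auto
  have add: "h + h' \<in> ?H" if "h \<in> ?H" "h' \<in> ?H" for h h'
    using generate.eng[of h ?G _ h'] that unfolding scissor_subgroup_def G by simp
  have zero: "0 \<in> ?H" using generate.one[of ?G] unfolding scissor_subgroup_def G by simp
  define r where "r = s - (u + z)"
  have rel: "r \<in> scissor_relations k"
    unfolding scissor_relations_def r_def s_def u_def z_def using S Z i by blast
  have r: "r \<in> ?H" unfolding scissor_subgroup_def by (rule generate.incl[OF rel])
  \<comment> \<open>Membership in the carrier is what identifies the group inverse of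
    \<open>r\<close> with \<open>- r\<close>.\<close>
  have "r \<in> carrier ?G"
    using suz unfolding r_def G by simp (meson Un_least keys_add keys_diff order_trans)
  then have "inv\<^bsub>?G\<^esub> r = - r" unfolding G by simp
  then have mr: "- r \<in> ?H" using generate.inv[OF rel, of ?G] unfolding scissor_subgroup_def by simp
  have cos: "?H #>\<^bsub>?G\<^esub> x = {h + x | h. h \<in> ?H}" for x
    unfolding r_coset_def G by auto
  have mG: "a \<otimes>\<^bsub>?G\<^esub> b = a + b" for a b unfolding G by simp
  have sum: "(?H #>\<^bsub>?G\<^esub> u) <#>\<^bsub>?G\<^esub> (?H #>\<^bsub>?G\<^esub> z) = ?H #>\<^bsub>?G\<^esub> s"
  proof (rule subset_antisym; rule subsetI)
    fix x assume "x \<in> (?H #>\<^bsub>?G\<^esub> u) <#>\<^bsub>?G\<^esub> (?H #>\<^bsub>?G\<^esub> z)"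
    then obtain a b where ab: "a \<in> ?H #>\<^bsub>?G\<^esub> u" "b \<in> ?H #>\<^bsub>?G\<^esub> z" "x = a + b"
      unfolding set_mult_def mG by blast
    obtain h where h1: "h \<in> ?H" "a = h + u" using ab(1) unfolding cos by blast
    obtain h' where h2: "h' \<in> ?H" "b = h' + z" using ab(2) unfolding cos by blast
    have h: "h \<in> ?H" "h' \<in> ?H" "x = (h + u) + (h' + z)" using h1 h2 ab(3) by simp_all
    then have "x = (h + h' + - r) + s" by (simp add: r_def)
    then show "x \<in> ?H #>\<^bsub>?G\<^esub> s" unfolding cos using add[OF add[OF h(1,2)] mr] by blast
  next
    fix x assume "x \<in> ?H #>\<^bsub>?G\<^esub> s"
    then obtain h where h: "h \<in> ?H" "x = h + s" unfolding cos by blast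
    then have "x = ((h + r) + u) + (0 + z)" by (simp add: r_def)
    moreover have "(h + r) + u \<in> ?H #>\<^bsub>?G\<^esub> u" "0 + z \<in> ?H #>\<^bsub>?G\<^esub> z" unfolding cos using add[OF h(1) r] zero by blast+
    ultimately show "x \<in> (?H #>\<^bsub>?G\<^esub> u) <#>\<^bsub>?G\<^esub> (?H #>\<^bsub>?G\<^esub> z)" unfolding set_mult_def mG by blast
  qed
  have vc: "var_class k S = ?H #>\<^bsub>?G\<^esub> s" "var_class k ?U = ?H #>\<^bsub>?G\<^esub> u" "var_class k Z = ?H #>\<^bsub>?G\<^esub> z"
    unfolding var_class_def s_def u_def z_def by (rule refl)+
  have mem: "?H #>\<^bsub>?G\<^esub> x \<in> carrier A" if "x \<in> carrier ?G" for x
  proof -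
    have "carrier A = carrier (K0_group k)" using A unfolding is_K0_ring_def by blast
    then show ?thesis using that unfolding K0_group_def FactGroup_def RCOSETS_def by auto
  qed
  have "\<forall>a\<in>carrier A. \<forall>b\<in>carrier A. a \<oplus>\<^bsub>A\<^esub> b = a \<otimes>\<^bsub>K0_group k\<^esub> b" using A unfolding is_K0_ring_def by blast
  then have "var_class k ?U \<oplus>\<^bsub>A\<^esub> var_class k Z = (?H #>\<^bsub>?G\<^esub> u) <#>\<^bsub>?G\<^esub> (?H #>\<^bsub>?G\<^esub> z)"
    unfolding vc using mem suz by (simp add: K0_group_def FactGroup_def)
  then show ?thesis unfolding sum vc by simp
qed

text \<open>\<open>scissor_relations\<close> asks for small spaces as whole scheme and closed part,
  so \<open>R\<close> and \<open>R''\<close> are replaced by copies with carrier in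
  \<open>'k\<close>. The open part is then an open subspace of the copy, and \<open>R'\<close>
  enters only through its isomorphism class.\<close>

lemma affine_scissor:
  fixes k :: "'k::field set"
  assumes A: "is_K0_ring k A"
    and loc: "kalg_localization R k \<iota> R' \<iota>' \<phi> f" and cl: "kalg_closed R k \<iota> R'' \<iota>'' \<pi> f"
    and small: "small_alg k R \<iota>" "small_alg k R' \<iota>'" "small_alg k R'' \<iota>''"
  shows "var_class k (Spec R \<iota>) = var_class k (Spec R' \<iota>') \<oplus>\<^bsub>A\<^esub> var_class k (Spec R'' \<iota>'')"
proof -
  interpret L: kalg_localization R k \<iota> R' \<iota>' \<phi> f by fact
  interpret C: kalg_closed R k \<iota> R'' \<iota>'' \<pi> f by fact
  from small_copy[OF small(1)] obtain R0 :: "'k ring" and \<iota>0 e where R0: "kalg R0 k \<iota>0" "domain R0" "fg_algebra k R0 \<iota>0"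
    and e: "e \<in> ring_iso R R0" "\<And>c. c \<in> k \<Longrightarrow> e (\<iota> c) = \<iota>0 c" by metis
  from small_copy[OF small(3)] obtain R2 :: "'k ring" and \<iota>2 d where R2: "kalg R2 k \<iota>2" "domain R2" "fg_algebra k R2 \<iota>2"
    and d: "d \<in> ring_iso R'' R2" "\<And>c. c \<in> k \<Longrightarrow> d (\<iota>'' c) = \<iota>2 c" by metis
  interpret R0: kalg R0 k \<iota>0 by fact
  interpret R2: kalg R2 k \<iota>2 by fact
  define g where "g = inv_into (carrier R) e"
  have g: "g \<in> ring_iso R0 R" unfolding g_def by (rule ring_iso_set_sym[OF L.A.ring_axioms e(1)])
  have eb: "bij_betw e (carrier R) (carrier R0)" using e(1) by (simp add: ring_iso_def)
  have ge: "g (e a) = a" if "a \<in> carrier R" for a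
    unfolding g_def using inv_into_f_f[OF bij_betw_imp_inj_on[OF eb] that] .
  have gh: "g \<in> ring_hom R0 R" and gb: "bij_betw g (carrier R0) (carrier R)" using g by (auto simp: ring_iso_def)
  have eh: "e \<in> ring_hom R R0" using e(1) by (simp add: ring_iso_def)
  have dh: "d \<in> ring_hom R'' R2" and db: "bij_betw d (carrier R'') (carrier R2)" using d(1) by (auto simp: ring_iso_def)
  have gs: "g (\<iota>0 c) = \<iota> c" if "c \<in> k" for c using ge[OF L.A.\<iota>_closed[OF that]] e(2)[OF that] by simp
  note fe = ge[OF L.f] ring_hom_closed[OF eh L.f]
  have loc0: "kalg_localization R0 k \<iota>0 R' \<iota>' (\<phi> \<circ> g) (e f)"
  proof
    show "\<phi> \<circ> g \<in> ring_hom R0 R'" by (rule ring_hom_trans[OF gh L.\<phi>_hom])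
    show "\<exists>a n. a \<in> carrier R0 \<and> y \<otimes>\<^bsub>R'\<^esub> (\<phi> \<circ> g) (e f) [^]\<^bsub>R'\<^esub> (n::nat) = (\<phi> \<circ> g) a" if y: "y \<in> carrier R'" for y
    proof -
      obtain a and n :: nat where a: "a \<in> carrier R" "y \<otimes>\<^bsub>R'\<^esub> \<phi> f [^]\<^bsub>R'\<^esub> n = \<phi> a" using L.frac[OF y] by blast
      then show ?thesis
        using ring_hom_closed[OF eh] fe by (intro exI[of _ "e a"] exI[of _ n]) (simp add: ge)
    qed
    show "inj_on (\<phi> \<circ> g) (carrier R0)"
      using comp_inj_on[OF bij_betw_imp_inj_on[OF gb], of \<phi>] L.inj gb by (simp add: bij_betw_def)
  qed (use fe L.f_unit gs L.\<phi>_str in auto)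
  have cl0: "kalg_closed R0 k \<iota>0 R2 \<iota>2 (d \<circ> (\<pi> \<circ> g)) (e f)"
  proof
    show "d \<circ> (\<pi> \<circ> g) \<in> ring_hom R0 R2" by (rule ring_hom_trans[OF ring_hom_trans[OF gh C.\<phi>_hom] dh])
    have d0: "d \<zero>\<^bsub>R''\<^esub> = \<zero>\<^bsub>R2\<^esub>" by (rule ring_hom_zero[OF dh C.B.ring_axioms R2.ring_axioms])
    show "(d \<circ> (\<pi> \<circ> g)) (e f) = \<zero>\<^bsub>R2\<^esub>" using fe C.f_zero d0 by simp
    show "(d \<circ> (\<pi> \<circ> g)) ` carrier R0 = carrier R2"
      by (simp only: image_comp[symmetric] bij_betw_imp_surj_on[OF gb] C.surj bij_betw_imp_surj_on[OF db])
    show "\<exists>c n. c \<in> carrier R0 \<and> a [^]\<^bsub>R0\<^esub> (n::nat) = c \<otimes>\<^bsub>R0\<^esub> e f"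
      if a: "a \<in> carrier R0" "(d \<circ> (\<pi> \<circ> g)) a = \<zero>\<^bsub>R2\<^esub>" for a
    proof -
      obtain b where b: "b \<in> carrier R" "a = e b" using a(1) eb unfolding bij_betw_def by blast
      have "d (\<pi> b) = d \<zero>\<^bsub>R''\<^esub>" using a(2) b ge d0 by simp
      then have "\<pi> b = \<zero>\<^bsub>R''\<^esub>" using db C.\<phi>_closed[OF b(1)] C.B.zero_closed unfolding bij_betw_def inj_on_def by blast
      then obtain c and n :: nat where c: "c \<in> carrier R" "b [^]\<^bsub>R\<^esub> n = c \<otimes>\<^bsub>R\<^esub> f" using C.nilp[OF b(1)] by blast
      have "e (b [^]\<^bsub>R\<^esub> m) = e b [^]\<^bsub>R0\<^esub> m" for m :: nat
        by (induction m) (use b(1) ring_hom_one[OF eh] ring_hom_mult[OF eh] in simp_all)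
      then have "a [^]\<^bsub>R0\<^esub> n = e c \<otimes>\<^bsub>R0\<^esub> e f" using ring_hom_mult[OF eh c(1) L.f] c(2) b(2) by metis
      then show ?thesis using ring_hom_closed[OF eh c(1)] by blast
    qed
  qed (use fe gs C.\<phi>_str d(2) in auto)
  interpret C0: kalg_closed R0 k \<iota>0 R2 \<iota>2 "d \<circ> (\<pi> \<circ> g)" "e f" by fact
  let ?i = "(C0.M.pt, C0.M.F)" and ?U = "open_subspace (Spec R0 \<iota>0) (basic_open R0 (e f))"
  have oU: "openin (topol (Spec R0 \<iota>0)) (basic_open R0 (e f))" using openin_basic[OF R0.is_cring fe(2)] by simp
  have isoU: "iso_class k ?U = iso_class k (Spec R' \<iota>')"
    using iso_class_cong[OF L.B.rspace_Spec rspace_open_subspace[OF R0.rspace_Spec oU] kalg_localization.kiso_localization[OF loc0]] ..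
  have compl: "pts (Spec R0 \<iota>0) - fst ?i ` pts (Spec R2 \<iota>2) = basic_open R0 (e f)"
    using C0.complement by simp
  have "var_class k (Spec R0 \<iota>0) = var_class k ?U \<oplus>\<^bsub>A\<^esub> var_class k (Spec R2 \<iota>2)"
    using K0_add[OF A kalg.finite_type_Spec[OF R0] kalg.finite_type_Spec[OF R2] C0.closed_immersion_Spec]
      iso_class_small[OF small(2)] unfolding compl isoU by blast
  moreover have "iso_class k (Spec R \<iota>) = iso_class k (Spec R0 \<iota>0)"
    by (rule iso_class_Spec[OF L.A.kalg_axioms R0(1) e])
  moreover have "iso_class k (Spec R'' \<iota>'') = iso_class k (Spec R2 \<iota>2)"
    by (rule iso_class_Spec[OF C.B.kalg_axioms R2(1) d])
  ultimately show ?thesis unfolding var_class_def isoU by simp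
qed

section \<open>Subrings of a type, and notation for finitely supported maps\<close>

abbreviation keys :: "('a \<Rightarrow>\<^sub>0 'b::zero) \<Rightarrow> 'a set" where "keys \<equiv> Poly_Mapping.keys"
abbreviation lookup :: "('a \<Rightarrow>\<^sub>0 'b::zero) \<Rightarrow> 'a \<Rightarrow> 'b" where "lookup \<equiv> Poly_Mapping.lookup"
abbreviation single :: "'a \<Rightarrow> 'b::zero \<Rightarrow> 'a \<Rightarrow>\<^sub>0 'b" where "single \<equiv> Poly_Mapping.single"

type_synonym 'k laurent = "((nat \<Rightarrow>\<^sub>0 int) \<Rightarrow>\<^sub>0 'k)"

abbreviation subalg :: "'a::comm_ring_1 set \<Rightarrow> 'a ring"
  where "subalg C \<equiv> ring_of_type_algebra\<lparr>carrier := C\<rparr>"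

lemma subalg_simps [simp]:
  "carrier (subalg C) = C" "x \<otimes>\<^bsub>subalg C\<^esub> y = x * y" "x \<oplus>\<^bsub>subalg C\<^esub> y = x + y"
  "\<one>\<^bsub>subalg C\<^esub> = 1" "\<zero>\<^bsub>subalg C\<^esub> = 0"
  by (simp_all add: ring_of_type_algebra_def)

lemma type_algebra_simps [simp]:
  "carrier ring_of_type_algebra = UNIV" "x \<otimes>\<^bsub>ring_of_type_algebra\<^esub> y = x * y"
  "x \<oplus>\<^bsub>ring_of_type_algebra\<^esub> y = x + y" "\<one>\<^bsub>ring_of_type_algebra\<^esub> = 1" "\<zero>\<^bsub>ring_of_type_algebra\<^esub> = 0"
  by (simp_all add: ring_of_type_algebra_def)

lemma subalg_pow [simp]: "x [^]\<^bsub>subalg C\<^esub> (n::nat) = x ^ n"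
  by (induction n) (simp_all add: mult.commute)

definition subring_type :: "'a::comm_ring_1 set \<Rightarrow> bool"
  where "subring_type C \<longleftrightarrow> 0 \<in> C \<and> 1 \<in> C \<and> (\<forall>x\<in>C. - x \<in> C) \<and> (\<forall>x\<in>C. \<forall>y\<in>C. x + y \<in> C \<and> x * y \<in> C)"

lemma subalg_cring: "subring_type C \<Longrightarrow> cring (subalg C)"
proof (rule cringI)
  assume C: "subring_type C"
  show "abelian_group (subalg C)"
  proof (rule abelian_groupI)
    show "\<exists>y\<in>carrier (subalg C). y \<oplus>\<^bsub>subalg C\<^esub> x = \<zero>\<^bsub>subalg C\<^esub>" if "x \<in> carrier (subalg C)" for x
      by (rule bexI[of _ "- x"]) (use C that in \<open>simp_all add: subring_type_def\<close>)
  qed (use C in \<open>simp_all add: subring_type_def add_ac\<close>)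
  show "comm_monoid (subalg C)"
    by (rule comm_monoidI) (use C in \<open>simp_all add: subring_type_def mult_ac\<close>)
qed (simp add: distrib_right)

lemma subalg_domain: "subring_type (C :: 'a::idom set) \<Longrightarrow> domain (subalg C)"
  by (rule domain.intro[OF subalg_cring]) (unfold_locales, simp_all)

lemma subalg_minus: "subring_type C \<Longrightarrow> x \<in> C \<Longrightarrow> \<ominus>\<^bsub>subalg C\<^esub> x = - x"
  by (rule abelian_group.minus_equality[OF ring.is_abelian_group[OF cring.axioms(1)[OF subalg_cring]]])
    (simp_all add: subring_type_def)

section \<open>Additive extensions from monomials\<close>

lemma pm_expand: "p = (\<Sum>a\<in>keys p. single a (lookup p a))"
proof (rule poly_mapping_eqI)
  fix b
  have "lookup (\<Sum>a\<in>keys p. single a (lookup p a)) b =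
      (\<Sum>a\<in>keys p. if a = b then lookup p b else 0)"
    unfolding lookup_sum by (rule sum.cong) (simp_all add: lookup_single when_def)
  also have "\<dots> = lookup p b"
    by (simp add: not_in_keys_iff_lookup_eq_zero)
  finally show "lookup p b =
    lookup (\<Sum>a\<in>keys p. single a (lookup p a)) b" ..
qed

text \<open>The additive extension of a map given on monomials. Setting a variable to 0, the torus
  isomorphism, evaluation of polynomials and the group action in coordinates are all of this
  form.\<close>

definition ext :: "('a \<Rightarrow> 'b::zero \<Rightarrow> 'c::comm_monoid_add) \<Rightarrow> ('a \<Rightarrow>\<^sub>0 'b) \<Rightarrow> 'c"
  where "ext h p = (\<Sum>a\<in>keys p. h a (lookup p a))"

lemma ext_superset:
  assumes "finite A" "keys p \<subseteq> A" "\<And>a. h a 0 = 0"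
  shows "ext h p = (\<Sum>a\<in>A. h a (lookup p a))"
  unfolding ext_def
  by (rule sum.mono_neutral_left) (use assms in \<open>auto simp: not_in_keys_iff_lookup_eq_zero\<close>)

lemma ext_zero [simp]: "ext h 0 = 0"
  by (simp add: ext_def)

lemma ext_single: "h a 0 = 0 \<Longrightarrow> ext h (single a c) = h a c"
  by (simp add: ext_def)

lemma ext_add:
  fixes h :: "'a \<Rightarrow> 'b::comm_monoid_add \<Rightarrow> 'c::comm_monoid_add"
  assumes h: "\<And>a. h a 0 = 0" "\<And>a x y. h a (x + y) = h a x + h a y"
  shows "ext h (p + q) = ext h p + ext h q"
proof -
  let ?A = "keys p \<union> keys q"
  have "ext h (p + q) = (\<Sum>a\<in>?A. h a (lookup (p + q) a))"
    by (rule ext_superset[OF _ keys_add]) (simp_all add: h)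
  also have "\<dots> = (\<Sum>a\<in>?A. h a (lookup p a)) + (\<Sum>a\<in>?A. h a (lookup q a))"
    by (simp add: lookup_add h sum.distrib)
  also have "(\<Sum>a\<in>?A. h a (lookup p a)) = ext h p"
    by (rule ext_superset[symmetric]) (use h in auto)
  also have "(\<Sum>a\<in>?A. h a (lookup q a)) = ext h q"
    by (rule ext_superset[symmetric]) (use h in auto)
  finally show ?thesis .
qed

lemma ext_sum:
  fixes h :: "'a \<Rightarrow> 'b::comm_monoid_add \<Rightarrow> 'c::comm_monoid_add"
  assumes h: "\<And>a. h a 0 = 0" "\<And>a x y. h a (x + y) = h a x + h a y"
  shows "ext h (\<Sum>i\<in>A. f i) = (\<Sum>i\<in>A. ext h (f i))"
  by (induction A rule: infinite_finite_induct) (simp_all add: ext_add[OF h])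

lemma mult_expand:
  fixes p q :: "'a::monoid_add \<Rightarrow>\<^sub>0 'b::semiring_0"
  shows "p * q = (\<Sum>a\<in>keys p. \<Sum>b\<in>keys q.
    single (a + b) (lookup p a * lookup q b))"
  by (subst pm_expand[of p], subst pm_expand[of q]) (simp add: sum_product mult_single)

text \<open>Multiplicativity is asked only for exponents in \<open>S\<close>: setting a variable to
  0 respects products of monomials with nonnegative exponents in it, but not the product of the
  variable and its inverse.\<close>

lemma ext_mult:
  fixes h :: "'a::monoid_add \<Rightarrow> 'b::semiring_0 \<Rightarrow> 'c::semiring_0"
  assumes h: "\<And>a. h a 0 = 0" "\<And>a x y. h a (x + y) = h a x + h a y"
    and m: "\<And>a b x y. \<lbrakk>a \<in> S; b \<in> S\<rbrakk> \<Longrightarrow> h (a + b) (x * y) = h a x * h b y"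
    and p: "keys p \<subseteq> S" and q: "keys q \<subseteq> S"
  shows "ext h (p * q) = ext h p * ext h q"
proof -
  have "ext h (p * q) = (\<Sum>a\<in>keys p. \<Sum>b\<in>keys q.
      h (a + b) (lookup p a * lookup q b))"
    unfolding mult_expand by (simp add: ext_sum[OF h] ext_single h)
  also have "\<dots> = (\<Sum>a\<in>keys p. \<Sum>b\<in>keys q.
      h a (lookup p a) * h b (lookup q b))"
    by (intro sum.cong refl m) (use p q in auto)
  also have "\<dots> = ext h p * ext h q" by (simp add: ext_def sum_product)
  finally show ?thesis .
qed

section \<open>Graded algebras of Laurent polynomials\<close>

definition graded :: "(nat \<Rightarrow>\<^sub>0 int) set \<Rightarrow> ((nat \<Rightarrow>\<^sub>0 int) \<Rightarrow> 'k::zero set) \<Rightarrow> 'k laurent set"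
  where "graded S D = {p. \<forall>a\<in>keys p. a \<in> S \<and> lookup p a \<in> D a}"

definition expo :: "nat set \<Rightarrow> nat set \<Rightarrow> (nat \<Rightarrow>\<^sub>0 int) set"
  where "expo I J = {a. keys a \<subseteq> I \<and> (\<forall>i. i \<notin> J \<longrightarrow> 0 \<le> lookup a i)}"

text \<open>For the constant family \<open>k\<close> and \<open>J \<subseteq> I\<close> this is the
  coordinate ring of an affine space times a split torus: polynomials in the variables
  \<open>I\<close> with those in \<open>J\<close> inverted.\<close>

abbreviation galg :: "((nat \<Rightarrow>\<^sub>0 int) \<Rightarrow> 'k::field set) \<Rightarrow> nat set \<Rightarrow> nat set \<Rightarrow> 'k laurent ring"
  where "galg D I J \<equiv> subalg (graded (expo I J) D)"

abbreviation lconst :: "'k::field \<Rightarrow> 'k laurent"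
  where "lconst c \<equiv> single 0 c"

text \<open>\<open>D_inverse\<close> makes every nonzero \<open>D a\<close> a line over
  \<open>k\<close>, because the quotient of two nonzero elements lies in \<open>D 0 = k\<close>.
  \<open>D_N\<close> makes \<open>x_i ^ N\<close> available in every algebra of the family; in the
  application it holds since the characters take values in the \<open>N\<close>-th roots of
  unity.\<close>

locale grading =
  fixes k :: "'k::field_char_0 set" and D :: "(nat \<Rightarrow>\<^sub>0 int) \<Rightarrow> 'k set" and N :: nat
  assumes D_zero: "D 0 = k"
    and D_add: "\<lbrakk>c \<in> D a; d \<in> D a\<rbrakk> \<Longrightarrow> c + d \<in> D a"
    and D_mult: "\<lbrakk>c \<in> D a; d \<in> D b\<rbrakk> \<Longrightarrow> c * d \<in> D (a + b)"
    and D_inverse: "c \<in> D a \<Longrightarrow> inverse c \<in> D (- a)"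
    and k_1: "1 \<in> k" and k_uminus: "c \<in> k \<Longrightarrow> - c \<in> k"
    and D_0: "0 \<in> D a"
    and N_pos: "0 < N" and D_N: "1 \<in> D (single i (int N))"
begin

lemma D_scale: "\<lbrakk>c \<in> k; d \<in> D a\<rbrakk> \<Longrightarrow> c * d \<in> D a"
  using D_mult[of c 0 d a] D_zero by simp

lemma D_uminus: "c \<in> D a \<Longrightarrow> - c \<in> D a"
  using D_scale[of "- 1" c a] k_1 k_uminus by simp

lemma graded_zero: "0 \<in> graded S D" by (simp add: graded_def)

lemma graded_single: "\<lbrakk>a \<in> S; c \<in> D a\<rbrakk> \<Longrightarrow> single a c \<in> graded S D"
  by (simp add: graded_def)

lemma graded_add:
  assumes "p \<in> graded S D" "q \<in> graded S D"
  shows "p + q \<in> graded S D"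
proof -
  have l: "lookup r a \<in> D a" if "r \<in> graded S D" for r a
    using that D_0[of a] by (cases "a \<in> keys r") (auto simp: graded_def not_in_keys_iff_lookup_eq_zero)
  have "a \<in> S \<and> lookup (p + q) a \<in> D a" if "a \<in> keys (p + q)" for a
  proof -
    have "a \<in> S" using that keys_add[of p q] assms by (auto simp: graded_def)
    then show ?thesis using D_add[OF l[OF assms(1)] l[OF assms(2)]] by (simp add: lookup_add)
  qed
  then show ?thesis by (simp add: graded_def)
qed

lemma graded_sum: "(\<And>i. i \<in> A \<Longrightarrow> f i \<in> graded S D) \<Longrightarrow> (\<Sum>i\<in>A. f i) \<in> graded S D"
  by (induction A rule: infinite_finite_induct) (auto simp: graded_zero intro: graded_add)

lemma graded_mult:
  assumes p: "p \<in> graded S D" and q: "q \<in> graded S' D" and S: "\<And>a b. \<lbrakk>a \<in> S; b \<in> S'\<rbrakk> \<Longrightarrow> a + b \<in> S''"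
  shows "p * q \<in> graded S'' D"
  unfolding mult_expand
  by (intro graded_sum graded_single S D_mult) (use p q in \<open>auto simp: graded_def\<close>)

lemma graded_uminus: "p \<in> graded S D \<Longrightarrow> - p \<in> graded S D"
  using D_uminus by (auto simp: graded_def)

lemma expo_add: "\<lbrakk>a \<in> expo I J; b \<in> expo I J\<rbrakk> \<Longrightarrow> a + b \<in> expo I J"
  using keys_add[of a b] by (auto simp: expo_def lookup_add)

lemma expo_zero: "0 \<in> expo I J"
  by (simp add: expo_def)

lemma subring_graded: "subring_type (graded (expo I J) D)"
proof -
  have "1 \<in> graded (expo I J) D"
    using graded_single[of 0 "expo I J" 1] expo_zero k_1 D_zero by simp
  then show ?thesis
    unfolding subring_type_def
    by (intro conjI ballI graded_zero graded_uminus graded_add graded_mult[OF _ _ expo_add])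
qed

lemma kalg_galg: "kalg (galg D I J) k lconst"
proof -
  interpret cring "galg D I J" by (rule subalg_cring[OF subring_graded])
  show ?thesis
  proof
    show "lconst \<in> ring_hom (base_ring k) (galg D I J)"
      by (rule ring_hom_memI)
        (use graded_single[OF expo_zero] D_zero in \<open>auto simp: mult_single single_add\<close>)
  qed
qed

lemma domain_galg: "domain (galg D I J)"
  by (rule subalg_domain[OF subring_graded])

text \<open>A power of \<open>x_i ^ N\<close>, with coefficient 1 allowed for every family. These
  monomials stand in for \<open>x_i\<close>, which need not occur in the algebra.\<close>

definition xN :: "nat \<Rightarrow> int \<Rightarrow> 'k laurent"
  where "xN i z = single (single i (z * int N)) 1"

lemma D_Nz: "1 \<in> D (single i (z * int N))"
proof -
  have p: "1 \<in> D (single i (int n * int N))" for n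
  proof (induction n)
    case 0
    then show ?case using D_zero k_1 by simp
  next
    case (Suc n)
    have "single i (int (Suc n) * int N) =
        single i (int n * int N) + single i (int N)"
      by (simp add: single_add[symmetric] algebra_simps)
    then show ?case using D_mult[OF Suc.IH D_N[of i]] by simp
  qed
  show ?thesis
  proof (cases "0 \<le> z")
    case True
    then show ?thesis using p[of "nat z"] by simp
  next
    case False
    have "single i (z * int N) = - single i (int (nat (- z)) * int N)"
      using False by (simp add: single_uminus[symmetric])
    then show ?thesis using D_inverse[OF p[of "nat (- z)"]] by simp
  qed
qed

lemma xN_mult: "xN i z * xN i w = xN i (z + w)"
  by (simp add: xN_def mult_single single_add[symmetric] distrib_right)

lemma xN_0: "xN i 0 = 1"
  by (simp add: xN_def)

lemma xN_pow: "xN i z ^ n = xN i (int n * z)"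
  by (induction n) (simp_all add: xN_0 xN_mult algebra_simps)

lemma expo_single: "i \<in> I \<Longrightarrow> (i \<in> J \<or> 0 \<le> z) \<Longrightarrow> single i z \<in> expo I J"
  by (auto simp: expo_def lookup_single when_def)

lemma xN_graded: "i \<in> I \<Longrightarrow> (i \<in> J \<or> 0 \<le> z) \<Longrightarrow> xN i z \<in> graded (expo I J) D"
  unfolding xN_def by (rule graded_single[OF expo_single D_Nz]) (auto intro: mult_nonneg_nonneg)

lemma graded_mono: "S \<subseteq> S' \<Longrightarrow> graded S D \<subseteq> graded S' D"
  by (auto simp: graded_def)

lemma localization_galg:
  assumes i: "i \<in> I" "i \<notin> J"
  shows "kalg_localization (galg D I J) k lconst (galg D I (insert i J)) lconst id (xN i 1)"
proof -
  interpret A: kalg "galg D I J" k lconst by (rule kalg_galg)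
  interpret B: kalg "galg D I (insert i J)" k lconst by (rule kalg_galg)
  have sub: "graded (expo I J) D \<subseteq> graded (expo I (insert i J)) D"
    by (rule graded_mono) (auto simp: expo_def)
  show ?thesis
  proof
    show "id \<in> ring_hom (galg D I J) (galg D I (insert i J))"
      by (rule ring_hom_memI) (use sub in auto)
    show "xN i 1 \<in> carrier (galg D I J)" using xN_graded[OF i(1)] by simp
    have "xN i 1 * xN i (- 1) = 1" "xN i (- 1) * xN i 1 = 1" by (simp_all add: xN_mult xN_0)
    moreover have "xN i z \<in> graded (expo I (insert i J)) D" for z by (rule xN_graded) (use i in auto)
    ultimately show "id (xN i 1) \<in> Units (galg D I (insert i J))"
      unfolding Units_def by (intro CollectI conjI bexI[of _ "xN i (- 1)"]) simp_all
    fix y assume "y \<in> carrier (galg D I (insert i J))"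
    then have y: "y \<in> graded (expo I (insert i J)) D" by simp
    \<comment> \<open>\<open>n\<close> bounds the negative exponents of \<open>x_i\<close> in
      \<open>y\<close>. Multiplying by the \<open>n\<close>-th power of \<open>xN i 1\<close> adds
      \<open>n * N\<close>, which is at least \<open>n\<close> as \<open>N\<close> is positive. The
      inserted 0 keeps \<open>Max\<close> meaningful for \<open>y = 0\<close>.\<close>
    define n where "n = Max (insert 0 ((\<lambda>a. nat (- lookup a i)) ` keys y))"
    have n: "- lookup a i \<le> int n" if "a \<in> keys y" for a
    proof -
      have "nat (- lookup a i) \<le> n" unfolding n_def by (rule Max_ge) (use that in auto)
      then show ?thesis by simp
    qed
    have y': "y \<in> graded {a \<in> expo I (insert i J). - int n \<le> lookup a i} D"
      using y n by (fastforce simp: graded_def)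
    have x: "xN i (int n) \<in> graded {single i (int n * int N)} D"
      unfolding xN_def by (rule graded_single[OF _ D_Nz]) simp
    have "y * xN i (int n) \<in> graded (expo I J) D"
    proof (rule graded_mult[OF y' x])
      fix a b assume a: "a \<in> {a \<in> expo I (insert i J). - int n \<le> lookup a i}"
        and b: "b \<in> {single i (int n * int N)}"
      have "int n * 1 \<le> int n * int N" using N_pos by (intro mult_left_mono) auto
      then show "a + b \<in> expo I J"
        using a b i keys_add[of a b] by (auto simp: expo_def lookup_add lookup_single when_def split: if_splits)
    qed
    then show "\<exists>a n. a \<in> carrier (galg D I J) \<and>
      y \<otimes>\<^bsub>galg D I (insert i J)\<^esub> id (xN i 1) [^]\<^bsub>galg D I (insert i J)\<^esub> (n::nat) = id a"
      by (intro exI[of _ "y * xN i (int n)"] exI[of _ n]) (simp add: xN_pow)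
  qed (use sub in auto)
qed

text \<open>Substitution of 0 for \<open>x_i\<close> in elements with nonnegative exponents at
  \<open>i\<close>.\<close>

definition cut :: "nat \<Rightarrow> 'k laurent \<Rightarrow> 'k laurent"
  where "cut i = ext (\<lambda>a c. if lookup a i = 0 then single a c else 0)"

lemma lookup_cut: "lookup (cut i p) a = (if lookup a i = 0 then lookup p a else 0)"
proof -
  have "lookup (cut i p) a = (\<Sum>b\<in>keys p.
      if b = a then (if lookup a i = 0 then lookup p a else 0) else 0)"
    unfolding cut_def ext_def lookup_sum by (rule sum.cong) (auto simp: lookup_single when_def)
  then show ?thesis by (auto simp: not_in_keys_iff_lookup_eq_zero)
qed

text \<open>\<open>cut i\<close> fixes the algebra without \<open>x_i\<close>, hence is onto. An
  element of its kernel has only monomials of degree at least 1 in \<open>x_i\<close>, so those of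
  its \<open>N\<close>-th power have degree at least \<open>N\<close> and are divisible by
  \<open>xN i 1\<close>, although \<open>xN i 1\<close> need not generate the kernel.\<close>

lemma closed_galg:
  assumes i: "i \<in> I" "i \<notin> J"
  shows "kalg_closed (galg D I J) k lconst (galg D (I - {i}) J) lconst (cut i) (xN i 1)"
proof -
  interpret A: kalg "galg D I J" k lconst by (rule kalg_galg)
  interpret B: kalg "galg D (I - {i}) J" k lconst by (rule kalg_galg)
  let ?h = "\<lambda>a c. if lookup a i = 0 then single a c else 0 :: 'k laurent"
  have h: "?h a 0 = 0" "?h a (x + y) = ?h a x + ?h a y" for a x y by (simp_all add: single_add)
  have m: "?h (a + b) (x * y) = ?h a x * ?h b y" if "a \<in> expo I J" "b \<in> expo I J" for a b x y
  proof -
    have "0 \<le> lookup a i" "0 \<le> lookup b i" using that i by (auto simp: expo_def)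
    then show ?thesis by (auto simp: lookup_add mult_single)
  qed
  have keys: "keys p \<subseteq> expo I J" if "p \<in> graded (expo I J) D" for p using that by (auto simp: graded_def)
  have cut_id: "cut i p = p" if "p \<in> graded (expo (I - {i}) J) D" for p
  proof (rule poly_mapping_eqI)
    fix a
    have "lookup a i = 0" if "a \<in> keys p"
    proof -
      have "i \<notin> keys a" using \<open>a \<in> _\<close> \<open>p \<in> _\<close> by (auto simp: graded_def expo_def)
      then show ?thesis by (simp add: in_keys_iff)
    qed
    then show "lookup (cut i p) a = lookup p a"
      unfolding lookup_cut by (auto simp: in_keys_iff)
  qed
  have closed: "cut i p \<in> graded (expo (I - {i}) J) D" if "p \<in> graded (expo I J) D" for p
    using that by (auto simp: graded_def in_keys_iff lookup_cut expo_def split: if_splits)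
  show ?thesis
  proof
    show "cut i \<in> ring_hom (galg D I J) (galg D (I - {i}) J)"
    proof (rule ring_hom_memI)
      have "1 \<in> graded (expo (I - {i}) J) D" using subring_graded[of "I - {i}" J] by (simp add: subring_type_def)
      then show "cut i \<one>\<^bsub>galg D I J\<^esub> = \<one>\<^bsub>galg D (I - {i}) J\<^esub>" using cut_id by simp
      show "cut i (x \<otimes>\<^bsub>galg D I J\<^esub> y) = cut i x \<otimes>\<^bsub>galg D (I - {i}) J\<^esub> cut i y"
        if "x \<in> carrier (galg D I J)" "y \<in> carrier (galg D I J)" for x y
        using ext_mult[of ?h "expo I J" x y, OF h m keys keys] that by (simp add: cut_def)
      show "cut i (x \<oplus>\<^bsub>galg D I J\<^esub> y) = cut i x \<oplus>\<^bsub>galg D (I - {i}) J\<^esub> cut i y"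
        if "x \<in> carrier (galg D I J)" "y \<in> carrier (galg D I J)" for x y
        using ext_add[of ?h x y, OF h] by (simp add: cut_def)
    qed (use closed in simp)
    show "cut i (lconst c) = lconst c" if "c \<in> k" for c
      by (rule cut_id) (use graded_single[OF expo_zero] D_zero that in auto)
    show "xN i 1 \<in> carrier (galg D I J)" using xN_graded[OF i(1)] by simp
    show "cut i (xN i 1) = \<zero>\<^bsub>galg D (I - {i}) J\<^esub>"
      using N_pos by (simp add: cut_def xN_def ext_single[of ?h, OF h(1)])
    have "graded (expo (I - {i}) J) D \<subseteq> graded (expo I J) D" by (rule graded_mono) (auto simp: expo_def)
    then show "cut i ` carrier (galg D I J) = carrier (galg D (I - {i}) J)"
      using closed cut_id by (auto simp: image_iff) (metis subsetD)
    fix p assume "p \<in> carrier (galg D I J)" "cut i p = \<zero>\<^bsub>galg D (I - {i}) J\<^esub>"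
    then have p: "p \<in> graded (expo I J) D" and p0: "cut i p = 0" by simp_all
    let ?S = "\<lambda>m. {a \<in> expo I J. int m \<le> lookup a i}"
    have "1 \<le> lookup a i" if a: "a \<in> keys p" for a
    proof -
      have "lookup a i \<noteq> 0"
        using arg_cong[OF p0, of "\<lambda>q. lookup q a"] a by (auto simp: lookup_cut in_keys_iff split: if_splits)
      moreover have "0 \<le> lookup a i" using keys[OF p] a i by (auto simp: expo_def)
      ultimately show ?thesis by simp
    qed
    then have p1: "p \<in> graded (?S 1) D" using p by (auto simp: graded_def)
    have pn: "p ^ n \<in> graded (?S n) D" for n
    proof (induction n)
      case 0
      show ?case using graded_single[of 0 "?S 0" 1] expo_zero k_1 D_zero by simp
    next
      case (Suc n)
      show ?case unfolding power_Suc
        by (rule graded_mult[OF p1 Suc.IH]) (use expo_add in \<open>auto simp: lookup_add\<close>)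
    qed
    have "p ^ N * xN i (- 1) \<in> graded (expo I J) D"
    proof (rule graded_mult[OF pn])
      show "xN i (- 1) \<in> graded {single i (- int N)} D"
        unfolding xN_def using graded_single[OF _ D_Nz, of i "- 1"] by simp
      show "a + b \<in> expo I J" if "a \<in> ?S N" "b \<in> {single i (- int N)}" for a b
        using that i keys_add[of a b] by (auto simp: expo_def lookup_add lookup_single when_def split: if_splits)
    qed
    moreover have "p ^ N = (p ^ N * xN i (- 1)) * xN i 1" by (simp add: mult.assoc xN_mult xN_0)
    ultimately show "\<exists>c n. c \<in> carrier (galg D I J) \<and>
      p [^]\<^bsub>galg D I J\<^esub> (n::nat) = c \<otimes>\<^bsub>galg D I J\<^esub> xN i 1"
      by (intro exI[of _ "p ^ N * xN i (- 1)"] exI[of _ N]) simp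
  qed
qed

text \<open>A monomial with an exponent beyond \<open>N\<close> in absolute value is a smaller one
  times \<open>x_i ^ N\<close> or its inverse, and the latter has coefficient 1. What remains are
  the finitely many exponents in \<open>B\<close>, and for each of them \<open>D a\<close> is
  spanned by one element over \<open>k\<close>.\<close>

lemma fg_galg:
  assumes I: "finite I"
  shows "fg_algebra k (galg D I J) lconst"
proof -
  interpret A: kalg "galg D I J" k lconst by (rule kalg_galg)
  define B where "B = {a \<in> expo I J. \<forall>i. \<bar>lookup a i\<bar> \<le> int N}"
  have "finite B"
  proof (rule finite_imageD)
    have "lookup ` B \<subseteq> {f. \<forall>x. (x \<in> I \<longrightarrow> f x \<in> {- int N..int N}) \<and> (x \<notin> I \<longrightarrow> f x = 0)}"
      by (auto simp: B_def expo_def abs_le_iff in_keys_iff subset_iff minus_le_iff)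
    then show "finite (lookup ` B)"
      by (rule finite_subset) (rule finite_set_of_finite_funs, use I in auto)
    show "inj_on lookup B" by (simp add: inj_on_def poly_mapping_eqI)
  qed
  \<comment> \<open>A basis of the line \<open>D a\<close>, or 0 if \<open>D a\<close> is
    zero.\<close>
  define c where "c a = (SOME c. c \<in> D a \<and> (D a \<noteq> {0} \<longrightarrow> c \<noteq> 0))" for a
  have c': "c a \<in> D a \<and> (D a \<noteq> {0} \<longrightarrow> c a \<noteq> 0)" for a
  proof -
    have "\<exists>c. c \<in> D a \<and> (D a \<noteq> {0} \<longrightarrow> c \<noteq> 0)" using D_0[of a] by blast
    from someI_ex[OF this] show ?thesis unfolding c_def .
  qed
  have c: "c a \<in> D a" "d \<in> D a \<Longrightarrow> d \<noteq> 0 \<Longrightarrow> c a \<noteq> 0" for a d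
    using c'[of a] by blast+
  define F where "F = (\<lambda>a. single a (c a)) ` B"
  have F: "finite F" "F \<subseteq> graded (expo I J) D"
    unfolding F_def using \<open>finite B\<close> c(1) by (auto simp: B_def intro: graded_single)
  let ?G = "generate_ring (galg D I J) (lconst ` k \<union> F)"
  have add: "x + y \<in> ?G" and mult: "x * y \<in> ?G" if "x \<in> ?G" "y \<in> ?G" for x y
    using generate_ring.eng_add[OF that] generate_ring.eng_mult[OF that] by simp_all
  have zero: "0 \<in> ?G" using A.zero_in_generate[of "lconst ` k \<union> F"] by simp
  have base: "single a d \<in> ?G" if a: "a \<in> B" and d: "d \<in> D a" for a d
  proof (cases "d = 0")
    case False
    have "d * inverse (c a) \<in> k" using D_mult[OF d D_inverse[OF c(1)[of a]]] D_zero by simp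
    then have "lconst (d * inverse (c a)) \<in> ?G" by (intro generate_ring.incl) simp
    moreover have "single a (c a) \<in> ?G" by (rule generate_ring.incl) (simp add: F_def a)
    ultimately have "lconst (d * inverse (c a)) * single a (c a) \<in> ?G" by (rule mult)
    moreover have "d * inverse (c a) * c a = d" using c(2)[OF d False] by (simp add: mult.assoc)
    ultimately show ?thesis by (simp add: mult_single)
  qed (use zero in simp)
  have single: "single a d \<in> ?G" if "a \<in> expo I J" "d \<in> D a" for a d
    using that
  proof (induction "\<Sum>i\<in>I. nat \<bar>lookup a i\<bar>" arbitrary: a rule: less_induct)
    case less
    show ?case
    proof (cases "a \<in> B")
      case False
      then obtain i where i: "int N < \<bar>lookup a i\<bar>" using less.prems(1) by (auto simp: B_def not_le)
      have iI: "i \<in> I" using i less.prems(1) by (auto simp: expo_def in_keys_iff)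
      \<comment> \<open>The sign of the large exponent: subtracting \<open>z * N\<close> moves it
        towards 0 without crossing, since its absolute value exceeds \<open>N\<close>. For
        \<open>i\<close> outside \<open>J\<close> the exponent is nonnegative, so \<open>z\<close>
        is 1 and the split-off factor stays in the algebra.\<close>
      define z :: int where "z = sgn (lookup a i)"
      have z: "z = 1 \<or> z = - 1" "i \<in> J \<or> 0 \<le> z"
        using i less.prems(1) by (auto simp: z_def sgn_if expo_def)
      define b where "b = a + single i (- z * int N)"
      have lb: "lookup b j = (if j = i then lookup a i - z * int N else lookup a j)" for j
        by (auto simp: b_def lookup_add lookup_single when_def)
      have lz: "\<bar>lookup a i - z * int N\<bar> < \<bar>lookup a i\<bar>"
        "0 \<le> lookup a i \<Longrightarrow> 0 \<le> lookup a i - z * int N"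
        using i N_pos by (auto simp: z_def sgn_if)
      have "(\<Sum>j\<in>I. nat \<bar>lookup b j\<bar>) < (\<Sum>j\<in>I. nat \<bar>lookup a j\<bar>)"
        by (rule sum_strict_mono_ex1[OF I]) (use lz(1) iI in \<open>auto simp: lb intro!: bexI[of _ i]\<close>)
      moreover have bE: "b \<in> expo I J"
        using less.prems(1) iI lz(2) by (auto simp: expo_def lb in_keys_iff subset_iff split: if_splits)
      moreover have "d \<in> D b" using D_mult[OF less.prems(2) D_Nz[of i "- z"]] by (simp add: b_def)
      ultimately have "single b d \<in> ?G" using less.hyps by blast
      moreover have "single (single i (z * int N)) 1 \<in> ?G"
      proof (rule base[OF _ D_Nz])
        show "single i (z * int N) \<in> B"
          unfolding B_def using expo_single[OF iI, of J "z * int N"] z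
          by (auto simp: lookup_single when_def)
      qed
      ultimately have "single b d * single (single i (z * int N)) 1 \<in> ?G" by (rule mult)
      moreover have "b + single i (z * int N) = a"
        by (simp add: b_def add.assoc single_add[symmetric])
      ultimately show ?thesis by (simp add: mult_single)
    qed (use base less.prems in blast)
  qed
  have sum: "(\<Sum>i\<in>A. f i) \<in> ?G" if "\<And>i. i \<in> A \<Longrightarrow> f i \<in> ?G" for A and f :: "(nat \<Rightarrow>\<^sub>0 int) \<Rightarrow> 'k laurent"
    using that by (induction A rule: infinite_finite_induct) (auto simp: zero intro: add)
  have "p \<in> ?G" if p: "p \<in> graded (expo I J) D" for p
    by (subst pm_expand, rule sum, rule single) (use p in \<open>auto simp: graded_def\<close>)
  moreover have "?G \<subseteq> carrier (galg D I J)"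
  proof
    fix x assume "x \<in> ?G"
    moreover have "lconst ` k \<union> F \<subseteq> carrier (galg D I J)" using F A.\<iota>_closed by auto
    ultimately show "x \<in> carrier (galg D I J)" using A.generate_ring_in_carrier by blast
  qed
  ultimately have "?G = carrier (galg D I J)" by auto
  then show ?thesis unfolding fg_algebra_def using F by (intro exI[of _ F]) auto
qed

end

lemma inj_graph: "inj (\<lambda>p. (\<lambda>x. (x, lookup p x)) ` keys p)"
proof (rule injI, rule poly_mapping_eqI)
  fix p q :: "'a \<Rightarrow>\<^sub>0 'b" and x
  let ?g = "\<lambda>p :: 'a \<Rightarrow>\<^sub>0 'b. (\<lambda>x. (x, lookup p x)) ` keys p"
  assume eq: "?g p = ?g q"
  have "(x, c) \<in> ?g p \<longleftrightarrow> c \<noteq> 0 \<and> lookup p x = c" for p c by (auto simp: in_keys_iff)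
  then have "c \<noteq> 0 \<and> lookup p x = c \<longleftrightarrow> c \<noteq> 0 \<and> lookup q x = c" for c
    using eq by metis
  then show "lookup p x = lookup q x" by metis
qed

lemma inj_image: "inj f \<Longrightarrow> inj (image f)"
  by (rule injI) (simp add: inj_image_eq_iff)

text \<open>A Laurent polynomial is determined by the graph of its nonzero coefficients, a finite
  set of pairs of an exponent and a scalar. Exponents are countable and \<open>'k\<close> contains
  the natural numbers, so pairs are coded by elements of \<open>'k\<close>, and then finite sets of
  them as well because \<open>'k\<close> is infinite. This is what \<open>small_alg\<close> asks
  for.\<close>

lemma laurent_inj: "\<exists>e :: 'k::field_char_0 laurent \<Rightarrow> 'k. inj e"
proof -
  have infk: "infinite (UNIV :: 'k set)" by (rule infinite_UNIV_char_0)
  have "countable (UNIV :: (nat \<Rightarrow>\<^sub>0 int) set)"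
  proof (rule countable_image_inj_on)
    show "countable ((\<lambda>p :: nat \<Rightarrow>\<^sub>0 int. (\<lambda>x. (x, lookup p x)) ` keys p) ` UNIV)"
      by (rule countable_subset[OF _ countable_Collect_finite]) auto
  qed (rule inj_graph)
  then obtain t :: "(nat \<Rightarrow>\<^sub>0 int) \<Rightarrow> nat" where t: "inj t" by (auto simp: countable_def)
  have "|UNIV \<times> UNIV :: ('k \<times> 'k) set| =o |UNIV :: 'k set|" by (rule card_of_Times_same_infinite[OF infk])
  then obtain w :: "'k \<times> 'k \<Rightarrow> 'k" where w: "inj w" unfolding card_of_ordIso[symmetric] by (auto simp: bij_betw_def)
  define u where "u = (\<lambda>(a, c :: 'k). w (of_nat (t a), c))"
  have u: "inj u"
  proof (rule injI)
    fix x y assume "u x = u y"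
    then have "(of_nat (t (fst x)) :: 'k, snd x) = (of_nat (t (fst y)), snd y)"
      by (intro injD[OF w]) (simp add: u_def case_prod_beta)
    then have "t (fst x) = t (fst y)" "snd x = snd y" by simp_all
    then show "x = y" using injD[OF t, of "fst x" "fst y"] by (simp add: prod_eq_iff)
  qed
  obtain v :: "'k set \<Rightarrow> 'k" where v: "inj_on v (Fpow UNIV)"
    using eqpoll_Fpow[OF infk] unfolding eqpoll_def bij_betw_def by blast
  let ?g = "\<lambda>p :: 'k laurent. (\<lambda>x. (x, lookup p x)) ` keys p"
  have "inj (\<lambda>p. v (u ` ?g p))"
  proof (rule injI)
    fix p q :: "'k laurent" assume "v (u ` ?g p) = v (u ` ?g q)"
    then have "u ` ?g p = u ` ?g q"
      by (rule inj_onD[OF v[unfolded Fpow_def]]) (intro CollectI conjI subset_UNIV finite_imageI finite_keys)+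
    then have "?g p = ?g q" by (rule injD[OF inj_image[OF u]])
    then show "p = q" by (rule injD[OF inj_graph])
  qed
  then show ?thesis by blast
qed

lemma (in grading) small_galg: "finite I \<Longrightarrow> small_alg k (galg D I J) lconst"
proof -
  assume I: "finite I"
  obtain e :: "'k laurent \<Rightarrow> 'k" where "inj e" using laurent_inj by blast
  then have "inj_on e (carrier (galg D I J))" by (rule inj_on_subset) simp
  then show "small_alg k (galg D I J) lconst"
    unfolding small_alg_def using kalg_galg domain_galg fg_galg[OF I] by (intro conjI exI[of _ e])
qed

section \<open>Lattice charts and the splitting of tori\<close>

context grading
begin

definition Z :: "nat \<Rightarrow> (nat \<Rightarrow>\<^sub>0 int) set"
  where "Z m = {a. keys a \<subseteq> {..<m}}"

text \<open>The exponents on the variables \<open>J\<close> that actually occur. They form a group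
  containing \<open>N\<close> times each unit vector of \<open>J\<close>, hence a lattice of full
  rank.\<close>

definition M :: "nat set \<Rightarrow> (nat \<Rightarrow>\<^sub>0 int) set"
  where "M J = {a. keys a \<subseteq> J \<and> (\<exists>c\<in>D a. c \<noteq> 0)}"

lemma MI: "\<lbrakk>keys a \<subseteq> J; c \<in> D a; c \<noteq> 0\<rbrakk> \<Longrightarrow> a \<in> M J"
  unfolding M_def by blast

lemma Z_add: "\<lbrakk>a \<in> Z m; b \<in> Z m\<rbrakk> \<Longrightarrow> a + b \<in> Z m"
  unfolding Z_def using keys_add[of a b] by auto

lemma k_closed: "\<lbrakk>c \<in> k; d \<in> k\<rbrakk> \<Longrightarrow> c + d \<in> k" "\<lbrakk>c \<in> k; d \<in> k\<rbrakk> \<Longrightarrow> c * d \<in> k" "c \<in> k \<Longrightarrow> inverse c \<in> k" "0 \<in> k"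
  using D_add[of c 0 d] D_mult[of c 0 d 0] D_inverse[of c 0] D_0[of 0] by (simp_all add: D_zero)

text \<open>The family of comparison, giving the ordinary Laurent polynomial rings over
  \<open>k\<close>; here 1 already serves as \<open>N\<close>.\<close>

lemma grading_trivial: "grading k (\<lambda>_. k) 1"
  by unfold_locales (simp_all add: k_closed k_1 k_uminus)

lemma D_powi:
  assumes "e \<in> D b"
  shows "e powi z \<in> D (frag_cmul z b)"
proof -
  have p: "e ^ n \<in> D (frag_cmul (int n) b)" for n
  proof (induction n)
    case 0
    then show ?case using D_zero k_1 by simp
  next
    case (Suc n)
    have "frag_cmul (int (Suc n)) b = b + frag_cmul (int n) b"
      using frag_cmul_distrib[of 1 "int n" b] by simp
    then show ?case using D_mult[OF assms Suc.IH] by simp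
  qed
  show ?thesis
  proof (cases "0 \<le> z")
    case True
    then show ?thesis using p[of "nat z"] by (simp add: power_int_def)
  next
    case False
    then have "- frag_cmul (int (nat (- z))) b = frag_cmul z b" by simp
    then show ?thesis using D_inverse[OF p[of "nat (- z)"]] False by (simp add: power_int_def power_inverse)
  qed
qed

text \<open>A basis of the lattice \<open>M J\<close> together with a splitting of the lines over
  it: as \<open>c\<close> is multiplicative, sending the monomial of exponent \<open>a\<close> to
  \<open>c a\<close> times that of exponent \<open>h a\<close> is a ring homomorphism.\<close>

definition chart :: "nat set \<Rightarrow> ((nat \<Rightarrow>\<^sub>0 int) \<Rightarrow> (nat \<Rightarrow>\<^sub>0 int)) \<Rightarrow> ((nat \<Rightarrow>\<^sub>0 int) \<Rightarrow> 'k) \<Rightarrow> bool"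
  where "chart J h c \<longleftrightarrow>
    (\<forall>a\<in>Z (card J). \<forall>b\<in>Z (card J). h (a + b) = h a + h b \<and> c (a + b) = c a * c b) \<and>
    bij_betw h (Z (card J)) (M J) \<and> (\<forall>a\<in>Z (card J). c a \<noteq> 0 \<and> c a \<in> D (h a))"

text \<open>The usual proof that a subgroup of a free abelian group of finite rank is free, by
  induction on the coordinates: the new basis vector has minimal positive
  \<open>i\<close>-coordinate, and division with remainder reduces the rest to \<open>M J\<close>.
  The coefficients follow along, starting from any nonzero element of the line of the new basis
  vector.\<close>

lemma chart_exists:
  assumes "finite J"
  shows "\<exists>h c. chart J h c"
  using assms
proof (induction J rule: finite_induct)
  case empty
  have "Z 0 = {0}" by (auto simp: Z_def)
  moreover have "M {} = {0}" using MI[of 0 "{}" 1] D_zero k_1 by (auto simp: M_def)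
  ultimately have "chart {} (\<lambda>a. a) (\<lambda>_. 1)"
    unfolding chart_def using D_zero k_1 by (simp add: bij_betw_def)
  then show ?case by blast
next
  case (insert i J)
  then obtain h0 c0 where ch: "chart J h0 c0" by blast
  define m where "m = card J"
  have card: "card (insert i J) = Suc m" using insert by (simp add: m_def)
  have h0_add: "h0 (a + b) = h0 a + h0 b" and c0_mult: "c0 (a + b) = c0 a * c0 b"
    if "a \<in> Z m" "b \<in> Z m" for a b using ch that unfolding chart_def m_def by simp_all
  have bij: "bij_betw h0 (Z m) (M J)" using ch unfolding chart_def m_def by simp
  have c0: "c0 a \<noteq> 0" "c0 a \<in> D (h0 a)" if "a \<in> Z m" for a using ch that unfolding chart_def m_def by simp_all
  have h0M: "h0 a \<in> M J" if "a \<in> Z m" for a using bij that unfolding bij_betw_def by blast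
  have h0i: "lookup (h0 a) i = 0" if "a \<in> Z m" for a
  proof -
    have "i \<notin> keys (h0 a)" using h0M[OF that] insert(2) by (auto simp: M_def)
    then show ?thesis by (simp add: in_keys_iff)
  qed
  \<comment> \<open>The positive values of the \<open>i\<close>-coordinate on the lattice;
    \<open>N\<close> is among them, so there is a least one.\<close>
  define P where "P z \<longleftrightarrow> 0 < z \<and> (\<exists>b\<in>M (insert i J). lookup b i = int z)" for z
  have "P N" unfolding P_def
    using N_pos D_N[of i] by (intro conjI bexI[of _ "single i (int N)"] MI[of _ _ 1]) auto
  define d where "d = (LEAST z. P z)"
  have "P d" unfolding d_def by (rule LeastI[where P = P, OF \<open>P N\<close>])
  then obtain b0 where d0: "0 < d" and b0: "b0 \<in> M (insert i J)" "lookup b0 i = int d" unfolding P_def by blast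
  then obtain e where e: "e \<in> D b0" "e \<noteq> 0" unfolding M_def by blast
  have dmin: "\<not> P z" if "z < d" for z using not_less_Least[of z P] that by (simp add: d_def)
  \<comment> \<open>Coordinate \<open>m\<close> of the standard lattice is reserved for the new
    basis vector \<open>b0\<close>; \<open>r\<close> clears it and leads back to the chart of
    \<open>J\<close>.\<close>
  define r where "r a = a - single m (lookup a m)" for a :: "nat \<Rightarrow>\<^sub>0 int"
  have lr: "lookup (r a) j = (if j = m then 0 else lookup a j)" for a j
    by (simp add: r_def lookup_minus lookup_single when_def)
  have rZ: "r a \<in> Z m" if "a \<in> Z (Suc m)" for a
    using that by (auto simp: Z_def lr in_keys_iff subset_iff less_Suc_eq)
  have r_add: "r (a + b) = r a + r b" for a b
    by (rule poly_mapping_eqI) (simp add: lr lookup_add)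
  define h where "h a = h0 (r a) + frag_cmul (lookup a m) b0" for a
  define c where "c a = c0 (r a) * e powi lookup a m" for a
  have cD: "c a \<in> D (h a)" "c a \<noteq> 0" if "a \<in> Z (Suc m)" for a
    unfolding c_def h_def using D_mult[OF c0(2)[OF rZ[OF that]] D_powi[OF e(1)]] c0(1)[OF rZ[OF that]] e(2) by simp_all
  have hM: "h a \<in> M (insert i J)" if "a \<in> Z (Suc m)" for a
  proof (rule MI[OF _ cD[OF that]])
    have "keys (h0 (r a)) \<subseteq> J" using h0M[OF rZ[OF that]] by (simp add: M_def)
    moreover have "keys b0 \<subseteq> insert i J" using b0(1) by (simp add: M_def)
    ultimately show "keys (h a) \<subseteq> insert i J"
      unfolding h_def using keys_add[of "h0 (r a)" "frag_cmul (lookup a m) b0"] keys_cmul by blast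
  qed
  have hi: "lookup (h a) i = lookup a m * int d" if "a \<in> Z (Suc m)" for a
    unfolding h_def using h0i[OF rZ[OF that]] b0(2) by (simp add: lookup_add)
  have "inj_on h (Z (Suc m))"
  proof (rule inj_onI)
    fix a b assume ab: "a \<in> Z (Suc m)" "b \<in> Z (Suc m)" "h a = h b"
    then have m': "lookup a m = lookup b m"
      using hi[OF ab(1)] hi[OF ab(2)] d0 by simp
    then have "h0 (r a) = h0 (r b)" using ab(3) by (simp add: h_def)
    then have "r a = r b" using bij rZ[OF ab(1)] rZ[OF ab(2)] unfolding bij_betw_def inj_on_def by blast
    then show "a = b" using m' by (metis diff_add_cancel r_def)
  qed
  moreover have "x \<in> h ` Z (Suc m)" if x: "x \<in> M (insert i J)" for x
  proof -
    \<comment> \<open>Subtracting the quotient times \<open>b0\<close> leaves the remainder as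
      \<open>i\<close>-coordinate. It is below \<open>d\<close>, hence 0 by minimality, and what is
      left lies in \<open>M J\<close>.\<close>
    define q where "q = lookup x i div int d"
    define y where "y = x - frag_cmul q b0"
    obtain cx where cx: "cx \<in> D x" "cx \<noteq> 0" using x unfolding M_def by blast
    have "cx * inverse (e powi q) \<in> D (x + - frag_cmul q b0)" by (rule D_mult[OF cx(1) D_inverse[OF D_powi[OF e(1)]]])
    then have cy: "cx * inverse (e powi q) \<in> D y" "cx * inverse (e powi q) \<noteq> 0"
      unfolding y_def diff_conv_add_uminus using cx e by simp_all
    have ky: "keys y \<subseteq> insert i J"
      using keys_diff[of x "frag_cmul q b0"] keys_cmul[of q b0] x b0(1) unfolding y_def M_def by blast
    have li: "lookup y i = lookup x i mod int d"
      unfolding y_def q_def using b0(2) by (simp add: lookup_minus minus_div_mult_eq_mod)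
    have "lookup y i = 0"
    proof (rule ccontr)
      assume "lookup y i \<noteq> 0"
      then have "0 < lookup y i" "lookup y i < int d"
        unfolding li using d0 pos_mod_sign[of "int d" "lookup x i"] pos_mod_bound[of "int d" "lookup x i"]
        by (auto simp del: pos_mod_sign pos_mod_bound)
      moreover have "y \<in> M (insert i J)" by (rule MI[OF ky cy])
      ultimately have "P (nat (lookup y i))" "nat (lookup y i) < d" unfolding P_def by auto
      then show False using dmin by blast
    qed
    then have "i \<notin> keys y" by (simp add: in_keys_iff)
    then have "y \<in> M J" using ky by (intro MI[OF _ cy]) blast
    then have "y \<in> h0 ` Z m" unfolding bij_betw_imp_surj_on[OF bij] .
    then obtain a1 where a1: "h0 a1 = y" "a1 \<in> Z m" by (rule imageE) simp
    define a where "a = a1 + single m q"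
    have "m \<notin> keys a1" using a1(2) by (auto simp: Z_def)
    then have lm: "lookup a m = q" by (simp add: a_def lookup_add in_keys_iff)
    have "r a = a1" unfolding r_def lm by (simp add: a_def)
    then have "h a = x" unfolding h_def lm by (simp add: a1 y_def)
    moreover have "a \<in> Z (Suc m)" unfolding a_def
    proof (rule Z_add)
      show "a1 \<in> Z (Suc m)" using a1(2) unfolding Z_def by auto
      show "single m q \<in> Z (Suc m)" unfolding Z_def by simp
    qed
    ultimately show ?thesis by (intro image_eqI[of _ h a]) simp_all
  qed
  ultimately have bij': "bij_betw h (Z (Suc m)) (M (insert i J))"
    unfolding bij_betw_def using hM by (intro conjI subset_antisym image_subsetI subsetI)
  have hom: "h (a + b) = h a + h b \<and> c (a + b) = c a * c b" if ab: "a \<in> Z (Suc m)" "b \<in> Z (Suc m)" for a b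
    using h0_add[OF rZ[OF ab(1)] rZ[OF ab(2)]] c0_mult[OF rZ[OF ab(1)] rZ[OF ab(2)]] e(2)
    by (simp add: h_def c_def r_add lookup_add frag_cmul_distrib power_int_add ac_simps)
  have "chart (insert i J) h c"
    unfolding chart_def card by (intro conjI ballI bij' cD hom[THEN conjunct1] hom[THEN conjunct2])
  then show ?case by blast
qed

lemma expo_self: "expo J J = {a. keys a \<subseteq> J}"
  by (auto simp: expo_def in_keys_iff) (metis in_keys_iff order_refl subsetD)

text \<open>With all variables inverted, the nonzero homogeneous components sit exactly at the
  exponents in \<open>M J\<close>, and each is the line spanned by the corresponding
  \<open>c a\<close>. The chart therefore matches them with the monomials of the standard
  torus.\<close>

lemma torus_iso:
  assumes "finite J"
  obtains \<Phi> where "\<Phi> \<in> ring_iso (galg (\<lambda>_. k) {..<card J} {..<card J}) (galg D J J)" "\<And>c. \<Phi> (lconst c) = lconst c"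
proof -
  obtain h c where ch: "chart J h c" using chart_exists[OF assms] by blast
  define m where "m = card J"
  have h_add: "h (a + b) = h a + h b" and c_mult: "c (a + b) = c a * c b"
    if "a \<in> Z m" "b \<in> Z m" for a b using ch that unfolding chart_def m_def by simp_all
  have bij: "bij_betw h (Z m) (M J)" using ch unfolding chart_def m_def by simp
  have c: "c a \<noteq> 0" "c a \<in> D (h a)" if "a \<in> Z m" for a using ch that unfolding chart_def m_def by simp_all
  have Z0: "0 \<in> Z m" by (simp add: Z_def)
  have h0: "h 0 = 0" using h_add[OF Z0 Z0] by simp
  have c0: "c 0 = 1" using c_mult[OF Z0 Z0] c(1)[OF Z0] by simp
  have hM: "h a \<in> M J" if "a \<in> Z m" for a using bij that unfolding bij_betw_def by blast
  define H where "H a x = single (h a) (c a * x)" for a x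
  have H: "H a 0 = 0" "H a (x + y) = H a x + H a y" for a x y
    by (simp_all add: H_def distrib_left single_add)
  have Hm: "H (a + b) (x * y) = H a x * H b y" if "a \<in> Z m" "b \<in> Z m" for a b x y
    using h_add[OF that] c_mult[OF that] by (simp add: H_def mult_single mult_ac)
  define \<Phi> where "\<Phi> = ext H"
  have eS: "expo {..<m} {..<m} = Z m" "expo J J = {a. keys a \<subseteq> J}" by (simp_all add: expo_self Z_def)
  let ?T = "graded (Z m) (\<lambda>_. k)" and ?R = "graded (expo J J) D"
  have keys: "keys p \<subseteq> Z m" "a \<in> Z m \<Longrightarrow> lookup p a \<in> k" if "p \<in> ?T" for p a
    using that k_closed(4) by (auto simp: graded_def in_keys_iff)
  have closed: "\<Phi> p \<in> ?R" if p: "p \<in> ?T" for p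
    unfolding \<Phi>_def ext_def H_def
  proof (intro graded_sum graded_single)
    fix a assume "a \<in> keys p"
    then have a: "a \<in> Z m" using keys(1)[OF p] by blast
    show "h a \<in> expo J J" using hM[OF a] by (simp add: eS M_def)
    show "c a * lookup p a \<in> D (h a)"
      using D_scale[OF keys(2)[OF p a] c(2)[OF a]] by (simp add: mult.commute)
  qed
  have lookup: "lookup (\<Phi> p) (h a) = c a * lookup p a" if p: "p \<in> ?T" and a: "a \<in> Z m" for p a
  proof -
    have "lookup (\<Phi> p) (h a) = (\<Sum>b\<in>keys p. if b = a then c a * lookup p a else 0)"
      unfolding \<Phi>_def ext_def H_def lookup_sum
    proof (rule sum.cong[OF refl])
      fix b assume "b \<in> keys p"
      then have "b \<in> Z m" using keys(1)[OF p] by blast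
      then have "h b = h a \<longleftrightarrow> b = a" using bij a unfolding bij_betw_def inj_on_def by blast
      then show "lookup (single (h b) (c b * lookup p b)) (h a) =
        (if b = a then c a * lookup p a else 0)" by (auto simp: lookup_single when_def)
    qed
    then show ?thesis by (auto simp: in_keys_iff)
  qed
  have "inj_on \<Phi> ?T"
  proof (rule inj_onI, rule poly_mapping_eqI)
    fix p q a assume p: "p \<in> ?T" and q: "q \<in> ?T" and eq: "\<Phi> p = \<Phi> q"
    show "lookup p a = lookup q a"
    proof (cases "a \<in> Z m")
      case True
      then show ?thesis using lookup[OF p True] lookup[OF q True] eq c(1)[OF True] by simp
    next
      case False
      then have "a \<notin> keys p" "a \<notin> keys q" using keys(1)[OF p] keys(1)[OF q] by auto
      then show ?thesis by (simp add: in_keys_iff)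
    qed
  qed
  moreover have "q \<in> \<Phi> ` ?T" if q: "q \<in> ?R" for q
  proof -
    define g where "g = inv_into (Z m) h"
    have g: "g b \<in> Z m" "h (g b) = b" if "b \<in> keys q" for b
    proof -
      have "b \<in> M J" using that q by (intro MI[of b J "lookup q b"]) (auto simp: graded_def eS in_keys_iff)
      then have "b \<in> h ` Z m" using bij unfolding bij_betw_def by blast
      then show "g b \<in> Z m" "h (g b) = b" unfolding g_def by (rule inv_into_into, rule f_inv_into_f)
    qed
    \<comment> \<open>The coefficients are divided by those of the chart; the quotients have degree
      0 and so lie in \<open>k\<close>.\<close>
    define p where "p = (\<Sum>b\<in>keys q. single (g b) (lookup q b * inverse (c (g b))))"
    have "\<Phi> p = (\<Sum>b\<in>keys q. H (g b) (lookup q b * inverse (c (g b))))"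
      unfolding \<Phi>_def p_def ext_sum[OF H] by (simp add: ext_single H)
    also have "\<dots> = (\<Sum>b\<in>keys q. single b (lookup q b))"
    proof (rule sum.cong[OF refl])
      fix b assume b: "b \<in> keys q"
      have "c (g b) * (lookup q b * inverse (c (g b))) = lookup q b"
        using c(1)[OF g(1)[OF b]] by (simp add: field_simps)
      then show "H (g b) (lookup q b * inverse (c (g b))) = single b (lookup q b)"
        unfolding H_def g(2)[OF b] by (rule arg_cong)
    qed
    also have "\<dots> = q" by (rule pm_expand[symmetric])
    finally have "\<Phi> p = q" .
    moreover have "p \<in> ?T" unfolding p_def
    proof (intro grading.graded_sum[OF grading_trivial] grading.graded_single[OF grading_trivial])
      fix b assume b: "b \<in> keys q"
      show "g b \<in> Z m" by (rule g(1)[OF b])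
      have "lookup q b \<in> D b" using q b by (simp add: graded_def)
      from D_mult[OF this D_inverse[OF c(2)[OF g(1)[OF b]]]]
      show "lookup q b * inverse (c (g b)) \<in> k" by (simp add: g(2)[OF b] D_zero)
    qed
    ultimately show ?thesis by blast
  qed
  ultimately have "bij_betw \<Phi> ?T ?R" unfolding bij_betw_def using closed by blast
  moreover have "\<Phi> (lconst d) = lconst d" for d
    unfolding \<Phi>_def by (simp add: ext_single H) (simp add: H_def h0 c0)
  moreover have "\<Phi> 1 = 1" using \<open>\<Phi> (lconst 1) = lconst 1\<close> by simp
  moreover have "\<Phi> (p + q) = \<Phi> p + \<Phi> q" for p q unfolding \<Phi>_def by (rule ext_add[OF H])
  moreover have "\<Phi> (p * q) = \<Phi> p * \<Phi> q" if "p \<in> ?T" "q \<in> ?T" for p q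
    unfolding \<Phi>_def by (rule ext_mult[OF H Hm keys(1)[OF that(1)] keys(1)[OF that(2)]])
  ultimately have "\<Phi> \<in> ring_iso (subalg ?T) (subalg ?R)"
    using closed by (intro ring_iso_memI) simp_all
  then have "\<Phi> \<in> ring_iso (galg (\<lambda>_. k) {..<card J} {..<card J}) (galg D J J)"
    unfolding eS(1)[unfolded m_def] m_def .
  then show ?thesis by (rule that) fact
qed

lemma torus_class:
  assumes "finite J"
  shows "var_class k (Spec (galg D J J) lconst) = var_class k (Spec (galg (\<lambda>_. k) {..<card J} {..<card J}) lconst)"
proof -
  obtain \<Phi> where "\<Phi> \<in> ring_iso (galg (\<lambda>_. k) {..<card J} {..<card J}) (galg D J J)" "\<And>c. \<Phi> (lconst c) = lconst c"
    using torus_iso[OF assms] by metis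
  from iso_class_Spec[OF grading.kalg_galg[OF grading_trivial] kalg_galg this] show ?thesis
    by (simp add: var_class_def)
qed

end

text \<open>Induction on the number of variables not inverted, for both families at once. Inverting
  a variable and setting it to 0 both lower this number, and the scissor relation adds the two
  classes. When every variable is inverted, both sides are the class of the same standard torus by
  \<open>torus_class\<close>.\<close>

lemma galg_class_eq:
  assumes A: "is_K0_ring k A" and D: "grading k D N" and D': "grading k D' N'"
    and "finite I" "finite I'" "J \<subseteq> I" "J' \<subseteq> I'" "card I = card I'" "card J = card J'"
  shows "var_class k (Spec (galg D I J) lconst) = var_class k (Spec (galg D' I' J') lconst)"
  using assms(4-9)
proof (induction "card (I - J)" arbitrary: I I' J J' rule: less_induct)
  case less
  note fin = less.prems(1,2) and sub = less.prems(3,4) and card = less.prems(5,6)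
  have finJ: "finite J" "finite J'" using fin sub finite_subset by auto
  have cardd: "card (I' - J') = card (I - J)"
    using card card_Diff_subset[OF finJ(1) sub(1)] card_Diff_subset[OF finJ(2) sub(2)] by simp
  show ?case
  proof (cases "I - J = {}")
    case True
    then have "card (I' - J') = 0" using cardd by (simp only: card.empty)
    then have "I' - J' = {}" using fin(2) by simp
    then have "I = J" "I' = J'" using True sub by auto
    then show ?thesis
      using grading.torus_class[OF D finJ(1)] grading.torus_class[OF D' finJ(2)] card by simp
  next
    case False
    then obtain i where i: "i \<in> I" "i \<notin> J" by blast
    have "I' - J' \<noteq> {}" using False cardd fin by (metis card_eq_0_iff finite_Diff)
    then obtain i' where i': "i' \<in> I'" "i' \<notin> J'" by blast
    have lt: "card (I - insert i J) < card (I - J)" "card (I - {i} - J) < card (I - J)"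
      by (rule psubset_card_mono; use i fin in auto)+
    have 1: "var_class k (Spec (galg D I (insert i J)) lconst) = var_class k (Spec (galg D' I' (insert i' J')) lconst)"
      by (rule less.hyps[OF lt(1)]) (use fin finJ sub card i i' in auto)
    have 2: "var_class k (Spec (galg D (I - {i}) J) lconst) = var_class k (Spec (galg D' (I' - {i'}) J') lconst)"
      by (rule less.hyps[OF lt(2)]) (use fin finJ sub card i i' in auto)
    have fin': "finite (I - {i})" "finite (I' - {i'})" using fin by auto
    show ?thesis
      using affine_scissor[OF A grading.localization_galg[OF D i] grading.closed_galg[OF D i]
          grading.small_galg[OF D fin(1)] grading.small_galg[OF D fin(1)] grading.small_galg[OF D fin'(1)]]
        affine_scissor[OF A grading.localization_galg[OF D' i'] grading.closed_galg[OF D' i']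
          grading.small_galg[OF D' fin(2)] grading.small_galg[OF D' fin(2)] grading.small_galg[OF D' fin'(2)]]
      by (simp add: 1 2)
  qed
qed

section \<open>Products\<close>

lemma kmap_eq_sym: "kmap_eq S T m n \<Longrightarrow> kmap_eq S T n m"
  by (simp add: kmap_eq_def)

lemma kmap_eq_trans: "kmap_eq S T m n \<Longrightarrow> kmap_eq S T n l \<Longrightarrow> kmap_eq S T m l"
  by (simp add: kmap_eq_def)

text \<open>The converse passage in the universal property: the induced homomorphism into the global
  sections, to which \<open>spec_map\<close> can then be applied.\<close>

lemma kmorphism_Spec_hom:
  assumes Q: "rspace k Q" and R: "kalg R k \<iota>" and a: "kmorphism k Q (Spec R \<iota>) a"
  shows "snd a (primes R) \<circ> kalg.glob R \<in> ring_hom R (sec Q (pts Q))"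
    and "c \<in> k \<Longrightarrow> (snd a (primes R) \<circ> kalg.glob R) (\<iota> c) = str Q c"
proof -
  interpret R: kalg R k \<iota> by fact
  note D = kmorphismD[OF Q R.rspace_Spec a]
  note pD = premorphismD[OF D(1)]
  have "preimg Q (fst a) (primes R) = pts Q" using preimg_pts[OF pD(1)] by (simp only: R.pts_Spec)
  then show "snd a (primes R) \<circ> R.glob \<in> ring_hom R (sec Q (pts Q))"
    using ring_hom_trans[OF R.glob_hom, of "snd a (primes R)"] pD(2)[of "primes R"] R.open_primes_all by simp
  show "(snd a (primes R) \<circ> R.glob) (\<iota> c) = str Q c" if "c \<in> k"
    using D(2)[OF that] by (simp only: R.pts_Spec R.str_glob comp_def)
qed

lemma kmap_eqD: "\<lbrakk>kmap_eq S T m n; openin (topol T) V; t \<in> carrier (sec T V)\<rbrakk> \<Longrightarrow> snd m V t = snd n V t"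
  by (simp add: kmap_eq_def)

text \<open>A product of affine schemes is the spectrum of a coproduct of algebras; here \<open>'s\<close> is the type
  of the rings of sections against which the coproduct is tested.\<close>

definition coproduct ::
    "'s itself \<Rightarrow> 'k::field set \<Rightarrow> 'a ring \<Rightarrow> ('k \<Rightarrow> 'a) \<Rightarrow> 'b ring \<Rightarrow> ('k \<Rightarrow> 'b) \<Rightarrow> 'c ring \<Rightarrow> ('a \<Rightarrow> 'c) \<Rightarrow> ('b \<Rightarrow> 'c) \<Rightarrow> bool"
  where "coproduct _ k A \<iota>A B \<iota>B C i j \<longleftrightarrow>
    (\<forall>(T :: 's ring) f g. cring T \<and> f \<in> ring_hom A T \<and> g \<in> ring_hom B T \<and> (\<forall>c\<in>k. f (\<iota>A c) = g (\<iota>B c)) \<longrightarrow>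
      (\<exists>h\<in>ring_hom C T. (\<forall>x\<in>carrier A. h (i x) = f x) \<and> (\<forall>x\<in>carrier B. h (j x) = g x) \<and>
        (\<forall>h'\<in>ring_hom C T. (\<forall>x\<in>carrier A. h' (i x) = f x) \<and> (\<forall>x\<in>carrier B. h' (j x) = g x) \<longrightarrow>
          (\<forall>y\<in>carrier C. h' y = h y))))"

lemma coproductE:
  assumes "coproduct TYPE('s) k A \<iota>A B \<iota>B C i j" and "cring (T :: 's ring)" "f \<in> ring_hom A T" "g \<in> ring_hom B T"
    and "\<And>c. c \<in> k \<Longrightarrow> f (\<iota>A c) = g (\<iota>B c)"
  obtains h where "h \<in> ring_hom C T" "\<And>x. x \<in> carrier A \<Longrightarrow> h (i x) = f x" "\<And>x. x \<in> carrier B \<Longrightarrow> h (j x) = g x"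
    "\<And>h' y. \<lbrakk>h' \<in> ring_hom C T; \<And>x. x \<in> carrier A \<Longrightarrow> h' (i x) = f x;
      \<And>x. x \<in> carrier B \<Longrightarrow> h' (j x) = g x; y \<in> carrier C\<rbrakk> \<Longrightarrow> h' y = h y"
proof -
  have "\<exists>h\<in>ring_hom C T. (\<forall>x\<in>carrier A. h (i x) = f x) \<and> (\<forall>x\<in>carrier B. h (j x) = g x) \<and>
        (\<forall>h'\<in>ring_hom C T. (\<forall>x\<in>carrier A. h' (i x) = f x) \<and> (\<forall>x\<in>carrier B. h' (j x) = g x) \<longrightarrow>
          (\<forall>y\<in>carrier C. h' y = h y))"
    by (rule assms(1)[unfolded coproduct_def, rule_format]) (intro conjI assms(2-4) ballI assms(5))
  then show ?thesis by (elim bexE conjE) (rule that, assumption, blast+)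
qed

text \<open>Morphisms from a scheme \<open>Q\<close> to a spectrum correspond to homomorphisms into
  \<open>sec Q (pts Q)\<close>, so the product property is the coproduct property of
  \<open>C\<close> tested on that ring. This determines the type of test rings in
  \<open>cop\<close>.\<close>

lemma is_product_Spec:
  fixes k :: "'k::field set" and A B C :: "'k ring"
  assumes i: "kalg_hom A k \<iota>A C \<iota>C i" and j: "kalg_hom B k \<iota>B C \<iota>C j"
    and cop: "coproduct TYPE('k set \<Rightarrow> ('k \<times> 'k) set) k A \<iota>A B \<iota>B C i j"
  shows "is_product k (Spec A \<iota>A) (Spec B \<iota>B) (Spec C \<iota>C)"
proof -
  interpret I: kalg_hom A k \<iota>A C \<iota>C i by fact
  interpret J: kalg_hom B k \<iota>B C \<iota>C j by fact
  let ?A = "Spec A \<iota>A" and ?B = "Spec B \<iota>B" and ?C = "Spec C \<iota>C"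
  let ?p = "(I.M.pt, I.M.F)" and ?q = "(J.M.pt, J.M.F)"
  have comp_p: "(snd (kmap_comp ?C ?p n) (primes A) \<circ> I.A.glob) x = (snd n (primes C) \<circ> I.B.glob) (i x)"
    if "x \<in> carrier A" for x and n :: "('p, 's, 'k set, 'k set \<Rightarrow> ('k \<times> 'k) set) kmap"
    using I.M.F_glob[OF that] I.M.pre_primes by (simp add: kmap_comp_def I.B.pts_Spec topspace_spec[OF I.B.is_cring])
  have comp_q: "(snd (kmap_comp ?C ?q n) (primes B) \<circ> J.A.glob) x = (snd n (primes C) \<circ> I.B.glob) (j x)"
    if "x \<in> carrier B" for x and n :: "('p, 's, 'k set, 'k set \<Rightarrow> ('k \<times> 'k) set) kmap"
    using J.M.F_glob[OF that] J.M.pre_primes by (simp add: kmap_comp_def I.B.pts_Spec topspace_spec[OF I.B.is_cring])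
  show ?thesis unfolding is_product_def
  proof (rule exI[of _ ?p], rule exI[of _ ?q], intro conjI allI impI I.M.kmorphism_F J.M.kmorphism_F, elim conjE)
    fix Q :: "'k small_space" and a b
    assume Q: "kscheme k Q" and a: "kmorphism k Q ?A a" and b: "kmorphism k Q ?B b"
    have lr: "locally_ringed_space k Q" using Q by (simp add: kscheme_def)
    then have "rspace k Q" by (simp add: locally_ringed_space_def rspace_def)
    then interpret Q: rspace k Q .
    have loc: "\<And>x. x \<in> pts Q \<Longrightarrow> Q.local_at x" using lr unfolding locally_ringed_iff by simp
    define \<theta>a where "\<theta>a = snd a (primes A) \<circ> I.A.glob"
    define \<theta>b where "\<theta>b = snd b (primes B) \<circ> J.A.glob"
    note ha = kmorphism_Spec_hom[OF Q.rspace_axioms I.A.kalg_axioms a, folded \<theta>a_def]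
    note hb = kmorphism_Spec_hom[OF Q.rspace_axioms J.A.kalg_axioms b, folded \<theta>b_def]
    interpret MA: spec_map A k \<iota>A Q \<theta>a by unfold_locales (use loc ha in auto)
    interpret MB: spec_map B k \<iota>B Q \<theta>b by unfold_locales (use loc hb in auto)
    \<comment> \<open>A morphism is recovered, up to \<open>kmap_eq\<close>, from the homomorphism
      it induces; from here on it suffices to compare homomorphisms.\<close>
    have ea: "kmap_eq Q ?A a (MA.pt, MA.F)" by (rule MA.kmorphism_unique[OF a]) (simp add: \<theta>a_def)
    have eb: "kmap_eq Q ?B b (MB.pt, MB.F)" by (rule MB.kmorphism_unique[OF b]) (simp add: \<theta>b_def)
    have fg: "\<theta>a (\<iota>A c) = \<theta>b (\<iota>B c)" if "c \<in> k" for c using ha(2)[OF that] hb(2)[OF that] by simp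
    obtain \<gamma> where \<gamma>: "\<gamma> \<in> ring_hom C (sec Q (pts Q))" "\<And>x. x \<in> carrier A \<Longrightarrow> \<gamma> (i x) = \<theta>a x"
        "\<And>x. x \<in> carrier B \<Longrightarrow> \<gamma> (j x) = \<theta>b x"
      and un: "\<And>h' y. \<lbrakk>h' \<in> ring_hom C (sec Q (pts Q)); \<And>x. x \<in> carrier A \<Longrightarrow> h' (i x) = \<theta>a x;
        \<And>x. x \<in> carrier B \<Longrightarrow> h' (j x) = \<theta>b x; y \<in> carrier C\<rbrakk> \<Longrightarrow> h' y = \<gamma> y"
      by (rule coproductE[OF cop Q.sec_cring[OF Q.pts_open] ha(1) hb(1) fg]) (assumption, rule that, assumption, blast+)
    have \<gamma>s: "\<gamma> (\<iota>C c) = str Q c" if "c \<in> k" for c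
      using \<gamma>(2)[OF I.A.\<iota>_closed[OF that]] I.\<phi>_str[OF that] ha(2)[OF that] by simp
    interpret MC: spec_map C k \<iota>C Q \<gamma> by unfold_locales (use loc \<gamma>(1) \<gamma>s in auto)
    let ?m = "(MC.pt, MC.F)"
    have eqA: "kmap_eq Q ?A n (MA.pt, MA.F)" if "kmorphism k Q ?A n" "\<And>x. x \<in> carrier A \<Longrightarrow> (snd n (primes A) \<circ> I.A.glob) x = \<theta>a x" for n
      by (rule MA.kmorphism_unique[OF that(1)]) (use that(2) in simp)
    have eqB: "kmap_eq Q ?B n (MB.pt, MB.F)" if "kmorphism k Q ?B n" "\<And>x. x \<in> carrier B \<Longrightarrow> (snd n (primes B) \<circ> J.A.glob) x = \<theta>b x" for n
      by (rule MB.kmorphism_unique[OF that(1)]) (use that(2) in simp)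
    show "\<exists>m. (kmorphism k Q ?C m \<and> kmap_eq Q ?A (kmap_comp ?C ?p m) a \<and> kmap_eq Q ?B (kmap_comp ?C ?q m) b) \<and>
      (\<forall>n. kmorphism k Q ?C n \<and> kmap_eq Q ?A (kmap_comp ?C ?p n) a \<and> kmap_eq Q ?B (kmap_comp ?C ?q n) b \<longrightarrow> kmap_eq Q ?C n m)"
    proof (intro exI[of _ ?m] conjI allI impI, goal_cases)
      case 1
      show ?case by (rule MC.kmorphism_F)
    next
      case 2
      have "kmap_eq Q ?A (kmap_comp ?C ?p ?m) (MA.pt, MA.F)"
      proof (rule eqA)
        show "kmorphism k Q ?A (kmap_comp ?C ?p ?m)"
          by (rule kmorphism_comp[OF Q.rspace_axioms I.B.rspace_Spec I.A.rspace_Spec MC.kmorphism_F I.M.kmorphism_F])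
        show "(snd (kmap_comp ?C ?p ?m) (primes A) \<circ> I.A.glob) x = \<theta>a x" if x: "x \<in> carrier A" for x
          unfolding comp_p[OF x] using MC.F_glob[OF I.\<phi>_closed[OF x]] \<gamma>(2)[OF x] by simp
      qed
      then show ?case using ea by (meson kmap_eq_sym kmap_eq_trans)
    next
      case 3
      have "kmap_eq Q ?B (kmap_comp ?C ?q ?m) (MB.pt, MB.F)"
      proof (rule eqB)
        show "kmorphism k Q ?B (kmap_comp ?C ?q ?m)"
          by (rule kmorphism_comp[OF Q.rspace_axioms I.B.rspace_Spec J.A.rspace_Spec MC.kmorphism_F J.M.kmorphism_F])
        show "(snd (kmap_comp ?C ?q ?m) (primes B) \<circ> J.A.glob) x = \<theta>b x" if x: "x \<in> carrier B" for x
          unfolding comp_q[OF x] using MC.F_glob[OF J.\<phi>_closed[OF x]] \<gamma>(3)[OF x] by simp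
      qed
      then show ?case using eb by (meson kmap_eq_sym kmap_eq_trans)
    next
      case (4 n)
      then have n: "kmorphism k Q ?C n" and na: "kmap_eq Q ?A (kmap_comp ?C ?p n) a" and nb: "kmap_eq Q ?B (kmap_comp ?C ?q n) b"
        by auto
      define \<nu> where "\<nu> = snd n (primes C) \<circ> I.B.glob"
      have \<nu>: "\<nu> \<in> ring_hom C (sec Q (pts Q))"
        unfolding \<nu>_def by (rule kmorphism_Spec_hom(1)[OF Q.rspace_axioms I.B.kalg_axioms n])
      have gA: "I.A.glob x \<in> carrier (sec ?A (primes A))" if "x \<in> carrier A" for x by (rule ring_hom_closed[OF I.A.glob_hom that])
      have gB: "J.A.glob x \<in> carrier (sec ?B (primes B))" if "x \<in> carrier B" for x by (rule ring_hom_closed[OF J.A.glob_hom that])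
      have "\<nu> (i x) = \<theta>a x" if x: "x \<in> carrier A" for x
      proof -
        have "snd (kmap_comp ?C ?p n) (primes A) (I.A.glob x) = snd a (primes A) (I.A.glob x)"
          by (rule kmap_eqD[OF na _ gA[OF x]]) (simp add: I.A.open_primes_all)
        then have "(snd (kmap_comp ?C ?p n) (primes A) \<circ> I.A.glob) x = \<theta>a x"
          by (simp only: \<theta>a_def comp_apply)
        moreover have "\<nu> (i x) = (snd (kmap_comp ?C ?p n) (primes A) \<circ> I.A.glob) x"
          unfolding \<nu>_def by (rule comp_p[OF x, symmetric])
        ultimately show ?thesis by (simp only:)
      qed
      moreover have "\<nu> (j x) = \<theta>b x" if x: "x \<in> carrier B" for x
      proof -
        have "snd (kmap_comp ?C ?q n) (primes B) (J.A.glob x) = snd b (primes B) (J.A.glob x)"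
          by (rule kmap_eqD[OF nb _ gB[OF x]]) (simp add: J.A.open_primes_all)
        then have "(snd (kmap_comp ?C ?q n) (primes B) \<circ> J.A.glob) x = \<theta>b x"
          by (simp only: \<theta>b_def comp_apply)
        moreover have "\<nu> (j x) = (snd (kmap_comp ?C ?q n) (primes B) \<circ> J.A.glob) x"
          unfolding \<nu>_def by (rule comp_q[OF x, symmetric])
        ultimately show ?thesis by (simp only:)
      qed
      ultimately have "\<nu> y = \<gamma> y" if "y \<in> carrier C" for y by (rule un[OF \<nu> _ _ that])
      then show ?case by (intro MC.kmorphism_unique[OF n]) (simp add: \<nu>_def)
    qed
  qed
qed

lemma coproduct_iso:
  assumes cop: "coproduct TYPE('s) k A \<iota>A B \<iota>B C i j"
    and R: "ring A" "ring B" "ring C" and i: "i \<in> ring_hom A C" and j: "j \<in> ring_hom B C"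
    and cA: "\<And>c. c \<in> k \<Longrightarrow> \<iota>A c \<in> carrier A" and cB: "\<And>c. c \<in> k \<Longrightarrow> \<iota>B c \<in> carrier B"
    and a: "a \<in> ring_iso A A0" and b: "b \<in> ring_iso B B0" and c: "c \<in> ring_iso C C0"
    and sA: "\<And>x. x \<in> k \<Longrightarrow> a (\<iota>A x) = \<iota>A0 x" and sB: "\<And>x. x \<in> k \<Longrightarrow> b (\<iota>B x) = \<iota>B0 x"
  shows "coproduct TYPE('s) k A0 \<iota>A0 B0 \<iota>B0 C0 (c \<circ> i \<circ> inv_into (carrier A) a) (c \<circ> j \<circ> inv_into (carrier B) b)"
  unfolding coproduct_def
proof (intro allI impI, elim conjE)
  fix T :: "'s ring" and f g
  assume T: "cring T" and f: "f \<in> ring_hom A0 T" and g: "g \<in> ring_hom B0 T" and fg: "\<forall>c\<in>k. f (\<iota>A0 c) = g (\<iota>B0 c)"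
  let ?a = "inv_into (carrier A) a" and ?b = "inv_into (carrier B) b" and ?c = "inv_into (carrier C) c"
  have ah: "a \<in> ring_hom A A0" "bij_betw a (carrier A) (carrier A0)" using a by (auto simp: ring_iso_def)
  have bh: "b \<in> ring_hom B B0" "bij_betw b (carrier B) (carrier B0)" using b by (auto simp: ring_iso_def)
  have ch: "c \<in> ring_hom C C0" "bij_betw c (carrier C) (carrier C0)" using c by (auto simp: ring_iso_def)
  have c': "?c \<in> ring_hom C0 C" using ring_iso_set_sym[OF R(3) c] by (simp add: ring_iso_def)
  have inv: "?a (a x) = x" "?b (b y) = y" "?c (c z) = z" if "x \<in> carrier A" "y \<in> carrier B" "z \<in> carrier C" for x y z
    using that ah(2) bh(2) ch(2) by (auto simp: bij_betw_def)
  have sub: "?a x \<in> carrier A" "a (?a x) = x" if "x \<in> carrier A0" for x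
    using that ah(2) by (auto simp: bij_betw_def inv_into_into f_inv_into_f)
  have subB: "?b x \<in> carrier B" "b (?b x) = x" if "x \<in> carrier B0" for x
    using that bh(2) by (auto simp: bij_betw_def inv_into_into f_inv_into_f)
  have subC: "?c x \<in> carrier C" "c (?c x) = x" if "x \<in> carrier C0" for x
    using that ch(2) by (auto simp: bij_betw_def inv_into_into f_inv_into_f)
  have fgc: "(f \<circ> a) (\<iota>A x) = (g \<circ> b) (\<iota>B x)" if "x \<in> k" for x using fg sA sB that by simp
  obtain h where h: "h \<in> ring_hom C T" "\<And>x. x \<in> carrier A \<Longrightarrow> h (i x) = (f \<circ> a) x" "\<And>x. x \<in> carrier B \<Longrightarrow> h (j x) = (g \<circ> b) x"
    and un: "\<And>h' y. \<lbrakk>h' \<in> ring_hom C T; \<And>x. x \<in> carrier A \<Longrightarrow> h' (i x) = (f \<circ> a) x;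
        \<And>x. x \<in> carrier B \<Longrightarrow> h' (j x) = (g \<circ> b) x; y \<in> carrier C\<rbrakk> \<Longrightarrow> h' y = h y"
    by (rule coproductE[OF cop T ring_hom_trans[OF ah(1) f] ring_hom_trans[OF bh(1) g] fgc]) (assumption, rule that, assumption, blast+)
  have ic: "i x \<in> carrier C" if "x \<in> carrier A" for x by (rule ring_hom_closed[OF i that])
  have jc: "j x \<in> carrier C" if "x \<in> carrier B" for x by (rule ring_hom_closed[OF j that])
  have invC: "?c (c z) = z" if "z \<in> carrier C" for z using that ch(2) by (auto simp: bij_betw_def)
  have invA: "?a (a z) = z" if "z \<in> carrier A" for z using that ah(2) by (auto simp: bij_betw_def)
  have invB: "?b (b z) = z" if "z \<in> carrier B" for z using that bh(2) by (auto simp: bij_betw_def)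
  have acl: "a x \<in> carrier A0" if "x \<in> carrier A" for x by (rule ring_hom_closed[OF ah(1) that])
  have bcl: "b x \<in> carrier B0" if "x \<in> carrier B" for x by (rule ring_hom_closed[OF bh(1) that])
  show "\<exists>h\<in>ring_hom C0 T. (\<forall>x\<in>carrier A0. h ((c \<circ> i \<circ> ?a) x) = f x) \<and> (\<forall>x\<in>carrier B0. h ((c \<circ> j \<circ> ?b) x) = g x) \<and>
        (\<forall>h'\<in>ring_hom C0 T. (\<forall>x\<in>carrier A0. h' ((c \<circ> i \<circ> ?a) x) = f x) \<and> (\<forall>x\<in>carrier B0. h' ((c \<circ> j \<circ> ?b) x) = g x) \<longrightarrow>
          (\<forall>y\<in>carrier C0. h' y = h y))"
  proof (intro bexI[of _ "h \<circ> ?c"] conjI ballI impI, goal_cases)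
    case (1 x)
    then show ?case using h(2) sub[OF 1] invC[OF ic[OF sub(1)[OF 1]]] by simp
  next
    case (2 x)
    then show ?case using h(3) subB[OF 2] invC[OF jc[OF subB(1)[OF 2]]] by simp
  next
    case (3 h' y)
    have "h' \<circ> c \<in> ring_hom C T" by (rule ring_hom_trans[OF ch(1) 3(1)])
    moreover have "(h' \<circ> c) (i x) = (f \<circ> a) x" if x: "x \<in> carrier A" for x
      using 3(2) acl[OF x] invA[OF x] by fastforce
    moreover have "(h' \<circ> c) (j x) = (g \<circ> b) x" if x: "x \<in> carrier B" for x
      using 3(2) bcl[OF x] invB[OF x] by fastforce
    ultimately have "(h' \<circ> c) (?c y) = h (?c y)" by (rule un[OF _ _ _ subC(1)[OF 3(3)]])
    then show ?case using subC(2)[OF 3(3)] by simp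
  next
    case 4
    show ?case by (rule ring_hom_trans[OF c' h(1)])
  qed
qed

text \<open>The product of \<open>K0\<close> is described on small spaces, so the three algebras and
  the two maps of the coproduct are first moved to copies with carrier in \<open>'k\<close>.\<close>

lemma var_class_mult:
  fixes k :: "'k::field set"
  assumes K: "is_K0_ring k K0" and small: "small_alg k A \<iota>A" "small_alg k B \<iota>B" "small_alg k C \<iota>C"
    and i: "kalg_hom A k \<iota>A C \<iota>C i" and j: "kalg_hom B k \<iota>B C \<iota>C j"
    and cop: "coproduct TYPE('k set \<Rightarrow> ('k \<times> 'k) set) k A \<iota>A B \<iota>B C i j"
  shows "var_class k (Spec A \<iota>A) \<otimes>\<^bsub>K0\<^esub> var_class k (Spec B \<iota>B) = var_class k (Spec C \<iota>C)"
proof -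
  interpret I: kalg_hom A k \<iota>A C \<iota>C i by fact
  interpret J: kalg_hom B k \<iota>B C \<iota>C j by fact
  from small_copy[OF small(1)] obtain A0 :: "'k ring" and \<iota>A0 a where A0: "kalg A0 k \<iota>A0" "domain A0" "fg_algebra k A0 \<iota>A0"
    and a: "a \<in> ring_iso A A0" "\<And>c. c \<in> k \<Longrightarrow> a (\<iota>A c) = \<iota>A0 c" by metis
  from small_copy[OF small(2)] obtain B0 :: "'k ring" and \<iota>B0 b where B0: "kalg B0 k \<iota>B0" "domain B0" "fg_algebra k B0 \<iota>B0"
    and b: "b \<in> ring_iso B B0" "\<And>c. c \<in> k \<Longrightarrow> b (\<iota>B c) = \<iota>B0 c" by metis
  from small_copy[OF small(3)] obtain C0 :: "'k ring" and \<iota>C0 c where C0: "kalg C0 k \<iota>C0" "domain C0" "fg_algebra k C0 \<iota>C0"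
    and c: "c \<in> ring_iso C C0" "\<And>x. x \<in> k \<Longrightarrow> c (\<iota>C x) = \<iota>C0 x" by metis
  let ?i = "c \<circ> i \<circ> inv_into (carrier A) a" and ?j = "c \<circ> j \<circ> inv_into (carrier B) b"
  have ai: "inv_into (carrier A) a \<in> ring_hom A0 A" using ring_iso_set_sym[OF I.A.ring_axioms a(1)] by (simp add: ring_iso_def)
  have bi: "inv_into (carrier B) b \<in> ring_hom B0 B" using ring_iso_set_sym[OF J.A.ring_axioms b(1)] by (simp add: ring_iso_def)
  have ch: "c \<in> ring_hom C C0" using c(1) by (simp add: ring_iso_def)
  have ia: "inv_into (carrier A) a (a x) = x" if "x \<in> carrier A" for x
    using a(1) that by (auto simp: ring_iso_def bij_betw_def)
  have ib: "inv_into (carrier B) b (b x) = x" if "x \<in> carrier B" for x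
    using b(1) that by (auto simp: ring_iso_def bij_betw_def)
  have i0: "kalg_hom A0 k \<iota>A0 C0 \<iota>C0 ?i"
  proof (intro kalg_hom.intro A0(1) C0(1) kalg_hom_axioms.intro)
    show "?i \<in> ring_hom A0 C0" by (rule ring_hom_trans[OF ai ring_hom_trans[OF I.\<phi>_hom ch]])
    show "?i (\<iota>A0 x) = \<iota>C0 x" if "x \<in> k" for x
      using a(2)[OF that] ia[OF I.A.\<iota>_closed[OF that]] I.\<phi>_str[OF that] c(2)[OF that] by simp
  qed
  have j0: "kalg_hom B0 k \<iota>B0 C0 \<iota>C0 ?j"
  proof (intro kalg_hom.intro B0(1) C0(1) kalg_hom_axioms.intro)
    show "?j \<in> ring_hom B0 C0" by (rule ring_hom_trans[OF bi ring_hom_trans[OF J.\<phi>_hom ch]])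
    show "?j (\<iota>B0 x) = \<iota>C0 x" if "x \<in> k" for x
      using b(2)[OF that] ib[OF J.A.\<iota>_closed[OF that]] J.\<phi>_str[OF that] c(2)[OF that] by simp
  qed
  have cop0: "coproduct TYPE('k set \<Rightarrow> ('k \<times> 'k) set) k A0 \<iota>A0 B0 \<iota>B0 C0 ?i ?j"
    by (rule coproduct_iso[OF cop I.A.ring_axioms J.A.ring_axioms I.B.ring_axioms I.\<phi>_hom J.\<phi>_hom
          I.A.\<iota>_closed J.A.\<iota>_closed a(1) b(1) c(1) a(2) b(2)])
  have prod: "is_product k (Spec A0 \<iota>A0) (Spec B0 \<iota>B0) (Spec C0 \<iota>C0)" by (rule is_product_Spec[OF i0 j0 cop0])
  have "\<forall>S T P. finite_type_scheme k S \<and> finite_type_scheme k T \<and> finite_type_scheme k P \<and>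
      is_product k S T P \<longrightarrow> var_class k S \<otimes>\<^bsub>K0\<^esub> var_class k T = var_class k P"
    using K unfolding is_K0_ring_def by (elim conjE)
  then have "var_class k (Spec A0 \<iota>A0) \<otimes>\<^bsub>K0\<^esub> var_class k (Spec B0 \<iota>B0) = var_class k (Spec C0 \<iota>C0)"
    using kalg.finite_type_Spec[OF A0] kalg.finite_type_Spec[OF B0] kalg.finite_type_Spec[OF C0] prod by simp
  moreover have "iso_class k (Spec A \<iota>A) = iso_class k (Spec A0 \<iota>A0)" by (rule iso_class_Spec[OF I.A.kalg_axioms A0(1) a])
  moreover have "iso_class k (Spec B \<iota>B) = iso_class k (Spec B0 \<iota>B0)" by (rule iso_class_Spec[OF J.A.kalg_axioms B0(1) b])
  moreover have "iso_class k (Spec C \<iota>C) = iso_class k (Spec C0 \<iota>C0)" by (rule iso_class_Spec[OF I.B.kalg_axioms C0(1) c])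
  ultimately show ?thesis by (simp add: var_class_def)
qed

section \<open>Polynomial rings\<close>

text \<open>The counterpart of \<open>ext\<close> for a target ring given by a carrier, where sums
  are \<open>finsum\<close> and all laws hold on the carrier only. Such targets are the test rings
  of the coproduct and \<open>univ_poly\<close>.\<close>

lemma (in cring) finsum_ext_hom:
  assumes D: "grading k (\<lambda>_. k) N"
    and h_closed: "\<And>a x. \<lbrakk>a \<in> expo I J; x \<in> k\<rbrakk> \<Longrightarrow> h a x \<in> carrier R"
    and h_zero: "\<And>a. a \<in> expo I J \<Longrightarrow> h a 0 = \<zero>"
    and h_add: "\<And>a x y. \<lbrakk>a \<in> expo I J; x \<in> k; y \<in> k\<rbrakk> \<Longrightarrow> h a (x + y) = h a x \<oplus> h a y"
    and h_mult: "\<And>a b x y. \<lbrakk>a \<in> expo I J; b \<in> expo I J; x \<in> k; y \<in> k\<rbrakk> \<Longrightarrow> h (a + b) (x * y) = h a x \<otimes> h b y"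
    and h_one: "h 0 1 = \<one>"
  defines "E \<equiv> \<lambda>p. \<Oplus>a\<in>keys p. h a (lookup p a)"
  shows "E \<in> ring_hom (galg (\<lambda>_. k) I J) R"
    and "\<And>a x. \<lbrakk>a \<in> expo I J; x \<in> k\<rbrakk> \<Longrightarrow> E (single a x) = h a x"
proof -
  interpret D: grading k "\<lambda>_. k" N by fact
  have E_def': "E p = (\<Oplus>a\<in>keys p. h a (lookup p a))" for p by (simp add: E_def)
  let ?S = "expo I J" and ?G = "graded (expo I J) (\<lambda>_. k)"
  have kl: "lookup p a \<in> k" if "p \<in> ?G" for p a
    using that D.D_0 by (cases "a \<in> keys p") (auto simp: graded_def in_keys_iff)
  have keys: "keys p \<subseteq> ?S" if "p \<in> ?G" for p using that by (auto simp: graded_def)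
  have sup: "E p = (\<Oplus>a\<in>A. h a (lookup p a))"
    if p: "p \<in> ?G" and A: "finite A" "keys p \<subseteq> A" "A \<subseteq> ?S" for p A
    unfolding E_def
    by (rule add.finprod_mono_neutral_cong_left) (use A h_zero h_closed kl[OF p] in \<open>auto simp: in_keys_iff\<close>)
  have E_closed: "E p \<in> carrier R" if "p \<in> ?G" for p
    unfolding E_def by (rule finsum_closed) (use keys[OF that] h_closed kl[OF that] in auto)
  show E_single: "E (single a x) = h a x" if "a \<in> ?S" "x \<in> k" for a x
    using h_zero[OF that(1)] h_closed[OF that] by (cases "x = 0") (simp_all add: E_def)
  have E_add: "E (p + q) = E p \<oplus> E q" if p: "p \<in> ?G" and q: "q \<in> ?G" for p q
  proof -
    let ?A = "keys p \<union> keys q"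
    have A: "finite ?A" "?A \<subseteq> ?S" using keys[OF p] keys[OF q] by auto
    have "E (p + q) = (\<Oplus>a\<in>?A. h a (lookup (p + q) a))"
      by (rule sup[OF D.graded_add[OF p q] A(1) keys_add A(2)])
    also have "\<dots> = (\<Oplus>a\<in>?A. h a (lookup p a) \<oplus> h a (lookup q a))"
      by (rule add.finprod_cong') (use A(2) h_add h_closed kl[OF p] kl[OF q] in \<open>auto simp: lookup_add\<close>)
    also have "\<dots> = (\<Oplus>a\<in>?A. h a (lookup p a)) \<oplus> (\<Oplus>a\<in>?A. h a (lookup q a))"
      by (rule finsum_addf) (use A(2) h_closed kl[OF p] kl[OF q] in auto)
    also have "\<dots> = E p \<oplus> E q" using sup[OF p A(1) _ A(2)] sup[OF q A(1) _ A(2)] by simp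
    finally show ?thesis .
  qed
  have E_sum: "E (\<Sum>i\<in>A. f i) = (\<Oplus>i\<in>A. E (f i))" if "finite A" "\<And>i. i \<in> A \<Longrightarrow> f i \<in> ?G" for A and f :: "(nat \<Rightarrow>\<^sub>0 int) \<Rightarrow> _"
    using that
  proof (induction A rule: finite_induct)
    case empty
    then show ?case by (simp add: E_def)
  next
    case (insert i A)
    have "(\<Sum>i\<in>A. f i) \<in> ?G" by (rule D.graded_sum) (use insert in auto)
    then have "E (f i + (\<Sum>i\<in>A. f i)) = E (f i) \<oplus> E (\<Sum>i\<in>A. f i)" by (intro E_add) (use insert in auto)
    moreover have "(\<lambda>i. E (f i)) \<in> A \<rightarrow> carrier R" using insert E_closed by auto
    ultimately show ?case using insert E_closed by (simp add: finsum_insert)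
  qed
  have E_mult: "E (p * q) = E p \<otimes> E q" if p: "p \<in> ?G" and q: "q \<in> ?G" for p q
  proof -
    let ?P = "keys p" and ?Q = "keys q"
    let ?p = "lookup p" and ?q = "lookup q"
    have sg: "single (a + b) (?p a * ?q b) \<in> ?G" if "a \<in> ?P" "b \<in> ?Q" for a b
      by (rule D.graded_single[OF D.expo_add D.k_closed(2)[OF kl[OF p] kl[OF q]]]) (use that keys[OF p] keys[OF q] in auto)
    have hc: "h a (?p a) \<in> carrier R" if "a \<in> ?P" for a using that keys[OF p] h_closed kl[OF p] by auto
    have hc': "h b (?q b) \<in> carrier R" if "b \<in> ?Q" for b using that keys[OF q] h_closed kl[OF q] by auto
    have "E (p * q) = (\<Oplus>a\<in>?P. E (\<Sum>b\<in>?Q. single (a + b) (?p a * ?q b)))"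
      by (subst mult_expand) (intro E_sum D.graded_sum finite_keys sg)
    also have "\<dots> = (\<Oplus>a\<in>?P. h a (?p a) \<otimes> E q)"
    proof (rule add.finprod_cong'[OF refl])
      show "(\<lambda>a. h a (?p a) \<otimes> E q) \<in> ?P \<rightarrow> carrier R" using hc E_closed[OF q] by auto
      fix a assume a: "a \<in> ?P"
      have "E (\<Sum>b\<in>?Q. single (a + b) (?p a * ?q b)) = (\<Oplus>b\<in>?Q. E (single (a + b) (?p a * ?q b)))"
        by (rule E_sum) (use a sg in auto)
      also have "\<dots> = (\<Oplus>b\<in>?Q. h a (?p a) \<otimes> h b (?q b))"
      proof (rule add.finprod_cong'[OF refl])
        fix b assume b: "b \<in> ?Q"
        have ab: "a \<in> ?S" "b \<in> ?S" using a b keys[OF p] keys[OF q] by auto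
        show "E (single (a + b) (?p a * ?q b)) = h a (?p a) \<otimes> h b (?q b)"
          using E_single[OF D.expo_add[OF ab] D.k_closed(2)[OF kl[OF p] kl[OF q]]] h_mult[OF ab kl[OF p] kl[OF q]] by simp
      qed (use hc[OF a] hc' in auto)
      also have "\<dots> = h a (?p a) \<otimes> E q"
        unfolding E_def by (rule finsum_rdistr[symmetric]) (use hc[OF a] hc' in auto)
      finally show "E (\<Sum>b\<in>?Q. single (a + b) (?p a * ?q b)) = h a (?p a) \<otimes> E q" .
    qed
    also have "\<dots> = E p \<otimes> E q"
      unfolding E_def'[of p] by (rule finsum_ldistr[symmetric]) (use hc E_closed[OF q] in auto)
    finally show ?thesis .
  qed
  show "E \<in> ring_hom (galg (\<lambda>_. k) I J) R"
    by (rule ring_hom_memI)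
      (use E_closed E_add E_mult E_single[OF D.expo_zero D.k_1] h_one in simp_all)
qed

lemma galg_hom_eqI:
  assumes D: "grading k D N" and R: "ring R" and h: "h \<in> ring_hom (galg D I J) R" and h': "h' \<in> ring_hom (galg D I J) R"
    and eq: "\<And>a x. \<lbrakk>a \<in> expo I J; x \<in> D a\<rbrakk> \<Longrightarrow> h (single a x) = h' (single a x)"
    and p: "p \<in> carrier (galg D I J)"
  shows "h p = h' p"
proof -
  interpret D: grading k D N by fact
  have pD: "a \<in> expo I J" "lookup p a \<in> D a" if "a \<in> keys p" for a
    using p that by (auto simp: graded_def)
  have rG: "ring (galg D I J)" using subalg_cring[OF D.subring_graded] by (simp add: cring_def)
  let ?s = "\<lambda>a. single a (lookup p a)"
  have "h (\<Sum>a\<in>A. ?s a) = h' (\<Sum>a\<in>A. ?s a)" if "A \<subseteq> keys p" for A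
    using finite_subset[OF that finite_keys] that
  proof (induction A rule: finite_induct)
    case empty
    show ?case using ring_hom_zero[OF h rG R] ring_hom_zero[OF h' rG R] by simp
  next
    case (insert a A)
    have s: "?s b \<in> graded (expo I J) D" if "b \<in> insert a A" for b
      by (rule D.graded_single) (use pD insert.prems that in auto)
    have S: "(\<Sum>a\<in>A. ?s a) \<in> graded (expo I J) D" by (rule D.graded_sum) (use s in auto)
    have "h (?s a + (\<Sum>a\<in>A. ?s a)) = h' (?s a + (\<Sum>a\<in>A. ?s a))"
      using ring_hom_add[OF h, of "?s a" "\<Sum>a\<in>A. ?s a"] ring_hom_add[OF h', of "?s a" "\<Sum>a\<in>A. ?s a"]
        s[of a] S insert eq[OF pD(1)[of a] pD(2)[of a]] by simp
    then show ?case using insert by simp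
  qed
  from this[OF subset_refl] show ?thesis by (simp add: pm_expand[symmetric])
qed

context grading
begin

lemma galg_inclusion: "I \<subseteq> I' \<Longrightarrow> kalg_hom (galg D I J) k lconst (galg D I' J) lconst id"
proof (intro kalg_hom.intro kalg_galg kalg_hom_axioms.intro)
  assume "I \<subseteq> I'"
  then have "graded (expo I J) D \<subseteq> graded (expo I' J) D" by (intro graded_mono) (auto simp: expo_def)
  then show "id \<in> ring_hom (galg D I J) (galg D I' J)" by (intro ring_hom_memI) auto
qed simp

text \<open>A monomial is its part in the variables \<open>I\<close> times a power of
  \<open>x_i\<close>. The induced map must be \<open>f\<close> on the first factor times
  \<open>g\<close> on the second, which yields existence and uniqueness together.\<close>

lemma coproduct_polynomials:
  assumes i: "i \<notin> I"
  shows "coproduct TYPE('s) k (galg (\<lambda>_. k) I {}) lconst (galg (\<lambda>_. k) {i} {}) lconst (galg (\<lambda>_. k) (insert i I) {}) id id"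
  unfolding coproduct_def
proof (intro allI impI, elim conjE)
  fix T :: "'s ring" and f g
  assume "cring T" and f: "f \<in> ring_hom (galg (\<lambda>_. k) I {}) T" and g: "g \<in> ring_hom (galg (\<lambda>_. k) {i} {}) T"
    and fg: "\<forall>c\<in>k. f (lconst c) = g (lconst c)"
  then interpret T: cring T by simp
  note D = grading_trivial
  interpret D: grading k "\<lambda>_. k" 1 by (rule D)
  let ?A = "galg (\<lambda>_. k) I {}" and ?B = "galg (\<lambda>_. k) {i} {}" and ?C = "galg (\<lambda>_. k) (insert i I) {}"
  let ?s = "single :: (nat \<Rightarrow>\<^sub>0 int) \<Rightarrow> 'k \<Rightarrow> 'k laurent"
  define v where "v a = single i (lookup a i)" for a :: "nat \<Rightarrow>\<^sub>0 int"
  define u where "u a = a - v a" for a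
  have uv: "u a + v a = a" for a by (simp add: u_def)
  have v_add: "v (a + b) = v a + v b" for a b by (simp add: v_def lookup_add single_add)
  have u_add: "u (a + b) = u a + u b" for a b by (simp add: u_def v_add)
  have u_expo: "u a \<in> expo I {}" and v_expo: "v a \<in> expo {i} {}" if "a \<in> expo (insert i I) {}" for a
    using that by (auto simp: expo_def u_def v_def lookup_minus lookup_single when_def in_keys_iff subset_iff split: if_splits)
  have sub: "expo I {} \<subseteq> expo (insert i I) {}" "expo {i} {} \<subseteq> expo (insert i I) {}" by (auto simp: expo_def)
  have uI: "u a = a" "v a = 0" if "a \<in> expo I {}" for a
  proof -
    have "lookup a i = 0" using that i by (auto simp: expo_def in_keys_iff)
    then show "u a = a" "v a = 0" by (simp_all add: u_def v_def)
  qed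
  have vB: "v a = a" if "a \<in> expo {i} {}" for a
  proof (rule poly_mapping_eqI)
    fix j
    have "j \<noteq> i \<Longrightarrow> lookup a j = 0" using that by (auto simp: expo_def in_keys_iff)
    then show "lookup (v a) j = lookup a j" by (auto simp: v_def lookup_single when_def)
  qed
  then have uB: "u a = 0" if "a \<in> expo {i} {}" for a using that by (simp add: u_def)
  have cA: "?s a x \<in> carrier ?A" if "a \<in> expo I {}" "x \<in> k" for a x using D.graded_single[OF that] by simp
  have cB: "?s a x \<in> carrier ?B" if "a \<in> expo {i} {}" "x \<in> k" for a x using D.graded_single[OF that] by simp
  have cC: "?s a x \<in> carrier ?C" if "a \<in> expo (insert i I) {}" "x \<in> k" for a x using D.graded_single[OF that] by simp
  \<comment> \<open>The scalar is placed in the first factor; for monomials in \<open>x_i\<close>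
    alone it can be moved to the second, because \<open>f\<close> and \<open>g\<close> agree on
    constants.\<close>
  define h where "h a x = f (?s (u a) x) \<otimes>\<^bsub>T\<^esub> g (?s (v a) 1)" for a x
  define E where "E = (\<lambda>p. \<Oplus>\<^bsub>T\<^esub>a\<in>keys p. h a (lookup p a))"
  have fc: "f (?s (u a) x) \<in> carrier T" if "a \<in> expo (insert i I) {}" "x \<in> k" for a x
    by (rule ring_hom_closed[OF f cA[OF u_expo[OF that(1)] that(2)]])
  have gc: "g (?s (v a) 1) \<in> carrier T" if "a \<in> expo (insert i I) {}" for a
    by (rule ring_hom_closed[OF g cB[OF v_expo[OF that] D.k_1]])
  have rA: "ring ?A" using subalg_cring[OF D.subring_graded] by (simp add: cring_def)
  have hc: "h a x \<in> carrier T" if "a \<in> expo (insert i I) {}" "x \<in> k" for a x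
    unfolding h_def using fc[OF that] gc[OF that(1)] by simp
  have h0: "h a 0 = \<zero>\<^bsub>T\<^esub>" if "a \<in> expo (insert i I) {}" for a
    unfolding h_def using ring_hom_zero[OF f rA T.ring_axioms] gc[OF that] by simp
  have ha: "h a (x + y) = h a x \<oplus>\<^bsub>T\<^esub> h a y" if "a \<in> expo (insert i I) {}" "x \<in> k" "y \<in> k" for a x y
    unfolding h_def using ring_hom_add[OF f cA[OF u_expo[OF that(1)] that(2)] cA[OF u_expo[OF that(1)] that(3)]]
        fc[OF that(1,2)] fc[OF that(1,3)] gc[OF that(1)] by (simp add: single_add T.l_distr)
  have hm: "h (a + b) (x * y) = h a x \<otimes>\<^bsub>T\<^esub> h b y"
      if "a \<in> expo (insert i I) {}" "b \<in> expo (insert i I) {}" "x \<in> k" "y \<in> k" for a b x y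
    unfolding h_def
      using ring_hom_mult[OF f cA[OF u_expo[OF that(1)] that(3)] cA[OF u_expo[OF that(2)] that(4)]]
        ring_hom_mult[OF g cB[OF v_expo[OF that(1)] D.k_1] cB[OF v_expo[OF that(2)] D.k_1]]
        fc[OF that(1,3)] fc[OF that(2,4)] gc[OF that(1)] gc[OF that(2)]
      by (simp add: mult_single u_add v_add T.m_ac)
  have h1: "h 0 1 = \<one>\<^bsub>T\<^esub>"
      using uI[OF expo_zero] ring_hom_one[OF f] ring_hom_one[OF g] by (simp add: h_def)
  have E1: "E \<in> ring_hom ?C T"
    unfolding E_def by (rule T.finsum_ext_hom(1)[OF D, where h = h]) (fact hc h0 ha hm h1)+
  have E2: "E (single a x) = h a x" if "a \<in> expo (insert i I) {}" "x \<in> k" for a x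
    unfolding E_def
    by (rule T.finsum_ext_hom(2)[OF D, where h = h and I = "insert i I" and J = "{}"]) (fact hc h0 ha hm h1 that)+
  note E = E1 E2
  have EA: "E (id x) = f x" if x: "x \<in> carrier ?A" for x
  proof -
    have "E \<circ> id \<in> ring_hom ?A T"
      by (rule ring_hom_trans[OF kalg_hom.\<phi>_hom[OF D.galg_inclusion] E(1)]) auto
    then have "(E \<circ> id) x = f x"
    proof (rule galg_hom_eqI[OF D T.ring_axioms _ f _ x])
      fix a y assume a: "a \<in> expo I {}" and y: "y \<in> k"
      then show "(E \<circ> id) (?s a y) = f (?s a y)"
        using E(2)[of a y] sub uI[OF a] ring_hom_one[OF g] ring_hom_closed[OF f cA[OF a y]] by (auto simp: h_def)
    qed
    then show ?thesis by simp
  qed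
  have EB: "E (id x) = g x" if x: "x \<in> carrier ?B" for x
  proof -
    have "E \<circ> id \<in> ring_hom ?B T"
      by (rule ring_hom_trans[OF kalg_hom.\<phi>_hom[OF D.galg_inclusion] E(1)]) auto
    then have "(E \<circ> id) x = g x"
    proof (rule galg_hom_eqI[OF D T.ring_axioms _ g _ x])
      fix a y assume a: "a \<in> expo {i} {}" and y: "y \<in> k"
      have "g (?s 0 y * ?s a 1) = g (?s 0 y) \<otimes>\<^bsub>T\<^esub> g (?s a 1)"
        using ring_hom_mult[OF g cB[OF expo_zero y] cB[OF a D.k_1]] by simp
      then show "(E \<circ> id) (?s a y) = g (?s a y)"
        using E(2)[of a y] sub a y vB[OF a] uB[OF a] fg by (auto simp: h_def mult_single)
    qed
    then show ?thesis by simp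
  qed
  have un: "h' p = E p" if h': "h' \<in> ring_hom ?C T" and hA: "\<forall>x\<in>carrier ?A. h' (id x) = f x"
    and hB: "\<forall>x\<in>carrier ?B. h' (id x) = g x" and p: "p \<in> carrier ?C" for h' p
  proof (rule galg_hom_eqI[OF D T.ring_axioms h' E(1) _ p])
    fix a x assume a: "a \<in> expo (insert i I) {}" and x: "x \<in> k"
    have "h' (?s (u a) x * ?s (v a) 1) = h' (?s (u a) x) \<otimes>\<^bsub>T\<^esub> h' (?s (v a) 1)"
      using ring_hom_mult[OF h' cC[of "u a" x] cC[of "v a" 1]] u_expo[OF a] v_expo[OF a] sub x D.k_1 by auto
    also have "\<dots> = h a x" using hA cA[OF u_expo[OF a] x] hB cB[OF v_expo[OF a] D.k_1] by (simp add: h_def)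
    finally show "h' (?s a x) = E (?s a x)" using E(2)[OF a x] by (simp add: mult_single uv)
  qed
  show "\<exists>h\<in>ring_hom ?C T. (\<forall>x\<in>carrier ?A. h (id x) = f x) \<and> (\<forall>x\<in>carrier ?B. h (id x) = g x) \<and>
      (\<forall>h'\<in>ring_hom ?C T. (\<forall>x\<in>carrier ?A. h' (id x) = f x) \<and> (\<forall>x\<in>carrier ?B. h' (id x) = g x) \<longrightarrow>
        (\<forall>y\<in>carrier ?C. h' y = h y))"
    by (intro bexI[OF _ E(1)] conjI ballI impI; (elim conjE)?) (rule EA EB un, assumption+)+
qed

end

section \<open>Powers of the Lefschetz class\<close>

text \<open>The coproduct adjoins the variable with index \<open>n\<close>;
  \<open>galg_class_eq\<close> identifies the class of that line with the one for index 0, so the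
  factor is the same for all \<open>n\<close>.\<close>

lemma var_class_polynomials_Suc:
  assumes K: "is_K0_ring k K0" and D: "grading k (\<lambda>_. k) N"
  shows "var_class k (Spec (galg (\<lambda>_. k) {..<Suc n} {}) lconst) =
    var_class k (Spec (galg (\<lambda>_. k) {..<n} {}) lconst) \<otimes>\<^bsub>K0\<^esub> var_class k (Spec (galg (\<lambda>_. k) {0} {}) lconst)"
proof -
  interpret D: grading k "\<lambda>_. k" N by fact
  have "var_class k (Spec (galg (\<lambda>_. k) {..<n} {}) lconst) \<otimes>\<^bsub>K0\<^esub> var_class k (Spec (galg (\<lambda>_. k) {n} {}) lconst) =
      var_class k (Spec (galg (\<lambda>_. k) (insert n {..<n}) {}) lconst)"
    by (rule var_class_mult[OF K D.small_galg D.small_galg D.small_galg D.galg_inclusion D.galg_inclusion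
          D.coproduct_polynomials]) auto
  moreover have "var_class k (Spec (galg (\<lambda>_. k) {n} {}) lconst) = var_class k (Spec (galg (\<lambda>_. k) {0} {}) lconst)"
    by (rule galg_class_eq[OF K D D]) auto
  ultimately show ?thesis by (simp add: lessThan_Suc)
qed

text \<open>The affine line is defined through polynomials as coefficient lists, which have to be
  matched with finitely supported coefficient functions. The map is onto because every list is its
  own evaluation at the variable, and injective by comparison of coefficients.\<close>

lemma affine_line_class:
  assumes D: "grading k (\<lambda>_. k) N" and sf: "subfield k ring_of_type_algebra"
  shows "lefschetz k = var_class k (Spec (galg (\<lambda>_. k) {0} {}) lconst)"
proof -
  interpret D: grading k "\<lambda>_. k" N by fact
  interpret F: domain "ring_of_type_algebra :: 'a ring"
    using subalg_domain[of "UNIV :: 'a set"] by (simp add: subring_type_def ring_of_type_algebra_def)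
  let ?U = "univ_poly ring_of_type_algebra k" and ?X = "var ring_of_type_algebra" and ?c = "F.poly_of_const"
  let ?G = "galg (\<lambda>_. k) {0} {}"
  have K: "subring k ring_of_type_algebra" by (rule subfieldE(1)[OF sf])
  interpret U: cring ?U by (rule F.univ_poly_is_cring[OF K])
  have c: "?c \<in> ring_hom (base_ring k) ?U" by (rule F.canonical_embedding_is_hom[OF K])
  have cc: "?c x \<in> carrier ?U" if "x \<in> k" for x using ring_hom_closed[OF c] that by simp
  have c_add: "?c (x + y) = ?c x \<oplus>\<^bsub>?U\<^esub> ?c y" and c_mult: "?c (x * y) = ?c x \<otimes>\<^bsub>?U\<^esub> ?c y" if "x \<in> k" "y \<in> k" for x y
    using ring_hom_add[OF c] ring_hom_mult[OF c] that by simp_all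
  have c0: "?c 0 = \<zero>\<^bsub>?U\<^esub>" by (simp add: F.poly_of_const_def univ_poly_zero)
  have c1: "?c 1 = \<one>\<^bsub>?U\<^esub>" using ring_hom_one[OF c] by simp
  have Xc: "?X \<in> carrier ?U" by (rule F.var_closed(1)[OF K])
  \<comment> \<open>For exponents in \<open>expo {0} {}\<close> the value \<open>lookup a 0\<close>
    is nonnegative, so \<open>nat\<close> loses nothing.\<close>
  define h where "h a x = ?c x \<otimes>\<^bsub>?U\<^esub> ?X [^]\<^bsub>?U\<^esub> nat (lookup a 0)" for a :: "nat \<Rightarrow>\<^sub>0 int" and x
  define E where "E = (\<lambda>p. \<Oplus>\<^bsub>?U\<^esub>a\<in>keys p. h a (lookup p a))"
  have hc: "h a x \<in> carrier ?U" if "a \<in> expo {0} {}" "x \<in> k" for a x using cc[OF that(2)] Xc by (simp add: h_def)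
  have h0: "h a 0 = \<zero>\<^bsub>?U\<^esub>" if "a \<in> expo {0} {}" for a using Xc by (simp add: h_def c0)
  have ha: "h a (x + y) = h a x \<oplus>\<^bsub>?U\<^esub> h a y" if "a \<in> expo {0} {}" "x \<in> k" "y \<in> k" for a x y
    using cc that Xc by (simp add: h_def c_add U.l_distr)
  have hm: "h (a + b) (x * y) = h a x \<otimes>\<^bsub>?U\<^esub> h b y"
    if "a \<in> expo {0} {}" "b \<in> expo {0} {}" "x \<in> k" "y \<in> k" for a b x y
  proof -
    have "nat (lookup (a + b) 0) = nat (lookup a 0) + nat (lookup b 0)"
      using that by (simp add: expo_def lookup_add nat_add_distrib)
    then show ?thesis using cc that Xc by (simp add: h_def c_mult U.nat_pow_mult[symmetric] U.m_ac)
  qed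
  have h1: "h 0 1 = \<one>\<^bsub>?U\<^esub>" by (simp add: h_def c1)
  have E1: "E \<in> ring_hom ?G ?U"
    unfolding E_def by (rule U.finsum_ext_hom(1)[OF D, where h = h]) (fact hc h0 ha hm h1)+
  have E2: "E (single a x) = h a x" if "a \<in> expo ({0}) {}" "x \<in> k" for a x
    unfolding E_def
    by (rule U.finsum_ext_hom(2)[OF D, where h = h and I = "{0}" and J = "{}"]) (fact hc h0 ha hm h1 that)+
  note E = E1 E2
  have rG: "ring ?G" using subalg_cring[OF D.subring_graded] by (simp add: cring_def)
  have eval: "U.eval (map ?c l) ?X \<in> E ` carrier ?G" if "set l \<subseteq> k" for l
    using that
  proof (induction l)
    case Nil
    have "E 0 = \<zero>\<^bsub>?U\<^esub>" using ring_hom_zero[OF E(1) rG U.ring_axioms] by simp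
    then show ?case using D.graded_zero[of "expo {0} {}"] by (auto intro!: image_eqI[of _ E 0])
  next
    case (Cons x l)
    then obtain p where p: "p \<in> graded (expo {0} {}) (\<lambda>_. k)" "U.eval (map ?c l) ?X = E p" by auto
    let ?q = "single (single 0 (int (length l))) x"
    have e: "single 0 (int (length l)) \<in> expo {0} {}" by (rule D.expo_single) auto
    have x: "x \<in> k" using Cons.prems by simp
    have q: "?q \<in> graded (expo {0} {}) (\<lambda>_. k)" by (rule D.graded_single[OF e x])
    have Eq: "E ?q = ?c x \<otimes>\<^bsub>?U\<^esub> ?X [^]\<^bsub>?U\<^esub> length l"
      using E(2)[OF e x] by (simp only: h_def lookup_single_eq nat_int)
    have "U.eval (map ?c (x # l)) ?X = E ?q \<oplus>\<^bsub>?U\<^esub> E p" unfolding Eq using p(2) by simp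
    also have "\<dots> = E (?q + p)" using ring_hom_add[OF E(1), of ?q p] p q by simp
    finally show ?case using D.graded_add[OF q p(1)] by auto
  qed
  have surj: "y \<in> E ` carrier ?G" if y: "y \<in> carrier ?U" for y
  proof -
    have "set y \<subseteq> k" using y by (auto simp: univ_poly_carrier[symmetric] polynomial_def)
    from eval[OF this] show ?thesis using F.eval_rewrite[OF K y] by simp
  qed
  have coeff_h: "F.coeff (h a x) m = (if m = nat (lookup a 0) then x else 0)" if "x \<in> k" for a x m
  proof (cases "x = 0")
    case True
    then show ?thesis using Xc by (simp add: h_def c0) (simp add: univ_poly_zero)
  next
    case False
    then have "h a x = F.monom x (nat (lookup a 0))"
      using F.monom_eq_var_pow[OF K, of x] by (simp add: h_def F.poly_of_const_def)
    then show ?thesis by (simp add: F.monom_coeff)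
  qed
  have set_k: "set q \<subseteq> carrier ring_of_type_algebra" for q :: "'a list" by simp
  have coeff_sum: "F.coeff (\<Oplus>\<^bsub>?U\<^esub>a\<in>A. h a (f a)) m = (\<Sum>a\<in>A. if m = nat (lookup a 0) then f a else 0)"
    if "finite A" "A \<subseteq> expo {0} {}" "\<And>a. a \<in> A \<Longrightarrow> f a \<in> k" for A f m
    using that
  proof (induction A rule: finite_induct)
    case empty
    show ?case by simp (simp add: univ_poly_zero)
  next
    case (insert a A)
    have "(\<Oplus>\<^bsub>?U\<^esub>a\<in>insert a A. h a (f a)) = h a (f a) \<oplus>\<^bsub>?U\<^esub> (\<Oplus>\<^bsub>?U\<^esub>a\<in>A. h a (f a))"
      by (rule U.finsum_insert) (use insert hc in auto)
    then show ?case
      using insert coeff_h[of "f a" a m] F.poly_add_coeff[OF set_k set_k] by (simp add: univ_poly_add)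
  qed
  have coeff_E: "F.coeff (E p) m = lookup p (single 0 (int m))" if p: "p \<in> carrier ?G" for p m
  proof -
    have pk: "keys p \<subseteq> expo {0} {}" "\<And>a. a \<in> keys p \<Longrightarrow> lookup p a \<in> k"
      using p by (auto simp: graded_def)
    have eq: "m = nat (lookup a 0) \<longleftrightarrow> a = single 0 (int m)" if "a \<in> expo {0} {}" for a
    proof -
      have z: "lookup a j = 0" if "j \<noteq> 0" for j using \<open>a \<in> _\<close> that by (auto simp: expo_def in_keys_iff)
      have "0 \<le> lookup a 0" using that by (simp add: expo_def)
      then show ?thesis using z by (auto simp: poly_mapping_eq_iff fun_eq_iff lookup_single when_def simp del: single_of_nat single_of_int)
    qed
    have "F.coeff (E p) m = (\<Sum>a\<in>keys p. if m = nat (lookup a 0) then lookup p a else 0)"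
      unfolding E_def by (rule coeff_sum[OF finite_keys pk])
    also have "\<dots> = (\<Sum>a\<in>keys p. if a = single 0 (int m) then lookup p a else 0)"
      by (rule sum.cong[OF refl]) (use eq pk(1) in auto)
    also have "\<dots> = lookup p (single 0 (int m))"
      by (simp add: in_keys_iff)
    finally show ?thesis .
  qed
  have "inj_on E (carrier ?G)"
  proof (rule inj_onI, rule poly_mapping_eqI)
    fix p q a assume p: "p \<in> carrier ?G" and q: "q \<in> carrier ?G" and eq: "E p = E q"
    have l: "lookup p (single 0 (int m)) = lookup q (single 0 (int m))" for m
      using coeff_E[OF p, of m] coeff_E[OF q, of m] eq by simp
    show "lookup p a = lookup q a"
    proof (cases "a \<in> expo {0} {}")
      case True
      then have "a = single 0 (int (nat (lookup a 0)))"
        by (auto simp: poly_mapping_eq_iff fun_eq_iff lookup_single when_def expo_def in_keys_iff simp del: single_of_nat single_of_int)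
      then show ?thesis using l by metis
    next
      case False
      then have "a \<notin> keys p" "a \<notin> keys q" using p q by (auto simp: graded_def)
      then show ?thesis by (simp add: in_keys_iff)
    qed
  qed
  moreover have "E ` carrier ?G = carrier ?U" using surj ring_hom_closed[OF E(1)] by blast
  ultimately have iso: "E \<in> ring_iso ?G ?U" using E(1) by (simp add: ring_iso_def bij_betw_def)
  have str: "E (lconst x) = ?c x" if "x \<in> k" for x using E(2)[OF D.expo_zero that] cc[OF that] by (simp add: h_def)
  have kU: "kalg ?U k ?c" by (intro kalg.intro U.cring_axioms kalg_axioms.intro c)
  show ?thesis using iso_class_Spec[OF D.kalg_galg kU iso str] by (simp add: var_class_def affine_line_def)
qed

text \<open>Without variables only the exponent 0 remains and the graded algebra is \<open>k\<close>
  itself; this starts the induction on the power.\<close>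

lemma unit_class:
  assumes D: "grading k (\<lambda>_. k) N"
  shows "var_class k (Spec (base_ring k) id) = var_class k (Spec (galg (\<lambda>_. k) {} {}) lconst)"
proof -
  interpret D: grading k "\<lambda>_. k" N by fact
  let ?G = "galg (\<lambda>_. k) {} {}"
  have k: "subring_type k" unfolding subring_type_def using D.k_closed D.k_1 D.k_uminus by auto
  have kk: "kalg (base_ring k) k id"
    by (intro kalg.intro kalg_axioms.intro subalg_cring k ring_hom_memI) auto
  have e: "expo {} {} = {0}" by (auto simp: expo_def)
  have "lconst \<in> ring_hom (base_ring k) ?G" by (rule kalg.str_ring_hom[OF D.kalg_galg])
  moreover have "bij_betw lconst k (graded {0} (\<lambda>_. k))"
  proof (rule bij_betwI[where g = "\<lambda>p. lookup p 0"])
    show "lconst \<in> k \<rightarrow> graded {0} (\<lambda>_. k)" using D.graded_single[of 0 "{0}"] by auto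
    show "(\<lambda>p. lookup p 0) \<in> graded {0} (\<lambda>_. k) \<rightarrow> k"
    proof
      fix p assume "p \<in> graded {0} (\<lambda>_. k)"
      then show "lookup p 0 \<in> k"
        using D.k_closed(4) by (cases "0 \<in> keys p") (auto simp: graded_def in_keys_iff)
    qed
    show "lconst (lookup p 0) = p" if "p \<in> graded {0} (\<lambda>_. k)" for p
      using that by (intro poly_mapping_eqI) (auto simp: graded_def lookup_single when_def in_keys_iff)
  qed simp
  ultimately have "lconst \<in> ring_iso (base_ring k) ?G" by (simp add: ring_iso_def e)
  from iso_class_Spec[OF kk D.kalg_galg this] show ?thesis by (simp add: var_class_def)
qed

theorem lefschetz_power:
  assumes K: "is_K0_ring k K0" and D: "grading k (\<lambda>_. k) N" and sf: "subfield k ring_of_type_algebra"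
  shows "lefschetz k [^]\<^bsub>K0\<^esub> n = var_class k (Spec (galg (\<lambda>_. k) {..<n} {}) lconst)"
proof (induction n)
  case 0
  have "\<one>\<^bsub>K0\<^esub> = var_class k (Spec (base_ring k) id)" using K unfolding is_K0_ring_def by (elim conjE)
  then show ?case using unit_class[OF D] by simp
next
  case (Suc n)
  then show ?case using var_class_polynomials_Suc[OF K D, of n] affine_line_class[OF D sf] by simp
qed

section \<open>Eigenbases of semilinear actions\<close>

text \<open>\<open>X^N - 1\<close> splits into linear factors, and its derivative does not vanish at
  a root, so every root is simple. This supplies, via the algebraic closure, enough roots of unity
  for the Fourier transform.\<close>

lemma card_roots_of_unity_alg_closed:
  assumes N: "0 < N"
  shows "card {x :: 'a::{alg_closed_field, field_char_0}. x ^ N = 1} = N"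
proof -
  let ?p = "Polynomial.monom (1 :: 'a) N - 1"
  have root: "poly ?p x = 0 \<longleftrightarrow> x ^ N = 1" for x by (simp add: poly_monom)
  have deg: "Polynomial.degree ?p = N"
  proof (rule antisym)
    show "Polynomial.degree ?p \<le> N" by (rule degree_diff_le) (simp_all add: degree_monom_le)
    have "Polynomial.coeff ?p N \<noteq> 0" using N by simp
    then show "N \<le> Polynomial.degree ?p" by (rule le_degree)
  qed
  then have "?p \<noteq> 0" using N by (metis degree_0 less_numeral_extra(3))
  from alg_closed_imp_factorization[OF this] obtain A
    where A: "size A = N" "?p = smult (lead_coeff ?p) (\<Prod>x\<in>#A. [:- x, 1:])" unfolding deg by blast
  define c where "c = lead_coeff ?p"
  have c: "c \<noteq> 0" unfolding c_def leading_coeff_0_iff by fact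
  have mem: "x \<in># A \<longleftrightarrow> x ^ N = 1" for x
  proof -
    have "poly ?p x = c * (\<Prod>a\<in>#A. x - a)"
      by (subst A(2)) (simp add: c_def poly_prod_mset image_mset.compositionality comp_def)
    then show ?thesis using root[of x] c by auto
  qed
  have "count A x = 1" if x: "x \<in># A" for x
  proof -
    obtain B where B: "A = add_mset x B" using x by (metis mset_add)
    define q where "q = smult c (\<Prod>a\<in>#B. [:- a, 1:])"
    have p: "?p = [:- x, 1:] * q" by (subst A(2)) (simp add: B q_def c_def)
    have "pderiv ?p = Polynomial.monom (of_nat N) (N - 1)" by (simp add: pderiv_diff pderiv_monom)
    then have "poly (pderiv ?p) x = of_nat N * x ^ (N - 1)" by (simp add: poly_monom)
    moreover have "x \<noteq> 0" using mem[of x] x N by (auto simp: zero_power)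
    ultimately have "poly (pderiv ?p) x \<noteq> 0" using N by simp
    \<comment> \<open>The derivative of \<open>(X - x) q\<close> takes at \<open>x\<close> the value
      of \<open>q\<close>, so \<open>x\<close> cannot be a root of \<open>q\<close> as well.\<close>
    moreover have "poly (pderiv ?p) x = poly q x" unfolding p pderiv_mult by (simp add: pderiv_pCons)
    ultimately have q0: "poly q x \<noteq> 0" by simp
    have "x \<notin># B"
    proof
      assume "x \<in># B"
      then obtain B' where "B = add_mset x B'" by (metis mset_add)
      then show False using q0 by (simp add: q_def)
    qed
    then show ?thesis using B by (simp add: not_in_iff)
  qed
  then have "size A = card (set_mset A)" unfolding size_multiset_overloaded_eq by simp
  moreover have "set_mset A = {x. x ^ N = 1}" using mem by auto
  ultimately show ?thesis using A(1) by simp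
qed

locale semilinear_action =
  fixes G :: "('g, 'm) monoid_scheme"
    and k :: "'k::field_char_0 set"
    and \<rho> :: "'g \<Rightarrow> 'k \<Rightarrow> 'k"
    and scale :: "'k \<Rightarrow> 'v::ab_group_add \<Rightarrow> 'v"
    and act :: "'g \<Rightarrow> 'v \<Rightarrow> 'v"
  assumes G_comm: "comm_group G" and G_finite: "finite (carrier G)"
    and galois: "galois_extension k"
    and \<rho>_epi: "\<rho> \<in> epi G (gal_group k)"
    and finite_dim: "\<exists>B. finite_dimensional_vector_space scale B"
    and action: "group_action G UNIV act"
    and act_add: "\<And>\<sigma> v w. \<sigma> \<in> carrier G \<Longrightarrow> act \<sigma> (v + w) = act \<sigma> v + act \<sigma> w"
    and act_scale: "\<And>\<sigma> c v. \<sigma> \<in> carrier G \<Longrightarrow> act \<sigma> (scale c v) = scale (\<rho> \<sigma> c) (act \<sigma> v)"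
    and roots: "\<And>\<zeta> :: 'k alg_closure. \<zeta> ^ group_exponent G = 1 \<Longrightarrow> \<zeta> \<in> to_ac ` k"
begin

sublocale G: comm_group G by (rule G_comm)

sublocale V: vector_space scale
  using finite_dim finite_dimensional_vector_space.axioms(1) by blast

lemma \<rho>_gal: "\<sigma> \<in> carrier G \<Longrightarrow> \<rho> \<sigma> \<in> ring_iso ring_of_type_algebra ring_of_type_algebra \<and> (\<forall>c\<in>k. \<rho> \<sigma> c = c)"
proof -
  assume "\<sigma> \<in> carrier G"
  then have "\<rho> \<sigma> \<in> carrier (gal_group k)" using \<rho>_epi by (auto simp: epi_def hom_def)
  then show ?thesis by (simp add: gal_group_def)
qed

lemma \<rho>_k: "\<lbrakk>\<sigma> \<in> carrier G; c \<in> k\<rbrakk> \<Longrightarrow> \<rho> \<sigma> c = c"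
  using \<rho>_gal by blast

lemma \<rho>_ring_hom: "\<sigma> \<in> carrier G \<Longrightarrow> \<rho> \<sigma> \<in> ring_hom ring_of_type_algebra ring_of_type_algebra"
  using \<rho>_gal by (simp add: ring_iso_def)

lemma \<rho>_bij: "\<sigma> \<in> carrier G \<Longrightarrow> bij (\<rho> \<sigma>)"
  using \<rho>_gal by (simp add: ring_iso_def)

lemma \<rho>_ring:
  assumes "\<sigma> \<in> carrier G"
  shows "\<rho> \<sigma> (x + y) = \<rho> \<sigma> x + \<rho> \<sigma> y" "\<rho> \<sigma> (x * y) = \<rho> \<sigma> x * \<rho> \<sigma> y" "\<rho> \<sigma> 1 = 1" "\<rho> \<sigma> 0 = 0"
proof -
  show a: "\<rho> \<sigma> (x + y) = \<rho> \<sigma> x + \<rho> \<sigma> y" for x y using ring_hom_add[OF \<rho>_ring_hom[OF assms], of x y] by simp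
  show "\<rho> \<sigma> (x * y) = \<rho> \<sigma> x * \<rho> \<sigma> y" "\<rho> \<sigma> 1 = 1"
    using ring_hom_mult[OF \<rho>_ring_hom[OF assms], of x y] ring_hom_one[OF \<rho>_ring_hom[OF assms]] by simp_all
  show "\<rho> \<sigma> 0 = 0" using a[of 0 0] by simp
qed

lemma \<rho>_inverse: "\<sigma> \<in> carrier G \<Longrightarrow> \<rho> \<sigma> (inverse x) = inverse (\<rho> \<sigma> x)"
proof (cases "x = 0")
  case False
  assume s: "\<sigma> \<in> carrier G"
  have "\<rho> \<sigma> x * \<rho> \<sigma> (inverse x) = 1" using \<rho>_ring(2,3)[OF s] False by (metis right_inverse)
  then show ?thesis using inverse_unique by metis
qed (simp add: \<rho>_ring)

lemma \<rho>_comp: "\<lbrakk>\<sigma> \<in> carrier G; \<tau> \<in> carrier G\<rbrakk> \<Longrightarrow> \<rho> (\<sigma> \<otimes>\<^bsub>G\<^esub> \<tau>) x = \<rho> \<sigma> (\<rho> \<tau> x)"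
proof -
  assume s: "\<sigma> \<in> carrier G" "\<tau> \<in> carrier G"
  have "\<rho> (\<sigma> \<otimes>\<^bsub>G\<^esub> \<tau>) = \<rho> \<sigma> \<otimes>\<^bsub>gal_group k\<^esub> \<rho> \<tau>" using \<rho>_epi s by (auto simp: epi_def hom_def)
  moreover have "\<rho> \<sigma> \<in> Bij UNIV" "\<rho> \<tau> \<in> Bij UNIV" using \<rho>_bij s by (auto simp: Bij_def)
  ultimately show ?thesis by (simp add: gal_group_def BijGroup_def compose_def)
qed

lemma \<rho>_one: "\<rho> \<one>\<^bsub>G\<^esub> x = x"
  using \<rho>_comp[of "\<one>\<^bsub>G\<^esub>" "\<one>\<^bsub>G\<^esub>" x] \<rho>_bij[of "\<one>\<^bsub>G\<^esub>"] by (simp add: bij_def inj_eq)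

text \<open>As \<open>\<rho>\<close> maps onto the Galois group, both have the same fixed elements,
  and these are \<open>k\<close> by the Galois assumption.\<close>

lemma fixed_iff: "(\<forall>\<sigma>\<in>carrier G. \<rho> \<sigma> x = x) \<longleftrightarrow> x \<in> k"
proof -
  have "\<rho> ` carrier G = carrier (gal_group k)" using \<rho>_epi by (simp add: epi_def)
  moreover have "{x. \<forall>\<tau>\<in>carrier (gal_group k). \<tau> x = x} = k" using galois by (simp add: galois_extension_def)
  then have "x \<in> k \<longleftrightarrow> (\<forall>\<tau>\<in>carrier (gal_group k). \<tau> x = x)" by blast
  ultimately show ?thesis by (metis (no_types, lifting) image_iff)
qed

lemma act_comp: "\<lbrakk>\<sigma> \<in> carrier G; \<tau> \<in> carrier G\<rbrakk> \<Longrightarrow> act (\<sigma> \<otimes>\<^bsub>G\<^esub> \<tau>) v = act \<sigma> (act \<tau> v)"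
  using group_action.composition_rule[OF action] by simp

lemma act_one: "act \<one>\<^bsub>G\<^esub> v = v"
  using group_action.id_eq_one[OF action] by (metis restrict_apply UNIV_I)

lemma act_sum: "\<sigma> \<in> carrier G \<Longrightarrow> act \<sigma> (\<Sum>i\<in>A. f i) = (\<Sum>i\<in>A. act \<sigma> (f i))"
proof (induction A rule: infinite_finite_induct)
  case empty
  then show ?case using act_add[of \<sigma> 0 0] by simp
next
  case (infinite A)
  then show ?case using act_add[of \<sigma> 0 0] by simp
qed (simp add: act_add)

definition "N = group_exponent G"

lemma exponent: "0 < N" "\<sigma> \<in> carrier G \<Longrightarrow> \<sigma> [^]\<^bsub>G\<^esub> N = \<one>\<^bsub>G\<^esub>"
proof -
  \<comment> \<open>The order of the group is one admissible value, so \<open>LEAST\<close> is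
    attained.\<close>
  have "0 < Coset.order G \<and> (\<forall>g\<in>carrier G. g [^]\<^bsub>G\<^esub> Coset.order G = \<one>\<^bsub>G\<^esub>)"
    using G.pow_order_eq_1 G.order_gt_0_iff_finite G_finite by blast
  from LeastI[of "\<lambda>n. 0 < n \<and> (\<forall>g\<in>carrier G. g [^]\<^bsub>G\<^esub> n = \<one>\<^bsub>G\<^esub>)", OF this]
  show "0 < N" "\<sigma> \<in> carrier G \<Longrightarrow> \<sigma> [^]\<^bsub>G\<^esub> N = \<one>\<^bsub>G\<^esub>"
    unfolding N_def group_exponent_def by blast+
qed

text \<open>The roots of unity available as eigenvalues. All of them lie in \<open>k\<close>
  (\<open>Z_k\<close>), and there are \<open>N\<close> of them (\<open>card_Z\<close>), both by
  passing to the algebraic closure.\<close>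

definition "Z = {z :: 'k. z ^ N = 1}"

lemma Z_k: "Z \<subseteq> k"
proof
  fix z assume "z \<in> Z"
  then have "to_ac z ^ group_exponent G = 1" by (simp add: Z_def N_def flip: to_ac_power)
  from roots[OF this] show "z \<in> k" by auto
qed

lemma Z_pow: "z \<in> Z \<Longrightarrow> z ^ j \<in> Z"
  by (simp add: Z_def power_mult[symmetric] mult.commute[of _ N]) (simp add: power_mult)

lemma Z_0: "z \<in> Z \<Longrightarrow> z \<noteq> 0"
  using exponent(1) by (auto simp: Z_def zero_power)

lemma card_Z: "card Z = N"
proof -
  have "to_ac ` Z = {x :: 'k alg_closure. x ^ N = 1}"
  proof (intro equalityI subsetI)
    fix x :: "'k alg_closure" assume "x \<in> {x. x ^ N = 1}"
    then have x: "x ^ N = 1" by simp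
    then obtain z where z: "x = to_ac z" using roots unfolding N_def by blast
    then have "to_ac (z ^ N) = 1" using x by simp
    then have "z ^ N = 1" by (simp only: to_ac_eq_1_iff)
    then show "x \<in> to_ac ` Z" using z by (simp add: Z_def)
  qed (auto simp: Z_def simp flip: to_ac_power)
  then have "card (to_ac ` Z) = N" using card_roots_of_unity_alg_closed[OF exponent(1)] by metis
  moreover have "inj_on to_ac Z" by (rule inj_on_subset[OF inj_to_ac]) simp
  ultimately show ?thesis by (simp add: card_image)
qed

text \<open>Orthogonality of characters: for \<open>0 < j < N\<close> some root satisfies
  \<open>z0 ^ j \<noteq> 1\<close>, since \<open>X^j - 1\<close> has at most \<open>j\<close> roots,
  and multiplying the sum by \<open>z0 ^ j\<close> only permutes its terms.\<close>

lemma sum_Z: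
  assumes "j < N"
  shows "(\<Sum>z\<in>Z. z ^ j) = (if j = 0 then of_nat N else 0)"
proof (cases "j = 0")
  case False
  have "\<exists>z\<in>Z. z ^ j \<noteq> 1"
  proof (rule ccontr)
    assume "\<not> (\<exists>z\<in>Z. z ^ j \<noteq> 1)"
    then have sub: "Z \<subseteq> {z. poly (Polynomial.monom 1 j - 1) z = 0}" by (auto simp: poly_monom)
    have d: "Polynomial.degree (Polynomial.monom (1 :: 'k) j - 1) \<le> j"
      by (rule degree_diff_le) (simp_all add: degree_monom_le)
    have "poly (Polynomial.monom (1 :: 'k) j - 1) 0 \<noteq> 0" using False by (simp add: poly_monom zero_power)
    then have nz: "Polynomial.monom (1 :: 'k) j - 1 \<noteq> 0" by (metis poly_0)
    have "N \<le> card {z :: 'k. poly (Polynomial.monom 1 j - 1) z = 0}"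
      using card_mono[OF poly_roots_finite[OF nz] sub] by (simp add: card_Z)
    also have "\<dots> \<le> j" using card_poly_roots_bound[OF nz] d by simp
    finally show False using assms by simp
  qed
  then obtain z0 where z0: "z0 \<in> Z" "z0 ^ j \<noteq> 1" by blast
  have "z0 ^ j * (\<Sum>z\<in>Z. z ^ j) = (\<Sum>z\<in>Z. (z0 * z) ^ j)" by (simp add: sum_distrib_left power_mult_distrib)
  also have "\<dots> = (\<Sum>z\<in>Z. z ^ j)"
    by (rule sum.reindex_bij_witness[where i = "\<lambda>z. inverse z0 * z" and j = "\<lambda>z. z0 * z"])
      (use z0 Z_0[OF z0(1)] in \<open>auto simp: Z_def power_mult_distrib power_inverse mult.assoc[symmetric]\<close>)
  finally have "(z0 ^ j - 1) * (\<Sum>z\<in>Z. z ^ j) = 0" by (simp add: algebra_simps)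
  then show ?thesis using z0(2) False by simp
qed (simp add: card_Z)

text \<open>Eigenvalues are restricted to roots of unity; these lie in \<open>k\<close>, so the
  semilinear maps commute with scaling by them.\<close>

definition "eig S = {v. \<forall>\<sigma>\<in>S. \<exists>z\<in>Z. act \<sigma> v = scale z v}"

text \<open>Splits \<open>v\<close> by a finite Fourier transform over the powers of \<open>\<sigma>\<close>.\<close>

lemma eig_step:
  assumes S: "S \<subseteq> carrier G" and s: "\<sigma> \<in> carrier G" and v: "v \<in> eig S"
  shows "v \<in> V.span (eig (insert \<sigma> S))"
proof -
  define f where "f z j = scale (z ^ j) (act (\<sigma> [^]\<^bsub>G\<^esub> (j::nat)) v)" for z j
  \<comment> \<open>Up to the factor \<open>N\<close>, the component of \<open>v\<close> on which
    \<open>\<sigma>\<close> acts as the inverse of \<open>z\<close>: applying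
    \<open>\<sigma>\<close> shifts \<open>j\<close> by one, and the shift is cyclic because the
    orders of \<open>\<sigma>\<close> and \<open>z\<close> divide \<open>N\<close>.\<close>
  define w where "w z = (\<Sum>j<N. f z j)" for z
  have pc: "\<sigma> [^]\<^bsub>G\<^esub> (j::nat) \<in> carrier G" for j using s by simp
  \<comment> \<open>Here the roots of unity have to lie in \<open>k\<close>: being fixed by the
    Galois group, they pass unchanged through the semilinear maps.\<close>
  have zk: "\<rho> \<tau> (z ^ j) = z ^ j" if "\<tau> \<in> carrier G" "z \<in> Z" for \<tau> z j using \<rho>_k that Z_pow Z_k by blast
  have w: "w z \<in> eig (insert \<sigma> S)" if z: "z \<in> Z" for z
    unfolding eig_def
  proof (intro CollectI ballI)
    fix \<tau> assume "\<tau> \<in> insert \<sigma> S"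
    then consider "\<tau> = \<sigma>" | "\<tau> \<in> S" by blast
    then show "\<exists>x\<in>Z. act \<tau> (w z) = scale x (w z)"
    proof cases
      case 1
      have "f z N = f z 0" using z exponent(2)[OF s] by (simp add: f_def Z_def)
      then have shift: "(\<Sum>j<N. f z (Suc j)) = w z"
        using sum.lessThan_Suc_shift[of "f z" N] by (simp add: w_def)
      have "act \<sigma> (f z j) = scale (inverse z) (f z (Suc j))" for j
      proof -
        have "act \<sigma> (act (\<sigma> [^]\<^bsub>G\<^esub> j) v) = act (\<sigma> [^]\<^bsub>G\<^esub> Suc j) v"
          using act_comp[OF s pc] G.m_comm[OF s pc] by simp
        then show ?thesis using act_scale[OF s] zk[OF s z] Z_0[OF z] by (simp add: f_def)
      qed
      then have "act \<sigma> (w z) = scale (inverse z) (w z)"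
        using shift by (simp add: w_def act_sum[OF s] flip: V.scale_sum_right)
      moreover have "inverse z \<in> Z" using z by (simp add: Z_def power_inverse)
      ultimately show ?thesis using 1 by blast
    next
      \<comment> \<open>Commutativity of the group preserves the eigenvalues already obtained for
        \<open>S\<close>.\<close>
      case 2
      then have t: "\<tau> \<in> carrier G" using S by blast
      obtain x where x: "x \<in> Z" "act \<tau> v = scale x v" using v 2 by (auto simp: eig_def)
      have "act \<tau> (f z j) = scale x (f z j)" for j
      proof -
        have "act \<tau> (act (\<sigma> [^]\<^bsub>G\<^esub> j) v) = act (\<sigma> [^]\<^bsub>G\<^esub> j) (act \<tau> v)"
          using act_comp[OF t pc, of j v] act_comp[OF pc t, of j v] G.m_comm[OF t pc] by simp
        also have "\<dots> = scale x (act (\<sigma> [^]\<^bsub>G\<^esub> j) v)" using x act_scale[OF pc] zk[OF pc x(1), of j 1] by simp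
        finally show ?thesis using act_scale[OF t] zk[OF t z] by (simp add: f_def mult.commute)
      qed
      then have "act \<tau> (w z) = scale x (w z)" by (simp add: w_def act_sum[OF t] V.scale_sum_right)
      then show ?thesis using x(1) by blast
    qed
  qed
  \<comment> \<open>By orthogonality only \<open>j = 0\<close> survives, so the components add up to
    \<open>N\<close> times \<open>v\<close>, and \<open>N\<close> is invertible in characteristic
    0.\<close>
  have "(\<Sum>z\<in>Z. w z) = (\<Sum>j<N. \<Sum>z\<in>Z. f z j)" unfolding w_def by (rule sum.swap)
  also have "\<dots> = (\<Sum>j<N. scale (if j = 0 then of_nat N else 0) (act (\<sigma> [^]\<^bsub>G\<^esub> j) v))"
    by (rule sum.cong) (simp_all add: f_def sum_Z flip: V.scale_sum_left)
  also have "\<dots> = (\<Sum>j<N. if j = 0 then scale (of_nat N) v else 0)"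
    by (rule sum.cong) (simp_all add: act_one)
  also have "\<dots> = scale (of_nat N) v" using exponent(1) by simp
  finally have "v = scale (inverse (of_nat N)) (\<Sum>z\<in>Z. w z)" using exponent(1) by simp
  also have "\<dots> \<in> V.span (eig (insert \<sigma> S))" by (intro V.span_scale V.span_sum V.span_base w)
  finally show ?thesis .
qed

text \<open>One group element is diagonalised after another; for the empty set every vector is an
  eigenvector.\<close>

lemma span_eig: "V.span (eig (carrier G)) = UNIV"
proof -
  have "finite S \<Longrightarrow> S \<subseteq> carrier G \<Longrightarrow> V.span (eig S) = UNIV" for S
  proof (induction S rule: finite_induct)
    case empty
    show ?case by (simp add: eig_def)
  next
    case (insert \<sigma> S)
    have "V.span (eig S) \<subseteq> V.span (eig (insert \<sigma> S))"
      by (rule V.span_minimal[OF _ V.subspace_span]) (use eig_step insert.prems in blast)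
    then show ?case using insert by auto
  qed
  then show ?thesis using G_finite by simp
qed

lemma eigenbasis:
  "\<exists>b \<chi>. inj_on b {..<V.dim UNIV} \<and> V.independent (b ` {..<V.dim UNIV}) \<and> V.span (b ` {..<V.dim UNIV}) = UNIV \<and>
    (\<forall>i<V.dim UNIV. \<forall>\<sigma>\<in>carrier G. \<chi> i \<sigma> \<in> Z \<and> act \<sigma> (b i) = scale (\<chi> i \<sigma>) (b i))"
proof -
  obtain B where B: "B \<subseteq> eig (carrier G)" "V.independent B" "eig (carrier G) \<subseteq> V.span B"
    by (rule V.maximal_independent_subset)
  have span: "V.span B = UNIV" using V.span_minimal[OF B(3) V.subspace_span] span_eig by auto
  obtain B0 where "finite_dimensional_vector_space scale B0" using finite_dim by blast
  then have fin: "finite B" using finite_dimensional_vector_space.finiteI_independent B(2) by blast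
  have "card B = V.dim UNIV" by (rule V.basis_card_eq_dim) (use B(2) span in auto)
  then obtain b where b: "bij_betw b {..<V.dim UNIV} B" using ex_bij_betw_nat_finite[OF fin] by (auto simp: atLeast0LessThan)
  have "\<forall>i \<sigma>. \<exists>z. i < V.dim UNIV \<and> \<sigma> \<in> carrier G \<longrightarrow> z \<in> Z \<and> act \<sigma> (b i) = scale z (b i)"
  proof (intro allI)
    fix i \<sigma>
    show "\<exists>z. i < V.dim UNIV \<and> \<sigma> \<in> carrier G \<longrightarrow> z \<in> Z \<and> act \<sigma> (b i) = scale z (b i)"
    proof (cases "i < V.dim UNIV \<and> \<sigma> \<in> carrier G")
      case True
      then have "b i \<in> eig (carrier G)" using bij_betwE[OF b] B(1) by blast
      then show ?thesis using True by (auto simp: eig_def)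
    qed blast
  qed
  then obtain \<chi> where "\<forall>i \<sigma>. i < V.dim UNIV \<and> \<sigma> \<in> carrier G \<longrightarrow> \<chi> i \<sigma> \<in> Z \<and> act \<sigma> (b i) = scale (\<chi> i \<sigma>) (b i)"
    by metis
  moreover have "b ` {..<V.dim UNIV} = B" "inj_on b {..<V.dim UNIV}" using b by (auto simp: bij_betw_def)
  ultimately show ?thesis using B(2) span by (intro exI[of _ b] exI[of _ \<chi>]) auto
qed

end

section \<open>Characters of a diagonal action and the grading they define\<close>

locale diagonal_action = semilinear_action G k \<rho> scale act
  for G :: "('g, 'm) monoid_scheme" and k :: "'k::field_char_0 set" and \<rho>
    and scale :: "'k \<Rightarrow> 'v::ab_group_add \<Rightarrow> 'v" and act +
  fixes n :: nat and b :: "nat \<Rightarrow> 'v" and \<chi> :: "nat \<Rightarrow> 'g \<Rightarrow> 'k"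
  assumes b_inj: "inj_on b {..<n}" and b_indep: "V.independent (b ` {..<n})" and b_span: "V.span (b ` {..<n}) = UNIV"
    and \<chi>_Z: "\<lbrakk>i < n; \<sigma> \<in> carrier G\<rbrakk> \<Longrightarrow> \<chi> i \<sigma> \<in> Z"
    and act_b: "\<lbrakk>i < n; \<sigma> \<in> carrier G\<rbrakk> \<Longrightarrow> act \<sigma> (b i) = scale (\<chi> i \<sigma>) (b i)"
begin

lemma b_0: "i < n \<Longrightarrow> b i \<noteq> 0"
  using b_indep V.dependent_zero by (metis imageI lessThan_iff)

text \<open>The eigenvalues lie in \<open>k\<close> and are fixed by \<open>\<rho> \<sigma>\<close>,
  so what is in general a twisted cocycle of a semilinear action becomes a character.\<close>

lemma \<chi>_mult: "\<lbrakk>i < n; \<sigma> \<in> carrier G; \<tau> \<in> carrier G\<rbrakk> \<Longrightarrow> \<chi> i (\<sigma> \<otimes>\<^bsub>G\<^esub> \<tau>) = \<chi> i \<sigma> * \<chi> i \<tau>"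
proof -
  assume i: "i < n" and s: "\<sigma> \<in> carrier G" "\<tau> \<in> carrier G"
  have "\<rho> \<sigma> (\<chi> i \<tau>) = \<chi> i \<tau>" using \<rho>_k[OF s(1)] \<chi>_Z[OF i s(2)] Z_k by blast
  then have "scale (\<chi> i (\<sigma> \<otimes>\<^bsub>G\<^esub> \<tau>)) (b i) = scale (\<chi> i \<sigma> * \<chi> i \<tau>) (b i)"
    using act_b[OF i] act_comp[OF s, of "b i"] act_scale[OF s(1)] s by (simp add: mult.commute)
  then show ?thesis using V.scale_right_imp_eq[OF b_0[OF i]] by blast
qed

lemma \<chi>_inv: "\<lbrakk>i < n; \<sigma> \<in> carrier G\<rbrakk> \<Longrightarrow> \<chi> i (inv\<^bsub>G\<^esub> \<sigma>) = inverse (\<chi> i \<sigma>)"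
proof -
  assume i: "i < n" and s: "\<sigma> \<in> carrier G"
  have "scale (\<chi> i \<one>\<^bsub>G\<^esub>) (b i) = scale 1 (b i)" using act_b[OF i, of "\<one>\<^bsub>G\<^esub>"] act_one by simp
  then have "\<chi> i \<one>\<^bsub>G\<^esub> = 1" using V.scale_right_imp_eq[OF b_0[OF i]] by blast
  then have "\<chi> i \<sigma> * \<chi> i (inv\<^bsub>G\<^esub> \<sigma>) = 1" using \<chi>_mult[OF i s, of "inv\<^bsub>G\<^esub> \<sigma>"] s by simp
  then show ?thesis by (metis inverse_unique)
qed

definition "\<chi>' a \<sigma> = (\<Prod>i<n. \<chi> i \<sigma> powi lookup a i)" for a :: "nat \<Rightarrow>\<^sub>0 int"

lemma \<chi>'_0 [simp]: "\<chi>' 0 \<sigma> = 1"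
  by (simp add: \<chi>'_def)

lemma \<chi>'_nz: "\<sigma> \<in> carrier G \<Longrightarrow> \<chi>' a \<sigma> \<noteq> 0"
  using Z_0[OF \<chi>_Z] by (simp add: \<chi>'_def)

lemma \<chi>'_add: "\<sigma> \<in> carrier G \<Longrightarrow> \<chi>' (a + a') \<sigma> = \<chi>' a \<sigma> * \<chi>' a' \<sigma>"
  using Z_0[OF \<chi>_Z] by (simp add: \<chi>'_def lookup_add power_int_add flip: prod.distrib)

lemma \<chi>'_uminus: "\<chi>' (- a) \<sigma> = inverse (\<chi>' a \<sigma>)"
  by (simp add: \<chi>'_def power_int_minus prod_inversef[unfolded comp_def])

lemma \<chi>'_single: "i < n \<Longrightarrow> \<chi>' (single i z) \<sigma> = \<chi> i \<sigma> powi z"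
proof -
  assume i: "i < n"
  have "\<chi>' (single i z) \<sigma> = (\<Prod>j<n. if j = i then \<chi> i \<sigma> powi z else 1)"
    unfolding \<chi>'_def by (rule prod.cong) (auto simp: lookup_single when_def)
  then show ?thesis using i by simp
qed

text \<open>The group multiplies the dual coordinate \<open>x_i\<close> by the inverse of
  \<open>\<chi> i\<close>. A term with coefficient \<open>c\<close> and exponent \<open>a\<close> is
  therefore invariant iff \<open>\<rho> \<sigma> c\<close> times the inverse of
  \<open>\<chi>' a \<sigma>\<close> is \<open>c\<close>, which is the equation here. Negative
  exponents are covered in view of the localizations.\<close>

definition "D a = {c. \<forall>\<sigma>\<in>carrier G. \<rho> \<sigma> c = \<chi>' a \<sigma> * c}"

lemma grading_D: "grading k D N"
proof
  show "D 0 = k" using fixed_iff by (auto simp: D_def)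
  show "c + d \<in> D a" if "c \<in> D a" "d \<in> D a" for c d a using that by (simp add: D_def \<rho>_ring distrib_left)
  show "c * d \<in> D (a + b)" if "c \<in> D a" "d \<in> D b" for c d a b using that by (simp add: D_def \<rho>_ring \<chi>'_add mult_ac)
  show "inverse c \<in> D (- a)" if "c \<in> D a" for c a using that by (simp add: D_def \<rho>_inverse \<chi>'_uminus)
  show "1 \<in> k" using fixed_iff[of 1] \<rho>_ring(3) by blast
  show "- c \<in> k" if "c \<in> k" for c
  proof -
    have "\<rho> \<sigma> c + \<rho> \<sigma> (- c) = 0" if "\<sigma> \<in> carrier G" for \<sigma> using \<rho>_ring(1,4)[OF that] by (metis right_minus)
    then have "\<forall>\<sigma>\<in>carrier G. \<rho> \<sigma> (- c) = - c" using \<rho>_k \<open>c \<in> k\<close> by (metis add.inverse_unique)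
    then show ?thesis using fixed_iff by blast
  qed
  show "0 \<in> D a" for a by (simp add: D_def \<rho>_ring)
  show "0 < N" by (rule exponent(1))
  show "1 \<in> D (single i (int N))" for i
  proof -
    have "\<chi>' (single i (int N)) \<sigma> = 1" if s: "\<sigma> \<in> carrier G" for \<sigma>
    proof (cases "i < n")
      case True
      then show ?thesis using \<chi>_Z[OF True s] by (simp add: \<chi>'_single Z_def)
    next
      \<comment> \<open>Indices from \<open>n\<close> on do not enter \<open>\<chi>'\<close>, so
        their weights are trivial; \<open>grading\<close> asks for \<open>D_N\<close> at every
        index.\<close>
      case False
      then show ?thesis unfolding \<chi>'_def by (intro prod.neutral) (auto simp: lookup_single when_def)
    qed
    then show ?thesis by (simp add: D_def \<rho>_ring)
  qed
qed

end

section \<open>Quotients of linear actions\<close>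

lemma subring_mpoly: "subring_type {p :: ('x, 'k::field) mpoly. \<forall>m\<in>keys p. keys m \<subseteq> W}"
proof -
  have add: "keys m \<subseteq> W" if "m \<in> keys (p + q)"
    "\<forall>m\<in>keys p. keys m \<subseteq> W" "\<forall>m\<in>keys q. keys m \<subseteq> W"
    for p q :: "('x, 'k) mpoly" and m
    using that keys_add[of p q] by blast
  have mult: "keys m \<subseteq> W" if m: "m \<in> keys (p * q)"
    and p: "\<forall>m\<in>keys p. keys m \<subseteq> W" and q: "\<forall>m\<in>keys q. keys m \<subseteq> W"
    for p q :: "('x, 'k) mpoly" and m
  proof -
    obtain a c where "m = a + c" "a \<in> keys p" "c \<in> keys q" using m keys_mult[of p q] by blast
    then show ?thesis using p q keys_add[of a c] by blast
  qed
  show ?thesis unfolding subring_type_def using add mult by auto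
qed

definition mon :: "('x \<Rightarrow> 'c::comm_ring_1) \<Rightarrow> ('x \<Rightarrow>\<^sub>0 nat) \<Rightarrow> 'c"
  where "mon V m = (\<Prod>x\<in>keys m. V x ^ lookup m x)"

lemma mon_add: "mon V (m + l) = mon V m * mon V l"
proof -
  let ?A = "keys m \<union> keys l"
  have e: "mon V q = (\<Prod>x\<in>?A. V x ^ lookup q x)" if "keys q \<subseteq> ?A" for q
    unfolding mon_def by (rule prod.mono_neutral_left) (use that in \<open>auto simp: in_keys_iff\<close>)
  show ?thesis using e[OF keys_add] e[of m] e[of l] by (simp add: lookup_add power_add prod.distrib)
qed

text \<open>Evaluation of polynomials, with \<open>C\<close> on coefficients and \<open>V\<close> on
  variables. The coordinate map \<open>\<Psi>\<close> and the action \<open>poly_act\<close> are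
  both evaluations and inherit their homomorphism laws from \<open>ev_hom\<close>.\<close>

definition ev :: "('k::field \<Rightarrow> 'c::comm_ring_1) \<Rightarrow> ('x \<Rightarrow> 'c) \<Rightarrow> ('x, 'k) mpoly \<Rightarrow> 'c"
  where "ev C V = ext (\<lambda>m c. C c * mon V m)"

lemma ev_hom:
  assumes C: "C 0 = 0" "C 1 = 1" "\<And>x y. C (x + y) = C x + C y" "\<And>x y. C (x * y) = C x * C y"
  shows "ev C V (p + q) = ev C V p + ev C V q" "ev C V (p * q) = ev C V p * ev C V q"
    "ev C V (mpoly_const c) = C c" "ev C V (mpoly_var x) = V x"
proof -
  have h: "C 0 * mon V m = 0" "C (x + y) * mon V m = C x * mon V m + C y * mon V m" for m x y
    by (simp_all add: C distrib_right)
  show "ev C V (p + q) = ev C V p + ev C V q" unfolding ev_def by (rule ext_add[OF h])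
  show "ev C V (p * q) = ev C V p * ev C V q"
    unfolding ev_def by (rule ext_mult[OF h, where S = UNIV]) (simp_all add: C mon_add mult_ac)
  show "ev C V (mpoly_const c) = C c" "ev C V (mpoly_var x) = V x"
    using C by (simp_all add: ev_def mpoly_const_def mpoly_var_def ext_single mon_def)
qed

lemma mpoly_const_hom:
  "mpoly_const 0 = 0" "mpoly_const 1 = 1" "mpoly_const (c + d) = mpoly_const c + mpoly_const d"
  "mpoly_const (c * d) = mpoly_const c * mpoly_const d"
  by (simp_all add: mpoly_const_def single_add mult_single)

text \<open>Constants and variables generate the polynomial ring, so identities between
  homomorphisms need checking on them only.\<close>

lemma mpoly_induct [consumes 1, case_names const var add mult]:
  fixes p :: "('x, 'k::field) mpoly"
  assumes p: "\<forall>m\<in>keys p. keys m \<subseteq> W"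
    and const: "\<And>c. P (mpoly_const c)" and var: "\<And>x. x \<in> W \<Longrightarrow> P (mpoly_var x)"
    and add: "\<And>p q. P p \<Longrightarrow> P q \<Longrightarrow> P (p + q)" and mult: "\<And>p q. P p \<Longrightarrow> P q \<Longrightarrow> P (p * q)"
  shows "P p"
proof -
  let ?s = "single :: ('x \<Rightarrow>\<^sub>0 nat) \<Rightarrow> 'k \<Rightarrow> ('x, 'k) mpoly"
  have P0: "P 0" "P 1" using const[of 0] const[of 1] by (simp_all add: mpoly_const_hom)
  have pow: "P (?s (single x e) 1)" if "x \<in> W" for x e
  proof (induction e)
    case (Suc e)
    have "P (mpoly_var x * ?s (single x e) 1)" by (rule mult[OF var[OF that] Suc.IH])
    then show ?case by (simp add: mpoly_var_def mult_single single_add[symmetric])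
  qed (use P0 in simp)
  have prod: "P (?s (\<Sum>x\<in>A. single x (e x)) 1)" if "finite A" "A \<subseteq> W" for A e
    using that
  proof (induction A rule: finite_induct)
    case (insert x A)
    then have "P (?s (single x (e x)) 1 * ?s (\<Sum>x\<in>A. single x (e x)) 1)"
      by (intro mult pow) auto
    then show ?case using insert by (simp add: mult_single)
  qed (use P0 in simp)
  have single: "P (?s m c)" if "keys m \<subseteq> W" for m c
  proof -
    have "P (mpoly_const c * ?s (\<Sum>x\<in>keys m. single x (lookup m x)) 1)"
      by (rule mult[OF const prod[OF finite_keys that]])
    then show ?thesis by (simp add: mpoly_const_def mult_single pm_expand[symmetric])
  qed
  have "P (\<Sum>m\<in>A. ?s m (lookup p m))" if "finite A" "A \<subseteq> keys p" for A
    using that by (induction A rule: finite_induct) (use P0 p in \<open>auto intro!: add single\<close>)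
  from this[OF finite_keys subset_refl] show ?thesis by (simp add: pm_expand[symmetric])
qed

text \<open>The trivial family over the whole field \<open>'k\<close>. It makes the facts on graded
  algebras available for the coordinate ring of the vector space itself, before invariants are
  taken.\<close>

lemma grading_UNIV: "grading (UNIV :: 'k::field_char_0 set) (\<lambda>_. UNIV) 1"
  by unfold_locales simp_all

section \<open>The symmetric algebra in dual coordinates\<close>

context diagonal_action
begin

abbreviation "W \<equiv> dual_space scale"
abbreviation "\<P> \<equiv> mpoly_ring W :: ('v \<Rightarrow> 'k, 'k) mpoly ring"
abbreviation "\<J> \<equiv> sym_ideal scale"
abbreviation "P0 \<equiv> graded (expo {..<n} {}) (\<lambda>_. UNIV :: 'k set)"

lemma \<P>_eq: "\<P> = subalg {p. \<forall>m\<in>keys p. keys m \<subseteq> W}"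
  by (simp add: mpoly_ring_def)

lemma carrier_\<P>: "carrier \<P> = {p. \<forall>m\<in>keys p. keys m \<subseteq> W}"
  by (simp add: \<P>_eq)

lemma \<P>_simps: "p \<otimes>\<^bsub>\<P>\<^esub> q = p * q" "p \<oplus>\<^bsub>\<P>\<^esub> q = p + q" "\<one>\<^bsub>\<P>\<^esub> = 1" "\<zero>\<^bsub>\<P>\<^esub> = 0"
  by (simp_all add: \<P>_eq)

lemma cring_\<P>: "cring \<P>"
  unfolding \<P>_eq by (rule subalg_cring[OF subring_mpoly])

lemma \<P>_closed:
  "p \<in> carrier \<P> \<Longrightarrow> q \<in> carrier \<P> \<Longrightarrow> p + q \<in> carrier \<P>"
  "p \<in> carrier \<P> \<Longrightarrow> q \<in> carrier \<P> \<Longrightarrow> p * q \<in> carrier \<P>"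
  "p \<in> carrier \<P> \<Longrightarrow> - p \<in> carrier \<P>" "0 \<in> carrier \<P>" "1 \<in> carrier \<P>"
proof -
  have "subring_type (carrier \<P>)" unfolding carrier_\<P> by (rule subring_mpoly)
  then show "p \<in> carrier \<P> \<Longrightarrow> q \<in> carrier \<P> \<Longrightarrow> p + q \<in> carrier \<P>"
    "p \<in> carrier \<P> \<Longrightarrow> q \<in> carrier \<P> \<Longrightarrow> p * q \<in> carrier \<P>"
    "p \<in> carrier \<P> \<Longrightarrow> - p \<in> carrier \<P>" "0 \<in> carrier \<P>" "1 \<in> carrier \<P>"
    unfolding subring_type_def by blast+
qed

lemma const_closed: "mpoly_const c \<in> carrier \<P>"
  by (simp add: carrier_\<P> mpoly_const_def)

lemma var_closed: "\<phi> \<in> W \<Longrightarrow> mpoly_var \<phi> \<in> carrier \<P>"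
  by (simp add: carrier_\<P> mpoly_var_def)

lemma \<P>_induct [consumes 1, case_names const var add mult]:
  assumes "p \<in> carrier \<P>" and "\<And>c. Q (mpoly_const c)" and "\<And>x. x \<in> W \<Longrightarrow> Q (mpoly_var x)"
    and "\<And>p q. Q p \<Longrightarrow> Q q \<Longrightarrow> Q (p + q)" and "\<And>p q. Q p \<Longrightarrow> Q q \<Longrightarrow> Q (p * q)"
  shows "Q p"
proof (rule mpoly_induct[where W = W])
  show "\<forall>m\<in>keys p. keys m \<subseteq> W" using assms(1) by (simp add: carrier_\<P>)
qed (fact assms)+

lemma W_iff: "\<phi> \<in> W \<longleftrightarrow> (\<forall>u v. \<phi> (u + v) = \<phi> u + \<phi> v) \<and> (\<forall>c v. \<phi> (scale c v) = c * \<phi> v)"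
proof -
  have "vector_space ((*) :: 'k \<Rightarrow> 'k \<Rightarrow> 'k)" by unfold_locales (simp_all add: algebra_simps)
  then show ?thesis unfolding dual_space_def Vector_Spaces.linear_iff using V.vector_space_axioms by auto
qed

lemma W_add: "\<phi> \<in> W \<Longrightarrow> \<psi> \<in> W \<Longrightarrow> (\<lambda>v. \<phi> v + \<psi> v) \<in> W"
  and W_smult: "\<phi> \<in> W \<Longrightarrow> (\<lambda>v. c * \<phi> v) \<in> W"
  by (simp_all add: W_iff algebra_simps)

lemma W_sum: "(\<And>i. i \<in> A \<Longrightarrow> \<phi> i \<in> W) \<Longrightarrow> (\<lambda>v. \<Sum>i\<in>A. c i * \<phi> i v) \<in> W"
  by (simp add: W_iff sum.distrib sum_distrib_left algebra_simps)

text \<open>The basis of linear forms dual to \<open>b\<close>.\<close>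

definition "bd i = (\<lambda>v. V.representation (b ` {..<n}) v (b i))"

lemma bd_W: "bd i \<in> W"
  using V.linear_representation[OF b_indep b_span, of "b i"] by (simp add: bd_def dual_space_def)

lemma bd_b: "\<lbrakk>i < n; j < n\<rbrakk> \<Longrightarrow> bd i (b j) = (if i = j then 1 else 0)"
  using V.representation_basis[OF b_indep, of "b j"] b_inj by (auto simp: bd_def inj_on_def)

lemma W_expand: "\<phi> \<in> W \<Longrightarrow> \<phi> = (\<lambda>v. \<Sum>i<n. \<phi> (b i) * bd i v)"
proof
  fix v assume \<phi>: "\<phi> \<in> W"
  have sum: "\<phi> (\<Sum>i\<in>A. f i) = (\<Sum>i\<in>A. \<phi> (f i))" if "finite A" for A :: "nat set" and f
  proof -
    have "\<phi> (scale 0 0) = 0" using \<phi> unfolding W_iff by (metis mult_zero_left)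
    then have "\<phi> 0 = 0" by simp
    with that show ?thesis using \<phi> by (induction A rule: finite_induct) (auto simp: W_iff)
  qed
  have "v = (\<Sum>w\<in>b ` {..<n}. scale (V.representation (b ` {..<n}) v w) w)"
    by (rule V.sum_representation_eq[symmetric, OF b_indep]) (simp_all add: b_span)
  also have "\<dots> = (\<Sum>i<n. scale (bd i v) (b i))" by (simp add: sum.reindex[OF b_inj] bd_def)
  finally have "\<phi> v = \<phi> (\<Sum>i<n. scale (bd i v) (b i))" by (rule arg_cong)
  then show "\<phi> v = (\<Sum>i<n. \<phi> (b i) * bd i v)" using \<phi> by (simp add: sum W_iff mult.commute)
qed

text \<open>A linear form written in dual coordinates, with \<open>x_i\<close> standing for
  \<open>bd i\<close>.\<close>

definition "\<psi> \<phi> = (\<Sum>i<n. single (single i (1::int)) (\<phi> (b i) :: 'k))"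

text \<open>The map from the presentation of the symmetric algebra to the polynomial ring over
  \<open>'k\<close> in \<open>n\<close> coordinates. \<open>\<Psi>_\<J>\<close> and
  \<open>s_\<Psi>\<close> show that its kernel is \<open>\<J>\<close>, with \<open>s\<close> as a
  section.\<close>

definition "\<Psi> = ev lconst \<psi>"

lemma \<Psi>_simps:
  "\<Psi> (p + q) = \<Psi> p + \<Psi> q" "\<Psi> (p * q) = \<Psi> p * \<Psi> q" "\<Psi> (mpoly_const c) = lconst c" "\<Psi> (mpoly_var \<phi>) = \<psi> \<phi>"
  unfolding \<Psi>_def by (rule ev_hom; simp add: single_add mult_single)+

lemma \<Psi>_0: "\<Psi> 0 = 0" and \<Psi>_1: "\<Psi> 1 = 1"
  using \<Psi>_simps(3)[of 0] \<Psi>_simps(3)[of 1] by (simp_all add: mpoly_const_hom)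

lemma \<Psi>_uminus: "\<Psi> (- p) = - \<Psi> p"
  using \<Psi>_simps(1)[of p "- p"] \<Psi>_0 by (metis add.inverse_unique right_minus)

lemma \<Psi>_diff: "\<Psi> (p - q) = \<Psi> p - \<Psi> q"
  using \<Psi>_simps(1)[of p "- q"] by (simp add: \<Psi>_uminus)

interpretation U: grading UNIV "\<lambda>_. UNIV :: 'k set" 1 by (rule grading_UNIV)

lemma \<Psi>_P0: "q \<in> carrier \<P> \<Longrightarrow> \<Psi> q \<in> P0"
proof (induction q rule: \<P>_induct)
  case (const c)
  show ?case unfolding \<Psi>_simps by (rule U.graded_single[OF U.expo_zero]) simp
next
  case (var \<phi>)
  show ?case unfolding \<Psi>_simps \<psi>_def by (intro U.graded_sum U.graded_single U.expo_single) auto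
next
  case (add p q)
  then show ?case unfolding \<Psi>_simps by (rule U.graded_add)
next
  case (mult p q)
  then show ?case unfolding \<Psi>_simps by (rule U.graded_mult[OF _ _ U.expo_add])
qed

text \<open>The monomial with the variable of \<open>bd i\<close> in place of \<open>x_i\<close>.
  Since \<open>nat\<close> truncates negative exponents, products are respected only on
  \<open>P0\<close> (\<open>s_mult\<close>).\<close>

definition "sm a = (\<Prod>i<n. mpoly_var (bd i) ^ nat (lookup a i) :: ('v \<Rightarrow> 'k, 'k) mpoly)" for a :: "nat \<Rightarrow>\<^sub>0 int"

definition "s = ext (\<lambda>a c. mpoly_const c * sm a)"

lemma s_add: "s (x + y) = s x + s y"
  unfolding s_def by (rule ext_add) (simp_all add: mpoly_const_hom distrib_right)

lemma s_single: "s (single a c) = mpoly_const c * sm a"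
  unfolding s_def by (rule ext_single) (simp add: mpoly_const_hom)

lemma s_const: "s (lconst c) = mpoly_const c"
  by (simp add: s_single sm_def)

lemma s_mult: "x \<in> P0 \<Longrightarrow> y \<in> P0 \<Longrightarrow> s (x * y) = s x * s y"
  unfolding s_def
proof (rule ext_mult[where S = "expo {..<n} {}"])
  fix a a' c c' assume a: "a \<in> expo {..<n} {}" "a' \<in> expo {..<n} {}"
  have "sm (a + a') = sm a * sm a'"
    unfolding sm_def prod.distrib[symmetric]
    by (rule prod.cong) (use a in \<open>auto simp: expo_def lookup_add nat_add_distrib power_add\<close>)
  then show "mpoly_const (c * c') * sm (a + a') = mpoly_const c * sm a * (mpoly_const c' * sm a')"
    by (simp only: mpoly_const_hom mult_ac)
qed (auto simp: mpoly_const_hom distrib_right graded_def)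

lemma s_sum: "s (\<Sum>i\<in>A. f i) = (\<Sum>i\<in>A. s (f i))"
  unfolding s_def by (rule ext_sum) (simp_all add: mpoly_const_hom distrib_right)

lemma s_closed: "s y \<in> carrier \<P>"
proof -
  have pow: "p ^ e \<in> carrier \<P>" if "p \<in> carrier \<P>" for p e by (induction e) (use that \<P>_closed in auto)
  have "(\<Prod>i\<in>A. mpoly_var (bd i) ^ f i) \<in> carrier \<P>" for A :: "nat set" and f
    by (induction A rule: infinite_finite_induct) (use \<P>_closed pow var_closed[OF bd_W] in auto)
  then have "mpoly_const c * sm a \<in> carrier \<P>" for a c unfolding sm_def by (intro \<P>_closed const_closed)
  then have "(\<Sum>a\<in>A. mpoly_const (f a) * sm a) \<in> carrier \<P>" for A f
    by (induction A rule: infinite_finite_induct) (use \<P>_closed in auto)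
  then show ?thesis by (simp add: s_def ext_def)
qed

lemma \<psi>_bd: "i < n \<Longrightarrow> \<psi> (bd i) = single (single i 1) 1"
proof -
  assume i: "i < n"
  have "\<psi> (bd i) = (\<Sum>j<n. if j = i then single (single i 1) 1 else 0)"
    unfolding \<psi>_def by (rule sum.cong) (use i in \<open>auto simp: bd_b\<close>)
  then show ?thesis using i by simp
qed

lemma \<Psi>_s: "y \<in> P0 \<Longrightarrow> \<Psi> (s y) = y"
proof -
  assume y: "y \<in> P0"
  have sum: "\<Psi> (\<Sum>i\<in>A. f i) = (\<Sum>i\<in>A. \<Psi> (f i))" for A :: "(nat \<Rightarrow>\<^sub>0 int) set" and f
    by (induction A rule: infinite_finite_induct) (simp_all add: \<Psi>_0 \<Psi>_simps)
  have pow: "\<Psi> (p ^ e) = \<Psi> p ^ e" for p e by (induction e) (simp_all add: \<Psi>_1 \<Psi>_simps)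
  have xpow: "(single (single i (1::int)) 1 :: 'k laurent) ^ e = single (single i (int e)) 1" for i e
    by (induction e) (simp_all add: mult_single single_add[symmetric])
  have prod: "\<Psi> (\<Prod>i\<in>A. mpoly_var (bd i) ^ e i) = single (\<Sum>i\<in>A. single i (int (e i))) 1"
    if "finite A" "A \<subseteq> {..<n}" for A e
    using that by (induction A rule: finite_induct) (auto simp: \<Psi>_1 \<Psi>_simps pow \<psi>_bd xpow mult_single)
  have "\<Psi> (s (single a c)) = single a c" if a: "a \<in> expo {..<n} {}" for a c
  proof -
    have "a = (\<Sum>i\<in>keys a. single i (lookup a i))" by (rule pm_expand)
    also have "\<dots> = (\<Sum>i<n. single i (lookup a i))"
      by (rule sum.mono_neutral_left) (use a in \<open>auto simp: expo_def in_keys_iff\<close>)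
    also have "\<dots> = (\<Sum>i<n. single i (int (nat (lookup a i))))"
      by (rule sum.cong) (use a in \<open>auto simp: expo_def\<close>)
    finally have "\<Psi> (sm a) = single a 1"
      using prod[of "{..<n}" "\<lambda>i. nat (lookup a i)"] by (simp add: sm_def)
    then show ?thesis by (simp add: s_single \<Psi>_simps mult_single)
  qed
  moreover have "\<Psi> (s y) = (\<Sum>a\<in>keys y. \<Psi> (s (single a (lookup y a))))"
    by (subst pm_expand[of y]) (simp only: s_sum sum)
  ultimately have "\<Psi> (s y) = (\<Sum>a\<in>keys y. single a (lookup y a))"
    using y by (auto simp: graded_def)
  then show ?thesis by (simp add: pm_expand[symmetric])
qed

abbreviation "relations \<equiv>
  {mpoly_var (\<lambda>v. \<phi> v + \<psi> v) - (mpoly_var \<phi> + mpoly_var \<psi>) | \<phi> \<psi>. \<phi> \<in> W \<and> \<psi> \<in> W} \<union>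
  {mpoly_var (\<lambda>v. c * \<phi> v) - mpoly_const c * mpoly_var \<phi> | c \<phi>. \<phi> \<in> W}"

lemma relations_closed: "relations \<subseteq> carrier \<P>"
proof
  fix r assume "r \<in> relations"
  then show "r \<in> carrier \<P>"
    unfolding diff_conv_add_uminus
    by (elim UnE CollectE exE conjE) (simp_all only:, (intro \<P>_closed var_closed const_closed W_add W_smult; assumption)+)
qed

lemma ideal_\<J>: "ideal \<J> \<P>" and relations_\<J>: "relations \<subseteq> \<J>"
proof -
  have R: "ring \<P>" using cring_\<P> by (simp add: cring_def)
  show "ideal \<J> \<P>" unfolding sym_ideal_def by (rule ring.genideal_ideal[OF R relations_closed])
  show "relations \<subseteq> \<J>" unfolding sym_ideal_def by (rule ring.genideal_self[OF R relations_closed])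
qed

lemma \<J>_closed:
  "x \<in> \<J> \<Longrightarrow> y \<in> \<J> \<Longrightarrow> x + y \<in> \<J>" "x \<in> \<J> \<Longrightarrow> r \<in> carrier \<P> \<Longrightarrow> r * x \<in> \<J>" "0 \<in> \<J>" "x \<in> \<J> \<Longrightarrow> x \<in> carrier \<P>"
  using additive_subgroup.a_closed[OF ideal.axioms(1)[OF ideal_\<J>], of x y] ideal.I_l_closed[OF ideal_\<J>, of x r]
    additive_subgroup.zero_closed[OF ideal.axioms(1)[OF ideal_\<J>]] ideal.Icarr[OF ideal_\<J>, of x]
  by (simp_all add: \<P>_simps)

lemma \<J>_diff: "x \<in> \<J> \<Longrightarrow> y \<in> \<J> \<Longrightarrow> x - y \<in> \<J>"
  using \<J>_closed(1)[of x "- y"] \<J>_closed(2)[of y "- 1"] \<P>_closed(3)[OF \<P>_closed(5)] by simp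

text \<open>The kernel of \<open>\<Psi>\<close> on \<open>\<P>\<close> is an ideal containing the
  defining relations, because \<open>\<psi>\<close> is linear in the form.\<close>

lemma \<Psi>_\<J>: "q \<in> \<J> \<Longrightarrow> \<Psi> q = 0"
proof -
  interpret P: cring \<P> by (rule cring_\<P>)
  have \<psi>: "\<psi> (\<lambda>v. \<phi> v + \<phi>' v) = \<psi> \<phi> + \<psi> \<phi>'" "\<psi> (\<lambda>v. c * \<phi> v) = lconst c * \<psi> \<phi>" for \<phi> \<phi>' c
    by (simp_all add: \<psi>_def single_add sum.distrib sum_distrib_left mult_single)
  let ?K = "{q \<in> carrier \<P>. \<Psi> q = 0}"
  have "ideal ?K \<P>"
  proof (rule idealI[OF P.ring_axioms])
    show "subgroup ?K (add_monoid \<P>)"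
    proof (rule P.add.subgroupI)
      fix x assume x: "x \<in> ?K"
      have "\<ominus>\<^bsub>\<P>\<^esub> x = - x" using subalg_minus[OF subring_mpoly, of x W] x by (simp add: \<P>_eq)
      then show "\<ominus>\<^bsub>\<P>\<^esub> x \<in> ?K" using x \<P>_closed by (simp add: \<Psi>_uminus)
    qed (use \<P>_closed(4) in \<open>auto simp: \<P>_simps \<Psi>_simps \<Psi>_0 intro: \<P>_closed\<close>)
  qed (auto simp: \<P>_simps \<Psi>_simps intro: \<P>_closed)
  moreover have "relations \<subseteq> ?K"
  proof
    fix r assume r: "r \<in> relations"
    then have "\<Psi> r = 0" by (auto simp: \<Psi>_simps \<Psi>_diff \<psi>)
    then show "r \<in> ?K" using r relations_closed by blast
  qed
  ultimately have "\<J> \<subseteq> ?K" unfolding sym_ideal_def by (rule P.genideal_minimal)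
  then show "q \<in> \<J> \<Longrightarrow> \<Psi> q = 0" by blast
qed

lemma var_sum: "finite A \<Longrightarrow> mpoly_var (\<lambda>v. \<Sum>i\<in>A. c i * bd i v) - (\<Sum>i\<in>A. mpoly_const (c i) * mpoly_var (bd i)) \<in> \<J>"
proof (induction A rule: finite_induct)
  case empty
  have "mpoly_var (\<lambda>v. 0 * bd 0 v) - mpoly_const 0 * mpoly_var (bd 0) \<in> \<J>" using relations_\<J> bd_W by blast
  then show ?case by (simp add: mpoly_const_hom)
next
  case (insert i A)
  let ?f = "\<lambda>v. c i * bd i v" and ?g = "\<lambda>v. \<Sum>i\<in>A. c i * bd i v"
  have 1: "mpoly_var (\<lambda>v. ?f v + ?g v) - (mpoly_var ?f + mpoly_var ?g) \<in> \<J>"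
    using relations_\<J> W_smult[OF bd_W] W_sum[of A bd c] bd_W by blast
  have 2: "mpoly_var ?f - mpoly_const (c i) * mpoly_var (bd i) \<in> \<J>" using relations_\<J> bd_W by blast
  show ?case using \<J>_closed(1)[OF \<J>_closed(1)[OF 1 2] insert.IH] insert.hyps by (simp add: algebra_simps)
qed

text \<open>Modulo the ideal, every polynomial in linear forms equals one in the dual basis: a
  single form is expanded in that basis by \<open>var_sum\<close>, and the property passes to sums
  and products. In particular an element killed by \<open>\<Psi>\<close> lies in
  \<open>\<J>\<close>.\<close>

lemma s_\<Psi>: "q \<in> carrier \<P> \<Longrightarrow> q - s (\<Psi> q) \<in> \<J>"
proof -
  assume "q \<in> carrier \<P>"
  then have "q \<in> carrier \<P> \<and> q - s (\<Psi> q) \<in> \<J>"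
  proof (induction q rule: \<P>_induct)
    case (const c)
    then show ?case using const_closed \<J>_closed(3) by (simp add: \<Psi>_simps s_const)
  next
    case (var \<phi>)
    have m: "sm (single i 1) = mpoly_var (bd i)" if "i < n" for i
    proof -
      have "sm (single i 1) = (\<Prod>j<n. if j = i then mpoly_var (bd i) else 1)"
        unfolding sm_def by (rule prod.cong) (auto simp: lookup_single when_def)
      then show ?thesis using that by simp
    qed
    have "s (\<psi> \<phi>) = (\<Sum>i<n. mpoly_const (\<phi> (b i)) * mpoly_var (bd i))"
      by (simp add: \<psi>_def s_sum s_single m)
    then show ?case using var_sum[of "{..<n}" "\<lambda>i. \<phi> (b i)"] W_expand[OF var] var_closed[OF var]
      by (simp add: \<Psi>_simps)
  next
    case (add p q)
    then have "(p - s (\<Psi> p)) + (q - s (\<Psi> q)) \<in> \<J>" by (intro \<J>_closed) auto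
    then show ?case using add \<P>_closed(1) by (simp add: \<Psi>_simps s_add algebra_simps)
  next
    case (mult p q)
    then have "q * (p - s (\<Psi> p)) + s (\<Psi> p) * (q - s (\<Psi> q)) \<in> \<J>"
      by (intro \<J>_closed(1,2) s_closed) auto
    then show ?case using mult \<P>_closed(2) \<Psi>_P0 by (simp add: \<Psi>_simps s_mult algebra_simps)
  qed
  then show ?thesis ..
qed

text \<open>If \<open>\<Psi>\<close> takes the same value at \<open>p\<close> and \<open>q\<close>,
  both are congruent to \<open>s\<close> of that value. Cosets thereby become fibres of
  \<open>\<Psi>\<close>, and the group action on them can be followed in coordinates.\<close>

lemma coset_eq: "p \<in> carrier \<P> \<Longrightarrow> \<J> +>\<^bsub>\<P>\<^esub> p = {q \<in> carrier \<P>. \<Psi> q = \<Psi> p}"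
proof (intro equalityI subsetI)
  fix q assume p: "p \<in> carrier \<P>" and "q \<in> \<J> +>\<^bsub>\<P>\<^esub> p"
  then obtain j where "j \<in> \<J>" "q = j + p" by (auto simp: a_r_coset_def' \<P>_simps)
  then show "q \<in> {q \<in> carrier \<P>. \<Psi> q = \<Psi> p}" using p \<J>_closed(4) \<P>_closed(1) \<Psi>_\<J> by (auto simp: \<Psi>_simps)
next
  fix q assume p: "p \<in> carrier \<P>" and "q \<in> {q \<in> carrier \<P>. \<Psi> q = \<Psi> p}"
  then have q: "q \<in> carrier \<P>" and eq: "\<Psi> q = \<Psi> p" by auto
  have "q - p \<in> \<J>" using \<J>_diff[OF s_\<Psi>[OF q] s_\<Psi>[OF p]] eq by simp
  then show "q \<in> \<J> +>\<^bsub>\<P>\<^esub> p" by (auto simp: a_r_coset_def' \<P>_simps intro!: bexI[of _ "q - p"])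
qed

section \<open>The invariant ring as a graded algebra\<close>

definition "\<theta> y = \<J> +>\<^bsub>\<P>\<^esub> s y"

lemma \<theta>_eq: "y \<in> P0 \<Longrightarrow> \<theta> y = {q \<in> carrier \<P>. \<Psi> q = y}"
  by (simp add: \<theta>_def coset_eq[OF s_closed] \<Psi>_s)

text \<open>The action of \<open>\<sigma>\<close> in coordinates (\<open>\<Psi>_poly_act\<close>):
  \<open>\<rho> \<sigma>\<close> on coefficients and the inverse character on monomials, as linear
  forms are precomposed with the inverse of \<open>\<sigma>\<close>.\<close>

definition "twist \<sigma> = ext (\<lambda>a c. single a (\<rho> \<sigma> c * inverse (\<chi>' a \<sigma>)))"

lemma twist_simps:
  assumes "\<sigma> \<in> carrier G"
  shows "twist \<sigma> (x + y) = twist \<sigma> x + twist \<sigma> y" "twist \<sigma> (x * y) = twist \<sigma> x * twist \<sigma> y"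
    "twist \<sigma> (single a c) = single a (\<rho> \<sigma> c * inverse (\<chi>' a \<sigma>))"
    "twist \<sigma> (\<Sum>i\<in>A. f i) = (\<Sum>i\<in>A. twist \<sigma> (f i))"
proof -
  let ?h = "\<lambda>a c. single a (\<rho> \<sigma> c * inverse (\<chi>' a \<sigma>))"
  have h: "?h a 0 = 0" "?h a (x + y) = ?h a x + ?h a y" for a x y
    by (simp_all add: \<rho>_ring[OF assms] distrib_right single_add)
  show "twist \<sigma> (x + y) = twist \<sigma> x + twist \<sigma> y" unfolding twist_def by (rule ext_add[OF h])
  show "twist \<sigma> (\<Sum>i\<in>A. f i) = (\<Sum>i\<in>A. twist \<sigma> (f i))" unfolding twist_def by (rule ext_sum[OF h])
  show "twist \<sigma> (single a c) = ?h a c" unfolding twist_def by (rule ext_single[where h = ?h, OF h(1)])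
  show "twist \<sigma> (x * y) = twist \<sigma> x * twist \<sigma> y" unfolding twist_def
    by (rule ext_mult[OF h, where S = UNIV]) (simp_all add: \<rho>_ring[OF assms] \<chi>'_add[OF assms] mult_single mult_ac)
qed

lemma lookup_twist: "\<sigma> \<in> carrier G \<Longrightarrow> lookup (twist \<sigma> y) a = \<rho> \<sigma> (lookup y a) * inverse (\<chi>' a \<sigma>)"
proof -
  assume s: "\<sigma> \<in> carrier G"
  have "lookup (twist \<sigma> y) a =
      (\<Sum>c\<in>keys y. if c = a then \<rho> \<sigma> (lookup y a) * inverse (\<chi>' a \<sigma>) else 0)"
    unfolding twist_def ext_def lookup_sum by (rule sum.cong) (auto simp: lookup_single when_def)
  then show ?thesis by (simp add: in_keys_iff \<rho>_ring[OF s])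
qed

definition "dual_act \<sigma> \<phi> = \<rho> \<sigma> \<circ> \<phi> \<circ> act (inv\<^bsub>G\<^esub> \<sigma>)"

definition "poly_act \<sigma> = mpoly_map (\<rho> \<sigma>) (dual_act \<sigma>)"

lemma \<rho>_inv: "\<sigma> \<in> carrier G \<Longrightarrow> \<rho> \<sigma> (\<rho> (inv\<^bsub>G\<^esub> \<sigma>) x) = x"
  using \<rho>_comp[of \<sigma> "inv\<^bsub>G\<^esub> \<sigma>" x] \<rho>_one by simp

lemma act_inv: "\<sigma> \<in> carrier G \<Longrightarrow> act \<sigma> (act (inv\<^bsub>G\<^esub> \<sigma>) v) = v"
  using act_comp[of \<sigma> "inv\<^bsub>G\<^esub> \<sigma>" v] act_one by simp

lemma dual_act_W: "\<sigma> \<in> carrier G \<Longrightarrow> \<phi> \<in> W \<Longrightarrow> dual_act \<sigma> \<phi> \<in> W"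
  by (simp add: W_iff dual_act_def act_add act_scale \<rho>_ring \<rho>_inv)

lemma dual_act_inv: "\<sigma> \<in> carrier G \<Longrightarrow> dual_act \<sigma> (dual_act (inv\<^bsub>G\<^esub> \<sigma>) \<phi>) = \<phi>"
  by (auto simp: dual_act_def \<rho>_inv act_inv)

lemma poly_act_simps:
  assumes "\<sigma> \<in> carrier G"
  shows "poly_act \<sigma> (p + q) = poly_act \<sigma> p + poly_act \<sigma> q" "poly_act \<sigma> (p * q) = poly_act \<sigma> p * poly_act \<sigma> q"
    "poly_act \<sigma> (mpoly_const c) = mpoly_const (\<rho> \<sigma> c)" "poly_act \<sigma> (mpoly_var \<phi>) = mpoly_var (dual_act \<sigma> \<phi>)"
proof -
  have e: "poly_act \<sigma> = ev (\<lambda>c. mpoly_const (\<rho> \<sigma> c)) (\<lambda>\<phi>. mpoly_var (dual_act \<sigma> \<phi>))"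
    by (rule ext) (simp add: poly_act_def mpoly_map_def ev_def ext_def mon_def)
  show "poly_act \<sigma> (p + q) = poly_act \<sigma> p + poly_act \<sigma> q" "poly_act \<sigma> (p * q) = poly_act \<sigma> p * poly_act \<sigma> q"
    "poly_act \<sigma> (mpoly_const c) = mpoly_const (\<rho> \<sigma> c)" "poly_act \<sigma> (mpoly_var \<phi>) = mpoly_var (dual_act \<sigma> \<phi>)"
    unfolding e by (rule ev_hom; simp add: \<rho>_ring[OF assms] mpoly_const_hom)+
qed

lemma poly_act_closed: "\<sigma> \<in> carrier G \<Longrightarrow> q \<in> carrier \<P> \<Longrightarrow> poly_act \<sigma> q \<in> carrier \<P>"
proof -
  assume s: "\<sigma> \<in> carrier G" and "q \<in> carrier \<P>"
  from this(2) show ?thesis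
    by (induction q rule: \<P>_induct)
      (simp_all add: poly_act_simps[OF s] const_closed var_closed dual_act_W[OF s] \<P>_closed)
qed

lemma poly_act_inv: "\<sigma> \<in> carrier G \<Longrightarrow> q \<in> carrier \<P> \<Longrightarrow> poly_act \<sigma> (poly_act (inv\<^bsub>G\<^esub> \<sigma>) q) = q"
proof -
  assume s: "\<sigma> \<in> carrier G" and "q \<in> carrier \<P>"
  from this(2) show ?thesis
    by (induction q rule: \<P>_induct)
      (simp_all add: poly_act_simps[OF s] poly_act_simps[OF G.inv_closed[OF s]] \<rho>_inv[OF s] dual_act_inv[OF s])
qed

lemma \<Psi>_poly_act: "\<sigma> \<in> carrier G \<Longrightarrow> q \<in> carrier \<P> \<Longrightarrow> \<Psi> (poly_act \<sigma> q) = twist \<sigma> (\<Psi> q)"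
proof -
  assume s: "\<sigma> \<in> carrier G" and "q \<in> carrier \<P>"
  from this(2) show ?thesis
  proof (induction q rule: \<P>_induct)
    case (var \<phi>)
    \<comment> \<open>The inverse of \<open>\<sigma>\<close> scales \<open>b i\<close> by the
      inverse of \<open>\<chi> i \<sigma>\<close>; this scalar lies in \<open>k\<close> and passes
      through \<open>\<rho> \<sigma>\<close> unchanged.\<close>
    have "dual_act \<sigma> \<phi> (b i) = \<rho> \<sigma> (\<phi> (b i)) * inverse (\<chi> i \<sigma>)" if i: "i < n" for i
    proof -
      have si: "inv\<^bsub>G\<^esub> \<sigma> \<in> carrier G" using s by simp
      have "\<rho> \<sigma> (\<chi> i (inv\<^bsub>G\<^esub> \<sigma>)) = \<chi> i (inv\<^bsub>G\<^esub> \<sigma>)" using \<rho>_k[OF s] \<chi>_Z[OF i si] Z_k by blast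
      then show ?thesis using var act_b[OF i si] \<chi>_inv[OF i s]
        by (simp add: dual_act_def W_iff \<rho>_ring[OF s] mult.commute)
    qed
    then show ?case by (simp add: poly_act_simps[OF s] \<Psi>_simps \<psi>_def twist_simps[OF s] \<chi>'_single)
  qed (simp_all add: poly_act_simps[OF s] \<Psi>_simps twist_simps[OF s])
qed

text \<open>\<open>\<theta> y\<close> is the fibre of \<open>\<Psi>\<close> over \<open>y\<close>,
  so its invariance as a set means that every \<open>twist \<sigma>\<close> fixes \<open>y\<close>;
  coefficient by coefficient this is membership in \<open>D\<close>.\<close>

lemma invariant_iff:
  assumes y: "y \<in> P0"
  shows "(\<forall>\<sigma>\<in>carrier G. sym_action G \<rho> act \<sigma> (\<theta> y) = \<theta> y) \<longleftrightarrow> y \<in> graded (expo {..<n} {}) D"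
proof -
  have sa: "sym_action G \<rho> act \<sigma> a = poly_act \<sigma> ` a" for \<sigma> a
    by (simp add: sym_action_def poly_act_def dual_act_def[abs_def])
  have sy: "s y \<in> \<theta> y" using \<theta>_eq[OF y] s_closed \<Psi>_s[OF y] by simp
  have "(\<forall>\<sigma>\<in>carrier G. poly_act \<sigma> ` \<theta> y = \<theta> y) \<longleftrightarrow> (\<forall>\<sigma>\<in>carrier G. twist \<sigma> y = y)"
  proof (intro iffI ballI)
    fix \<sigma> assume s: "\<sigma> \<in> carrier G" and "\<forall>\<sigma>\<in>carrier G. poly_act \<sigma> ` \<theta> y = \<theta> y"
    then have "poly_act \<sigma> (s y) \<in> \<theta> y" using sy by blast
    then show "twist \<sigma> y = y" using \<theta>_eq[OF y] \<Psi>_poly_act[OF s s_closed] \<Psi>_s[OF y] by simp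
  next
    fix \<sigma> assume s: "\<sigma> \<in> carrier G" and tw: "\<forall>\<sigma>\<in>carrier G. twist \<sigma> y = y"
    \<comment> \<open>Each \<open>poly_act \<tau>\<close> maps the fibre into itself; using this for
      the inverse of \<open>\<sigma>\<close> as well gives equality of the image with the
      fibre.\<close>
    have sub: "poly_act \<tau> q \<in> \<theta> y" if "\<tau> \<in> carrier G" "q \<in> \<theta> y" for \<tau> q
      using that tw \<theta>_eq[OF y] \<Psi>_poly_act poly_act_closed by auto
    have "q \<in> poly_act \<sigma> ` \<theta> y" if q: "q \<in> \<theta> y" for q
      using poly_act_inv[OF s, of q] sub[OF G.inv_closed[OF s] q] q \<theta>_eq[OF y] by (metis (no_types, lifting) image_eqI mem_Collect_eq)
    then show "poly_act \<sigma> ` \<theta> y = \<theta> y" using sub[OF s] by blast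
  qed
  also have "\<dots> \<longleftrightarrow> (\<forall>\<sigma>\<in>carrier G. \<forall>a. \<rho> \<sigma> (lookup y a) = \<chi>' a \<sigma> * lookup y a)"
  proof (intro ball_cong refl)
    fix \<sigma> assume s: "\<sigma> \<in> carrier G"
    have "r * inverse (\<chi>' a \<sigma>) = c \<longleftrightarrow> r = \<chi>' a \<sigma> * c" for r a c using \<chi>'_nz[OF s, of a] by (auto simp: field_simps)
    then show "twist \<sigma> y = y \<longleftrightarrow> (\<forall>a. \<rho> \<sigma> (lookup y a) = \<chi>' a \<sigma> * lookup y a)"
      by (simp add: poly_mapping_eq_iff fun_eq_iff lookup_twist[OF s])
  qed
  also have "\<dots> \<longleftrightarrow> y \<in> graded (expo {..<n} {}) D"
  proof -
    have "\<rho> \<sigma> (lookup y a) = \<chi>' a \<sigma> * lookup y a"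
      if "\<sigma> \<in> carrier G" "a \<notin> keys y" for \<sigma> a using that by (simp add: in_keys_iff \<rho>_ring)
    then show ?thesis using y by (auto simp: graded_def D_def)
  qed
  finally show ?thesis by (simp only: sa)
qed

lemma invariant_ring_iso: "\<theta> \<in> ring_iso (galg D {..<n} {}) (invariant_ring scale G \<rho> act)"
proof -
  let ?I = "invariant_ring scale G \<rho> act"
  interpret J: ideal \<J> \<P> by (rule ideal_\<J>)
  have sub: "graded (expo {..<n} {}) D \<subseteq> P0" by (auto simp: graded_def)
  have cI: "carrier ?I = {a \<in> a_rcosets\<^bsub>\<P>\<^esub> \<J>. \<forall>\<sigma>\<in>carrier G. sym_action G \<rho> act \<sigma> a = a}"
    by (simp add: invariant_ring_def sym_dual_def FactRing_def)
  have cosets: "a \<in> a_rcosets\<^bsub>\<P>\<^esub> \<J> \<longleftrightarrow> a \<in> \<theta> ` P0" for a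
  proof
    assume "a \<in> a_rcosets\<^bsub>\<P>\<^esub> \<J>"
    then obtain p where p: "p \<in> carrier \<P>" "a = \<J> +>\<^bsub>\<P>\<^esub> p" by (auto simp: A_RCOSETS_def')
    then have "a = \<theta> (\<Psi> p)" using \<theta>_eq[OF \<Psi>_P0] coset_eq by simp
    then show "a \<in> \<theta> ` P0" using \<Psi>_P0 p by blast
  next
    assume "a \<in> \<theta> ` P0"
    then show "a \<in> a_rcosets\<^bsub>\<P>\<^esub> \<J>" using s_closed by (auto simp: A_RCOSETS_def' \<theta>_def)
  qed
  have cI': "carrier ?I = \<theta> ` graded (expo {..<n} {}) D"
  proof (intro equalityI subsetI)
    fix a assume a: "a \<in> carrier ?I"
    then obtain y where y: "y \<in> P0" "a = \<theta> y" unfolding cI using cosets by blast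
    then have "y \<in> graded (expo {..<n} {}) D" using a invariant_iff[OF y(1)] unfolding cI by simp
    then show "a \<in> \<theta> ` graded (expo {..<n} {}) D" using y(2) by blast
  next
    fix a assume "a \<in> \<theta> ` graded (expo {..<n} {}) D"
    then obtain y where y: "y \<in> graded (expo {..<n} {}) D" "a = \<theta> y" by blast
    then have yP: "y \<in> P0" using sub by blast
    show "a \<in> carrier ?I" unfolding cI using invariant_iff[OF yP] y cosets[of a] yP by simp
  qed
  have "inj_on \<theta> (graded (expo {..<n} {}) D)"
  proof (rule inj_onI)
    fix x y assume "x \<in> graded (expo {..<n} {}) D" "y \<in> graded (expo {..<n} {}) D" and eq: "\<theta> x = \<theta> y"
    then have x: "x \<in> P0" and y: "y \<in> P0" using sub by auto
    have "s x \<in> \<theta> y" using \<theta>_eq[OF x] s_closed \<Psi>_s[OF x] eq by auto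
    then show "x = y" using \<theta>_eq[OF y] \<Psi>_s[OF x] by simp
  qed
  moreover have "\<theta> \<in> ring_hom (galg D {..<n} {}) ?I"
  proof (rule ring_hom_memI)
    fix x y assume "x \<in> carrier (galg D {..<n} {})" "y \<in> carrier (galg D {..<n} {})"
    then have "x \<in> P0" "y \<in> P0" using sub by auto
    then show "\<theta> (x \<otimes>\<^bsub>galg D {..<n} {}\<^esub> y) = \<theta> x \<otimes>\<^bsub>?I\<^esub> \<theta> y"
      using J.rcoset_mult_add[OF s_closed s_closed, of x y]
      by (simp add: \<theta>_def invariant_ring_def sym_dual_def FactRing_def s_mult \<P>_simps)
    show "\<theta> (x \<oplus>\<^bsub>galg D {..<n} {}\<^esub> y) = \<theta> x \<oplus>\<^bsub>?I\<^esub> \<theta> y"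
      using J.a_rcos_sum[OF s_closed s_closed, of x y]
      by (simp add: \<theta>_def invariant_ring_def sym_dual_def FactRing_def s_add \<P>_simps)
  next
    have "s 1 = 1" using s_const[of 1] by (simp add: mpoly_const_hom)
    then show "\<theta> \<one>\<^bsub>galg D {..<n} {}\<^esub> = \<one>\<^bsub>?I\<^esub>"
      by (simp add: \<theta>_def invariant_ring_def sym_dual_def FactRing_def \<P>_simps)
  qed (use cI' in auto)
  ultimately show ?thesis using cI' by (simp add: ring_iso_def bij_betw_def)
qed

lemma \<theta>_const: "\<theta> (lconst c) = sym_const scale c"
  by (simp add: \<theta>_def s_const sym_const_def)

lemma kalg_invariant_ring: "kalg (invariant_ring scale G \<rho> act) k (sym_const scale)"
proof -
  let ?I = "invariant_ring scale G \<rho> act"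
  interpret D: grading k D N by (rule grading_D)
  interpret A: kalg "galg D {..<n} {}" k lconst by (rule D.kalg_galg)
  interpret J: ideal \<J> \<P> by (rule ideal_\<J>)
  \<comment> \<open>The ring axioms are transported along the isomorphism to a record whose zero is
    the image of 0; this must be recognised as the zero of the factor ring, the ideal
    itself.\<close>
  have "\<theta> 0 = \<J>"
    using \<theta>_const[of 0] coset_eq[OF \<P>_closed(4)] J.a_coset_join2 J.a_rcos_zero
    by (simp add: sym_const_def mpoly_const_hom) (metis J.a_coset_add_zero J.a_subset \<P>_simps(4))
  then have "?I\<lparr>zero := \<theta> \<zero>\<^bsub>galg D {..<n} {}\<^esub>\<rparr> = ?I"
    by (simp add: invariant_ring_def sym_dual_def FactRing_def)
  then have "cring ?I" using A.ring_iso_imp_img_cring[OF invariant_ring_iso] by simp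
  moreover have "sym_const scale \<in> ring_hom (base_ring k) ?I"
  proof -
    have "\<theta> \<circ> lconst \<in> ring_hom (base_ring k) ?I"
      by (rule ring_hom_trans[OF A.str_ring_hom]) (use invariant_ring_iso in \<open>simp add: ring_iso_def\<close>)
    moreover have "\<theta> \<circ> lconst = sym_const scale" by (simp add: fun_eq_iff \<theta>_const)
    ultimately show ?thesis by simp
  qed
  ultimately show ?thesis by (intro kalg.intro kalg_axioms.intro)
qed

lemma quotient_class:
  "var_class k (quotient_variety scale G \<rho> act) = var_class k (Spec (galg D {..<n} {}) lconst)"
  using iso_class_Spec[OF grading.kalg_galg[OF grading_D] kalg_invariant_ring invariant_ring_iso \<theta>_const]
  by (simp add: var_class_def)

end

section \<open>The class of the quotient variety\<close>

theorem lemma1p1: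
  fixes G :: "('g, 'm) monoid_scheme"
    and k :: "'k::field_char_0 set"
    and \<rho> :: "'g \<Rightarrow> 'k \<Rightarrow> 'k"
    and scale :: "'k \<Rightarrow> 'v::ab_group_add \<Rightarrow> 'v"
    and act :: "'g \<Rightarrow> 'v \<Rightarrow> 'v"
    and K0 :: "('k small_space set, int) poly_mapping set ring"
  assumes "comm_group G" and "finite (carrier G)"
    and "galois_extension k" and "comm_group (gal_group k)"
    and "\<rho> \<in> epi G (gal_group k)"
    and "\<exists>B. finite_dimensional_vector_space scale B"
    and "group_action G UNIV act"
    and "\<And>\<sigma> v w. \<sigma> \<in> carrier G \<Longrightarrow> act \<sigma> (v + w) = act \<sigma> v + act \<sigma> w"
    and "\<And>\<sigma> c v. \<sigma> \<in> carrier G \<Longrightarrow> c \<in> k \<Longrightarrow> act \<sigma> (scale c v) = scale c (act \<sigma> v)"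
    and "\<And>\<sigma> c v. \<sigma> \<in> carrier G \<Longrightarrow> act \<sigma> (scale c v) = scale (\<rho> \<sigma> c) (act \<sigma> v)"
    and "\<And>\<zeta> :: 'k alg_closure. \<zeta> ^ group_exponent G = 1 \<Longrightarrow> \<zeta> \<in> to_ac ` k"
    and "is_K0_ring k K0"
  shows "var_class k (quotient_variety scale G \<rho> act) =
    lefschetz k [^]\<^bsub>K0\<^esub> vector_space.dim scale UNIV"
proof -
  interpret A: semilinear_action G k \<rho> scale act
    by (rule semilinear_action.intro) (fact assms)+
  let ?n = "A.V.dim UNIV"
  obtain b \<chi> where b: "inj_on b {..<?n}" "A.V.independent (b ` {..<?n})" "A.V.span (b ` {..<?n}) = UNIV"
    and \<chi>: "\<And>i \<sigma>. i < ?n \<Longrightarrow> \<sigma> \<in> carrier G \<Longrightarrow> \<chi> i \<sigma> \<in> A.Z \<and> act \<sigma> (b i) = scale (\<chi> i \<sigma>) (b i)"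
    using A.eigenbasis by blast
  interpret B: diagonal_action G k \<rho> scale act ?n b \<chi>
    by unfold_locales (use b \<chi> in auto)
  \<comment> \<open>The family of comparison has parameter 1 instead of \<open>N\<close>;
    \<open>galg_class_eq\<close> allows the two parameters to differ.\<close>
  have triv: "grading k (\<lambda>_. k) 1" by (rule grading.grading_trivial[OF B.grading_D])
  have "var_class k (quotient_variety scale G \<rho> act) = var_class k (Spec (galg B.D {..<?n} {}) lconst)"
    by (rule B.quotient_class)
  also have "\<dots> = var_class k (Spec (galg (\<lambda>_. k) {..<?n} {}) lconst)"
    by (rule galg_class_eq[OF assms(12) B.grading_D triv]) simp_all
  also have "\<dots> = lefschetz k [^]\<^bsub>K0\<^esub> ?n"
    using lefschetz_power[OF assms(12) triv] assms(3) by (simp add: galois_extension_def)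
  finally show ?thesis .
qed

end
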